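(* Fix a real $\beta$ with $0<\beta<1$. For every $u_0\in\mathfrak{L}(I_1)$, the functions $\mathrm{vp}(\mathbf{T}_\beta^N u_0)$ tend to $0$ in $L^{1,\infty}(I_1)$ as $N\to+\infty$, i.e. $\|\mathrm{vp}(\mathbf{T}_\beta^N u_0)\|_{L^{1,\infty}(I_1)}\to 0$.
   Context: Notation: $I_1=\,]-1,1[$. $L^1_0(\mathbb{R})$ is the set of $g\in L^1(\mathbb{R})$ with $\int_{\mathbb R} g=0$. Pairings are bilinear: $\langle f,g\rangle=\int fg$, extended to distributions. Hilbert transform: for a test function $\varphi\in C_c^\infty(\mathbb R)$, $\mathbf{H}\varphi(x)=\frac1\pi\,\mathrm{pv}\int_{\mathbb R}\frac{\varphi(t)}{x-t}\,dt$; for $g\in L^1(\mathbb R)$, $\mathbf{H}g$ is the distribution $\langle\varphi,\mathbf{H}g\rangle_{\mathbb R}=-\langle\mathbf{H}\varphi,g\rangle_{\mathbb R}$. $\mathfrak{L}(\mathbb R)=L^1(\mathbb R)+\mathbf{H}L^1_0(\mathbb R)$ is a space of distributions on $\mathbb R$, with norm $\|u\|=\inf\{\|f\|_{L^1}+\|g\|_{L^1}: u=f+\mathbf{H}g,\ f\in L^1(\mathbb R),\ g\in L^1_0(\mathbb R)\}$. $\mathfrak{L}(I_1)$ is the space of restrictions to $I_1$ of distributions in $\mathfrak{L}(\mathbb R)$, with the quotient norm. Involution: for $f\in L^1(\mathbb R)$, $\mathbf{J}_\beta f(x)=\frac{\beta}{x^2}f(-\beta/x)$; on $\mathfrak{L}(\mathbb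 R)$ it is extended by $\mathbf{J}_\beta(f+\mathbf{H}g)=\mathbf{J}_\beta f+\mathbf{H}\mathbf{J}_\beta g$ ($f\in L^1(\mathbb{R})$, $g\in L^1_0(\mathbb{R})$), which is well defined and bounded. Periodization: $\boldsymbol\Pi_2 f(x)=\sum_{j\in\mathbb Z}f(x+2j)$ for $f\in L^1(\mathbb R)$. The periodic Hilbert transform is $\mathbf{H}_2\varphi(x)=\frac12\mathrm{pv}\int_{-1}^1\varphi(t)\cot\frac{\pi(x-t)}2\,dt$ for $2$-periodic smooth $\varphi$, and $\langle\varphi,\mathbf{H}_2 w\rangle_{\mathbb R/2\mathbb Z}=-\langle\mathbf{H}_2\varphi,w\rangle_{\mathbb R/2\mathbb Z}$ for $2$-periodic distributions $w$. On $\mathfrak{L}(\mathbb R)$, $\boldsymbol\Pi_2(f+\mathbf{H}g)=\boldsymbol\Pi_2f+\mathbf{H}_2\boldsymbol\Pi_2g$, a $2$-periodic distribution, and $\boldsymbol\Sigma_2U:=\boldsymbol\Pi_2U-U$ (so formally $\boldsymbol\Sigma_2U(x)=\sum_{j\in\mathbb Z\setminus\{0\}}U(x+2j)$). Subtransfer operator: for $u\in\mathfrak{L}(I_1)$ choose any $U\in\mathfrak{L}(\mathbb R)$ with $U|_{I_1}=u$ and put $\mathbf{T}_\beta u:=(\boldsymbol\Sigma_2\mathbf{J}_\beta U)|_{I_1}\in\mathfrak{L}(I_1)$; this does not depend on the choice of $U$, and $\mathbf{T}_\beta$ is bounded on $\mathfrak{L}(I_1)$. On $L^1(I_1)$ it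 is given by $\mathbf{T}_\beta f(x)=\sum_{j\in\mathbb Z\setminus\{0\}}\frac{\beta}{(2j+x)^2}f\big(-\frac{\beta}{2j+x}\big)$, $x\in I_1$. $\mathbf{T}_\beta^N$ is the $N$-th iterate. Weak $L^1$: $L^{1,\infty}(E)$ consists of measurable $f:E\to\mathbb C$ with $\|f\|_{L^{1,\infty}(E)}=\sup_{\lambda>0}\lambda\,|\{t\in E:|f(t)|>\lambda\}|<\infty$. Valeur au point: for a distribution $u$, $\mathrm{vp}[u](x)=\lim_{\epsilon\to0^+}\langle\chi P_{x+\mathrm{i}\epsilon},u\rangle$ wherever the limit exists, where $P_{x+\mathrm{i}\epsilon}(t)=\pi^{-1}\epsilon/(\epsilon^2+(x-t)^2)$ and $\chi$ is a smooth cut-off, compactly supported in the domain of $u$, equal to $1$ near $x$ (the choice is immaterial). If $u=(f+\mathbf{H}g)|_{I_1}$ with $f\in L^1(\mathbb R)$, $g\in L^1_0(\mathbb R)$, then for a.e. $x\in I_1$, $\mathrm{vp}[u](x)=f(x)+\frac1\pi\mathrm{pv}\int_{\mathbb{R}}\frac{g(t)}{x-t}dt$; the map $\mathrm{vp}:\mathfrak{L}(I_1)\to L^{1,\infty}(I_1)$ is injective and continuous. *)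

theory Defs
  imports "HOL-Analysis.Analysis"
begin

definition smooth :: "(real \<Rightarrow> complex) \<Rightarrow> bool" where
  "smooth \<phi> \<longleftrightarrow>
     (\<forall>n x. ((\<lambda>\<psi> t. vector_derivative \<psi> (at t)) ^^ n) \<phi> differentiable (at x))"

definition test_functions :: "real set \<Rightarrow> (real \<Rightarrow> complex) set" where
  "test_functions E =
     {\<phi>. smooth \<phi> \<and> compact (closure {t. \<phi> t \<noteq> 0}) \<and> closure {t. \<phi> t \<noteq> 0} \<subseteq> E}"

definition periodic_test_functions :: "(real \<Rightarrow> complex) set" where
  "periodic_test_functions = {\<phi>. smooth \<phi> \<and> (\<forall>t. \<phi> (t + 2) = \<phi> t)}"

text \<open>
  A distribution on an open set \<open>E\<close> is represented by its pairing with test functions,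
  as a functional that takes the value \<open>undefined\<close> outside \<open>test_functions E\<close>. Hence equality
  of functionals is equality of distributions, and restriction to an open subset \<open>F\<close> is
  \<open>restrict _ (test_functions F)\<close>. In the same way, 2-periodic distributions are represented by
  functionals on \<open>periodic_test_functions\<close>. Every functional used below arises from integrable
  functions by pairing or by transposition of the (periodic) Hilbert transform, and so is linear
  and continuous; therefore this is not made part of the type.
\<close>

type_synonym distr = "(real \<Rightarrow> complex) \<Rightarrow> complex"

definition L1 :: "(real \<Rightarrow> complex) set" where
  "L1 = {f. integrable lebesgue f}"

definition L1_0 :: "(real \<Rightarrow> complex) set" where
  "L1_0 = {g \<in> L1. (LINT t|lebesgue. g t) = 0}"

definition distr_of :: "(real \<Rightarrow> complex) \<Rightarrow> distr" where
  "distr_of f = (\<lambda>\<phi>\<in>test_functions UNIV. LINT t|lebesgue. \<phi> t * f t)"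

definition periodic_distr_of :: "(real \<Rightarrow> complex) \<Rightarrow> distr" where
  "periodic_distr_of w =
     (\<lambda>\<phi>\<in>periodic_test_functions. LINT t:{-1..1}|lebesgue. \<phi> t * w t)"

text \<open>Principal value of the integral of \<open>f\<close> over \<open>A\<close>, with singularities at the points of \<open>S\<close>.\<close>

definition pv_integral :: "real set \<Rightarrow> real set \<Rightarrow> (real \<Rightarrow> complex) \<Rightarrow> complex" where
  "pv_integral S A f =
     Lim (at_right 0) (\<lambda>\<epsilon>. LINT t:{t \<in> A. \<forall>s\<in>S. \<epsilon> < \<bar>s - t\<bar>}|lebesgue. f t)"

definition hilbert :: "(real \<Rightarrow> complex) \<Rightarrow> real \<Rightarrow> complex" where
  "hilbert \<phi> x = of_real (1 / pi) * pv_integral {x} UNIV (\<lambda>t. \<phi> t / of_real (x - t))"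

definition hilbert_distr :: "(real \<Rightarrow> complex) \<Rightarrow> distr" where
  "hilbert_distr g = (\<lambda>\<phi>\<in>test_functions UNIV. - (LINT t|lebesgue. hilbert \<phi> t * g t))"

text \<open>
  The kernel is singular at all points of \<open>x + 2\<int>\<close>; excluding all of them gives the principal
  value on the circle for every real \<open>x\<close>, including the end points of the period interval.
\<close>

definition periodic_hilbert :: "(real \<Rightarrow> complex) \<Rightarrow> real \<Rightarrow> complex" where
  "periodic_hilbert \<phi> x = of_real (1 / 2) *
     pv_integral (range (\<lambda>j::int. x + 2 * of_int j)) {-1..1}
       (\<lambda>t. \<phi> t * of_real (cot (pi * (x - t) / 2)))"

definition periodic_hilbert_distr :: "distr \<Rightarrow> distr" where
  "periodic_hilbert_distr w = (\<lambda>\<phi>\<in>periodic_test_functions. - w (periodic_hilbert \<phi>))"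

text \<open>\<open>is_rep U (f, g)\<close> means \<open>U = f + H g\<close> as distributions on the real line.\<close>

definition is_rep :: "distr \<Rightarrow> (real \<Rightarrow> complex) \<times> (real \<Rightarrow> complex) \<Rightarrow> bool" where
  "is_rep U = (\<lambda>(f, g). f \<in> L1 \<and> g \<in> L1_0 \<and>
     U = (\<lambda>\<phi>\<in>test_functions UNIV. distr_of f \<phi> + hilbert_distr g \<phi>))"

definition LR :: "distr set" where
  "LR = {U. \<exists>f g. is_rep U (f, g)}"

definition LR_on :: "real set \<Rightarrow> distr set" where
  "LR_on E = (\<lambda>U. restrict U (test_functions E)) ` LR"

definition rep :: "distr \<Rightarrow> (real \<Rightarrow> complex) \<times> (real \<Rightarrow> complex)" where
  "rep U = (SOME p. is_rep U p)"

definition J_fun :: "real \<Rightarrow> (real \<Rightarrow> complex) \<Rightarrow> real \<Rightarrow> complex" where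
  "J_fun \<beta> f x = of_real (\<beta> / x\<^sup>2) * f (- \<beta> / x)"

definition J :: "real \<Rightarrow> distr \<Rightarrow> distr" where
  "J \<beta> U = (case rep U of (f, g) \<Rightarrow>
     (\<lambda>\<phi>\<in>test_functions UNIV. distr_of (J_fun \<beta> f) \<phi> + hilbert_distr (J_fun \<beta> g) \<phi>))"

text \<open>
  For integrable \<open>f\<close> the series converges absolutely for almost every \<open>x\<close>; on the exceptional
  null set \<open>infsum\<close> has the value 0.
\<close>

definition periodize :: "(real \<Rightarrow> complex) \<Rightarrow> real \<Rightarrow> complex" where
  "periodize f x = (\<Sum>\<^sub>\<infinity>j::int. f (x + 2 * of_int j))"

definition Pi2 :: "distr \<Rightarrow> distr" where
  "Pi2 U = (case rep U of (f, g) \<Rightarrow>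
     (\<lambda>\<phi>\<in>periodic_test_functions.
        periodic_distr_of (periodize f) \<phi> +
        periodic_hilbert_distr (periodic_distr_of (periodize g)) \<phi>))"

text \<open>
  A 2-periodic distribution \<open>w\<close> viewed as a distribution on the real line: for a 2-periodic locally
  integrable \<open>w\<close>, the integral of \<open>\<phi> w\<close> over the line is the integral of \<open>(periodize \<phi>) w\<close> over
  one period.
\<close>

definition unroll :: "distr \<Rightarrow> distr" where
  "unroll w = (\<lambda>\<phi>\<in>test_functions UNIV. w (periodize \<phi>))"

definition Sigma2 :: "distr \<Rightarrow> distr" where
  "Sigma2 U = (\<lambda>\<phi>\<in>test_functions UNIV. unroll (Pi2 U) \<phi> - U \<phi>)"

definition I1 :: "real set" where
  "I1 = {-1<..<1}"

definition extension :: "distr \<Rightarrow> distr" where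
  "extension u = (SOME U. U \<in> LR \<and> restrict U (test_functions I1) = u)"

definition T :: "real \<Rightarrow> distr \<Rightarrow> distr" where
  "T \<beta> u = restrict (Sigma2 (J \<beta> (extension u))) (test_functions I1)"

definition weak_L1_norm :: "real set \<Rightarrow> (real \<Rightarrow> complex) \<Rightarrow> ennreal" where
  "weak_L1_norm E f =
     (SUP c\<in>{0<..}. ennreal c * emeasure lebesgue {t \<in> E. c < norm (f t)})"

definition weak_L1 :: "real set \<Rightarrow> (real \<Rightarrow> complex) set" where
  "weak_L1 E = {f \<in> borel_measurable (lebesgue_on E). weak_L1_norm E f < \<infinity>}"

definition poisson :: "real \<Rightarrow> real \<Rightarrow> real \<Rightarrow> real" where
  "poisson x \<epsilon> t = (1 / pi) * (\<epsilon> / (\<epsilon>\<^sup>2 + (x - t)\<^sup>2))"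

definition cutoff :: "real set \<Rightarrow> real \<Rightarrow> real \<Rightarrow> complex" where
  "cutoff E x = (SOME h. h \<in> test_functions E \<and> (\<forall>\<^sub>F t in nhds x. h t = 1))"

text \<open>
  Valeur au point of a distribution on \<open>E\<close>. Where the limit does not exist, \<open>Lim\<close> denotes an
  unspecified constant, about which nothing can be proved.
\<close>

definition vp :: "real set \<Rightarrow> distr \<Rightarrow> real \<Rightarrow> complex" where
  "vp E u x = Lim (at_right 0) (\<lambda>\<epsilon>. u (\<lambda>t. cutoff E x t * of_real (poisson x \<epsilon> t)))"

end

theory Submission
 imports Defs "HOL-Complex_Analysis.Complex_Analysis" "HOL-Library.Nat_Bijection"
begin

text \<open>
 Write \<open>T\<^sup>N u\<^sub>0 = f\<^sub>N + H g\<^sub>N\<close> on \<open>]-\<beta>, \<beta>[\<close>; only this restriction matters for the next iterate. Up to a bounded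
 error for \<open>f\<^sub>N\<close> that is controlled by the norm of \<open>g\<^sub>N\<close>, both densities evolve under the positive transfer operator
 on \<open>L\<^sup>1(I\<^sub>1)\<close>. That operator contracts the weight \<open>1 / (1 - x^2)\<close>, so first \<open>g\<^sub>N\<close> and then \<open>f\<^sub>N\<close> tend to 0 in
 \<open>L\<^sup>1\<close>. The valeur au point is almost everywhere a boundary value of Cauchy integrals of the densities, and the weak
 type estimate for these turns convergence of the densities in \<open>L\<^sup>1\<close> into convergence in weak \<open>L\<^sup>1\<close>.
\<close>

text \<open>If |x| < 1 and j \<noteq> 0, then |x + 2j| > 1 and |\<beta> / (x + 2j)| < \<beta>; hence
  one iterate sees the previous one only on \<open>]-\<beta>, \<beta>[\<close>. The obstacle is the
  nonlocality of the Hilbert transform: on \<open>I1\<close> the periodic transform of a density is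
  the transform of three copies of it plus a bounded function, so a direct estimate lets the norm of
  g grow fourfold. The remedy is to discard after each step the part of g outside \<open>I1\<close>.
  Seen from \<open>]-\<beta>, \<beta>[\<close> its transform has a kernel bounded by 1 / (1 -
  \<beta>), so it can be moved to f; what remains of g obeys a recursion free of f. The choices of
  an extension and of representations in the definition of \<open>T\<close> are eliminated by
  transposition: \<open>T \<beta> u \<phi>\<close> is a limit of values of u at inverted finite
  combinations of translates of \<phi>, weighted so that their Hilbert transforms converge boundedly
  too. The weight is the invariant density for \<beta> = 1. It is not integrable on
  \<open>I1\<close>, but its image under the operator is bounded for \<beta> < 1, which
  suffices.\<close>

abbreviation Lint :: "(real => 'a::{banach,second_countable_topology}) => 'a" (binder "LI " [60] 60)
 where "LI x. f x \<equiv> integral\<^sup>L lebesgue f"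
abbreviation Nint :: "(real => ennreal) => ennreal" (binder "NI " [60] 60)
 where "NI x. f x \<equiv> integral\<^sup>N lebesgue f"
abbreviation Lintegrable :: "(real => 'a::{banach,second_countable_topology}) => bool"
 where "Lintegrable \<equiv> integrable lebesgue"
abbreviation Lmeasurable :: "(real => 'a::topological_space) set"
 where "Lmeasurable \<equiv> borel_measurable lebesgue"

lemmas bochner_add = Bochner_Integration.integral_add
 and bochner_diff = Bochner_Integration.integral_diff
 and bochner_cong = Bochner_Integration.integral_cong
 and bochner_nonneg = Bochner_Integration.integral_nonneg
 and bochner_integrable_add = Bochner_Integration.integrable_add
 and bochner_integrable_diff = Bochner_Integration.integrable_diff

abbreviation sdiff :: "(real => complex) => real => real => complex"
 where "sdiff f x t \<equiv> f (x - t) - f (x + t)"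
abbreviation Qk :: "real => real => real"
 where "Qk u \<delta> \<equiv> u / (u^2 + \<delta>^2)"
abbreviation sym_sum :: "(real => complex) => nat => real => complex"
 where "sym_sum f n y \<equiv> \<Sum>j\<in>{- int n..int n}. f (y - 2 * of_int j)"

section \<open>Smooth functions\<close>

abbreviation vd :: "(real => complex) => real => complex" where
 "vd \<phi> \<equiv> (\<lambda>t. vector_derivative \<phi> (at t))"

text \<open>The definition of \<open>smooth\<close> quantifies over all iterated derivatives. A set
  in which every member has a derivative inside the set replaces the induction on the order, so most
  smoothness proofs below only exhibit such a set.\<close>

lemma smooth_coinduct:
 assumes "\<phi> \<in> X"
  and step: "\<And>\<phi>. \<phi> \<in> X ==> \<exists>\<phi>'\<in>X. \<forall>x. (\<phi> has_vector_derivative \<phi>' x) (at x)"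
 shows "smooth \<phi>"
proof -
 let ?D = "\<lambda>\<psi> t. vector_derivative \<psi> (at t)"
 have vd_eq: "?D \<psi> \<in> X" if "\<psi> \<in> X" for \<psi> :: "real => complex" proof -
  from step[OF that] obtain \<psi>' where "\<psi>' \<in> X" "\<forall>x. (\<psi> has_vector_derivative \<psi>' x) (at x)" by blast
  moreover from this have "?D \<psi> = \<psi>'" by (intro ext vector_derivative_at) simp
  ultimately show ?thesis by simp
 qed
 have "(?D ^^ n) \<phi> \<in> X" for n by (induction n) (simp_all add: \<open>\<phi> \<in> X\<close> vd_eq)
 then show ?thesis unfolding smooth_def using step differentiableI_vector by blast
qed

lemma smooth_has_vd: "smooth \<phi> ==> (\<phi> has_vector_derivative vd \<phi> x) (at x)"
 unfolding smooth_def vector_derivative_works[symmetric] by (drule spec[where x = 0]) simp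

lemma smooth_vd: assumes "smooth \<phi>" shows "smooth (vd \<phi>)"
proof -
 let ?D = "\<lambda>\<psi> t. vector_derivative \<psi> (at t)"
 have "(?D ^^ n) (?D \<phi>) differentiable (at x)" for n x proof -
  have "(?D ^^ Suc n) \<phi> differentiable (at x)" using assms unfolding smooth_def by blast
  then show ?thesis unfolding funpow_Suc_right o_def .
 qed
 then show ?thesis unfolding smooth_def by blast
qed

lemma smooth_from_derivative:
 assumes "\<And>x. (\<phi> has_vector_derivative \<psi> x) (at x)" "smooth \<psi>"
 shows "smooth \<phi>"
proof (rule smooth_coinduct[where X = "insert \<phi> {\<psi>. smooth \<psi>}"])
 fix \<xi> assume "\<xi> \<in> insert \<phi> {\<psi>. smooth \<psi>}"
 then consider "\<xi> = \<phi>" | "smooth \<xi>" by blast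
 then show "\<exists>\<phi>'\<in>insert \<phi> {\<psi>. smooth \<psi>}. \<forall>x. (\<xi> has_vector_derivative \<phi>' x) (at x)" proof cases
  case 1 then show ?thesis using assms by (intro bexI[of _ \<psi>]) auto
 next
  case 2 then show ?thesis using smooth_has_vd smooth_vd by (intro bexI[of _ "vd \<xi>"]) auto
 qed
qed simp

lemma smooth_continuous: "smooth \<phi> ==> continuous_on S \<phi>"
 by (rule continuous_at_imp_continuous_on) (blast intro: has_vector_derivative_continuous smooth_has_vd)

lemma smooth_const [simp]: "smooth (\<lambda>_. c)" by (rule smooth_coinduct[where X = "{(\<lambda>_. c), (\<lambda>_. 0)}"]) auto

lemma smooth_add:
 assumes "smooth a" "smooth b" shows "smooth (\<lambda>t. a t + b t)"
proof (rule smooth_coinduct[where X = "{(\<lambda>t. a t + b t) | a b. smooth a \<and> smooth b}"])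
 fix \<phi> assume "\<phi> \<in> {(\<lambda>t. a t + b t) | a b. smooth a \<and> smooth b}"
 then obtain a b where ab: "\<phi> = (\<lambda>t. a t + b t)" "smooth a" "smooth b" by blast
 show "\<exists>\<phi>'\<in>{(\<lambda>t. a t + b t) | a b. smooth a \<and> smooth b}. \<forall>x. (\<phi> has_vector_derivative \<phi>' x) (at x)" proof (rule bexI[where x = "\<lambda>t. vd a t + vd b t"])
  show "\<forall>x. (\<phi> has_vector_derivative vd a x + vd b x) (at x)" unfolding ab(1) by (intro allI has_vector_derivative_add smooth_has_vd ab)
 qed (rule CollectI, intro exI conjI, rule refl, (intro smooth_vd ab)+)
qed (use assms in blast)

text \<open>The derivative of a product is a sum of products, so the set for
  \<open>smooth_coinduct\<close> must be closed under addition.\<close>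

inductive_set mult_class :: "(real => complex) set" where
 base: "smooth a ==> smooth b ==> (\<lambda>t. a t * b t) \<in> mult_class"
| plus: "a \<in> mult_class ==> b \<in> mult_class ==> (\<lambda>t. a t + b t) \<in> mult_class"

lemma smooth_mult:
 assumes "smooth a" "smooth b" shows "smooth (\<lambda>t. a t * b t)"
proof (rule smooth_coinduct[where X = mult_class])
 show "(\<lambda>t. a t * b t) \<in> mult_class" using assms by (rule mult_class.base)
next
 fix \<phi> assume "\<phi> \<in> mult_class"
 then show "\<exists>\<phi>'\<in>mult_class. \<forall>x. (\<phi> has_vector_derivative \<phi>' x) (at x)" proof induction
  case (base a b)
  then have "(\<lambda>t. (a t * vd b t) + (vd a t * b t)) \<in> mult_class" by (intro mult_class.intros smooth_vd)
  then show ?case by (rule rev_bexI) (use base in \<open>auto intro!: has_vector_derivative_mult smooth_has_vd\<close>)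
 next
  case (plus a b)
  then obtain a' b' where "a'\<in>mult_class" "b'\<in>mult_class"
   "\<forall>x. (a has_vector_derivative a' x) (at x)" "\<forall>x. (b has_vector_derivative b' x) (at x)" by blast
  then show ?case by (intro bexI[where x = "\<lambda>t. a' t + b' t"]) (auto intro!: has_vector_derivative_add mult_class.plus)
 qed
qed

lemma smooth_cmult: "smooth a ==> smooth (\<lambda>t. c * a t)" using smooth_mult[OF smooth_const] .

lemma smooth_minus: "smooth a ==> smooth b ==> smooth (\<lambda>t. a t - b t)" using smooth_add[of a "\<lambda>t. (-1) * b t"] smooth_cmult[of b "-1"] by simp

lemma smooth_affine:
 assumes "smooth a" shows "smooth (\<lambda>t. a (c + d * t))"
proof (rule smooth_coinduct[where X = "{(\<lambda>t. e * b (c + d * t)) | e b. smooth b}"])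
 show "(\<lambda>t. a (c + d * t)) \<in> {(\<lambda>t. e * b (c + d * t)) | e b. smooth b}"
  by (rule CollectI, rule exI[where x = 1], rule exI[where x = a]) (simp add: assms)
next
 fix \<phi> assume "\<phi> \<in> {(\<lambda>t. e * b (c + d * t)) | e b. smooth b}"
 then obtain e b where eb: "\<phi> = (\<lambda>t. e * b (c + d * t))" "smooth b" by blast
 have "(\<phi> has_vector_derivative (e * of_real d) * vd b (c + d * x)) (at x)" for x proof -
  have "((\<lambda>t. c + d * t) has_vector_derivative d) (at x)" by (auto intro!: derivative_eq_intros simp: has_vector_derivative_def)
  from vector_diff_chain_at[OF this smooth_has_vd[OF eb(2)]]
  have "((\<lambda>t. b (c + d * t)) has_vector_derivative d *\<^sub>R vd b (c + d * x)) (at x)" by (simp add: o_def)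
  from has_vector_derivative_mult_right[OF this, of e] show ?thesis by (simp add: eb scaleR_conv_of_real mult_ac)
 qed
 then show "\<exists>\<phi>'\<in>{(\<lambda>t. e * b (c + d * t)) | e b. smooth b}. \<forall>x. (\<phi> has_vector_derivative \<phi>' x) (at x)"
  by (intro bexI[where x = "\<lambda>t. (e * of_real d) * vd b (c + d * t)"] CollectI
    exI[where x = "e * of_real d"] exI[where x = "vd b"] conjI allI refl smooth_vd[OF eb(2)])
qed

text \<open>The functions c / (t - z)^n form a set closed under differentiation because z lies off
  the real line. By partial fractions this makes Poisson kernels smooth.\<close>

lemma smooth_inverse_linear:
 assumes "Im z \<noteq> 0" shows "smooth (\<lambda>t. 1 / (of_real t - z))"
proof (rule smooth_coinduct[where X = "{(\<lambda>t. c / (of_real t - z) ^ n) | c n. True}"])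
 show "(\<lambda>t. 1 / (of_real t - z)) \<in> {(\<lambda>t. c / (of_real t - z) ^ n) | c n. True}"
  by (rule CollectI, rule exI[where x = 1], rule exI[where x = "1::nat"]) simp
next
 fix \<phi> assume "\<phi> \<in> {(\<lambda>t. c / (of_real t - z) ^ n) | c n. True}"
 then obtain c n where \<phi>: "\<phi> = (\<lambda>t. c / (of_real t - z) ^ n)" by blast
 have nz: "of_real t - z \<noteq> 0" for t :: real using assms by (auto simp: complex_eq_iff)
 have "(\<phi> has_vector_derivative (- of_nat n * c) / (of_real x - z) ^ (Suc n)) (at x)" for x
 proof (rule has_vector_derivative_real_field[where f = "\<lambda>t. c / (t - z) ^ n", folded \<phi>])
  show "((\<lambda>t. c / (t - z) ^ n) has_field_derivative - of_nat n * c / (of_real x - z) ^ Suc n) (at (of_real x))" proof -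
   have "((\<lambda>t. c * inverse ((t - z) ^ n)) has_field_derivative
     c * (- (inverse ((of_real x - z) ^ n) * (of_nat n * (of_real x - z) ^ (n - 1)) * inverse ((of_real x - z) ^ n)))) (at (of_real x))"
    using nz[of x] by (auto intro!: derivative_eq_intros)
   also have "c * (- (inverse ((of_real x - z) ^ n) * (of_nat n * (of_real x - z) ^ (n - 1)) * inverse ((of_real x - z) ^ n)))
     = - of_nat n * c / (of_real x - z) ^ Suc n" using nz[of x] by (cases n) (simp_all add: divide_simps, simp add: algebra_simps)
   finally show ?thesis by (simp add: divide_inverse)
  qed
 qed
 then show "\<exists>\<phi>'\<in>{(\<lambda>t. c / (of_real t - z) ^ n) | c n. True}. \<forall>x. (\<phi> has_vector_derivative \<phi>' x) (at x)"
  by (intro bexI[where x = "\<lambda>t. (- of_nat n * c) / (of_real t - z) ^ (Suc n)"] CollectI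
    exI[where x = "- of_nat n * c"] exI[where x = "Suc n"] conjI allI refl TrueI) simp
qed

lemma test_functionsI:
 assumes "smooth \<phi>" "compact K" "K \<subseteq> E" "\<And>t. t \<notin> K ==> \<phi> t = 0"
 shows "\<phi> \<in> test_functions E"
proof -
 have "closure {t. \<phi> t \<noteq> 0} \<subseteq> K" using assms by (intro closure_minimal compact_imp_closed) auto
 moreover from this have "compact (closure {t. \<phi> t \<noteq> 0})" using assms(2) by (meson bounded_subset closed_closure compact_eq_bounded_closed)
 ultimately show ?thesis using assms by (auto simp: test_functions_def)
qed

lemma test_functionsE:
 assumes "\<phi> \<in> test_functions E"
 obtains K where "smooth \<phi>" "compact K" "K \<subseteq> E" "\<And>t. t \<notin> K ==> \<phi> t = 0"
 using assms closure_subset[of "{t. \<phi> t \<noteq> 0}"] unfolding test_functions_def by blast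

lemma test_functions_mono: "E \<subseteq> F ==> test_functions E \<subseteq> test_functions F" by (auto simp: test_functions_def)

lemma vd_eq_0_outside:
 assumes "\<And>t. t \<notin> K ==> \<phi> t = 0" "closed K" "t \<notin> K"
 shows "vd \<phi> t = 0"
proof -
 have "(\<phi> has_vector_derivative 0) (at t)" by (rule has_vector_derivative_transform_within_open[where S = "-K" and f = "\<lambda>_. 0"])
    (use assms in \<open>auto simp: open_Compl\<close>)
 then show ?thesis by (rule vector_derivative_at)
qed

lemma test_functions_vd:
 assumes "\<phi> \<in> test_functions E" shows "vd \<phi> \<in> test_functions E"
proof -
 obtain K where K: "smooth \<phi>" "compact K" "K \<subseteq> E" "\<And>t. t \<notin> K ==> \<phi> t = 0" using test_functionsE[OF assms] by blast
 then show ?thesis using smooth_vd vd_eq_0_outside[OF K(4) compact_imp_closed] by (intro test_functionsI[of _ K]) auto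
qed

section \<open>Flat functions, smooth steps and cut-offs\<close>

definition flat_fun :: "nat => real => real" where
 "flat_fun n t = (if 0 < t then exp (- 1 / t) / t ^ n else 0)"

lemma flat_fun_tendsto: "((\<lambda>t. exp (- 1 / t) / t ^ n) \<longlongrightarrow> 0) (at_right (0::real))"
proof -
 have "((\<lambda>t::real. inverse t ^ n / exp (inverse t)) \<longlongrightarrow> 0) (at_right 0)"
  by (rule filterlim_compose[OF tendsto_power_div_exp_0 filterlim_inverse_at_top_right])
 then show ?thesis by (rule tendsto_cong[THEN iffD1, rotated])
    (auto intro!: always_eventually simp: exp_minus field_simps)
qed

text \<open>The powers in the denominator make the family closed under differentiation up to linear
  combinations. Only t = 0 is delicate: there the right difference quotient is the member n + 1 of
  the family, which tends to 0.\<close>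

lemma flat_fun_DERIV:
 "(flat_fun n has_real_derivative (flat_fun (n + 2) t - real n * flat_fun (n + 1) t)) (at t)"
proof -
 consider "t > 0" | "t < 0" | "t = 0" by linarith
 then show ?thesis proof cases
  case 1
  have "((\<lambda>t. exp (- 1 / t) * inverse t ^ n) has_real_derivative (flat_fun (n + 2) t - real n * flat_fun (n + 1) t)) (at t)" proof (cases n)
   case 0
   then show ?thesis using 1 by (auto intro!: derivative_eq_intros simp: flat_fun_def field_simps power2_eq_square)
  next
   case (Suc k)
   have "((\<lambda>t. exp (- 1 / t) * inverse t ^ Suc k) has_real_derivative exp (- 1 / t) * (1 / t^2) * inverse t ^ Suc k +
     exp (- 1 / t) * (real (Suc k) * inverse t ^ k * (- (inverse t * inverse t)))) (at t)"
   proof -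
    have "((\<lambda>t. exp (- 1 / t)) has_real_derivative exp (- 1 / t) * (1 / t^2)) (at t)"
     using 1 by (auto intro!: derivative_eq_intros simp: power2_eq_square)
    from DERIV_mult[OF this DERIV_power_Suc[OF DERIV_inverse[of t], of k]] 1
    show ?thesis by (simp add: power2_eq_square algebra_simps)
   qed
   moreover have "exp (- 1 / t) * (1 / t^2) * inverse t ^ Suc k + exp (- 1 / t) * (real (Suc k) * inverse t ^ k * (- (inverse t * inverse t)))
     = flat_fun (n + 2) t - real n * flat_fun (n + 1) t"
    using 1 Suc by (simp add: flat_fun_def power2_eq_square divide_inverse power_inverse algebra_simps)
   ultimately show ?thesis using Suc by simp
  qed
  then show ?thesis by (rule has_field_derivative_transform_within_open[where S = "{0<..}"])
     (use 1 in \<open>auto simp: flat_fun_def field_simps\<close>)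
 next
  case 2
  have "((\<lambda>t. 0) has_real_derivative (flat_fun (n + 2) t - real n * flat_fun (n + 1) t)) (at t)" using 2 by (simp add: flat_fun_def)
  then show ?thesis by (rule has_field_derivative_transform_within_open[where S = "{..<0}"])
     (use 2 in \<open>auto simp: flat_fun_def\<close>)
 next
  case 3
  have "((\<lambda>h. (flat_fun n (0 + h) - flat_fun n 0) / h) \<longlongrightarrow> 0) (at 0)" proof (rule filterlim_split_at_real)
   show "((\<lambda>h. (flat_fun n (0 + h) - flat_fun n 0) / h) \<longlongrightarrow> 0) (at_left 0)" by (rule tendsto_eventually) (auto simp: flat_fun_def eventually_at_filter)
   have "\<forall>\<^sub>F h in at_right 0. exp (- 1 / h) / h ^ Suc n = (flat_fun n (0 + h) - flat_fun n 0) / h"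
    by (auto simp: flat_fun_def eventually_at_filter field_simps)
   then show "((\<lambda>h. (flat_fun n (0 + h) - flat_fun n 0) / h) \<longlongrightarrow> 0) (at_right 0)" by (rule tendsto_cong[THEN iffD1]) (rule flat_fun_tendsto)
  qed
  then show ?thesis using 3 by (simp add: DERIV_def flat_fun_def)
 qed
qed

inductive_set flat_class :: "(real => complex) set" where
 base: "(\<lambda>t. c * of_real (flat_fun n t)) \<in> flat_class"
| plus: "a \<in> flat_class ==> b \<in> flat_class ==> (\<lambda>t. a t + b t) \<in> flat_class"

lemma smooth_flat_fun: "smooth (\<lambda>t. of_real (flat_fun n t))"
proof (rule smooth_coinduct[where X = flat_class])
 show "(\<lambda>t. of_real (flat_fun n t)) \<in> flat_class" using flat_class.base[of 1 n] by simp
next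
 fix \<phi> assume "\<phi> \<in> flat_class"
 then show "\<exists>\<phi>'\<in>flat_class. \<forall>x. (\<phi> has_vector_derivative \<phi>' x) (at x)" proof induction
  case (base c n)
  have "((\<lambda>t. c * of_real (flat_fun n t)) has_vector_derivative
    c * of_real (flat_fun (n + 2) x) + (- c * of_nat n) * of_real (flat_fun (n + 1) x)) (at x)" for x
  proof -
   from has_vector_derivative_mult_right[OF has_vector_derivative_of_real[OF flat_fun_DERIV[of n x]], of c]
   show ?thesis by (simp add: algebra_simps)
  qed
  then show ?case by (intro bexI[where x = "\<lambda>x. c * of_real (flat_fun (n + 2) x) + (- c * of_nat n) * of_real (flat_fun (n + 1) x)"]
     flat_class.plus flat_class.base) blast
 next
  case (plus a b)
  then obtain a' b' where "a'\<in>flat_class" "b'\<in>flat_class"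
   "\<forall>x. (a has_vector_derivative a' x) (at x)" "\<forall>x. (b has_vector_derivative b' x) (at x)" by blast
  then show ?case by (intro bexI[where x = "\<lambda>t. a' t + b' t"]) (auto intro!: has_vector_derivative_add flat_class.plus)
 qed
qed

definition bump :: "real => complex" where
 "bump t = of_real (flat_fun 0 t) * of_real (flat_fun 0 (1 - t))"

lemma bump_of_real: "bump t = of_real (flat_fun 0 t * flat_fun 0 (1 - t))" by (simp add: bump_def)

lemma smooth_bump: "smooth bump" unfolding bump_def using smooth_affine[OF smooth_flat_fun[of 0], of 1 "-1"]
 by (intro smooth_mult smooth_flat_fun) simp

lemma bump_0: "t \<le> 0 \<or> 1 \<le> t ==> bump t = 0" by (auto simp: bump_def flat_fun_def)

definition step :: "real => complex" where
 "step t = integral {0..t} bump / integral {0..1} bump"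

lemma smooth_step: "smooth step"
proof (rule smooth_from_derivative)
 fix x :: real
 have cont: "continuous_on S bump" for S by (rule smooth_continuous[OF smooth_bump])
 have int: "bump integrable_on {a..b}" for a b by (intro integrable_continuous_interval cont)
 \<comment> \<open>The primitive is taken from a point left of both 0 and x, since differentiation
   at x needs an interval around x while \<open>{0..t}\<close> is empty for t < 0. The bump vanishes
   left of 0, so the value is the same.\<close>
 define B where "B = min 0 x - 1"
 have eq: "integral {0..t} bump = integral {B..t} bump" if t: "t > B" for t proof (cases "t \<ge> 0")
  case True
  have "integral {B..0} bump = integral {B..0} (\<lambda>_. 0::complex)" by (rule integral_cong) (auto intro: bump_0)
  then have "integral {B..0} bump = 0" by simp
  with True show ?thesis using Henstock_Kurzweil_Integration.integral_combine[OF _ True int, of B] by (simp add: B_def)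
 next
  case False
  have "integral {B..t} bump = integral {B..t} (\<lambda>_. 0::complex)" by (rule integral_cong) (use False in \<open>auto intro: bump_0\<close>)
  with False show ?thesis by simp
 qed
 have "((\<lambda>t. integral {B..t} bump) has_vector_derivative bump x) (at x within {B..x+1})"
  by (rule integral_has_vector_derivative) (auto intro: cont simp: B_def)
 then have "((\<lambda>t. integral {B..t} bump) has_vector_derivative bump x) (at x)" by (subst (asm) at_within_interior) (auto simp: B_def)
 then have "((\<lambda>t. integral {0..t} bump) has_vector_derivative bump x) (at x)"
  by (rule has_vector_derivative_transform_within_open[where S = "{B<..}"])
    (auto simp: eq, auto simp: B_def)
 then show "(step has_vector_derivative bump x * inverse (integral {0..1} bump)) (at x)"
  unfolding step_def[abs_def] divide_inverse by (rule has_vector_derivative_mult_left)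
 show "smooth (\<lambda>x. bump x * inverse (integral {0..1} bump))" by (intro smooth_mult smooth_bump) simp
qed

lemma step_0: "t \<le> 0 ==> step t = 0" by (cases "t = 0") (auto simp: step_def)

lemma step_1: assumes "1 \<le> t" shows "step t = 1"
proof -
 have cont: "continuous_on S bump" for S by (rule smooth_continuous[OF smooth_bump])
 have int: "bump integrable_on {a..b}" for a b by (intro integrable_continuous_interval cont)
 have "integral {1..t} bump = integral {1..t} (\<lambda>_. 0::complex)" by (rule integral_cong) (auto intro: bump_0)
 then have eq: "integral {0..t} bump = integral {0..1} bump" using Henstock_Kurzweil_Integration.integral_combine[OF _ assms int, of 0] by simp
 have c: "continuous_on {0..1} (\<lambda>t. flat_fun 0 t * flat_fun 0 (1 - t))"
  using continuous_on_Re[OF cont[of "{0..1}"]] by (simp add: bump_of_real del: of_real_mult)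
 have "integral {0..1} bump = of_real (integral {0..1} (\<lambda>t. flat_fun 0 t * flat_fun 0 (1 - t)))"
  using integral_linear[OF integrable_continuous_interval[OF c] bounded_linear_of_real] by (simp add: bump_of_real[abs_def] o_def del: of_real_mult)
 \<comment> \<open>The integrand is continuous, nonnegative and positive at 1/2, so the normalising
   integral cannot be 0.\<close>
 moreover have "integral {0..1} (\<lambda>t. flat_fun 0 t * flat_fun 0 (1 - t)) \<noteq> 0" proof
  assume "integral {0..1} (\<lambda>t. flat_fun 0 t * flat_fun 0 (1 - t)) = 0"
  then have "\<forall>t\<in>{0..1}. flat_fun 0 t * flat_fun 0 (1 - t) = 0" by (subst (asm) integral_eq_0_iff[OF c]) (auto simp: flat_fun_def)
  from bspec[OF this, of "1/2"] have "flat_fun 0 (1/2) * flat_fun 0 (1 - 1/2) = 0" by simp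
  then show False by (simp add: flat_fun_def)
 qed
 ultimately show ?thesis by (simp add: step_def eq)
qed

text \<open>Without such an h the choice in \<open>cutoff\<close> would be arbitrary. The witness is
  the product of a rising and a falling step, with margin l equal to a quarter of the distance to
  the nearer end point.\<close>

lemma cutoff_exists:
 assumes "a < x" "x < b"
 obtains h where "h \<in> test_functions {a<..<b}" "\<forall>\<^sub>F t in nhds x. h t = 1"
proof -
 define l where "l = min (x - a) (b - x) / 4"
 have l: "l > 0" "a + l < x - 2 * l" "x + 2 * l < b - l" using assms by (auto simp: l_def min_def field_simps)
 define h where "h t = step ((t - (a + l)) / l) * step ((b - l - t) / l)" for t
 have "h = (\<lambda>t. step (-(a + l) / l + 1 / l * t) * step ((b - l) / l + (-1 / l) * t))"
  using l(1) by (intro ext) (simp add: h_def diff_divide_distrib add_divide_distrib algebra_simps)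
 moreover have "smooth (\<lambda>t. step (-(a + l) / l + 1 / l * t) * step ((b - l) / l + (-1 / l) * t))"
  by (rule smooth_mult[OF smooth_affine[OF smooth_step] smooth_affine[OF smooth_step]])
 ultimately have "smooth h" by (simp only:)
 then have "h \<in> test_functions {a<..<b}" proof (rule test_functionsI[where K = "{a+l..b-l}"])
  fix t assume "t \<notin> {a+l..b-l}"
  then have "t - (a + l) \<le> 0 \<or> b - l - t \<le> 0" by auto
  then have "(t - (a + l)) / l \<le> 0 \<or> (b - l - t) / l \<le> 0" using l(1) by (auto simp only: divide_le_0_iff)
  then show "h t = 0" by (auto simp: h_def step_0)
 qed (use l in auto)
 moreover have "\<forall>\<^sub>F t in nhds x. h t = 1" unfolding eventually_nhds proof (intro exI[where x = "{x-l<..<x+l}"] conjI ballI)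
  fix t assume t: "t \<in> {x-l<..<x+l}"
  have "1 \<le> (t - (a + l)) / l" "1 \<le> (b - l - t) / l" using l t by auto
  then show "h t = 1" by (simp add: h_def step_1)
 qed (use l in auto)
 ultimately show ?thesis using that by blast
qed

text \<open>Since \<open>-\<beta> / 0 = 0\<close>, the function \<open>\<psi> \<circ> (\<lambda>s. -\<beta> / s)\<close> vanishes at 0 too.\<close>

inductive_set inversion_class :: "real => (real => complex) set" for \<beta> where
 base: "smooth a ==> (\<And>t. t \<notin> {r..R} \<union> {-R..-r} ==> a t = 0) ==> 0 < r ==> (\<lambda>s. c * a (- \<beta> / s) / of_real s ^ n) \<in> inversion_class \<beta>"
| plus: "a \<in> inversion_class \<beta> ==> b \<in> inversion_class \<beta> ==> (\<lambda>t. a t + b t) \<in> inversion_class \<beta>"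

lemma smooth_inversion:
 assumes "smooth a" and "\<And>t. t \<notin> {r..R} \<union> {-R..-r} ==> a t = 0" and "0 < r" and "0 < \<beta>"
 shows "smooth (\<lambda>s. a (- \<beta> / s))"
proof (rule smooth_coinduct[where X = "inversion_class \<beta>"])
 show "(\<lambda>s. a (- \<beta> / s)) \<in> inversion_class \<beta>" using inversion_class.base[OF assms(1-3), of R 1 \<beta> 0] by simp
next
 fix \<phi> assume "\<phi> \<in> inversion_class \<beta>"
 then show "\<exists>\<phi>'\<in>inversion_class \<beta>. \<forall>x. (\<phi> has_vector_derivative \<phi>' x) (at x)" proof induction
  case (base a r R c n)
  define f' where "f' = (\<lambda>s. (c * of_real \<beta>) * vd a (- \<beta> / s) / of_real s ^ (n + 2) + (- c * of_nat n) * a (- \<beta> / s) / of_real s ^ (n + 1))"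
  have vd0: "vd a t = 0" if "t \<notin> {r..R} \<union> {-R..-r}" for t by (rule vd_eq_0_outside[OF base(2) _ that]) auto
  have "((\<lambda>s. c * a (- \<beta> / s) / of_real s ^ n) has_vector_derivative f' x) (at x)" for x proof (cases "x = 0")
   case True
   \<comment> \<open>For |s| < d the argument - \<beta> / s lies beyond |R|, where a vanishes;
     \<open>abs R + 1\<close> because R may be 0 or negative.\<close>
   define d where "d = \<beta> / (abs R + 1)"
   have d: "d > 0" using assms(4) by (simp add: d_def)
   have 0: "a (- \<beta> / s) = 0" if "abs s < d" for s proof (cases "s = 0")
    case True then show ?thesis using base(2)[of 0] base(3) by auto
   next
    case False
    have "\<bar>\<beta> / s\<bar> > \<bar>R\<bar>" using False that assms(4) by (simp add: d_def field_simps abs_mult)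
    then have "\<bar>- \<beta> / s\<bar> > \<bar>R\<bar>" by simp
    moreover have "y \<notin> {r..R} \<union> {-R..-r}" if "abs R < abs y" for y using that base(3) by auto
    ultimately show ?thesis by (intro base(2))
   qed
   have "f' 0 = 0" using base(2)[of 0] vd0[of 0] base(3) by (auto simp: f'_def)
   moreover have "((\<lambda>s. c * a (- \<beta> / s) / of_real s ^ n) has_vector_derivative 0) (at 0)"
    by (rule has_vector_derivative_transform_within_open[where S = "{-d<..<d}" and f = "\<lambda>_. 0"])
      (use d 0 in auto)
   ultimately show ?thesis using True by simp
  next
   case False
   have "((\<lambda>s. - \<beta> / s) has_vector_derivative \<beta> / x^2) (at x)"
    using False by (auto intro!: derivative_eq_intros simp: has_real_derivative_iff_has_vector_derivative[symmetric] power2_eq_square)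
   from vector_diff_chain_at[OF this smooth_has_vd[OF base(1)]]
   have 1: "((\<lambda>s. a (- \<beta> / s)) has_vector_derivative (\<beta> / x^2) *\<^sub>R vd a (- \<beta> / x)) (at x)" by (simp add: o_def)
   have 2: "((\<lambda>s. c * inverse (of_real s ^ n)) has_vector_derivative
     c * (- (inverse (of_real x ^ n) * (of_nat n * of_real x ^ (n - 1)) * inverse (of_real x ^ n)))) (at x)"
    by (rule has_vector_derivative_real_field) (use False in \<open>auto intro!: derivative_eq_intros\<close>)
   have e: "c * inverse (of_real x ^ n) * ((\<beta> / x^2) *\<^sub>R vd a (- \<beta> / x)) +
     c * (- (inverse (of_real x ^ n) * (of_nat n * of_real x ^ (n - 1)) * inverse (of_real x ^ n))) * a (- \<beta> / x) = f' x"
    using False by (cases n) (simp_all add: f'_def scaleR_conv_of_real field_simps power2_eq_square)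
   show ?thesis using has_vector_derivative_mult[OF 2 1] unfolding e by (simp add: divide_inverse mult_ac)
  qed
  moreover have "f' \<in> inversion_class \<beta>" unfolding f'_def
   by (intro inversion_class.plus inversion_class.base[of _ r R] smooth_vd base(1,3)) (use vd0 base(2) in auto)
  ultimately show ?case by blast
 next
  case (plus a b)
  then obtain a' b' where "a'\<in>inversion_class \<beta>" "b'\<in>inversion_class \<beta>"
   "\<forall>x. (a has_vector_derivative a' x) (at x)" "\<forall>x. (b has_vector_derivative b' x) (at x)" by blast
  then show ?case by (intro bexI[where x = "\<lambda>t. a' t + b' t"]) (auto intro!: has_vector_derivative_add inversion_class.plus)
 qed
qed

section \<open>Inversion and periodization\<close>

lemma AE_lebesgue_neq: "AE x in lebesgue. x \<noteq> (c::real)"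
proof -
 have "{c} \<in> null_sets lebesgue" by simp
 then show ?thesis by (rule AE_I') auto
qed

text \<open>The map x -> - \<beta> / x is a bijection of the punctured line with derivative \<beta>
  / x^2, so this is a change of variables. It makes \<open>J_fun\<close> an isometry of L1 that
  preserves mean zero.\<close>

lemma inversion_integral_real:
 fixes f :: "real => real"
 assumes b: "0 < \<beta>" and f: "Lintegrable f"
 shows "Lintegrable (\<lambda>x. \<beta> / x^2 * f (- \<beta> / x))"
  and "(LI x. \<beta> / x^2 * f (- \<beta> / x)) = (LI x. f x)"
proof -
 let ?S = "- {0::real}" and ?g = "\<lambda>x. - \<beta> / x" and ?g' = "\<lambda>x. \<beta> / x^2"
 have S: "?S \<in> sets lebesgue" by simp
 have der: "(?g has_field_derivative ?g' x) (at x within ?S)" if "x \<in> ?S" for x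
  using that by (auto intro!: derivative_eq_intros simp: power2_eq_square)
 have inj: "inj_on ?g ?S" using b by (auto simp: inj_on_def)
 have img: "?g ` ?S = ?S" proof (intro equalityI subsetI)
  fix x :: real assume "x \<in> ?S"
  then show "x \<in> ?g ` ?S" using b by (intro image_eqI[of _ _ "- \<beta> / x"]) auto
 next
  fix x assume "x \<in> ?g ` ?S"
  then show "x \<in> ?S" using b by auto
 qed
 have fS: "set_integrable lebesgue ?S f" unfolding set_integrable_def by (intro integrable_mult_indicator f S)
 have eq: "(\<lambda>x. indicator ?S x *\<^sub>R (\<bar>?g' x\<bar> * f (?g x))) = (\<lambda>x. \<beta> / x^2 * f (- \<beta> / x))" using b by (auto simp: fun_eq_iff indicator_def)
 have *: "(\<lambda>x. \<bar>?g' x\<bar> * f(?g x)) absolutely_integrable_on ?S \<and> integral ?S (\<lambda>x. \<bar>?g' x\<bar> * f (?g x)) = integral ?S f"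
  using has_absolute_integral_change_of_variables_1'[OF S der inj, of f "integral ?S f"] fS unfolding img by simp
 then show "Lintegrable (\<lambda>x. \<beta> / x^2 * f (- \<beta> / x))" unfolding set_integrable_def eq by simp
 have "(LI x. \<beta> / x^2 * f (- \<beta> / x)) = (LINT x:?S|lebesgue. \<bar>?g' x\<bar> * f (?g x))" unfolding set_lebesgue_integral_def eq ..
 also have "... = (LINT x:?S|lebesgue. f x)" using * set_lebesgue_integral_eq_integral(2)[OF fS]
   set_lebesgue_integral_eq_integral(2)[of ?S "\<lambda>x. \<bar>?g' x\<bar> * f(?g x)"] by simp
 also have "... = (LI x. f x)" unfolding set_lebesgue_integral_def proof (rule integral_cong_AE)
  show "(\<lambda>x. indicat_real (- {0}) x *\<^sub>R f x) \<in> Lmeasurable" using fS unfolding set_integrable_def by (rule borel_measurable_integrable)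
  show "AE x in lebesgue. indicat_real (- {0}) x *\<^sub>R f x = f x" using AE_lebesgue_neq[of 0] by eventually_elim simp
 qed (use f in simp)
 finally show "(LI x. \<beta> / x^2 * f (- \<beta> / x)) = (LI x. f x)" .
qed

lemma inversion_integral:
 fixes f :: "real => complex"
 assumes b: "0 < \<beta>" and f: "Lintegrable f"
 shows "Lintegrable (J_fun \<beta> f)"
  and "(LI x. J_fun \<beta> f x) = (LI x. f x)"
proof -
 have eq: "J_fun \<beta> f = (\<lambda>x. of_real (\<beta> / x^2 * Re (f (- \<beta> / x))) + \<i> * of_real (\<beta> / x^2 * Im (f (- \<beta> / x))))"
  by (rule ext) (simp add: J_fun_def complex_eq_iff)
 note R = inversion_integral_real[OF b integrable_Re[OF f]]
 note I = inversion_integral_real[OF b integrable_Im[OF f]]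
 show i: "Lintegrable (J_fun \<beta> f)" unfolding eq by (intro bochner_integrable_add integrable_mult_right integrable_of_real R I)
 have "Re (LI x. J_fun \<beta> f x) = (LI x. \<beta> / x^2 * Re (f (- \<beta> / x)))" by (subst integral_Re[OF i, symmetric]) (simp add: eq)
 moreover have "Im (LI x. J_fun \<beta> f x) = (LI x. \<beta> / x^2 * Im (f (- \<beta> / x)))" by (subst integral_Im[OF i, symmetric]) (simp add: eq)
 ultimately show "(LI x. J_fun \<beta> f x) = (LI x. f x)" using R(2) I(2) f by (simp add: complex_eq_iff)
qed

text \<open>Truncating a at height n and to [-n, n] gives integrable functions increasing to a. The
  change of variables for integrable functions applies to these; the rest is monotone
  convergence.\<close>

lemma inversion_nn_integral:
 fixes a :: "real => ennreal"
 assumes b: "0 < \<beta>" and a: "a \<in> Lmeasurable"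
 shows "(\<lambda>x. ennreal (\<beta> / x^2) * a (- \<beta> / x)) \<in> Lmeasurable"
  and "(NI x. ennreal (\<beta> / x^2) * a (- \<beta> / x)) = (NI x. a x)"
proof -
 define f where "f n x = enn2real (min (a x) (of_nat n)) * indicator {- real n..real n} x" for n x
 have f0: "0 \<le> f n x" for n x by (simp add: f_def)
 have fm: "f n \<in> Lmeasurable" for n proof -
  have "(\<lambda>x. enn2real (min (a x) (of_nat n))) \<in> Lmeasurable" using a by measurable
  then show ?thesis unfolding f_def[abs_def] by (intro borel_measurable_times borel_measurable_indicator) auto
 qed
 have le: "enn2real (min (a x) (of_nat n)) \<le> real n" for x n by (rule enn2real_leI) (simp_all add: ennreal_of_nat_eq_real_of_nat)
 have fi: "Lintegrable (f n)" for n proof (rule Bochner_Integration.integrable_bound[OF _ fm])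
  show "Lintegrable (\<lambda>x. real n * indicator {- real n..real n} x)" by simp
 qed (use le in \<open>auto simp: f_def indicator_def\<close>)
 have ef: "ennreal (f n x) = min (a x) (of_nat n) * indicator {- real n..real n} x" for n x by (auto simp: f_def indicator_def min_def)
    (subst ennreal_enn2real, auto simp: less_top[symmetric] ennreal_of_nat_eq_real_of_nat top_unique)
 have inc: "incseq (\<lambda>n. ennreal (f n x))" for x unfolding ef by (intro incseq_SucI mult_mono) (auto simp: min_def indicator_def intro: order_trans)
 have sup: "(SUP n. ennreal (f n x)) = a x" for x proof (rule antisym)
  show "(SUP n. ennreal (f n x)) \<le> a x" by (intro SUP_least) (auto simp: ef indicator_def)
  obtain N where N: "abs x \<le> real N" using real_arch_simple by blast
  show "a x \<le> (SUP n. ennreal (f n x))" proof (rule dense_le)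
   fix y assume "y < a x"
   then have "y < top" using less_top by (metis order_less_le_trans top_greatest)
   then obtain m where m: "y \<le> of_nat m" by (metis ennreal_Ex_less_of_nat less_imp_le)
   have "y \<le> ennreal (f (max m N) x)" unfolding ef using N m \<open>y < a x\<close> by (auto simp: indicator_def min_def max_def intro: order_trans less_imp_le)
   then show "y \<le> (SUP n. ennreal (f n x))" by (rule order_trans) (intro SUP_upper UNIV_I)
  qed
 qed
 define g where "g n x = \<beta> / x^2 * f n (- \<beta> / x)" for n x
 note G = inversion_integral_real[OF b fi, folded g_def]
 have g0: "0 \<le> g n x" for n x using b f0 by (simp add: g_def)
 have eg: "ennreal (g n x) = ennreal (\<beta> / x^2) * ennreal (f n (- \<beta> / x))" for n x
  using b f0 by (simp add: g_def ennreal_mult del: times_divide_eq_left)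
 have incg: "incseq (\<lambda>n. ennreal (g n x))" for x unfolding eg using inc[of "- \<beta> / x"] by (auto simp: incseq_def intro: mult_left_mono)
 have supg: "(SUP n. ennreal (g n x)) = ennreal (\<beta> / x^2) * a (- \<beta> / x)" for x
  unfolding eg by (subst SUP_mult_left_ennreal[symmetric]) (simp only: sup)
 have gm: "(\<lambda>x. ennreal (g n x)) \<in> Lmeasurable" for n
  using borel_measurable_integrable[OF G(1)] by (intro measurable_compose[OF _ measurable_ennreal])
 show "(\<lambda>x. ennreal (\<beta> / x^2) * a (- \<beta> / x)) \<in> Lmeasurable" unfolding supg[symmetric] by (intro borel_measurable_SUP gm) auto
 have "(NI x. ennreal (\<beta> / x^2) * a (- \<beta> / x)) = (SUP n. \<integral>\<^sup>+x. ennreal (g n x) \<partial>lebesgue)"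
  unfolding supg[symmetric] using incg by (intro nn_integral_monotone_convergence_SUP gm) (auto simp: incseq_def le_fun_def)
 also have "... = (SUP n. \<integral>\<^sup>+x. ennreal (f n x) \<partial>lebesgue)" using nn_integral_eq_integral[OF G(1)] nn_integral_eq_integral[OF fi] g0 f0 G(2) by simp
 also have "... = (NI x. a x)" unfolding sup[symmetric] using inc fm
  by (intro nn_integral_monotone_convergence_SUP[symmetric]) (auto simp: incseq_def le_fun_def)
 finally show "(NI x. ennreal (\<beta> / x^2) * a (- \<beta> / x)) = (NI x. a x)" .
qed

section \<open>Periodization over the cells [2j - 1, 2j + 1[\<close>

abbreviation shift :: "nat => real" where
 "shift n \<equiv> 2 * real_of_int (int_decode n)"

text \<open>Omitting j = 0 from a sum over the integers thus means omitting the first term of the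
  enumerated series.\<close>

lemma shift_0: "int_decode 0 = 0" by (simp add: int_decode_def sum_decode_def)

definition cell :: "nat => real set" where
 "cell n = {shift n - 1..<shift n + 1}"

lemma cell_sets [measurable]: "cell n \<in> sets lebesgue" by (simp add: cell_def)

lemma cell_Union: "(\<Union>n. cell n) = UNIV"
proof -
 have "x \<in> cell (int_encode \<lfloor>(x + 1) / 2\<rfloor>)" for x proof -
  define k where "k = \<lfloor>(x + 1) / 2\<rfloor>"
  have "real_of_int k \<le> (x + 1) / 2" "(x + 1) / 2 < real_of_int k + 1" unfolding k_def by linarith+
  then have "2 * real_of_int k - 1 \<le> x" "x < 2 * real_of_int k + 1" by (simp_all add: field_simps)
  then show ?thesis by (simp add: cell_def k_def)
 qed
 then show ?thesis by blast
qed

lemma cell_disjoint: "disjoint_family cell"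
proof -
 have "n = m" if "x \<in> cell n" "x \<in> cell m" for x n m proof -
  have "\<bar>real_of_int (int_decode n) - real_of_int (int_decode m)\<bar> < 1" using that unfolding cell_def by (auto simp: abs_if)
  then have "int_decode n = int_decode m" by linarith
  then show ?thesis by (simp add: int_decode_eq)
 qed
 then show ?thesis unfolding disjoint_family_on_def by blast
qed

lemma shift_cell_iff: "x + shift n \<in> cell n \<longleftrightarrow> x \<in> {-1..<1}" by (auto simp: cell_def)

lemma lebesgue_measurable_shift:
 fixes f :: "real => 'b::topological_space"
 assumes "f \<in> Lmeasurable"
 shows "(\<lambda>x. f (x + c)) \<in> Lmeasurable"
proof -
 have "(\<lambda>x. c + 1 * x) \<in> lebesgue \<rightarrow>\<^sub>M lebesgue" using lebesgue_affine_measurable[where c = "\<lambda>x::real. 1"] by simp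
 from measurable_compose[OF this assms] show ?thesis by (simp add: add.commute)
qed

lemma nn_integral_shift:
 "f \<in> Lmeasurable ==> (NI x. f (x + c)) = (NI x. f x)" for c :: real using nn_integral_real_affine_lebesgue[of f 1 c] by (simp add: add.commute)

lemma integrable_shift:
 "Lintegrable f ==> Lintegrable (\<lambda>x. f (x + c))" for f :: "real => complex" using lebesgue_integrable_real_affine[of f 1 c] by (simp add: add.commute)

lemma integral_shift: "(LI x. f (x + c)) = (LI x. f x)" for f :: "real => complex"
 using lebesgue_integral_real_affine[of 1 f c] by (simp add: add.commute)

text \<open>The n-th translate, read over [-1, 1[, collects the part of a in cell n, and the cells
  tile the line.\<close>

lemma nn_integral_periodize:
 assumes [measurable]: "a \<in> Lmeasurable"
 shows "(\<integral>\<^sup>+x\<in>{-1..<1}. (\<Sum>n. a (x + shift n)) \<partial>lebesgue) = (NI x. a x)"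
proof -
 have [measurable]: "(\<lambda>x. a (x + shift n)) \<in> Lmeasurable" for n by (rule lebesgue_measurable_shift) simp
 have "(\<integral>\<^sup>+x\<in>{-1..<1}. (\<Sum>n. a (x + shift n)) \<partial>lebesgue) = (NI x. (\<Sum>n. a (x + shift n) * indicator (cell n) (x + shift n)))"
  using shift_cell_iff by (intro nn_integral_cong) (simp add: indicator_def)
 also have "... = (\<Sum>n. \<integral>\<^sup>+x. a (x + shift n) * indicator (cell n) (x + shift n) \<partial>lebesgue)"
  by (rule nn_integral_suminf, rule lebesgue_measurable_shift[where f = "\<lambda>x. a x * indicator (cell _) x"]) measurable
 also have "... = (\<Sum>n. \<integral>\<^sup>+x. a x * indicator (cell n) x \<partial>lebesgue)" proof (rule suminf_cong)
  fix n
  show "(NI x. a (x + shift n) * indicator (cell n) (x + shift n)) = (NI x. a x * indicator (cell n) x)"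
   by (rule nn_integral_shift[where f = "\<lambda>x. a x * indicator (cell n) x"]) measurable
 qed
 also have "... = (NI x. (\<Sum>n. a x * indicator (cell n) x))" by (rule nn_integral_suminf[symmetric]) measurable
 also have "... = (NI x. a x)" by (simp add: suminf_indicator[OF cell_disjoint] cell_Union)
 finally show ?thesis .
qed

lemma periodize_eq_suminf:
 assumes "summable (\<lambda>n. norm (f (x + shift n)))"
 shows "periodize f x = (\<Sum>n. f (x + shift n))"
proof -
 have "((\<lambda>n. f (x + shift n)) has_sum (\<Sum>n. f (x + shift n))) UNIV"
  using assms by (intro norm_summable_imp_has_sum summable_sums summable_norm_cancel[OF assms])
 then have "infsum (\<lambda>n. f (x + shift n)) UNIV = (\<Sum>n. f (x + shift n))" by (rule infsumI)
 then show ?thesis unfolding periodize_def using infsum_reindex_bij_betw[OF bij_int_decode, of "\<lambda>j. f (x + 2 * of_int j)"] by simp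
qed

lemma summable_norm_iff_ennreal:
 "summable (\<lambda>n. norm (f n)) \<longleftrightarrow> (\<Sum>n. ennreal (norm (f n))) \<noteq> top"
 using summable_suminf_not_top[of "\<lambda>n. norm (f n)"] by (metis norm_ge_zero suminf_ennreal2 ennreal_neq_top)

text \<open>For complex series unconditional and absolute convergence agree, so
  \<open>infsum\<close> takes its default value 0 exactly where the series of norms diverges. This
  lets the pointwise bounds below hold everywhere, not only almost everywhere.\<close>

lemma not_summable_periodize:
 assumes "\<not> summable (\<lambda>n. norm (f (x + shift n)))"
 shows "periodize f x = 0"
proof -
 have "\<not> (\<lambda>j::int. f (x + 2 * of_int j)) summable_on UNIV" proof
  assume "(\<lambda>j::int. f (x + 2 * of_int j)) summable_on UNIV"
  then have "(\<lambda>n. f (x + shift n)) summable_on UNIV" using summable_on_reindex_bij_betw[OF bij_int_decode, of "\<lambda>j. f (x + 2 * of_int j)"] by simp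
  then have "(\<lambda>n. norm (f (x + shift n))) summable_on UNIV" by (rule summable_on_iff_abs_summable_on_complex[THEN iffD1])
  then have "summable (\<lambda>n. norm (f (x + shift n)))" using summable_on_UNIV_nonneg_real_iff by auto
  with assms show False by blast
 qed
 then show ?thesis unfolding periodize_def by (rule infsum_not_exists)
qed

lemma norm_periodize_le: "ennreal (norm (periodize f x)) \<le> (\<Sum>n. ennreal (norm (f (x + shift n))))"
proof (cases "summable (\<lambda>n. norm (f (x + shift n)))")
 case True
 then have "norm (periodize f x) \<le> (\<Sum>n. norm (f (x + shift n)))" by (simp add: periodize_eq_suminf summable_norm)
 then show ?thesis using True by (subst suminf_ennreal2) (auto intro: ennreal_leI)
qed (simp add: not_summable_periodize)

text \<open>Where the series diverges, \<open>periodize f x\<close> is 0 and the left side is the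
  norm of \<open>f x\<close>; the right side is then still infinite, as only one finite term was
  removed.\<close>

lemma norm_periodize_minus_le:
 "ennreal (norm (periodize f x - f x)) \<le> (\<Sum>n. if n = 0 then 0 else ennreal (norm (f (x + shift n))))"
proof (cases "summable (\<lambda>n. norm (f (x + shift n)))")
 case True
 have s: "summable (\<lambda>n. norm (f (x + shift (Suc n))))" using True by (subst summable_Suc_iff)
 have "periodize f x - f x = (\<Sum>n. f (x + shift (Suc n)))" unfolding periodize_eq_suminf[OF True]
  by (subst suminf_split_head[OF summable_norm_cancel[OF True]]) (simp add: shift_0)
 then have "norm (periodize f x - f x) \<le> (\<Sum>n. norm (f (x + shift (Suc n))))" using summable_norm[OF s] by simp
 then have "ennreal (norm (periodize f x - f x)) \<le> (\<Sum>n. ennreal (norm (f (x + shift (Suc n)))))"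
  using s by (subst suminf_ennreal2) (auto intro: ennreal_leI)
 also have "... = (\<Sum>n. if n = 0 then 0 else ennreal (norm (f (x + shift n))))" by (subst (2) suminf_offset[of _ 1]) auto
 finally show ?thesis .
next
 case False
 then have "(\<Sum>n. ennreal (norm (f (x + shift n)))) = top" using summable_norm_iff_ennreal[of "\<lambda>n. f (x + shift n)"] by blast
 moreover have "(\<Sum>n. ennreal (norm (f (x + shift n)))) = ennreal (norm (f x)) + (\<Sum>n. ennreal (norm (f (x + shift (Suc n)))))"
  by (subst suminf_offset[of _ 1]) (auto simp: shift_0)
 ultimately have "(\<Sum>n. ennreal (norm (f (x + shift (Suc n))))) = top" by simp
 moreover have "(\<Sum>n. if n = 0 then 0 else ennreal (norm (f (x + shift n)))) = (\<Sum>n. ennreal (norm (f (x + shift (Suc n)))))"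
  by (subst suminf_offset[of _ 1]) auto
 ultimately show ?thesis by simp
qed

lemma periodize_integral:
 assumes f: "Lintegrable f"
 shows "set_integrable lebesgue {-1..1} (periodize f)"
  and "(LINT x:{-1..1}|lebesgue. periodize f x) = (LI x. f x)"
proof -
 define u where "u n x = indicator (cell n) (x + shift n) *\<^sub>R f (x + shift n)" for n x
 have fm[measurable]: "f \<in> Lmeasurable" using f by simp
 have nm: "(\<lambda>x. ennreal (norm (f x))) \<in> Lmeasurable" by measurable
 have fc: "Lintegrable (\<lambda>x. indicator (cell n) x *\<^sub>R f x)" for n by (intro integrable_mult_indicator f cell_sets)
 have ui: "Lintegrable (u n)" for n unfolding u_def by (rule integrable_shift[OF fc])
 have lu: "(LI x. u n x) = (LINT x:cell n|lebesgue. f x)" for n unfolding u_def set_lebesgue_integral_def by (rule integral_shift)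
 have un: "u n x = indicator {-1..<1} x *\<^sub>R f (x + shift n)" for n x unfolding u_def using shift_cell_iff[of x n] by (simp add: indicator_def)
 have fin: "(\<integral>\<^sup>+x\<in>{-1..<1}. (\<Sum>n. ennreal (norm (f (x + shift n)))) \<partial>lebesgue) < top"
  using nn_integral_periodize[OF nm] f by (simp add: integrable_iff_bounded)
 have sm[measurable]: "(\<lambda>x. f (x + shift n)) \<in> Lmeasurable" for n by (rule lebesgue_measurable_shift) simp
 have "AE x in lebesgue. (\<Sum>n. ennreal (norm (f (x + shift n)))) * indicator {-1..<1} x \<noteq> \<infinity>" proof (rule nn_integral_noteq_infinite)
  have "(\<lambda>x. \<Sum>n. ennreal (norm (f (x + shift n)))) \<in> Lmeasurable" by measurable
  then show "(\<lambda>x. (\<Sum>n. ennreal (norm (f (x + shift n)))) * indicator {-1..<1} x) \<in> Lmeasurable"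
   by (rule borel_measurable_times_ennreal[OF _ borel_measurable_indicator]) simp
 qed (use fin in simp)
 then have AEs: "AE x in lebesgue. x \<in> {-1..<1} \<longrightarrow> summable (\<lambda>n. norm (f (x + shift n)))" by eventually_elim (auto simp: summable_norm_iff_ennreal)
 have AEu: "AE x in lebesgue. summable (\<lambda>n. norm (u n x))" using AEs by eventually_elim (auto simp: un indicator_def)
 have su: "summable (\<lambda>n. LI x. norm (u n x))" proof (rule summable_suminf_not_top)
  have "(\<Sum>n. ennreal (LI x. norm (u n x))) = (\<Sum>n. \<integral>\<^sup>+x. ennreal (norm (u n x)) \<partial>lebesgue)"
   by (intro suminf_cong nn_integral_eq_integral[symmetric] integrable_norm ui) simp
  also have "... = (NI x. (\<Sum>n. ennreal (norm (u n x))))" using ui by (intro nn_integral_suminf[symmetric]) simp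
  also have "... = (\<integral>\<^sup>+x\<in>{-1..<1}. (\<Sum>n. ennreal (norm (f (x + shift n)))) \<partial>lebesgue)" proof (intro nn_integral_cong)
   fix x
   show "(\<Sum>n. ennreal (norm (u n x))) = (\<Sum>n. ennreal (norm (f (x + shift n)))) * indicator {-1..<1} x" unfolding un by (cases "x \<in> {-1..<1}") simp_all
  qed
  finally show "(\<Sum>n. ennreal (LI x. norm (u n x))) \<noteq> top" using fin by simp
 qed simp
 have I: "Lintegrable (\<lambda>x. \<Sum>n. u n x)" by (rule integrable_suminf[OF ui AEu su])
 \<comment> \<open>\<open>periodic_distr_of\<close> integrates over the closed interval whereas the
   cells are half-open; the difference is the null set consisting of 1.\<close>
 have AEeq: "AE x in lebesgue. (\<Sum>n. u n x) = indicator {-1..1} x *\<^sub>R periodize f x" using AEs AE_lebesgue_neq[of 1] proof eventually_elim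
  case (elim x)
  show ?case proof (cases "x \<in> {-1..<1}")
   case True then show ?thesis unfolding un using elim by (simp add: periodize_eq_suminf)
  next
   case False
   then have "x \<notin> {-1..1}" using elim by auto
   with False show ?thesis unfolding un by simp
  qed
 qed
 have pm: "(\<lambda>x. indicator {-1..1} x *\<^sub>R periodize f x) \<in> Lmeasurable" by (rule borel_measurable_AE[OF borel_measurable_integrable[OF I] AEeq])
 show "set_integrable lebesgue {-1..1} (periodize f)"
  unfolding set_integrable_def by (rule integrable_cong_AE_imp[OF I pm]) (use AEeq in \<open>auto elim: AE_mp\<close>)
 have "(LINT x:{-1..1}|lebesgue. periodize f x) = (LI x. (\<Sum>n. u n x))" unfolding set_lebesgue_integral_def
  by (rule integral_cong_AE[OF pm borel_measurable_integrable[OF I]]) (use AEeq in eventually_elim, simp)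
 also have "... = (\<Sum>n. LI x. u n x)" by (rule integral_suminf[OF ui AEu su])
 also have "... = (\<Sum>n. LINT x:cell n|lebesgue. f x)" by (simp add: lu)
 also have "... = (LINT x:(\<Union>n. cell n)|lebesgue. f x)" using cell_disjoint by (intro lebesgue_integral_countable_add[symmetric])
   (auto simp: cell_Union set_integrable_def f disjoint_family_on_def)
 finally show "(LINT x:{-1..1}|lebesgue. periodize f x) = (LI x. f x)" by (simp add: cell_Union set_lebesgue_integral_def)
qed

text \<open>Together with \<open>periodize_integral\<close> this turns pairings of a periodic
  function with a periodization over one period into integrals over the line.\<close>

lemma periodize_mult_periodic:
 assumes "\<And>x. q (x + 2) = q x"
 shows "periodize (\<lambda>x. q x * f x) x = q x * periodize f x"
proof -
 have n: "q (x + 2 * of_nat n) = q x" for n x by (induction n) (use assms[of "x + 2 * real _"] in \<open>simp_all add: algebra_simps\<close>)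
 have q: "q (x + 2 * of_int j) = q x" for j :: int proof (cases "j \<ge> 0")
  case True then show ?thesis using n[of x "nat j"] by simp
 next
  case False then show ?thesis using n[of "x + 2 * of_int j" "nat (- j)"] by simp
 qed
 show ?thesis unfolding periodize_def q by (rule infsum_cmult_right')
qed

section \<open>The Hilbert transform of a test function\<close>

lemma lipschitz_from_vd:
 assumes "\<And>x. (f has_vector_derivative f' x) (at x)" "\<And>x. norm (f' x) \<le> B"
 shows "norm (f x - f y) \<le> B * \<bar>x - y :: real\<bar>"
proof -
 have "norm (f x - f y) \<le> B * norm (x - y)" proof (rule differentiable_bound[of UNIV f "\<lambda>x h. h *\<^sub>R f' x"])
  show "(f has_derivative (\<lambda>h. h *\<^sub>R f' x)) (at x within UNIV)" for x using assms(1) by (simp add: has_vector_derivative_def)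
  have "0 \<le> B" using assms(2)[of 0] norm_ge_zero[of "f' 0"] by linarith
  then show "onorm (\<lambda>h. h *\<^sub>R f' x) \<le> B" for x by (intro onorm_bound) (use assms(2)[of x] in \<open>auto simp: mult.commute[of B] intro: mult_left_mono\<close>)
 qed auto
 then show ?thesis by simp
qed

lemma test_function_bounded:
 assumes "\<phi> \<in> test_functions E" obtains M where "M \<ge> 0" "\<And>x. norm (\<phi> x) \<le> M"
proof -
 obtain K where K: "smooth \<phi>" "compact K" "K \<subseteq> E" "\<And>t. t \<notin> K ==> \<phi> t = 0" using test_functionsE[OF assms] by blast
 have "compact (\<phi> ` K)" using K smooth_continuous by (intro compact_continuous_image) auto
 then obtain M where "\<And>y. y \<in> \<phi> ` K ==> norm y \<le> M" using compact_imp_bounded bounded_iff by metis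
 then have "norm (\<phi> x) \<le> max M 0" for x using K(4)[of x] by (cases "x \<in> K") (auto simp: le_max_iff_disj)
 then show ?thesis using that[of "max M 0"] by simp
qed

lemma test_function_support:
 assumes "\<phi> \<in> test_functions E" obtains R where "R > 0" "\<And>t. abs t > R ==> \<phi> t = 0"
proof -
 obtain K where K: "smooth \<phi>" "compact K" "K \<subseteq> E" "\<And>t. t \<notin> K ==> \<phi> t = 0" using test_functionsE[OF assms] by blast
 then obtain R where "R > 0" "\<And>y. y \<in> K ==> norm y \<le> R" using compact_imp_bounded bounded_pos by metis
 then show ?thesis using that[of R] K(4) by force
qed

lemma test_function_smooth: "\<phi> \<in> test_functions E ==> smooth \<phi>" by (auto simp: test_functions_def)

lemma test_function_lipschitz:
 assumes "\<phi> \<in> test_functions E" obtains L where "L \<ge> 0" "\<And>x y. norm (\<phi> x - \<phi> y) \<le> L * \<bar>x - y\<bar>"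
proof -
 obtain L where L: "L \<ge> 0" "\<And>x. norm (vd \<phi> x) \<le> L" using test_function_bounded[OF test_functions_vd[OF assms]] by metis
 then show ?thesis using that[of L] lipschitz_from_vd[OF smooth_has_vd[OF test_function_smooth[OF assms]]] by blast
qed

lemma continuous_measurable_lebesgue:
 fixes f :: "real => 'b::{second_countable_topology,metric_space}"
 assumes "continuous_on UNIV f" shows "f \<in> Lmeasurable" using borel_measurable_continuous_onI[OF assms] by (intro measurable_completion) simp

lemma integrable_mult_bounded:
 fixes f g :: "real => complex"
 assumes f: "Lintegrable f" and g: "g \<in> Lmeasurable" "\<And>x. norm (g x) \<le> B"
 shows "Lintegrable (\<lambda>x. g x * f x)"
proof (rule Bochner_Integration.integrable_bound[of lebesgue "\<lambda>x. B * norm (f x)"])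
 show "AE x in lebesgue. norm (g x * f x) \<le> norm (B * norm (f x))"
  by (intro AE_I2) (auto simp: norm_mult intro: order_trans[OF mult_right_mono[OF g(2) norm_ge_zero] abs_ge_self])
qed (use f g in auto)

lemma integrable_indicator_interval: "Lintegrable (\<lambda>x. c * indicator {a..b::real} x :: real)"
proof -
 have "emeasure lebesgue {a..b} < \<infinity>" by (simp add: emeasure_lborel_Icc_eq)
 then show ?thesis by (intro integrable_mult_right integrable_real_indicator) auto
qed

lemma integrable_compact_support:
 fixes f :: "real => complex"
 assumes f: "f \<in> Lmeasurable" "\<And>x. norm (f x) \<le> M" "\<And>t. abs t > R ==> f t = 0"
 shows "Lintegrable f"
proof (rule Bochner_Integration.integrable_bound[of lebesgue "\<lambda>x. M * indicator {-R..R} x"])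
 show "AE x in lebesgue. norm (f x) \<le> norm (M * indicator {- R..R} x)" proof (intro AE_I2)
  fix x show "norm (f x) \<le> norm (M * indicator {- R..R} x)" using f(2)[of x] f(3)[of x] by (cases "abs x \<le> R") (auto simp: indicator_def abs_le_iff)
 qed
qed (use f integrable_indicator_interval in auto)

lemma test_function_integrable:
 assumes "\<phi> \<in> test_functions E" shows "Lintegrable \<phi>"
proof -
 obtain M where "\<And>x. norm (\<phi> x) \<le> M" using test_function_bounded[OF assms] by blast
 moreover obtain R where "\<And>t. abs t > R ==> \<phi> t = 0" using test_function_support[OF assms] by blast
 ultimately show ?thesis by (intro integrable_compact_support continuous_measurable_lebesgue smooth_continuous test_function_smooth[OF assms])
qed

text \<open>Against an odd kernel the folded integrand contains the difference f (x - u) - f (x +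
  u), which cancels a simple pole. All principal values below are brought to this form.\<close>

lemma fold_integral:
 fixes G :: "real => complex"
 assumes G: "Lintegrable G"
 shows "(LI u. G u) = (LINT u:{0<..}|lebesgue. G u + G (- u))"
proof -
 have Gm: "Lintegrable (\<lambda>u. G (- u))" using lebesgue_integrable_real_affine[OF G, of "-1" 0] by simp
 have s: "set_integrable lebesgue A G" "set_integrable lebesgue A (\<lambda>u. G (- u))" if "A \<in> sets lebesgue" for A
  unfolding set_integrable_def by (intro integrable_mult_indicator that G Gm)+
 have "(LI u. G u) = (LI u. indicator {0<..} u *\<^sub>R G u + indicator {..<0} u *\<^sub>R G u)" proof (rule integral_cong_AE)
  have "{0::real} \<in> null_sets lebesgue" by simp
  then have "AE u in lebesgue. u \<noteq> (0::real)" by (rule AE_I') auto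
  then show "AE u in lebesgue. G u = indicator {0<..} u *\<^sub>R G u + indicator {..<0} u *\<^sub>R G u" by eventually_elim (auto simp: indicator_def)
 qed (use borel_measurable_integrable[OF G] in \<open>auto intro!: borel_measurable_add borel_measurable_scaleR borel_measurable_indicator\<close>)
 also have "... = (LINT u:{0<..}|lebesgue. G u) + (LINT u:{..<0}|lebesgue. G u)" unfolding set_lebesgue_integral_def
  using s(1)[of "{0<..}"] s(1)[of "{..<0}"] unfolding set_integrable_def by (intro bochner_add) auto
 also have "(LINT u:{..<0}|lebesgue. G u) = (LINT u:{0<..}|lebesgue. G (- u))" unfolding set_lebesgue_integral_def
  by (subst lebesgue_integral_real_affine[of "-1" _ 0]) (auto intro!: bochner_cong simp: indicator_def)
 also have "(LINT u:{0<..}|lebesgue. G u) + (LINT u:{0<..}|lebesgue. G (- u)) = (LINT u:{0<..}|lebesgue. G u + G (- u))"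
  by (rule set_integral_add(2)[symmetric]) (auto intro: s)
 finally show ?thesis .
qed

text \<open>The case \<open>\<delta> = 0\<close> is the principal value, the case \<open>\<delta> > 0\<close> the conjugate Poisson integral.\<close>

definition Qs :: "(real => complex) => real => real => complex" where
 "Qs \<xi> x \<delta> = (LINT t:{0<..}|lebesgue. (sdiff \<xi> x t) * of_real (Qk t \<delta>))"

lemma Q_kernel_le: "0 < t ==> 0 \<le> t / (t^2 + \<delta>^2) \<and> t / (t^2 + \<delta>^2) \<le> 1 / (t::real)"
 by (auto simp: divide_simps power2_eq_square add_nonneg_pos add_pos_nonneg)

text \<open>Near 0 the difference is at most 2 L t and cancels the pole; beyond 1 the kernel is at
  most 1. The bound is independent of \<delta>, so it survives the limit \<delta> = 0.\<close>

lemma Qs_integrand_bound: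
 fixes \<xi> :: "real => complex"
 assumes L: "\<And>x y. norm (\<xi> x - \<xi> y) \<le> L * \<bar>x - y\<bar>" and t: "0 < t"
 shows "norm (sdiff \<xi> x t * of_real (Qk t \<delta>)) \<le> (if t \<le> 1 then 2 * L else norm (\<xi> (x - t)) + norm (\<xi> (x + t)))"
proof -
 have k: "0 \<le> t / (t^2 + \<delta>^2)" "t / (t^2 + \<delta>^2) \<le> 1 / t" using Q_kernel_le[OF t] by auto
 have n: "norm (sdiff \<xi> x t * of_real (Qk t \<delta>)) \<le> norm (sdiff \<xi> x t) * (1 / t)"
  unfolding norm_mult norm_of_real using k by (intro mult_left_mono) auto
 show ?thesis proof (cases "t \<le> 1")
  case True
  have "norm (sdiff \<xi> x t) * (1 / t) \<le> (L * \<bar>(x - t) - (x + t)\<bar>) * (1 / t)" using t by (intro mult_right_mono L) auto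
  also have "... = 2 * L" using t by simp
  finally show ?thesis using n True by simp
 next
  case False
  have "norm (sdiff \<xi> x t) * (1 / t) \<le> (norm (\<xi> (x - t)) + norm (\<xi> (x + t))) * 1" using False by (intro mult_mono norm_triangle_ineq4) auto
  with n False show ?thesis by simp
 qed
qed

text \<open>Both variables may move, and \<delta> = 0 is allowed as a limit: this yields continuity
  of \<open>hilbert \<xi>\<close> and lets kernel identities proved for \<delta> > 0 pass to the
  principal value.\<close>

lemma Qs_tendsto:
 assumes \<xi>: "\<xi> \<in> test_functions E" and X: "X \<longlonglongrightarrow> x" and d: "d \<longlonglongrightarrow> \<delta>"
 shows "(\<lambda>n. Qs \<xi> (X n) (d n)) \<longlonglongrightarrow> Qs \<xi> x \<delta>"
proof -
 obtain L where L: "L \<ge> 0" "\<And>x y. norm (\<xi> x - \<xi> y) \<le> L * \<bar>x - y\<bar>" using test_function_lipschitz[OF \<xi>] by blast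
 obtain M where M: "M \<ge> 0" "\<And>x. norm (\<xi> x) \<le> M" using test_function_bounded[OF \<xi>] by blast
 obtain R where R: "R > 0" "\<And>t. abs t > R ==> \<xi> t = 0" using test_function_support[OF \<xi>] by blast
 obtain B where B: "B > 0" "\<And>n. \<bar>X n\<bar> \<le> B" using convergent_imp_Bseq[OF convergentI[OF X]] by (auto simp: Bseq_def)
 have c: "continuous_on UNIV \<xi>" using smooth_continuous[OF test_function_smooth[OF \<xi>]] .
 have [measurable]: "\<xi> \<in> borel_measurable borel" using c by (rule borel_measurable_continuous_onI)
 have meas: "(\<lambda>t. indicator {0<..} t *\<^sub>R (sdiff \<xi> x t * of_real (Qk t \<delta>))) \<in> Lmeasurable" for x \<delta> by (intro measurable_completion) measurable
 \<comment> \<open>Beyond R + B + 1 both \<open>X n - t\<close> and \<open>X n + t\<close> lie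
   outside the support of \<xi>, so the majorant lives on a fixed interval.\<close>
 show ?thesis unfolding Qs_def set_lebesgue_integral_def
 proof (rule integral_dominated_convergence[where w = "\<lambda>t. (2 * L + 2 * M) * indicator {0..R + B + 1} t"])
  show "AE t in lebesgue. (\<lambda>n. indicator {0<..} t *\<^sub>R (sdiff \<xi> (X n) t * of_real (t / (t^2 + (d n)^2))))
   \<longlonglongrightarrow> indicator {0<..} t *\<^sub>R (sdiff \<xi> x t * of_real (Qk t \<delta>))"
  proof (intro AE_I2)
   fix t :: real
   have ct: "isCont \<xi> y" for y using c by (simp add: continuous_on_eq_continuous_at)
   show "(\<lambda>n. indicator {0<..} t *\<^sub>R (sdiff \<xi> (X n) t * of_real (t / (t^2 + (d n)^2)))) \<longlonglongrightarrow> indicator {0<..} t *\<^sub>R (sdiff \<xi> x t * of_real (Qk t \<delta>))"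
   proof (cases "t > 0")
    case True
    then have nz: "t^2 + \<delta>^2 \<noteq> 0" by (simp add: add_pos_nonneg less_imp_neq[symmetric])
    show ?thesis by (intro tendsto_intros isCont_tendsto_compose[OF ct] X d nz)
   qed simp
  qed
 next
  fix n
  show "AE t in lebesgue. norm (indicator {0<..} t *\<^sub>R (sdiff \<xi> (X n) t * of_real (t / (t^2 + (d n)^2))))
   \<le> (2 * L + 2 * M) * indicator {0..R + B + 1} t"
  proof (intro AE_I2)
   fix t :: real
   show "norm (indicator {0<..} t *\<^sub>R (sdiff \<xi> (X n) t * of_real (t / (t^2 + (d n)^2)))) \<le> (2 * L + 2 * M) * indicator {0..R + B + 1} t"
   proof (cases "t > 0")
    case True
    note b = Qs_integrand_bound[OF L(2) True, of "X n" "d n"]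
    show ?thesis proof (cases "t \<le> R + B + 1")
     case le: True
     have "(if t \<le> 1 then 2 * L else norm (\<xi> (X n - t)) + norm (\<xi> (X n + t))) \<le> 2 * L + 2 * M"
      using L(1) M(1) M(2)[of "X n - t"] M(2)[of "X n + t"] by auto
     with b True le show ?thesis by (auto simp: indicator_def simp del: of_real_divide)
    next
     case False
     then have "\<xi> (X n - t) = 0" "\<xi> (X n + t) = 0" using B(2)[of n] R(1) by (auto intro!: R(2))
     with False L M show ?thesis by (simp add: indicator_def)
    qed
   qed (use L M in \<open>simp add: indicator_def\<close>)
  qed
 qed (rule meas integrable_indicator_interval)+
qed

lemma Qs_integrable:
 assumes \<xi>: "\<xi> \<in> test_functions E"
 shows "set_integrable lebesgue {0<..} (\<lambda>t. (sdiff \<xi> x t) * of_real (Qk t \<delta>))"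
proof -
 obtain L where L: "L \<ge> 0" "\<And>x y. norm (\<xi> x - \<xi> y) \<le> L * \<bar>x - y\<bar>" using test_function_lipschitz[OF \<xi>] by blast
 note i = test_function_integrable[OF \<xi>]
 have c: "continuous_on UNIV \<xi>" using smooth_continuous[OF test_function_smooth[OF \<xi>]] .
 have [measurable]: "\<xi> \<in> borel_measurable borel" using c by (rule borel_measurable_continuous_onI)
 have i': "Lintegrable (\<lambda>t. norm (\<xi> (x - t)))" "Lintegrable (\<lambda>t. norm (\<xi> (x + t)))"
  using lebesgue_integrable_real_affine[OF i, of "-1" x] lebesgue_integrable_real_affine[OF i, of 1 x] by auto
 show ?thesis unfolding set_integrable_def
 proof (rule Bochner_Integration.integrable_bound[of lebesgue "\<lambda>t. 2 * L * indicator {0..1} t + (norm (\<xi> (x - t)) + norm (\<xi> (x + t)))"])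
  show "AE t in lebesgue. norm (indicator {0<..} t *\<^sub>R (sdiff \<xi> x t * of_real (Qk t \<delta>)))
   \<le> norm (2 * L * indicator {0..1} t + (norm (\<xi> (x - t)) + norm (\<xi> (x + t))))"
   (is "AE t in _. ?l t \<le> ?r t")
  proof (intro AE_I2)
   fix t
   show "?l t \<le> ?r t" using Qs_integrand_bound[OF L(2), of t x \<delta>] L(1) norm_ge_zero[of "\<xi> (x - t)"] norm_ge_zero[of "\<xi> (x + t)"]
    by (cases "t > 0"; cases "t \<le> 1") (auto simp: indicator_def simp del: of_real_divide intro: add_increasing2)
  qed
  show "(\<lambda>t. indicator {0<..} t *\<^sub>R (sdiff \<xi> x t * of_real (Qk t \<delta>))) \<in> Lmeasurable" by (intro measurable_completion) measurable
 qed (use i' integrable_indicator_interval in \<open>auto intro!: bochner_integrable_add\<close>)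
qed

text \<open>The integrated majorant depends neither on \<delta> nor, by translation invariance of
  the L1 norm, on x.\<close>

lemma Qs_bound:
 assumes \<xi>: "\<xi> \<in> test_functions E"
 obtains B where "B \<ge> 0" "\<And>x \<delta>. norm (Qs \<xi> x \<delta>) \<le> B"
proof -
 obtain L where L: "L \<ge> 0" "\<And>x y. norm (\<xi> x - \<xi> y) \<le> L * \<bar>x - y\<bar>" using test_function_lipschitz[OF \<xi>] by blast
 note i = test_function_integrable[OF \<xi>]
 have i': "Lintegrable (\<lambda>t. norm (\<xi> (x - t)))" "Lintegrable (\<lambda>t. norm (\<xi> (x + t)))" for x
  using lebesgue_integrable_real_affine[OF i, of "-1" x] lebesgue_integrable_real_affine[OF i, of 1 x] by auto
 define B where "B = 2 * L + 2 * (LI t. norm (\<xi> t))"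
 have "norm (Qs \<xi> x \<delta>) \<le> B" for x \<delta> proof -
  have "norm (Qs \<xi> x \<delta>) \<le> (LI t. 2 * L * indicator {0..1} t + (norm (\<xi> (x - t)) + norm (\<xi> (x + t))))" unfolding Qs_def set_lebesgue_integral_def
  proof (rule order_trans[OF integral_norm_bound integral_mono])
   fix t
   show "norm (indicator {0<..} t *\<^sub>R (sdiff \<xi> x t * of_real (Qk t \<delta>))) \<le> 2 * L * indicator {0..1} t + (norm (\<xi> (x - t)) + norm (\<xi> (x + t)))"
    using Qs_integrand_bound[OF L(2), of t x \<delta>] L(1) norm_ge_zero[of "\<xi> (x - t)"] norm_ge_zero[of "\<xi> (x + t)"]
    by (cases "t > 0"; cases "t \<le> 1") (auto simp: indicator_def simp del: of_real_divide intro: add_increasing2)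
  next
   show "Lintegrable (\<lambda>t. norm (indicator {0<..} t *\<^sub>R (sdiff \<xi> x t * of_real (Qk t \<delta>))))"
    using Qs_integrable[OF \<xi>, of x \<delta>] unfolding set_integrable_def by (rule integrable_norm)
   show "Lintegrable (\<lambda>t. 2 * L * indicator {0..1} t + (norm (\<xi> (x - t)) + norm (\<xi> (x + t))))"
    by (intro bochner_integrable_add i' integrable_indicator_interval)
  qed
  also have "... = B" using i' lebesgue_integral_real_affine[of "-1" "\<lambda>t. norm (\<xi> t)" x] lebesgue_integral_real_affine[of 1 "\<lambda>t. norm (\<xi> t)" x]
   by (simp add: B_def)
  finally show ?thesis .
 qed
 moreover have "B \<ge> 0" using L(1) by (simp add: B_def)
 ultimately show ?thesis using that by blast
qed

text \<open>For \<delta> \<noteq> 0 the kernel is bounded, so no principal value is left, and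
  folding at x turns one form into the other.\<close>

lemma Qs_eq_integral:
 assumes \<xi>: "\<xi> \<in> test_functions E" and d: "\<delta> \<noteq> 0"
 shows "Qs \<xi> x \<delta> = (LI t. \<xi> t * of_real (Qk (x - t) \<delta>))"
proof -
 define G where "G u = \<xi> (x - u) * of_real (Qk u \<delta>)" for u
 have "Lintegrable G" proof -
  have "Lintegrable (\<lambda>u. complex_of_real (Qk u \<delta>) * \<xi> (x - u))" proof (rule integrable_mult_bounded[where B = "1 / abs \<delta>"])
   show "Lintegrable (\<lambda>u. \<xi> (x - u))" using lebesgue_integrable_real_affine[OF test_function_integrable[OF \<xi>], of "-1" x] by simp
   show "norm (complex_of_real (Qk u \<delta>)) \<le> 1 / abs \<delta>" for u proof -
    have "0 \<le> (abs u - abs \<delta>)^2" by simp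
    then have "abs u * abs \<delta> \<le> u^2 + \<delta>^2" by (simp add: power2_diff)
     (use mult_nonneg_nonneg[of "abs u" "abs \<delta>"] in linarith)
    moreover have "u^2 + \<delta>^2 > 0" using d by (simp add: add_nonneg_pos)
    ultimately show ?thesis using d unfolding norm_of_real abs_divide by (simp add: divide_simps abs_of_pos)
   qed
   show "(\<lambda>u. complex_of_real (Qk u \<delta>)) \<in> Lmeasurable" by (intro measurable_completion) measurable
  qed
  then show ?thesis by (simp add: G_def[abs_def] mult.commute)
 qed
 from fold_integral[OF this] have "(LI u. G u) = Qs \<xi> x \<delta>" by (simp add: Qs_def G_def algebra_simps diff_divide_distrib)
 moreover have "(LI t. \<xi> t * of_real (Qk (x - t) \<delta>)) = (LI u. G u)" by (subst lebesgue_integral_real_affine[of "-1" _ x]) (simp_all add: G_def)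
 ultimately show ?thesis by simp
qed

text \<open>The excluded interval is symmetric about x, so folding turns the truncated integrals
  into integrals over \<open>]\<tau>, \<infinity>[\<close> of one fixed integrable function.\<close>

lemma hilbert_eq_Qs:
 assumes \<xi>: "\<xi> \<in> test_functions E"
 shows "hilbert \<xi> x = of_real (1 / pi) * Qs \<xi> x 0"
proof -
 have c: "continuous_on UNIV \<xi>" using smooth_continuous[OF test_function_smooth[OF \<xi>]] .
 have [measurable]: "\<xi> \<in> borel_measurable borel" using c by (rule borel_measurable_continuous_onI)
 have eq: "(LINT t:{t \<in> UNIV. \<forall>s\<in>{x}. \<tau> < \<bar>s - t\<bar>}|lebesgue. \<xi> t / of_real (x - t)) =
   (LINT t:{0<..}|lebesgue. indicator {\<tau><..} t *\<^sub>R (sdiff \<xi> x t * of_real (Qk t 0)))"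
  if e: "\<tau> > 0" for \<tau>
 proof -
  define G where "G u = indicator {u. \<tau> < abs u} u *\<^sub>R (\<xi> (x - u) / of_real u)" for u
  have "Lintegrable (\<lambda>u. (indicator {u. \<tau> < abs u} u *\<^sub>R complex_of_real (1 / u)) * \<xi> (x - u))"
  proof (rule integrable_mult_bounded[where B = "1 / \<tau>"])
   show "Lintegrable (\<lambda>u. \<xi> (x - u))" using lebesgue_integrable_real_affine[OF test_function_integrable[OF \<xi>], of "-1" x] by simp
   show "norm (indicator {u. \<tau> < abs u} u *\<^sub>R complex_of_real (1 / u)) \<le> 1 / \<tau>" for u using e by (auto simp: indicator_def norm_divide divide_simps)
   show "(\<lambda>u. indicator {u. \<tau> < abs u} u *\<^sub>R complex_of_real (1 / u)) \<in> Lmeasurable" by (intro measurable_completion) measurable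
  qed
  then have "Lintegrable G" by (simp add: G_def[abs_def] mult.commute)
  from fold_integral[OF this] have "(LI u. G u) = (LINT u:{0<..}|lebesgue. G u + G (- u))" .
  also have "... = (LINT t:{0<..}|lebesgue. indicator {\<tau><..} t *\<^sub>R (sdiff \<xi> x t * of_real (Qk t 0)))" using e unfolding set_lebesgue_integral_def
   by (intro bochner_cong) (auto simp: G_def indicator_def power2_eq_square diff_divide_distrib)
  finally show ?thesis unfolding set_lebesgue_integral_def by (subst lebesgue_integral_real_affine[of "-1" _ x])
     (auto simp: G_def set_lebesgue_integral_def indicator_def cong: bochner_cong)
 qed
 have lim: "((\<lambda>\<tau>. LINT t:{t \<in> UNIV. \<forall>s\<in>{x}. \<tau> < \<bar>s - t\<bar>}|lebesgue. \<xi> t / of_real (x - t)) \<longlongrightarrow> Qs \<xi> x 0) (at_right 0)"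
  unfolding tendsto_at_iff_sequentially
 proof (intro allI impI)
  fix X :: "nat => real" assume X: "\<forall>i. X i \<in> {0<..} - {0}" "X \<longlonglongrightarrow> 0"
  have "(\<lambda>i. LINT t:{0<..}|lebesgue. indicator {X i<..} t *\<^sub>R (sdiff \<xi> x t * of_real (Qk t 0))) \<longlonglongrightarrow> Qs \<xi> x 0" unfolding Qs_def set_lebesgue_integral_def
  proof (rule integral_dominated_convergence[where w = "\<lambda>t. norm (indicator {0<..} t *\<^sub>R (sdiff \<xi> x t * of_real (Qk t 0)))"])
   show "AE t in lebesgue. (\<lambda>i. indicator {0<..} t *\<^sub>R indicator {X i<..} t *\<^sub>R (sdiff \<xi> x t * of_real (Qk t 0)))
    \<longlonglongrightarrow> indicator {0<..} t *\<^sub>R (sdiff \<xi> x t * of_real (Qk t 0))"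
   proof (intro AE_I2 tendsto_eventually)
    fix t :: real
    show "\<forall>\<^sub>F i in sequentially. indicator {0<..} t *\<^sub>R indicator {X i<..} t *\<^sub>R (sdiff \<xi> x t * of_real (Qk t 0))
     = indicator {0<..} t *\<^sub>R (sdiff \<xi> x t * complex_of_real (Qk t 0))"
    proof (cases "t > 0")
     case True
     have "\<forall>\<^sub>F i in sequentially. X i < t" using X(2) True by (rule order_tendstoD)
     then show ?thesis by eventually_elim (simp add: indicator_def)
    qed simp
   qed
   show "Lintegrable (\<lambda>t. norm (indicator {0<..} t *\<^sub>R (sdiff \<xi> x t * complex_of_real (Qk t 0))))"
    using Qs_integrable[OF \<xi>, of x 0] unfolding set_integrable_def by (rule integrable_norm)
  qed (auto simp: indicator_def intro!: measurable_completion)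
  moreover have "((\<lambda>\<tau>. LINT t:{t \<in> UNIV. \<forall>s\<in>{x}. \<tau> < \<bar>s - t\<bar>}|lebesgue. \<xi> t / of_real (x - t)) \<circ> X) =
    (\<lambda>i. LINT t:{0<..}|lebesgue. indicator {X i<..} t *\<^sub>R (sdiff \<xi> x t * of_real (Qk t 0)))" unfolding o_def using X(1) by (intro ext eq) auto
  ultimately show "((\<lambda>\<tau>. LINT t:{t \<in> UNIV. \<forall>s\<in>{x}. \<tau> < \<bar>s - t\<bar>}|lebesgue. \<xi> t / of_real (x - t)) \<circ> X) \<longlonglongrightarrow> Qs \<xi> x 0" by simp
 qed
 show ?thesis unfolding hilbert_def pv_integral_def using tendsto_Lim[OF _ lim] by simp
qed

section \<open>The weak type estimate for Cauchy integrals\<close>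

text \<open>The Hardy-Littlewood maximal inequality by Vitali covering: disjoint balls, each
  carrying more mass than \<alpha> times its length, whose fivefold enlargements cover the
  exceptional set. A measurable superset U is returned because that set is not shown to be
  measurable.\<close>

lemma HL_weak_type:
 fixes h :: "real => ennreal"
 assumes h[measurable]: "h \<in> Lmeasurable" and A: "(NI t. h t) \<le> ennreal A" "0 \<le> A" and \<alpha>: "0 < \<alpha>"
 obtains U where "U \<in> sets lebesgue" "emeasure lebesgue U \<le> ennreal (5 / \<alpha> * A)"
  "{x. \<exists>r>0. ennreal (2 * r * \<alpha>) < (\<integral>\<^sup>+t\<in>cball x r. h t \<partial>lebesgue)} \<subseteq> U"
proof -
 define E where "E = {x. \<exists>r>0. ennreal (2 * r * \<alpha>) < (\<integral>\<^sup>+t\<in>cball x r. h t \<partial>lebesgue)}"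
 have "\<forall>x\<in>E. \<exists>r>0. ennreal (2 * r * \<alpha>) < (\<integral>\<^sup>+t\<in>cball x r. h t \<partial>lebesgue)" by (auto simp: E_def)
 then obtain r where r: "\<And>x. x \<in> E ==> 0 < r x" "\<And>x. x \<in> E ==> ennreal (2 * r x * \<alpha>) < (\<integral>\<^sup>+t\<in>cball x (r x). h t \<partial>lebesgue)" by metis
 \<comment> \<open>A large ball would need more mass than A, so the radii are bounded, as the
   covering lemma requires.\<close>
 have rB: "0 < r x \<and> r x \<le> A / (2 * \<alpha>)" if "x \<in> E" for x proof -
  have "(\<integral>\<^sup>+t\<in>cball x (r x). h t \<partial>lebesgue) \<le> (NI t. h t)" by (intro nn_integral_mono) (auto simp: indicator_def)
  with r(2)[OF that] A have "ennreal (2 * r x * \<alpha>) \<le> ennreal A" by (meson less_imp_le order_trans)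
  then have "2 * r x * \<alpha> \<le> A" using A(2) by (simp add: ennreal_le_iff)
  then show ?thesis using r(1)[OF that] \<alpha> by (simp add: field_simps)
 qed
 obtain C where C: "countable C" "C \<subseteq> E"
   "pairwise (\<lambda>i j. disjnt (cball i (r i)) (cball j (r j))) C" "E \<subseteq> (\<Union>i\<in>C. cball i (5 * r i))"
 proof (rule Vitali_covering_lemma_cballs[where S = E and K = E and a = "\<lambda>x. x" and r = r and B = "A / (2 * \<alpha>)"])
  show "E \<subseteq> (\<Union>i\<in>E. cball i (r i))" proof
   fix x assume "x \<in> E"
   then have "x \<in> cball x (r x)" using r(1)[of x] by simp
   then show "x \<in> (\<Union>i\<in>E. cball i (r i))" using \<open>x \<in> E\<close> by blast
  qed
 qed (use rB in auto)
 \<comment> \<open>The countable family is indexed by natural numbers, with empty sets at missing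
   indices, so that countable subadditivity also covers a finite C.\<close>
 define N where "N = to_nat_on C ` C"
 define c where "c = from_nat_into C"
 have cN: "c n \<in> C" if "n \<in> N" for n using that C(1) by (auto simp: N_def c_def)
 have injc: "n = m" if "n \<in> N" "m \<in> N" "c n = c m" for n m using that C(1) by (auto simp: N_def c_def)
 define D where "D n = (if n \<in> N then cball (c n) (r (c n)) else {})" for n
 define D5 where "D5 n = (if n \<in> N then cball (c n) (5 * r (c n)) else {})" for n
 have Ds[measurable]: "D n \<in> sets lebesgue" "D5 n \<in> sets lebesgue" for n by (auto simp: D_def D5_def)
 have disj: "disjoint_family D" unfolding disjoint_family_on_def proof (intro ballI impI)
  fix m n :: nat assume "m \<noteq> n"
  show "D m \<inter> D n = {}" proof (cases "m \<in> N \<and> n \<in> N")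
   case True
   then have "c m \<noteq> c n" using injc \<open>m \<noteq> n\<close> by blast
   then have "disjnt (cball (c m) (r (c m))) (cball (c n) (r (c n)))" using C(3) cN True by (auto simp: pairwise_def)
   then show ?thesis using True by (simp add: D_def disjnt_def)
  qed (auto simp: D_def)
 qed
 have le: "emeasure lebesgue (D5 n) \<le> ennreal (5 / \<alpha>) * (\<integral>\<^sup>+t\<in>D n. h t \<partial>lebesgue)" for n proof (cases "n \<in> N")
  case True
  then have cE: "c n \<in> E" using cN C(2) by blast
  have "emeasure lebesgue (D5 n) = ennreal (10 * r (c n))" using r(1)[OF cE] True by (simp add: D5_def cball_eq_atLeastAtMost emeasure_lborel_Icc_eq)
  also have "... = ennreal (5 / \<alpha>) * ennreal (2 * r (c n) * \<alpha>)" using r(1)[OF cE] \<alpha> by (subst ennreal_mult[symmetric]) (auto simp: field_simps)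
  also have "... \<le> ennreal (5 / \<alpha>) * (\<integral>\<^sup>+t\<in>D n. h t \<partial>lebesgue)" using r(2)[OF cE] True by (intro mult_left_mono) (auto simp: D_def less_imp_le)
  finally show ?thesis .
 qed (simp add: D5_def)
 have "emeasure lebesgue (\<Union>n. D5 n) \<le> (\<Sum>n. emeasure lebesgue (D5 n))" by (rule emeasure_subadditive_countably) auto
 also have "... \<le> (\<Sum>n. ennreal (5 / \<alpha>) * (\<integral>\<^sup>+t\<in>D n. h t \<partial>lebesgue))" by (intro suminf_le le) auto
 also have "... = ennreal (5 / \<alpha>) * (\<Sum>n. \<integral>\<^sup>+t\<in>D n. h t \<partial>lebesgue)" by simp
 also have "(\<Sum>n. \<integral>\<^sup>+t\<in>D n. h t \<partial>lebesgue) = (NI t. (\<Sum>n. h t * indicator (D n) t))" by (rule nn_integral_suminf[symmetric]) measurable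
 also have "... \<le> (NI t. h t)" by (intro nn_integral_mono, simp only: ennreal_suminf_cmult suminf_indicator[OF disj]) (auto simp: indicator_def)
 also have "ennreal (5 / \<alpha>) * ... \<le> ennreal (5 / \<alpha>) * ennreal A" by (intro mult_left_mono A) simp
 also have "... = ennreal (5 / \<alpha> * A)" using \<alpha> A(2) by (intro ennreal_mult[symmetric]) auto
 finally have "emeasure lebesgue (\<Union>n. D5 n) \<le> ennreal (5 / \<alpha> * A)" by (simp add: mult_left_mono)
 moreover have "E \<subseteq> (\<Union>n. D5 n)" proof
  fix x assume "x \<in> E"
  then obtain i where i: "i \<in> C" "x \<in> cball i (5 * r i)" using C(4) by blast
  then have "to_nat_on C i \<in> N" "c (to_nat_on C i) = i" using C(1) by (auto simp: N_def c_def)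
  then have "x \<in> D5 (to_nat_on C i)" using i by (simp add: D5_def)
  then show "x \<in> (\<Union>n. D5 n)" by blast
 qed
 ultimately show ?thesis using that[of "\<Union>n. D5 n"] unfolding E_def by auto
qed

lemma poisson_nonneg: "0 \<le> y ==> 0 \<le> poisson x y t" by (simp add: poisson_def)

text \<open>Take the least k with |x - t| \<le> 2^k y. Either k = 0, or |x - t| exceeds 2^(k - 1) y;
  the factor 4 pays for the step from k - 1 to k.\<close>

lemma poisson_dyadic_bound:
 assumes y: "0 < y"
 shows "ennreal (poisson x y t) \<le> (\<Sum>k. ennreal (4 / (pi * y) / 4 ^ k) * indicator (cball x (2 ^ k * y)) t)"
proof -
 have "\<exists>k. \<bar>x - t\<bar> \<le> 2 ^ k * y" proof -
  obtain k where "\<bar>x - t\<bar> / y < 2 ^ k" using real_arch_pow[of 2] by auto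
  then show ?thesis using y by (intro exI[of _ k]) (simp add: field_simps)
 qed
 define k where "k = (LEAST k. \<bar>x - t\<bar> \<le> 2 ^ k * y)"
 have k: "\<bar>x - t\<bar> \<le> 2 ^ k * y" unfolding k_def by (rule LeastI_ex) fact
 have "poisson x y t \<le> 4 / (pi * y) / 4 ^ k" proof (cases k)
  case 0
  have "y^2 \<le> y^2 + (x - t)^2" by simp
  then have "y / (y^2 + (x - t)^2) \<le> y / y^2" using y by (intro divide_left_mono) (auto simp: add_pos_nonneg)
  also have "... \<le> 4 / y" using y by (simp add: power2_eq_square field_simps)
  finally have "y / (y^2 + (x - t)^2) \<le> 4 / y" .
  from mult_left_mono[OF this, of "1 / pi"] show ?thesis using 0 by (simp add: poisson_def)
 next
  case (Suc m)
  then have "\<not> \<bar>x - t\<bar> \<le> 2 ^ m * y" using not_less_Least[of m "\<lambda>k. \<bar>x - t\<bar> \<le> 2 ^ k * y"] k_def by auto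
  then have "(2 ^ m * y)^2 \<le> \<bar>x - t\<bar>^2" using y by (intro power_mono) auto
  then have le: "4 ^ m * y^2 \<le> y^2 + (x - t)^2" proof -
   have "(2 ^ m * y)^2 = 4 ^ m * y^2" by (simp add: power_mult_distrib) (simp add: power2_eq_square flip: power_mult_distrib)
   with \<open>(2 ^ m * y)^2 \<le> \<bar>x - t\<bar>^2\<close> show ?thesis by (simp add: add_increasing)
  qed
  then have "y / (y^2 + (x - t)^2) \<le> y / (4 ^ m * y^2)" using y by (intro divide_left_mono) (auto simp: add_pos_nonneg)
  also have "... = 4 / y / 4 ^ k" using y Suc by (simp add: power2_eq_square field_simps)
  finally have "y / (y^2 + (x - t)^2) \<le> 4 / y / 4 ^ k" .
  from mult_left_mono[OF this, of "1 / pi"] show ?thesis by (simp add: poisson_def)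
 qed
 then have "ennreal (poisson x y t) \<le> ennreal (4 / (pi * y) / 4 ^ k) * indicator (cball x (2 ^ k * y)) t"
  using k by (simp add: dist_real_def ennreal_leI indicator_def)
 also have "... \<le> (\<Sum>k. ennreal (4 / (pi * y) / 4 ^ k) * indicator (cball x (2 ^ k * y)) t)" proof -
  define g where "g k = ennreal (4 / (pi * y) / 4 ^ k) * indicator (cball x (2 ^ k * y)) t" for k
  have "sum g {k} \<le> suminf g" by (rule sum_le_suminf) auto
  then have "g k \<le> suminf g" by simp
  then show ?thesis unfolding g_def .
 qed
 finally show ?thesis .
qed

text \<open>Term k of the dyadic bound contributes \<open>4 / (pi * y) / 4 ^ k\<close> times
  \<open>2 * (2 ^ k * y) * \<alpha>\<close>, that is 8 \<alpha> / pi times 2^(-k); the geometric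
  series doubles the 8.\<close>

lemma poisson_maximal:
 fixes h :: "real => ennreal"
 assumes h[measurable]: "h \<in> Lmeasurable" and y: "0 < y" and \<alpha>: "0 < \<alpha>"
  and x: "\<And>r. 0 < r ==> (\<integral>\<^sup>+t\<in>cball x r. h t \<partial>lebesgue) \<le> ennreal (2 * r * \<alpha>)"
 shows "(NI t. ennreal (poisson x y t) * h t) \<le> ennreal (16 * \<alpha> / pi)"
proof -
 have [measurable]: "cball x s \<in> sets lebesgue" for s by auto
 have "(NI t. ennreal (poisson x y t) * h t) \<le> (NI t. (\<Sum>k. ennreal (4 / (pi * y) / 4 ^ k) * (h t * indicator (cball x (2 ^ k * y)) t)))"
 proof (rule nn_integral_mono)
  fix t
  have "ennreal (poisson x y t) * h t \<le> (\<Sum>k. ennreal (4 / (pi * y) / 4 ^ k) * indicator (cball x (2 ^ k * y)) t) * h t"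
   by (intro mult_right_mono poisson_dyadic_bound y) simp
  then show "ennreal (poisson x y t) * h t \<le> (\<Sum>k. ennreal (4 / (pi * y) / 4 ^ k) * (h t * indicator (cball x (2 ^ k * y)) t))"
   by (subst (asm) ennreal_suminf_multc[symmetric]) (simp add: mult_ac)
 qed
 also have "... = (\<Sum>k. \<integral>\<^sup>+t. ennreal (4 / (pi * y) / 4 ^ k) * (h t * indicator (cball x (2 ^ k * y)) t) \<partial>lebesgue)"
  by (rule nn_integral_suminf) measurable
 also have "... = (\<Sum>k. ennreal (4 / (pi * y) / 4 ^ k) * (\<integral>\<^sup>+t\<in>cball x (2 ^ k * y). h t \<partial>lebesgue))"
  by (intro suminf_cong nn_integral_cmult) measurable
 also have "... \<le> (\<Sum>k. ennreal (8 * \<alpha> / pi * (1 / 2) ^ k))" proof (intro suminf_le)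
  fix k
  have "ennreal (4 / (pi * y) / 4 ^ k) * (\<integral>\<^sup>+t\<in>cball x (2 ^ k * y). h t \<partial>lebesgue) \<le> ennreal (4 / (pi * y) / 4 ^ k) * ennreal (2 * (2 ^ k * y) * \<alpha>)"
   using y by (intro mult_left_mono x) auto
  also have "... = ennreal (4 / (pi * y) / 4 ^ k * (2 * (2 ^ k * y) * \<alpha>))" using y \<alpha> by (intro ennreal_mult[symmetric]) auto
  also have "4 / (pi * y) / 4 ^ k * (2 * (2 ^ k * y) * \<alpha>) = 8 * \<alpha> / pi * (1 / 2) ^ k" proof -
   have "(4::real) ^ k = 2 ^ k * 2 ^ k" by (simp flip: power_mult_distrib)
   then show ?thesis using y by (simp add: field_simps power_divide)
  qed
  finally show "ennreal (4 / (pi * y) / 4 ^ k) * (\<integral>\<^sup>+t\<in>cball x (2 ^ k * y). h t \<partial>lebesgue) \<le> ennreal (8 * \<alpha> / pi * (1 / 2) ^ k)" .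
 qed auto
 also have "... = ennreal (8 * \<alpha> / pi * 2)" proof -
  have "(\<lambda>k. 8 * \<alpha> / pi * (1 / 2) ^ k) sums (8 * \<alpha> / pi * 2)" using geometric_sums[of "1 / 2 :: real"] by (intro sums_mult) simp
  then show ?thesis using \<alpha> by (intro suminf_ennreal_eq) auto
 qed
 finally show ?thesis by simp
qed

section \<open>Cauchy integrals and Poisson representation in the upper half-plane\<close>

definition cauchy_int :: "(real => complex) => complex => complex" where
 "cauchy_int g z = (LI t. g t / (z - of_real t))"

lemma Im_le_norm_diff: "\<bar>Im z\<bar> \<le> norm (z - of_real t)" using abs_Im_le_cmod[of "z - of_real t"] by simp

lemma cauchy_kernel_measurable: "Im z \<noteq> 0 ==> (\<lambda>t. 1 / (z - of_real t)) \<in> Lmeasurable"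
 by (intro continuous_measurable_lebesgue continuous_intros) (auto simp: complex_eq_iff)

lemma cauchy_kernel_le: "Im z \<noteq> 0 ==> norm (1 / (z - of_real t)) \<le> 1 / \<bar>Im z\<bar>" using Im_le_norm_diff[of z t] by (simp add: norm_divide frac_le)

lemma cauchy_integrable:
 assumes "Lintegrable g" "Im z \<noteq> 0"
 shows "Lintegrable (\<lambda>t. g t / (z - of_real t))"
 using integrable_mult_bounded[OF assms(1) cauchy_kernel_measurable[OF assms(2)] cauchy_kernel_le[OF assms(2)]] by simp

lemma cauchy_int_bound:
 assumes "Lintegrable g" "Im z \<noteq> 0"
 shows "norm (cauchy_int g z) \<le> (LI t. norm (g t)) / \<bar>Im z\<bar>"
proof -
 have "norm (cauchy_int g z) \<le> (LI t. norm (g t / (z - of_real t)))" unfolding cauchy_int_def by (rule integral_norm_bound)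
 also have "... \<le> (LI t. norm (g t) * (1 / \<bar>Im z\<bar>))" proof (rule integral_mono)
  show "norm (g t / (z - of_real t)) \<le> norm (g t) * (1 / \<bar>Im z\<bar>)" for t
   using mult_left_mono[OF cauchy_kernel_le[OF assms(2), of t], of "norm (g t)"] by (simp add: norm_divide)
 qed (use cauchy_integrable[OF assms] assms in auto)
 also have "... = (LI t. norm (g t)) / \<bar>Im z\<bar>" by simp
 finally show ?thesis .
qed

text \<open>The bounded factor f serves the difference quotient of a Cauchy integral, where it is
  the negative of the kernel at the fixed point z.\<close>

lemma cauchy_int_tendsto:
 assumes g: "Lintegrable g" and c: "0 < c" and X: "\<And>n. c \<le> \<bar>Im (X n)\<bar>" "X \<longlonglongrightarrow> z"
  and f: "\<And>t. norm (f t) \<le> B" "f \<in> Lmeasurable"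
 shows "(\<lambda>n. LI t. g t * f t / (X n - of_real t)) \<longlonglongrightarrow> (LI t. g t * f t / (z - of_real t))"
proof -
 have cz: "c \<le> \<bar>Im z\<bar>" by (rule tendsto_lowerbound[OF tendsto_rabs[OF tendsto_Im[OF X(2)]]]) (use X(1) in auto)
 have gf: "Lintegrable (\<lambda>t. g t * f t)" using integrable_mult_bounded[OF g f(2) f(1)] by (simp add: mult.commute)
 show ?thesis proof (rule integral_dominated_convergence[where w = "\<lambda>t. norm (g t * f t) * (1 / c)"])
  show "AE t in lebesgue. (\<lambda>n. g t * f t / (X n - of_real t)) \<longlonglongrightarrow> g t * f t / (z - of_real t)"
   using c cz by (intro AE_I2 tendsto_intros X) (auto simp: complex_eq_iff)
  fix n
  show "AE t in lebesgue. norm (g t * f t / (X n - of_real t)) \<le> norm (g t * f t) * (1 / c)" proof (intro AE_I2)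
   fix t
   have "1 / norm (X n - of_real t) \<le> 1 / c" using X(1)[of n] Im_le_norm_diff[of "X n" t] c by (intro frac_le) auto
   from mult_left_mono[OF this, of "norm (g t * f t)"]
   show "norm (g t * f t / (X n - of_real t)) \<le> norm (g t * f t) * (1 / c)" by (simp add: norm_divide)
  qed
  show "(\<lambda>t. g t * f t / (X n - of_real t)) \<in> Lmeasurable" using cauchy_integrable[OF gf, of "X n"] X(1)[of n] c by auto
 next
  show "(\<lambda>t. g t * f t / (z - of_real t)) \<in> Lmeasurable" using cauchy_integrable[OF gf, of z] cz c by auto
  show "Lintegrable (\<lambda>t. norm (g t * f t) * (1 / c))" using gf by simp
 qed
qed

lemma cauchy_int_holomorphic:
 assumes g: "Lintegrable g"
 shows "cauchy_int g holomorphic_on {z. 0 < Im z}" unfolding holomorphic_on_def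
proof
 fix z assume "z \<in> {z. 0 < Im z}"
 define c where "c = Im z / 2"
 have c: "0 < c" "c < Im z" using \<open>z \<in> _\<close> by (auto simp: c_def)
 define D where "D = (LI t. g t * (- 1 / (z - of_real t)) / (z - of_real t))"
 have S: "open {w. c < Im w}" by (rule open_halfspace_Im_gt)
 have "(cauchy_int g has_field_derivative D) (at z within {w. c < Im w})" unfolding has_field_derivative_iff tendsto_at_iff_sequentially
 proof (intro allI impI)
  fix X :: "nat => complex" assume X: "\<forall>i. X i \<in> {w. c < Im w} - {z}" "X \<longlonglongrightarrow> z"
  have eq: "(cauchy_int g (X n) - cauchy_int g z) / (X n - z) = (LI t. g t * (- 1 / (z - of_real t)) / (X n - of_real t))" for n proof -
   have Xn: "X n \<noteq> z" "c < Im (X n)" using X(1) by auto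
   have nz: "X n - of_real t \<noteq> 0" "z - of_real t \<noteq> 0" for t using Xn c by (auto simp: complex_eq_iff)
   have "cauchy_int g (X n) - cauchy_int g z = (LI t. g t / (X n - of_real t) - g t / (z - of_real t))" unfolding cauchy_int_def using Xn c
    by (intro bochner_diff[symmetric] cauchy_integrable g) auto
   also have "... = (LI t. (X n - z) * (g t * (- 1 / (z - of_real t)) / (X n - of_real t)))" proof (intro bochner_cong refl)
    fix t
    have "u / a - u / b = (a - b) * (u * (- 1 / b) / a)" if "a \<noteq> 0" "b \<noteq> 0" for u a b :: complex using that by (simp add: field_simps)
    from this[OF nz, of "g t" t t]
    show "g t / (X n - of_real t) - g t / (z - of_real t) = (X n - z) * (g t * (- 1 / (z - of_real t)) / (X n - of_real t))" by simp
   qed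
   also have "... = (X n - z) * (LI t. g t * (- 1 / (z - of_real t)) / (X n - of_real t))" by (rule Bochner_Integration.integral_mult_right_zero)
   finally have e: "cauchy_int g (X n) - cauchy_int g z = (X n - z) * (LI t. g t * (- 1 / (z - of_real t)) / (X n - of_real t))" .
   show ?thesis unfolding e using Xn(1) by (intro nonzero_mult_div_cancel_left) simp
  qed
  have "(\<lambda>n. LI t. g t * (- 1 / (z - of_real t)) / (X n - of_real t)) \<longlonglongrightarrow> D" unfolding D_def
  proof (rule cauchy_int_tendsto[OF g c(1) _ X(2), where B = "1 / Im z"])
   show "c \<le> \<bar>Im (X n)\<bar>" for n proof -
    have "c < Im (X n)" using X(1) by auto
    then show ?thesis using c(1) by simp
   qed
   show "norm (- 1 / (z - of_real t)) \<le> 1 / Im z" for t using cauchy_kernel_le[of z t] c by (simp add: norm_divide)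
   show "(\<lambda>t. - 1 / (z - of_real t)) \<in> Lmeasurable" using borel_measurable_uminus[OF cauchy_kernel_measurable[of z]] c by simp
  qed
  then show "((\<lambda>y. (cauchy_int g y - cauchy_int g z) / (y - z)) \<circ> X) \<longlonglongrightarrow> D" unfolding o_def eq .
 qed
 then have "(cauchy_int g has_field_derivative D) (at z)" using at_within_open[OF _ S, of z] c by simp
 then show "cauchy_int g field_differentiable at z within {z. 0 < Im z}" by (meson field_differentiable_at_within field_differentiable_def)
qed

text \<open>Cauchy's formula at z minus Cauchy's theorem at the conjugate point, on the rectangle
  over [-R, R] of height R. The difference of the two kernels is 2 pi i times the Poisson kernel on
  the real axis and O(1 / R^2) on the other sides, so a bounded G suffices. The limit is taken over
  symmetric intervals; integrability of the Poisson kernel is itself derived later from the case G =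
  1.\<close>

lemma poisson_representation:
 assumes G: "G holomorphic_on {z. -\<delta> < Im z}" and \<delta>: "0 < \<delta>" and B: "\<And>z. 0 \<le> Im z ==> norm (G z) \<le> 1"
  and y: "0 < y"
 shows "((\<lambda>R. integral {-R..R} (\<lambda>t. of_real (poisson x y t) * G (of_real t))) \<longlongrightarrow> G (Complex x y)) at_top"
proof -
 define z where "z = Complex x y"
 define f where "f \<zeta> = G \<zeta> / (\<zeta> - z) - G \<zeta> / (\<zeta> - cnj z)" for \<zeta>
 have zz: "z \<noteq> cnj z" using y by (simp add: z_def complex_eq_iff)
 have bound: "norm (2 * pi * \<i> * G z - 2 * pi * \<i> * integral {-R..R} (\<lambda>t. of_real (poisson x y t) * G (of_real t))) \<le> 64 * y / R"
  if R: "R > 2 * norm z" "R > 0" for R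
 proof -
  define a1 where "a1 = complex_of_real (- R)"
  define a2 where "a2 = complex_of_real R"
  define a3 where "a3 = Complex R R"
  define a4 where "a4 = Complex (- R) R"
  have rp: "rectpath a1 a3 = linepath a1 a2 +++ linepath a2 a3 +++ linepath a3 a4 +++ linepath a4 a1"
   by (simp add: rectpath_def a1_def a2_def a3_def a4_def Let_def complex_of_real_def)
  \<comment> \<open>The strip below the axis must stay inside the domain of G and above the
    conjugate point, hence the minimum.\<close>
  define S where "S = {\<zeta>. - min \<delta> y < Im \<zeta>}"
  have GS: "G holomorphic_on S" using G by (rule holomorphic_on_subset) (auto simp: S_def)
  have cS: "convex S" unfolding S_def by (rule convex_halfspace_Im_gt)
  have oS: "open S" unfolding S_def by (rule open_halfspace_Im_gt)
  have zR: "\<bar>Re z\<bar> < R" "\<bar>Im z\<bar> < R" using R abs_Re_le_cmod[of z] abs_Im_le_cmod[of z] norm_ge_zero[of z] by linarith+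
  have zbox: "z \<in> box a1 a3" using zR y by (auto simp: in_box_complex_iff a1_def a3_def z_def)
  have img: "path_image (rectpath a1 a3) \<subseteq> S - {z}" proof -
   have "path_image (rectpath a1 a3) = cbox a1 a3 - box a1 a3" by (rule path_image_rectpath_cbox_minus_box) (use R in \<open>auto simp: a1_def a3_def\<close>)
   moreover have "0 \<le> Im w" if "w \<in> cbox a1 a3" for w using that by (simp add: in_cbox_complex_iff a1_def)
   moreover have "- min \<delta> y < 0" using \<delta> y by simp
   ultimately show ?thesis using zbox unfolding S_def by force
  qed
  have C1: "((\<lambda>w. G w / (w - z)) has_contour_integral (2 * pi * \<i> * winding_number (rectpath a1 a3) z * G z)) (rectpath a1 a3)"
   using img by (intro Cauchy_integral_formula_convex_simple[OF cS GS])
    (use oS y \<delta> in \<open>auto simp: interior_open S_def z_def\<close>)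
  have C2: "((\<lambda>w. G w / (w - cnj z)) has_contour_integral 0) (rectpath a1 a3)" proof (rule Cauchy_theorem_convex_simple[OF _ cS])
   show "(\<lambda>w. G w / (w - cnj z)) holomorphic_on S" by (intro holomorphic_intros GS) (auto simp: S_def z_def)
  qed (use img in auto)
  have C: "(f has_contour_integral (2 * pi * \<i> * G z)) (rectpath a1 a3)"
   using has_contour_integral_diff[OF C1 C2] winding_number_rectpath[OF zbox] by (simp add: f_def[abs_def])
  have seg: "closed_segment a1 a2 \<subseteq> path_image (rectpath a1 a3)" "closed_segment a2 a3 \<subseteq> path_image (rectpath a1 a3)"
   "closed_segment a3 a4 \<subseteq> path_image (rectpath a1 a3)" "closed_segment a4 a1 \<subseteq> path_image (rectpath a1 a3)"
   unfolding rp by (auto simp: path_image_join)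
  have fc: "continuous_on (path_image (rectpath a1 a3)) f" unfolding f_def using img
   by (intro continuous_intros holomorphic_on_imp_continuous_on[OF holomorphic_on_subset[OF GS]])
     (auto simp: S_def z_def)
  have ci: "f contour_integrable_on linepath a1 a2" "f contour_integrable_on linepath a2 a3"
   "f contour_integrable_on linepath a3 a4" "f contour_integrable_on linepath a4 a1"
   using seg by (auto intro!: contour_integrable_continuous_linepath continuous_on_subset[OF fc])
  have "contour_integral (rectpath a1 a3) f = contour_integral (linepath a1 a2) f + (contour_integral (linepath a2 a3) f +
   (contour_integral (linepath a3 a4) f + contour_integral (linepath a4 a1) f))"
   unfolding rp using ci by (simp add: contour_integral_join contour_integrable_join valid_path_join)
  then have sum: "2 * pi * \<i> * G z - contour_integral (linepath a1 a2) f = contour_integral (linepath a2 a3) f +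
   contour_integral (linepath a3 a4) f + contour_integral (linepath a4 a1) f" using contour_integral_unique[OF C] by simp
  \<comment> \<open>The two poles are 2 y apart, and R > 2 |z| keeps both at distance at least R / 2
    from \<zeta>; this gives the 8.\<close>
  have fb: "norm (f \<zeta>) \<le> 8 * y / R^2" if \<zeta>: "0 \<le> Im \<zeta>" "R \<le> norm \<zeta>" for \<zeta> proof -
   have n1: "R / 2 \<le> norm (\<zeta> - z)" using norm_triangle_ineq2[of \<zeta> z] \<zeta>(2) R by linarith
   have n2: "R / 2 \<le> norm (\<zeta> - cnj z)" using norm_triangle_ineq2[of \<zeta> "cnj z"] \<zeta>(2) R by simp
   have nz: "\<zeta> - z \<noteq> 0" "\<zeta> - cnj z \<noteq> 0" using n1 n2 R(2) by auto
   have "f \<zeta> = G \<zeta> * (z - cnj z) / ((\<zeta> - z) * (\<zeta> - cnj z))" using nz by (simp add: f_def field_simps)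
   then have "norm (f \<zeta>) = norm (G \<zeta>) * (2 * y) / (norm (\<zeta> - z) * norm (\<zeta> - cnj z))"
    using y by (simp add: norm_mult norm_divide z_def complex_diff_cnj)
   also have "... \<le> 1 * (2 * y) / (R / 2 * (R / 2))" using n1 n2 R y B[OF \<zeta>(1)] by (intro frac_le mult_right_mono mult_mono mult_pos_pos) auto
   also have "... = 8 * y / R^2" by (simp add: power2_eq_square)
   finally show ?thesis .
  qed
  have B0: "0 \<le> 8 * y / R^2" using y by simp
  have L1: "norm (contour_integral (linepath a2 a3) f) \<le> 8 * y / R^2 * norm (a3 - a2)" proof (rule contour_integral_bound_linepath[OF ci(2) B0 fb])
   fix \<zeta> assume "\<zeta> \<in> closed_segment a2 a3"
   then have "Re \<zeta> = R \<and> 0 \<le> Im \<zeta>" using R by (auto simp: a2_def a3_def closed_segment_same_Re closed_segment_eq_real_ivl)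
   then show "0 \<le> Im \<zeta>" "R \<le> norm \<zeta>" using complex_Re_le_cmod[of \<zeta>] by auto
  qed
  have L2: "norm (contour_integral (linepath a3 a4) f) \<le> 8 * y / R^2 * norm (a4 - a3)" proof (rule contour_integral_bound_linepath[OF ci(3) B0 fb])
   fix \<zeta> assume "\<zeta> \<in> closed_segment a3 a4"
   then have "Im \<zeta> = R" by (auto simp: a3_def a4_def closed_segment_same_Im)
   then show "0 \<le> Im \<zeta>" "R \<le> norm \<zeta>" using abs_Im_le_cmod[of \<zeta>] R by auto
  qed
  have L3: "norm (contour_integral (linepath a4 a1) f) \<le> 8 * y / R^2 * norm (a1 - a4)" proof (rule contour_integral_bound_linepath[OF ci(4) B0 fb])
   fix \<zeta> assume "\<zeta> \<in> closed_segment a4 a1"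
   then have "Re \<zeta> = - R \<and> 0 \<le> Im \<zeta>" using R by (auto simp: a4_def a1_def closed_segment_same_Re closed_segment_eq_real_ivl)
   then show "0 \<le> Im \<zeta>" "R \<le> norm \<zeta>" using abs_Re_le_cmod[of \<zeta>] R by auto
  qed
  have len: "norm (a3 - a2) = R" "norm (a4 - a3) = 2 * R" "norm (a1 - a4) = R" proof -
   have "a3 - a2 = Complex 0 R" "a4 - a3 = Complex (- 2 * R) 0" "a1 - a4 = Complex 0 (- R)"
    by (simp_all add: a1_def a2_def a3_def a4_def complex_eq_iff)
   then show "norm (a3 - a2) = R" "norm (a4 - a3) = 2 * R" "norm (a1 - a4) = R" using R(2) by (simp_all add: cmod_eq_Re cmod_eq_Im)
  qed
  have "norm (2 * pi * \<i> * G z - contour_integral (linepath a1 a2) f) \<le> 8 * y / R^2 * R + 8 * y / R^2 * (2 * R) + 8 * y / R^2 * R"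
   unfolding sum using L1 L2 L3 unfolding len by (intro order_trans[OF norm_triangle_ineq] add_mono)
  also have "... = 32 * y / R" using R by (simp add: power2_eq_square field_simps)
  also have "... \<le> 64 * y / R" using R y by (simp add: divide_right_mono)
  finally have *: "norm (2 * pi * \<i> * G z - contour_integral (linepath a1 a2) f) \<le> 64 * y / R" .
  have "contour_integral (linepath a1 a2) f = integral {-R..R} (\<lambda>t. f (of_real t))"
   using contour_integral_linepath_Reals_eq[of a1 a2 f] R by (simp add: a1_def a2_def)
  also have "(\<lambda>t. f (of_real t)) = (\<lambda>t. (2 * pi * \<i>) * (of_real (poisson x y t) * G (of_real t)))" proof
   fix t :: real
   have nz: "of_real t - z \<noteq> 0" "of_real t - cnj z \<noteq> 0" using y by (auto simp: z_def complex_eq_iff)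
   have "(of_real t - z) * (of_real t - cnj z) = of_real (y^2 + (x - t)^2)" by (simp add: z_def complex_eq_iff power2_eq_square algebra_simps)
   then have "f (of_real t) = G (of_real t) * (z - cnj z) / of_real (y^2 + (x - t)^2)" using nz by (simp add: f_def field_simps)
   also have "z - cnj z = 2 * \<i> * of_real y" by (simp add: z_def complex_eq_iff)
   finally show "f (of_real t) = (2 * pi * \<i>) * (of_real (poisson x y t) * G (of_real t))" by (simp add: poisson_def)
  qed
  finally show ?thesis using * by simp
 qed
 have "((\<lambda>R. 2 * pi * \<i> * G z - 2 * pi * \<i> * integral {-R..R} (\<lambda>t. of_real (poisson x y t) * G (of_real t))) \<longlongrightarrow> 0) at_top"
 proof (rule Lim_null_comparison)
  show "\<forall>\<^sub>F R in at_top. norm (2 * pi * \<i> * G z - 2 * pi * \<i> * integral {-R..R} (\<lambda>t. of_real (poisson x y t) * G (of_real t))) \<le> 64 * y / R"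
   using eventually_gt_at_top[of "2 * norm z"] eventually_gt_at_top[of 0] by eventually_elim (rule bound)
  show "((\<lambda>R. 64 * y / R) \<longlongrightarrow> 0) at_top" by (intro tendsto_divide_0[OF tendsto_const] filterlim_at_top_imp_at_infinity filterlim_ident)
 qed
 from tendsto_mult[OF tendsto_const[of "1 / (2 * pi * \<i>)"] this]
 have "((\<lambda>R. G z - integral {-R..R} (\<lambda>t. of_real (poisson x y t) * G (of_real t))) \<longlongrightarrow> 0) at_top"
  by (simp add: right_diff_distrib[symmetric] del: right_diff_distrib)
 from tendsto_diff[OF tendsto_const[of "G z"] this] show ?thesis by (simp add: z_def)
qed

text \<open>The Moebius map w -> w / (\<mu> + w) sends the right half-plane to the disc with
  diameter [0, 1], and the circle |w| = \<mu> to the line Re = 1 / 2.\<close>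

lemma Re_quotient:
 fixes w :: complex
 assumes w: "0 \<le> Re w" and l: "0 < \<mu>"
 shows "of_real \<mu> + w \<noteq> 0" "norm (w / (of_real \<mu> + w)) \<le> 1" "0 \<le> Re (w / (of_real \<mu> + w))"
  "\<mu> \<le> norm w ==> 1 / 2 \<le> Re (w / (of_real \<mu> + w))" "norm (w / (of_real \<mu> + w)) \<le> norm w / \<mu>"
proof -
 have pos: "0 < (\<mu> + Re w)^2 + (Im w)^2" using w l by (intro add_pos_nonneg) auto
 show nz: "of_real \<mu> + w \<noteq> 0" using w l by (auto simp: complex_eq_iff)
 have "norm w \<le> norm (of_real \<mu> + w)" unfolding cmod_def using w l power_mono[of "Re w" "\<mu> + Re w" 2] by (intro real_sqrt_le_mono) simp
 then show "norm (w / (of_real \<mu> + w)) \<le> 1" using nz by (simp add: norm_divide divide_le_eq_1)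
 have Re_eq: "Re (w / (of_real \<mu> + w)) = (Re w * (\<mu> + Re w) + (Im w)^2) / ((\<mu> + Re w)^2 + (Im w)^2)" by (simp add: Re_divide power2_eq_square)
 show "0 \<le> Re (w / (of_real \<mu> + w))" unfolding Re_eq using w l by (intro divide_nonneg_nonneg add_nonneg_nonneg mult_nonneg_nonneg) auto
 show "1 / 2 \<le> Re (w / (of_real \<mu> + w))" if "\<mu> \<le> norm w" proof -
  have "\<mu>^2 \<le> (norm w)^2" using that l by (intro power_mono) auto
  then have "\<mu>^2 \<le> (Re w)^2 + (Im w)^2" by (simp add: cmod_power2)
  then show ?thesis unfolding Re_eq using pos by (simp add: field_simps power2_eq_square)
 qed
 have "\<mu> \<le> norm (of_real \<mu> + w)" using complex_Re_le_cmod[of "of_real \<mu> + w"] w by simp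
 then show "norm (w / (of_real \<mu> + w)) \<le> norm w / \<mu>" unfolding norm_divide using l by (intro divide_left_mono mult_pos_pos) auto
qed

text \<open>For \<open>g \<ge> 0\<close> the function \<open>w = \<i> * cauchy_int g\<close> has nonnegative real part, so \<open>w / (\<mu> + w)\<close> is bounded by 1 and its
 real part is at least \<open>1 / 2\<close> where \<open>\<mu> \<le> \<bar>w\<bar>\<close>. It is the Poisson integral of its boundary values, whose integral is at
 most \<open>\<pi> * M / \<mu>\<close> by letting the height tend to infinity, and the Hardy-Littlewood estimate applies.\<close>

lemma weak_type_shifted:
 fixes g :: "real => real"
 assumes g: "Lintegrable g" "\<And>t. 0 \<le> g t" and l: "0 < \<mu>" and d: "0 < \<delta>"
 obtains U where "U \<in> sets lebesgue" "emeasure lebesgue U \<le> ennreal (60 * pi * (LI t. g t) / \<mu>)"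
  "{x. \<exists>y>0. \<mu> < norm (cauchy_int (\<lambda>t. of_real (g t)) (Complex x (y + \<delta>)))} \<subseteq> U"
proof -
 define M where "M = (LI t. g t)"
 have M0: "0 \<le> M" unfolding M_def using g(2) by simp
 define F where "F z = \<i> * cauchy_int (\<lambda>t. of_real (g t)) z" for z
 have gc: "Lintegrable (\<lambda>t. complex_of_real (g t))" using g(1) by simp
 have Fh: "F holomorphic_on {z. 0 < Im z}" unfolding F_def by (intro holomorphic_intros cauchy_int_holomorphic gc)
 have F0: "0 \<le> Re (F z)" if "0 < Im z" for z proof -
  have i: "Lintegrable (\<lambda>t. of_real (g t) / (z - of_real t))" using that by (intro cauchy_integrable gc) auto
  have "Re (F z) = - Im (cauchy_int (\<lambda>t. of_real (g t)) z)" by (simp add: F_def)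
  also have "Im (cauchy_int (\<lambda>t. of_real (g t)) z) = (LI t. Im (of_real (g t) / (z - of_real t)))"
   unfolding cauchy_int_def by (rule integral_Im[OF i, symmetric])
  also have "- ... = (LI t. - Im (of_real (g t) / (z - of_real t)))" by simp
  also have "... \<ge> 0" proof (intro bochner_nonneg)
   fix t
   show "0 \<le> - Im (of_real (g t) / (z - of_real t))" using that g(2)[of t] by (simp add: Im_divide divide_nonneg_nonneg)
  qed
  finally show ?thesis .
 qed
 have FM: "norm (F z) \<le> M / Im z" if "0 < Im z" for z using cauchy_int_bound[OF gc, of z] that g(2) by (simp add: F_def norm_mult M_def)
 \<comment> \<open>Raising the argument by \<delta> makes G holomorphic across the real axis, so its
   boundary values are continuous and the Poisson representation applies.\<close>
 define G where "G \<zeta> = F (\<zeta> + \<i> * of_real \<delta>) / (of_real \<mu> + F (\<zeta> + \<i> * of_real \<delta>))" for \<zeta>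
 have Im: "0 < Im (\<zeta> + \<i> * of_real \<delta>)" if "-\<delta> < Im \<zeta>" for \<zeta> using that by simp
 note GR = Re_quotient[OF F0[OF Im] l, folded G_def]
 have Fs: "(\<lambda>\<zeta>. F (\<zeta> + \<i> * of_real \<delta>)) holomorphic_on {z. -\<delta> < Im z}" proof -
  have "(F \<circ> (\<lambda>\<zeta>. \<zeta> + \<i> * of_real \<delta>)) holomorphic_on {z. -\<delta> < Im z}" by (rule holomorphic_on_compose_gen[OF _ Fh]) (auto intro!: holomorphic_intros)
  then show ?thesis by (simp add: o_def)
 qed
 have Gh: "G holomorphic_on {z. -\<delta> < Im z}" unfolding G_def by (intro holomorphic_intros Fs) (use Re_quotient(1)[OF F0[OF Im] l] in auto)
 have GB: "norm (G z) \<le> 1" if "0 \<le> Im z" for z using GR(2)[of z] that d by simp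
 define h where "h t = Re (G (of_real t))" for t :: real
 have h0: "0 \<le> h t" for t unfolding h_def using GR(3)[of "of_real t"] d by simp
 have Gc: "continuous_on UNIV (\<lambda>t::real. G (of_real t))"
  by (rule continuous_on_compose2[OF holomorphic_on_imp_continuous_on[OF Gh]]) (auto intro!: continuous_intros simp: d)
 have hc: "continuous_on S h" for S unfolding h_def using continuous_on_subset[OF Gc] by (intro continuous_intros) auto
 have hm: "(\<lambda>t. ennreal (h t)) \<in> borel_measurable borel"
  using borel_measurable_continuous_onI[OF hc] by (intro measurable_compose[OF _ measurable_ennreal])
 have pc: "continuous_on S (poisson x y)" if "0 < y" for x y S
  unfolding poisson_def using that by (intro continuous_intros) (auto simp: add_pos_nonneg less_imp_neq[symmetric])
 define I where "I x y R = integral {-R..R} (\<lambda>t. poisson x y t * h t)" for x y R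
 have Ih: "((\<lambda>t. poisson x y t * h t) has_integral I x y R) {-R..R}" if "0 < y" for x y R
  unfolding I_def by (intro integrable_integral integrable_continuous_interval continuous_intros pc hc that)
 have lim: "(I x y \<longlongrightarrow> Re (G (Complex x y))) at_top" if y: "0 < y" for x y proof -
  have e: "I x y = (\<lambda>R. Re (integral {-R..R} (\<lambda>t. of_real (poisson x y t) * G (of_real t))))" proof
   fix R
   have "(\<lambda>t. of_real (poisson x y t) * G (of_real t)) integrable_on {-R..R}"
    using continuous_on_subset[OF Gc] by (intro integrable_continuous_interval continuous_intros pc y) auto
   from integral_linear[OF this bounded_linear_Re]
   show "I x y R = Re (integral {-R..R} (\<lambda>t. of_real (poisson x y t) * G (of_real t)))" by (simp add: I_def h_def o_def)
  qed
  show ?thesis unfolding e by (rule tendsto_Re[OF poisson_representation[OF Gh d GB y, of x]])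
 qed
 have nn: "(NI t. ennreal (indicator {-R..R} t * f t)) = ennreal i"
  if "(f has_integral i) {-R..R}" "\<And>t. 0 \<le> f t" "continuous_on UNIV f" for f :: "real => real" and R i :: real
 proof -
  have "(\<lambda>t. ennreal (indicator {-R..R} t * f t)) \<in> borel_measurable borel"
   by (intro measurable_compose[OF _ measurable_ennreal] borel_measurable_times borel_measurable_indicator
     borel_measurable_continuous_onI that(3)) auto
  then show ?thesis using nn_integral_has_integral_lebesgue[OF that(2,1)] by (simp add: nn_integral_completion)
 qed
 have A: "ennreal (Re (G (Complex x y))) \<le> (NI t. ennreal (poisson x y t) * ennreal (h t))" if y: "0 < y" for x y proof (rule tendsto_upperbound)
  show "((\<lambda>R. ennreal (I x y R)) \<longlongrightarrow> ennreal (Re (G (Complex x y)))) at_top" by (rule tendsto_ennrealI[OF lim[OF y]])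
  show "\<forall>\<^sub>F R in at_top. ennreal (I x y R) \<le> (NI t. ennreal (poisson x y t) * ennreal (h t))" proof (intro always_eventually allI)
   fix R
   have "ennreal (I x y R) = (NI t. ennreal (indicator {-R..R} t * (poisson x y t * h t)))"
    using y h0 by (intro nn[symmetric] Ih mult_nonneg_nonneg poisson_nonneg continuous_intros pc hc) auto
   also have "... \<le> (NI t. ennreal (poisson x y t) * ennreal (h t))" using y h0 poisson_nonneg[of y x]
    by (intro nn_integral_mono) (auto simp: indicator_def ennreal_mult)
   finally show "ennreal (I x y R) \<le> (NI t. ennreal (poisson x y t) * ennreal (h t))" .
  qed
 qed simp
 \<comment> \<open>On [-R, R] the Poisson kernel at height y is at least c = y / (pi (y^2 + R^2)),
   while Re G (i y) is at most M / (y \<mu>). The quotient of these bounds tends to pi M / \<mu> as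
   y grows.\<close>
 have Hn: "integral {-R..R} h \<le> pi * M / \<mu>" if R: "0 \<le> R" for R proof (rule tendsto_lowerbound)
  show "((\<lambda>y. pi * M / \<mu> * (1 + R^2 / y^2)) \<longlongrightarrow> pi * M / \<mu>) at_top" proof -
   have "((\<lambda>y::real. R^2 / y^2) \<longlongrightarrow> 0) at_top"
    by (intro tendsto_divide_0[OF tendsto_const] filterlim_at_top_imp_at_infinity filterlim_pow_at_top filterlim_ident) simp
   from tendsto_mult[OF tendsto_const[of "pi * M / \<mu>"] tendsto_add[OF tendsto_const[of 1] this]] show ?thesis by simp
  qed
  show "\<forall>\<^sub>F y in at_top. integral {-R..R} h \<le> pi * M / \<mu> * (1 + R^2 / y^2)" using eventually_gt_at_top[of 0] proof eventually_elim
   case (elim y)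
   have 1: "I 0 y R \<le> Re (G (Complex 0 y))" proof (rule tendsto_lowerbound[OF lim[OF elim]])
    show "\<forall>\<^sub>F R' in at_top. I 0 y R \<le> I 0 y R'" using eventually_ge_at_top[of R] proof eventually_elim
     case (elim R')
     then show ?case unfolding I_def using \<open>0 < y\<close> h0
      by (intro integral_subset_le integrable_continuous_interval continuous_intros pc hc ballI mult_nonneg_nonneg poisson_nonneg) auto
    qed
   qed simp
   have "Re (G (Complex 0 y)) \<le> norm (G (Complex 0 y))" by (rule complex_Re_le_cmod)
   also have "... \<le> norm (F (Complex 0 y + \<i> * of_real \<delta>)) / \<mu>" using GR(5)[of "Complex 0 y"] elim d by simp
   also have "... \<le> (M / (y + \<delta>)) / \<mu>" using FM[of "Complex 0 y + \<i> * of_real \<delta>"] elim d l by (intro divide_right_mono) auto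
   also have "... \<le> (M / y) / \<mu>" using elim d l M0 by (intro divide_right_mono divide_left_mono) auto
   finally have 2: "Re (G (Complex 0 y)) \<le> M / y / \<mu>" .
   define c where "c = y / (pi * (y^2 + R^2))"
   have cp: "0 < c" unfolding c_def using elim by (intro divide_pos_pos mult_pos_pos add_pos_nonneg) auto
   have "c * integral {-R..R} h = integral {-R..R} (\<lambda>t. c * h t)" by simp
   also have "... \<le> I 0 y R" unfolding I_def proof (intro integral_le integrable_continuous_interval continuous_intros pc hc elim)
    fix t assume "t \<in> {-R..R}"
    then have "t^2 \<le> R^2" using R by (intro power2_le_iff_abs_le[THEN iffD2]) auto
    then have "y / (y^2 + R^2) \<le> y / (y^2 + t^2)" using elim by (intro divide_left_mono mult_pos_pos add_pos_nonneg) auto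
    then have "c \<le> poisson 0 y t" unfolding c_def poisson_def
     using mult_left_mono[of "y / (y^2 + R^2)" "y / (y^2 + t^2)" "1 / pi"] by (simp add: mult.commute)
    then show "c * h t \<le> poisson 0 y t * h t" using h0 by (rule mult_right_mono)
   qed
   finally have "c * integral {-R..R} h \<le> M / y / \<mu>" using 1 2 by linarith
   then have "integral {-R..R} h \<le> M / y / \<mu> / c" using cp by (metis mult.commute pos_le_divide_eq)
   also have "M / y / \<mu> / c = pi * M / \<mu> * (1 + R^2 / y^2)" using elim l by (simp add: c_def field_simps power2_eq_square)
   finally show ?case .
  qed
 qed simp
 have H: "(NI t. ennreal (h t)) \<le> ennreal (pi * M / \<mu>)" proof -
  have "(NI t. ennreal (h t)) = (NI t. (SUP n. ennreal (indicator {- real n..real n} t * h t)))" proof (intro nn_integral_cong antisym)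
   fix t
   obtain n where n: "abs t \<le> real n" using real_arch_simple by blast
   then have "ennreal (h t) = ennreal (indicator {- real n..real n} t * h t)" by (auto simp: indicator_def)
   then show "ennreal (h t) \<le> (SUP n. ennreal (indicator {- real n..real n} t * h t))" by (simp only:) (rule SUP_upper, simp)
   show "(SUP n. ennreal (indicator {- real n..real n} t * h t)) \<le> ennreal (h t)" using h0 by (intro SUP_least) (auto simp: indicator_def)
  qed
  also have "... = (SUP n. \<integral>\<^sup>+t. ennreal (indicator {- real n..real n} t * h t) \<partial>lebesgue)" proof (rule nn_integral_monotone_convergence_SUP)
   show "incseq (\<lambda>n t. ennreal (indicator {- real n..real n} t * h t))"
    using h0 by (intro incseq_SucI le_funI ennreal_leI mult_right_mono) (auto simp: indicator_def)
   have "(\<lambda>t. ennreal (indicator {- real n..real n} t * h t)) \<in> borel_measurable borel" for n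
    using borel_measurable_continuous_onI[OF hc] by measurable
   then show "(\<lambda>t. ennreal (indicator {- real n..real n} t * h t)) \<in> Lmeasurable" for n by (intro measurable_completion) simp
  qed
  also have "... \<le> ennreal (pi * M / \<mu>)" proof (rule SUP_least)
   fix n :: nat
   have "(NI t. ennreal (indicator {- real n..real n} t * h t)) = ennreal (integral {- real n..real n} h)"
    by (rule nn) (auto intro!: integrable_integral integrable_continuous_interval hc h0)
   also have "... \<le> ennreal (pi * M / \<mu>)" by (intro ennreal_leI Hn) simp
   finally show "(NI t. ennreal (indicator {- real n..real n} t * h t)) \<le> ennreal (pi * M / \<mu>)" .
  qed
  finally show ?thesis .
 qed
 have hml: "(\<lambda>t. ennreal (h t)) \<in> Lmeasurable" using hm by (intro measurable_completion) simp
 \<comment> \<open>The level 1 / 12 is so low that averages of h below it would give Re G \<le> 4 /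
   (3 pi), which is less than 1 / 2 because pi > 8 / 3. Hence 60 = 5 * 12 in the bound.\<close>
 obtain U where U: "U \<in> sets lebesgue" "emeasure lebesgue U \<le> ennreal (5 / (1 / 12) * (pi * M / \<mu>))"
  "{x. \<exists>r>0. ennreal (2 * r * (1 / 12)) < (\<integral>\<^sup>+t\<in>cball x r. ennreal (h t) \<partial>lebesgue)} \<subseteq> U" using HL_weak_type[OF hml H, of "1 / 12"] M0 l by auto
 show ?thesis proof (rule that[OF U(1)])
  show "emeasure lebesgue U \<le> ennreal (60 * pi * (LI t. g t) / \<mu>)" using U(2) by (simp add: M_def mult.assoc)
  show "{x. \<exists>y>0. \<mu> < norm (cauchy_int (\<lambda>t. of_real (g t)) (Complex x (y + \<delta>)))} \<subseteq> U" proof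
   fix x assume "x \<in> {x. \<exists>y>0. \<mu> < norm (cauchy_int (\<lambda>t. of_real (g t)) (Complex x (y + \<delta>)))}"
   then obtain y where y: "0 < y" "\<mu> < norm (cauchy_int (\<lambda>t. of_real (g t)) (Complex x (y + \<delta>)))" by blast
   have e: "Complex x (y + \<delta>) = Complex x y + \<i> * of_real \<delta>" by (simp add: complex_eq_iff)
   have "1 / 2 \<le> Re (G (Complex x y))" using GR(4)[of "Complex x y"] y d by (simp add: F_def norm_mult e)
   have "x \<in> {x. \<exists>r>0. ennreal (2 * r * (1 / 12)) < (\<integral>\<^sup>+t\<in>cball x r. ennreal (h t) \<partial>lebesgue)}" proof (rule ccontr)
    assume "x \<notin> {x. \<exists>r>0. ennreal (2 * r * (1 / 12)) < (\<integral>\<^sup>+t\<in>cball x r. ennreal (h t) \<partial>lebesgue)}"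
    then have "(\<integral>\<^sup>+t\<in>cball x r. ennreal (h t) \<partial>lebesgue) \<le> ennreal (2 * r * (1 / 12))" if "0 < r" for r
     using that by (simp add: not_less) (metis not_le)
    from poisson_maximal[OF hml y(1) _ this] have "(NI t. ennreal (poisson x y t) * ennreal (h t)) \<le> ennreal (16 * (1 / 12) / pi)" by simp
    with A[OF y(1), of x] have "ennreal (Re (G (Complex x y))) \<le> ennreal (16 * (1 / 12) / pi)" by (rule order_trans)
    then have "Re (G (Complex x y)) \<le> 16 * (1 / 12) / pi" by (subst (asm) ennreal_le_iff) auto
    with \<open>1 / 2 \<le> _\<close> have "1 / 2 \<le> 16 * (1 / 12) / pi" by linarith
    then have "pi \<le> 8 / 3" by (simp add: field_simps)
    then show False using pi_gt3 by simp
   qed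
   then show "x \<in> U" using U(3) by blast
  qed
 qed
qed

lemma open_superlevel:
 assumes g: "Lintegrable g" and d: "0 \<le> \<delta>"
 shows "open {x. \<exists>y>0. \<mu> < norm (cauchy_int g (Complex x (y + \<delta>)))}"
proof -
 have "{x. \<exists>y>0. \<mu> < norm (cauchy_int g (Complex x (y + \<delta>)))} = (\<Union>y\<in>{0<..}. {x. \<mu> < norm (cauchy_int g (Complex x (y + \<delta>)))})" by auto
 moreover have "open {x. \<mu> < norm (cauchy_int g (Complex x (y + \<delta>)))}" if "0 < y" for y proof (rule open_Collect_less)
  have "continuous_on UNIV (\<lambda>x. cauchy_int g (Complex x (y + \<delta>)))"
   by (rule continuous_on_compose2[OF holomorphic_on_imp_continuous_on[OF cauchy_int_holomorphic[OF g]]])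
     (use that d in \<open>auto intro!: continuous_intros simp: Complex_eq\<close>)
  then show "continuous_on UNIV (\<lambda>x. norm (cauchy_int g (Complex x (y + \<delta>))))" by (rule continuous_on_norm)
 qed auto
 ultimately show ?thesis by (simp only:) (rule open_UN, auto)
qed

text \<open>The level set of the vertical maximal function of the Cauchy integral. As a union of
  open sets over all heights it is open, hence measurable.\<close>

definition superlevel :: "(real => complex) => real => real set" where
 "superlevel g \<mu> = {x. \<exists>y>0. \<mu> < norm (cauchy_int g (Complex x y))}"

lemma superlevel_sets: "Lintegrable g ==> superlevel g \<mu> \<in> sets lebesgue" using open_superlevel[of g 0 \<mu>] by (simp add: superlevel_def)

text \<open>The bound of the shifted estimate does not involve \<delta>, and the sets for \<delta> =
  1 / (n + 1) increase to the superlevel set.\<close>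

lemma weak_type_nonneg:
 fixes g :: "real => real"
 assumes g: "Lintegrable g" "\<And>t. 0 \<le> g t" and l: "0 < \<mu>"
 shows "emeasure lebesgue (superlevel (\<lambda>t. of_real (g t)) \<mu>) \<le> ennreal (60 * pi * (LI t. g t) / \<mu>)"
proof -
 define E where "E n = {x. \<exists>y>0. \<mu> < norm (cauchy_int (\<lambda>t. of_real (g t)) (Complex x (y + 1 / real (Suc n))))}" for n
 have gc: "Lintegrable (\<lambda>t. complex_of_real (g t))" using g(1) by simp
 have Es: "E n \<in> sets lebesgue" for n unfolding E_def using open_superlevel[OF gc, of "1 / real (Suc n)"] by simp
 have Ele: "emeasure lebesgue (E n) \<le> ennreal (60 * pi * (LI t. g t) / \<mu>)" for n proof -
  obtain U where "U \<in> sets lebesgue" "emeasure lebesgue U \<le> ennreal (60 * pi * (LI t. g t) / \<mu>)" "E n \<subseteq> U"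
   using weak_type_shifted[OF g l, of "1 / real (Suc n)"] unfolding E_def by auto
  then show ?thesis using emeasure_mono order_trans by blast
 qed
 have inc: "incseq E" proof (rule incseq_SucI)
  fix n
  show "E n \<le> E (Suc n)" proof
   fix x assume "x \<in> E n"
   then obtain y where y: "0 < y" "\<mu> < norm (cauchy_int (\<lambda>t. of_real (g t)) (Complex x (y + 1 / real (Suc n))))" by (auto simp: E_def)
   have "1 / real (Suc (Suc n)) \<le> 1 / real (Suc n)" by (simp add: field_simps)
   then show "x \<in> E (Suc n)" unfolding E_def using y by (intro CollectI exI[of _ "y + 1 / real (Suc n) - 1 / real (Suc (Suc n))"]) simp
  qed
 qed
 have "superlevel (\<lambda>t. of_real (g t)) \<mu> = (\<Union>n. E n)" proof (intro equalityI subsetI)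
  fix x assume "x \<in> superlevel (\<lambda>t. of_real (g t)) \<mu>"
  then obtain y where y: "0 < y" "\<mu> < norm (cauchy_int (\<lambda>t. of_real (g t)) (Complex x y))" by (auto simp: superlevel_def)
  obtain n where "1 / real (Suc n) < y" using nat_approx_posE[OF y(1)] by auto
  then have "x \<in> E n" unfolding E_def using y by (intro CollectI exI[of _ "y - 1 / real (Suc n)"]) simp
  then show "x \<in> (\<Union>n. E n)" by blast
 next
  fix x assume "x \<in> (\<Union>n. E n)"
  then obtain n y where "0 < y" "\<mu> < norm (cauchy_int (\<lambda>t. of_real (g t)) (Complex x (y + 1 / real (Suc n))))" by (auto simp: E_def)
  then show "x \<in> superlevel (\<lambda>t. of_real (g t)) \<mu>" unfolding superlevel_def
   by (intro CollectI exI[of _ "y + 1 / real (Suc n)"]) (auto intro: add_pos_nonneg)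
 qed
 then have "emeasure lebesgue (superlevel (\<lambda>t. of_real (g t)) \<mu>) = (SUP n. emeasure lebesgue (E n))" proof -
  have "range E \<subseteq> sets lebesgue" using Es by blast
  from SUP_emeasure_incseq[OF this inc] show ?thesis using \<open>superlevel _ \<mu> = _\<close> by (simp only:)
 qed
 also have "... \<le> ennreal (60 * pi * (LI t. g t) / \<mu>)" by (intro SUP_least Ele)
 finally show ?thesis .
qed

lemma cauchy_int_add:
 "Lintegrable f ==> Lintegrable g ==> Im z \<noteq> 0 ==> cauchy_int (\<lambda>t. f t + g t) z = cauchy_int f z + cauchy_int g z" unfolding cauchy_int_def
 by (subst bochner_add[symmetric]) (auto intro: cauchy_integrable simp: add_divide_distrib)

lemma cauchy_int_cmult: "cauchy_int (\<lambda>t. c * g t) z = c * cauchy_int g z" unfolding cauchy_int_def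
 by (subst integral_mult_right_zero[symmetric]) (simp add: mult.assoc)

text \<open>One of the four nonnegative parts (positive and negative, real and imaginary) must
  exceed \<mu> / 4, whence 960 = 4 * 4 * 60.\<close>

theorem weak_type:
 assumes g: "Lintegrable g" and l: "0 < \<mu>"
 shows "emeasure lebesgue (superlevel g \<mu>) \<le> ennreal (960 * pi * (LI t. norm (g t)) / \<mu>)"
proof -
 define r where "r k t = max 0 (if k = 0 then Re (g t) else if k = 1 then - Re (g t) else if k = 2 then Im (g t) else - Im (g t))" for k :: nat and t
 define c :: "nat => complex" where "c k = (if k = 0 then 1 else if k = 1 then - 1 else if k = 2 then \<i> else - \<i>)" for k
 have ri: "Lintegrable (r k)" for k
  unfolding r_def using g by (cases "k = 0"; cases "k = 1"; cases "k = 2") (auto intro!: Bochner_Integration.integrable_max)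
 have r0: "0 \<le> r k t" for k t by (simp add: r_def)
 have rle: "r k t \<le> norm (g t)" for k t using abs_Re_le_cmod[of "g t"] abs_Im_le_cmod[of "g t"] by (auto simp: r_def)
 define R where "R k t = complex_of_real (r k t)" for k t
 have Ri: "Lintegrable (R k)" for k unfolding R_def using ri by simp
 have g_eq: "g = (\<lambda>t. c 0 * R 0 t + (c 1 * R 1 t + (c 2 * R 2 t + c 3 * R 3 t)))" by (rule ext) (auto simp: complex_eq_iff c_def R_def r_def max_def)
 have split: "cauchy_int g z = c 0 * cauchy_int (R 0) z + (c 1 * cauchy_int (R 1) z + (c 2 * cauchy_int (R 2) z + c 3 * cauchy_int (R 3) z))"
  if "Im z \<noteq> 0" for z
 proof -
  have ci: "Lintegrable (\<lambda>t. c k * R k t)" for k using Ri[of k] by simp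
  show ?thesis by (subst g_eq) (use that ci in \<open>simp add: cauchy_int_add cauchy_int_cmult\<close>)
 qed
 have nc: "norm (c k * z) = norm z" for k z by (simp add: c_def norm_mult)
 have sub: "superlevel g \<mu> \<subseteq> (\<Union>k\<in>{0,1,2,3}. superlevel (R k) (\<mu> / 4))" proof
  fix x assume "x \<in> superlevel g \<mu>"
  then obtain y where y: "0 < y" "\<mu> < norm (cauchy_int g (Complex x y))" by (auto simp: superlevel_def)
  let ?n = "\<lambda>k. norm (cauchy_int (R k) (Complex x y))"
  have "norm (cauchy_int g (Complex x y)) \<le> ?n 0 + (?n 1 + (?n 2 + ?n 3))"
   using y(1) by (subst split) (auto intro!: norm_triangle_le add_mono order_trans[OF norm_triangle_ineq] simp: nc)
  with y(2) have "\<mu> / 4 < ?n 0 \<or> \<mu> / 4 < ?n 1 \<or> \<mu> / 4 < ?n 2 \<or> \<mu> / 4 < ?n 3" by linarith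
  then show "x \<in> (\<Union>k\<in>{0,1,2,3}. superlevel (R k) (\<mu> / 4))" using y(1) unfolding superlevel_def by blast
 qed
 have le: "emeasure lebesgue (superlevel (R k) (\<mu> / 4)) \<le> ennreal (240 * pi * (LI t. norm (g t)) / \<mu>)" for k proof -
  have "emeasure lebesgue (superlevel (R k) (\<mu> / 4)) \<le> ennreal (60 * pi * (LI t. r k t) / (\<mu> / 4))"
   unfolding R_def using l by (intro weak_type_nonneg ri r0) simp
  also have "... \<le> ennreal (60 * pi * (LI t. norm (g t)) / (\<mu> / 4))"
   using l by (intro ennreal_leI divide_right_mono mult_left_mono integral_mono ri integrable_norm g rle) auto
  finally show ?thesis by (simp add: mult_ac)
 qed
 have "emeasure lebesgue (superlevel g \<mu>) \<le> emeasure lebesgue (\<Union>k\<in>{0,1,2,3}. superlevel (R k) (\<mu> / 4))"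
  by (rule emeasure_mono[OF sub]) (intro sets.finite_UN superlevel_sets Ri, simp)
 also have "... \<le> (\<Sum>k\<in>{0,1,2,3}. emeasure lebesgue (superlevel (R k) (\<mu> / 4)))" by (rule emeasure_subadditive_finite) (auto intro: superlevel_sets Ri)
 also have "... \<le> (\<Sum>k\<in>{0,1,2,3::nat}. ennreal (240 * pi * (LI t. norm (g t)) / \<mu>))" by (intro sum_mono le)
 also have "... = ennreal (\<Sum>k\<in>{0,1,2,3::nat}. 240 * pi * (LI t. norm (g t)) / \<mu>)"
  using l by (intro sum_ennreal) (auto intro!: divide_nonneg_nonneg mult_nonneg_nonneg)
 also have "(\<Sum>k\<in>{0,1,2,3::nat}. 240 * pi * (LI t. norm (g t)) / \<mu>) = 960 * pi * (LI t. norm (g t)) / \<mu>" by simp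
 finally show ?thesis .
qed

section \<open>Iteration of the transfer operator\<close>

text \<open>The formula of the subtransfer operator on L1, taken on extended nonnegative functions
  so that no question of convergence arises.\<close>

definition transfer :: "real => (real => ennreal) => real => ennreal" where
 "transfer \<beta> a x = indicator I1 x * (\<Sum>n. if n = 0 then 0 else ennreal (\<beta> / (x + shift n)^2) * a (- \<beta> / (x + shift n)))"

lemma I1_sets [measurable]: "I1 \<in> sets lebesgue" by (simp add: I1_def)

lemma transfer_measurable:
 assumes "0 < \<beta>" "a \<in> Lmeasurable"
 shows "transfer \<beta> a \<in> Lmeasurable"
proof -
 have [measurable]: "(\<lambda>x. if n = 0 then 0 else ennreal (\<beta> / (x + shift n)^2) * a (- \<beta> / (x + shift n))) \<in> Lmeasurable" for n
  using lebesgue_measurable_shift[OF inversion_nn_integral(1)[OF assms], of "shift n"] by (cases "n = 0") auto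
 show ?thesis unfolding transfer_def[abs_def] by measurable
qed

text \<open>Inversion and periodization preserve the integral of a nonnegative function; leaving out
  n = 0 can only decrease it.\<close>

lemma transfer_nn_integral:
 assumes b: "0 < \<beta>" and a: "a \<in> Lmeasurable"
 shows "(NI x. transfer \<beta> a x) \<le> (NI x. a x)"
proof -
 let ?b = "\<lambda>x. ennreal (\<beta> / x^2) * a (- \<beta> / x)"
 have "(NI x. transfer \<beta> a x) \<le> (\<integral>\<^sup>+x\<in>{-1..<1}. (\<Sum>n. ?b (x + shift n)) \<partial>lebesgue)" proof (rule nn_integral_mono)
  fix x
  have "(\<Sum>n. if n = 0 then 0 else ?b (x + shift n)) \<le> (\<Sum>n. ?b (x + shift n))" by (intro suminf_le) auto
  then show "transfer \<beta> a x \<le> (\<Sum>n. ?b (x + shift n)) * indicator {-1..<1} x" unfolding transfer_def by (cases "x \<in> I1") (auto simp: I1_def)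
 qed
 also have "... = (NI x. ?b x)" by (rule nn_integral_periodize[OF inversion_nn_integral(1)[OF b a]])
 also have "... = (NI x. a x)" by (rule inversion_nn_integral(2)[OF b a])
 finally show ?thesis .
qed

lemma transfer_mono: "(\<And>x. a x \<le> b x) ==> transfer \<beta> a x \<le> transfer \<beta> b x"
 unfolding transfer_def by (intro mult_left_mono suminf_le) (auto intro: mult_left_mono)

lemma transfer_add: "transfer \<beta> (\<lambda>x. a x + b x) x = transfer \<beta> a x + transfer \<beta> b x"
proof -
 have "(\<Sum>n. if n = 0 then 0 else ennreal (\<beta> / (x + shift n)^2) * (a (- \<beta> / (x + shift n)) + b (- \<beta> / (x + shift n)))) =
  (\<Sum>n. (if n = 0 then 0 else ennreal (\<beta> / (x + shift n)^2) * a (- \<beta> / (x + shift n))) +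
    (if n = 0 then 0 else ennreal (\<beta> / (x + shift n)^2) * b (- \<beta> / (x + shift n))))" by (intro suminf_cong) (auto simp: distrib_left)
 then show ?thesis unfolding transfer_def by (simp add: suminf_add[symmetric] distrib_left)
qed

lemma transfer_cmult: "transfer \<beta> (\<lambda>x. c * a x) x = c * transfer \<beta> a x"
proof -
 have "(\<Sum>n. if n = 0 then 0 else ennreal (\<beta> / (x + shift n)^2) * (c * a (- \<beta> / (x + shift n)))) =
  (\<Sum>n. c * (if n = 0 then 0 else ennreal (\<beta> / (x + shift n)^2) * a (- \<beta> / (x + shift n))))" by (intro suminf_cong) (auto simp: mult_ac)
 then show ?thesis unfolding transfer_def by (simp add: mult_ac)
qed

text \<open>Estimates are made for symmetric sums, but \<open>transfer\<close> sums along
  \<open>int_decode\<close>. With nonnegative terms, every finite section of the enumeration is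
  contained in some {-K..K} without 0.\<close>

lemma suminf_int_decode_le:
 assumes f: "\<And>j. 0 \<le> f j" and B: "\<And>K::nat. (\<Sum>j\<in>{1..int K}. f j + f (- j)) \<le> B"
 shows "(\<Sum>n. if n = 0 then 0 else ennreal (f (int_decode n))) \<le> ennreal B"
proof -
 have "(\<Sum>n<N. if n = 0 then 0 else ennreal (f (int_decode n))) \<le> ennreal B" for N proof -
  define A where "A = int_decode ` ({..<N} - {0})"
  have fA: "finite A" by (simp add: A_def)
  define K where "K = nat (Max (insert 0 ((\<lambda>j. abs j) ` A)))"
  have K: "abs j \<le> int K" if "j \<in> A" for j proof -
   have "abs j \<le> Max (insert 0 ((\<lambda>j. abs j) ` A))" using that fA by (intro Max_ge) auto
   then show ?thesis unfolding K_def by linarith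
  qed
  have A0: "0 \<notin> A" proof
   assume "0 \<in> A"
   then obtain n where "n \<noteq> 0" "int_decode n = 0" by (force simp: A_def)
   then show False using int_decode_eq[of n 0] by (simp add: shift_0)
  qed
  have sub: "A \<subseteq> {1..int K} \<union> uminus ` {1..int K}" proof
   fix j assume "j \<in> A"
   then have "abs j \<le> int K" "j \<noteq> 0" using K A0 by auto
   then show "j \<in> {1..int K} \<union> uminus ` {1..int K}" by (cases "j > 0") (auto simp: image_iff intro: bexI[of _ "- j"])
  qed
  have "(\<Sum>n<N. if n = 0 then 0 else ennreal (f (int_decode n))) = (\<Sum>n\<in>{..<N} - {0}. ennreal (f (int_decode n)))"
   by (rule sum.mono_neutral_cong_right) auto
  also have "... = (\<Sum>j\<in>A. ennreal (f j))" unfolding A_def by (subst sum.reindex) (auto simp: inj_int_decode)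
  also have "... = ennreal (\<Sum>j\<in>A. f j)" using f by (intro sum_ennreal) auto
  also have "(\<Sum>j\<in>A. f j) \<le> (\<Sum>j\<in>{1..int K} \<union> uminus ` {1..int K}. f j)" by (rule sum_mono2) (use sub f in auto)
  also have "... = (\<Sum>j\<in>{1..int K}. f j) + (\<Sum>j\<in>uminus ` {1..int K}. f j)" by (rule sum.union_disjoint) auto
  also have "(\<Sum>j\<in>uminus ` {1..int K}. f j) = (\<Sum>j\<in>{1..int K}. f (- j))" by (subst sum.reindex) auto
  also have "(\<Sum>j\<in>{1..int K}. f j) + ... = (\<Sum>j\<in>{1..int K}. f j + f (- j))" by (simp add: sum.distrib)
  also have "... \<le> B" by (rule B)
  finally show ?thesis by (simp add: ennreal_leI)
 qed
 then show ?thesis unfolding suminf_eq_SUP by (intro SUP_least)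
qed

text \<open>Up to the factor \<open>\<beta>\<close> this weight is a supersolution for the transfer operator: the partial fractions of
 \<open>1 / (y^2 - \<beta>^2)\<close> are dominated by a telescoping series.\<close>

definition gauss_weight :: "real => real" where
 "gauss_weight x = (if \<bar>x\<bar> < 1 then 1 / (1 - x^2) else 0)"

lemma shift_nonzero: "n \<noteq> 0 ==> int_decode n \<noteq> 0" by (metis int_decode_eq shift_0)

lemma shifted_ge_1:
 fixes x :: real
 assumes "abs x < 1" "j \<noteq> (0::int)" shows "2 * \<bar>of_int j\<bar> - 1 < \<bar>x + 2 * of_int j\<bar>" "1 \<le> \<bar>real_of_int j\<bar>"
proof -
 show "1 \<le> \<bar>real_of_int j\<bar>" using assms(2) by linarith
 show "2 * \<bar>of_int j\<bar> - 1 < \<bar>x + 2 * of_int j\<bar>" using assms(1) by linarith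
qed

lemma gauss_weight_term:
 assumes b: "0 < \<beta>" "\<beta> < 1" and y: "1 < abs y"
 shows "ennreal (\<beta> / y^2) * ennreal (gauss_weight (- \<beta> / y)) = ennreal (\<beta> / (y^2 - \<beta>^2))" "\<beta>^2 < y^2" "1 < y^2"
proof -
 have y2: "1 < y^2" using y by (simp add: abs_square_less_1 one_less_power[of "abs y" 2, simplified])
 have b2: "\<beta>^2 < 1" using b by (simp add: power_less_one_iff abs_square_less_1)
 show by2: "\<beta>^2 < y^2" and "1 < y^2" using y2 b2 by linarith+
 have y0: "y \<noteq> 0" using y by auto
 have "\<bar>- \<beta> / y\<bar> < 1" using b y by (simp add: divide_less_eq)
 then have "gauss_weight (- \<beta> / y) = 1 / (1 - \<beta>^2 / y^2)" by (simp add: gauss_weight_def power_divide)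
 moreover have "\<beta> / y^2 * (1 / (1 - \<beta>^2 / y^2)) = \<beta> / (y^2 - \<beta>^2)" using y0 by2 by (simp add: field_simps)
 moreover have "0 \<le> 1 / (1 - \<beta>^2 / y^2)" using by2 y0 by (simp add: divide_le_eq_1)
 ultimately show "ennreal (\<beta> / y^2) * ennreal (gauss_weight (- \<beta> / y)) = ennreal (\<beta> / (y^2 - \<beta>^2))" using b by (simp add: ennreal_mult[symmetric])
qed

text \<open>The first bound drives the iteration. As the weight is not integrable on
  \<open>I1\<close>, the second is needed as well: one image of the weight is bounded, hence
  integrable. Its 4 comes from the two signs of j and from partial sums of 1 / j^2 being at most
  2.\<close>

lemma transfer_gauss_weight:
 assumes b: "0 < \<beta>" "\<beta> < 1"
 shows "transfer \<beta> (\<lambda>x. ennreal (gauss_weight x)) x \<le> ennreal (\<beta> * gauss_weight x)"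
  and "transfer \<beta> (\<lambda>x. ennreal (gauss_weight x)) x \<le> ennreal (4 * \<beta> / (1 - \<beta>^2)) * indicator I1 x"
proof -
 have b2: "\<beta>^2 < 1" using b by (simp add: power_less_one_iff abs_square_less_1)
 have eq: "transfer \<beta> (\<lambda>x. ennreal (gauss_weight x)) x = (\<Sum>n. if n = 0 then 0 else ennreal (\<beta> / ((x + shift n)^2 - \<beta>^2)))"
  if x: "abs x < 1"
 proof -
  have "(if n = 0 then 0 else ennreal (\<beta> / (x + shift n)^2) * ennreal (gauss_weight (- \<beta> / (x + shift n)))) =
   (if n = 0 then 0 else ennreal (\<beta> / ((x + shift n)^2 - \<beta>^2)))" for n
  proof (cases "n = 0")
   case False
   have "1 < \<bar>x + shift n\<bar>" using shifted_ge_1[OF x shift_nonzero[OF False]] by linarith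
   then show ?thesis using gauss_weight_term(1)[OF b] False by simp
  qed simp
  then show ?thesis unfolding transfer_def using x by (simp add: I1_def abs_less_iff indicator_def)
 qed
 define f where "f j = (if j = 0 then 0 else \<beta> / ((x + 2 * of_int j)^2 - \<beta>^2))" for j :: int
 have eqf: "(\<Sum>n. if n = 0 then 0 else ennreal (\<beta> / ((x + shift n)^2 - \<beta>^2))) = (\<Sum>n. if n = 0 then 0 else ennreal (f (int_decode n)))"
  using shift_nonzero by (intro suminf_cong) (auto simp: f_def)
 have f0: "0 \<le> f j" if "abs x < 1" for j proof (cases "j = 0")
  case False
  have "1 < \<bar>x + 2 * of_int j\<bar>" using shifted_ge_1[OF that False] by linarith
  then show ?thesis using gauss_weight_term(2)[OF b] b by (simp add: f_def less_imp_le)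
 qed (simp add: f_def)
 show "transfer \<beta> (\<lambda>x. ennreal (gauss_weight x)) x \<le> ennreal (\<beta> * gauss_weight x)" proof (cases "abs x < 1")
  case x: True
  \<comment> \<open>The subtracted term is the remainder of the telescoping series; for K = 0 it
    cancels the first term exactly.\<close>
  have "(\<Sum>j\<in>{1..int K}. f j + f (- j)) \<le> \<beta> * (1 / (1 - x^2)) - \<beta> / 2 * (1 / (2 * real K + 1 + x) + 1 / (2 * real K + 1 - x))" for K
  proof (induction K)
   case 0
   have "1 - x^2 = (1 + x) * (1 - x)" by (simp add: algebra_simps power2_eq_square)
   moreover have "1 + x \<noteq> 0" "1 - x \<noteq> 0" using x by auto
   ultimately have "1 / (1 - x^2) = 1 / 2 * (1 / (1 + x) + 1 / (1 - x))" by (simp add: field_simps)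
   then have "\<beta> * (1 / (1 - x^2)) = \<beta> / 2 * (1 / (1 + x) + 1 / (1 - x))" by (simp only:)
   then have "\<beta> * (1 / (1 - x^2)) = \<beta> / 2 * (1 / (2 * real 0 + 1 + x) + 1 / (2 * real 0 + 1 - x))" by simp
   moreover have "(\<Sum>j\<in>{1..int 0}. f j + f (- j)) = 0" by simp
   ultimately show ?case by linarith
  next
   case (Suc K)
   define k where "k = 2 * real (Suc K)"
   have k: "k \<ge> 2" by (simp add: k_def)
   \<comment> \<open>Replacing \<beta>^2 by 1 in the denominator only increases the term and makes
     it telescope along steps of 2.\<close>
   have le: "\<beta> / (y^2 - \<beta>^2) \<le> \<beta> / 2 * (1 / (abs y - 1) - 1 / (abs y + 1))" if "1 < abs y" for y proof -
    have "\<beta> / (y^2 - \<beta>^2) \<le> \<beta> / (y^2 - 1)" using gauss_weight_term(2,3)[OF b that] b b2 by (intro divide_left_mono mult_pos_pos) auto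
    also have "y^2 - 1 = (abs y - 1) * (abs y + 1)" by (simp add: algebra_simps power2_eq_square)
    also have "\<beta> / ... = \<beta> / 2 * (1 / (abs y - 1) - 1 / (abs y + 1))" using that by (simp add: field_simps)
    finally show ?thesis .
   qed
   have y1: "\<bar>x + k\<bar> = k + x" "\<bar>x - k\<bar> = k - x" using x k by linarith+
   have "f (int (Suc K)) + f (- int (Suc K)) = \<beta> / ((x + k)^2 - \<beta>^2) + \<beta> / ((x - k)^2 - \<beta>^2)" by (simp add: f_def k_def algebra_simps)
   also have "... \<le> \<beta> / 2 * (1 / (k + x - 1) - 1 / (k + x + 1)) + \<beta> / 2 * (1 / (k - x - 1) - 1 / (k - x + 1))"
    using le[of "x + k"] le[of "x - k"] unfolding y1 using x k by (intro add_mono) auto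
   finally have st: "f (int (Suc K)) + f (- int (Suc K)) \<le> \<beta> / 2 * (1 / (k + x - 1) - 1 / (k + x + 1)) + \<beta> / 2 * (1 / (k - x - 1) - 1 / (k - x + 1))" .
   have e: "2 * real K + 1 + x = k + x - 1" "2 * real K + 1 - x = k - x - 1"
    "2 * real (Suc K) + 1 + x = k + x + 1" "2 * real (Suc K) + 1 - x = k - x + 1" by (simp_all add: k_def)
   have "{1..int (Suc K)} = insert (int (Suc K)) {1..int K}" by auto
   then have "(\<Sum>j\<in>{1..int (Suc K)}. f j + f (- j)) = (f (int (Suc K)) + f (- int (Suc K))) + (\<Sum>j\<in>{1..int K}. f j + f (- j))"
    by (simp only:) (subst sum.insert, auto)
   with st Suc show ?case unfolding e by (simp add: algebra_simps)
  qed
  moreover have "0 \<le> \<beta> / 2 * (1 / (2 * real K + 1 + x) + 1 / (2 * real K + 1 - x))" for K proof -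
   have "0 \<le> 2 * real K + 1 + x" "0 \<le> 2 * real K + 1 - x" using x by linarith+
   then have "0 \<le> 1 / (2 * real K + 1 + x) + 1 / (2 * real K + 1 - x)" by (metis add_nonneg_nonneg divide_nonneg_nonneg zero_le_one)
   then show ?thesis using b by (metis divide_nonneg_pos less_imp_le mult_nonneg_nonneg zero_less_numeral)
  qed
  ultimately have "(\<Sum>j\<in>{1..int K}. f j + f (- j)) \<le> \<beta> * (1 / (1 - x^2))" for K by (smt (verit))
  from suminf_int_decode_le[OF f0[OF x] this] show ?thesis unfolding eq[OF x] eqf using x by (simp add: gauss_weight_def)
 next
  case False
  then show ?thesis by (simp add: transfer_def I1_def indicator_def) (auto simp: abs_less_iff)
 qed
 show "transfer \<beta> (\<lambda>x. ennreal (gauss_weight x)) x \<le> ennreal (4 * \<beta> / (1 - \<beta>^2)) * indicator I1 x" proof (cases "abs x < 1")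
  case x: True
  \<comment> \<open>Put y = x + 2j. Then |y| \<ge> |j| \<ge> 1, so y^2 - \<beta>^2 is at least (1 -
    \<beta>^2) y^2 and hence at least (1 - \<beta>^2) j^2.\<close>
  have fle: "f j \<le> \<beta> / (1 - \<beta>^2) * (1 / (real_of_int j)^2)" if "j \<noteq> 0" for j proof -
   have "\<bar>real_of_int j\<bar> \<le> \<bar>x + 2 * of_int j\<bar>" using shifted_ge_1[OF x that] by linarith
   then have j: "(real_of_int j)^2 \<le> (x + 2 * of_int j)^2" by (simp add: abs_le_square_iff)
   have "1 \<le> (real_of_int j)^2" using shifted_ge_1(2)[OF x that] by (simp add: abs_le_square_iff[of 1, simplified])
   then have "\<beta>^2 * 1 \<le> \<beta>^2 * (x + 2 * of_int j)^2" using j by (intro mult_left_mono) auto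
   moreover have "(1 - \<beta>^2) * (real_of_int j)^2 \<le> (1 - \<beta>^2) * (x + 2 * of_int j)^2" using j b2 by (intro mult_left_mono) auto
   ultimately have le: "(1 - \<beta>^2) * (real_of_int j)^2 \<le> (x + 2 * of_int j)^2 - \<beta>^2" by (simp add: algebra_simps)
   have pos: "0 < (1 - \<beta>^2) * (real_of_int j)^2" using b2 that by simp
   have "f j \<le> \<beta> / ((1 - \<beta>^2) * (real_of_int j)^2)" using le pos b that unfolding f_def by (auto intro!: divide_left_mono mult_pos_pos)
   then show ?thesis by simp
  qed
  have sq: "(\<Sum>j\<in>{1..int K}. 1 / (real_of_int j)^2) \<le> 2" for K proof -
   have "(\<Sum>j\<in>{1..int K}. 1 / (real_of_int j)^2) \<le> 2 - 1 / real K" proof (induction K)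
    case (Suc K)
    have "{1..int (Suc K)} = insert (int (Suc K)) {1..int K}" by auto
    then have "(\<Sum>j\<in>{1..int (Suc K)}. 1 / (real_of_int j)^2) = 1 / (real K + 1)^2 + (\<Sum>j\<in>{1..int K}. 1 / (real_of_int j)^2)"
     by (simp only:) (subst sum.insert, auto simp: add.commute)
    moreover have "1 / (real K + 1)^2 \<le> 1 / real K - 1 / (real K + 1)" if "K \<noteq> 0" proof -
     have "1 / real K - 1 / (real K + 1) = 1 / (real K * (real K + 1))" using that by (simp add: field_simps)
     moreover have "1 / (real K + 1)^2 \<le> 1 / (real K * (real K + 1))"
      using that by (intro frac_le) (auto simp: power2_eq_square intro: mult_right_mono)
     ultimately show ?thesis by simp
    qed
    ultimately show ?case using Suc by (cases "K = 0") (auto simp: add.commute)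
   qed simp
   moreover have "0 \<le> 1 / real K" by simp
   ultimately show ?thesis by linarith
  qed
  have "(\<Sum>j\<in>{1..int K}. f j + f (- j)) \<le> 4 * \<beta> / (1 - \<beta>^2)" for K proof -
   have "(\<Sum>j\<in>{1..int K}. f j + f (- j)) \<le> (\<Sum>j\<in>{1..int K}. 2 * \<beta> / (1 - \<beta>^2) * (1 / (real_of_int j)^2))" proof (rule sum_mono)
    fix j assume "j \<in> {1..int K}"
    then show "f j + f (- j) \<le> 2 * \<beta> / (1 - \<beta>^2) * (1 / (real_of_int j)^2)" using fle[of j] fle[of "- j"] by simp
   qed
   also have "... = 2 * \<beta> / (1 - \<beta>^2) * (\<Sum>j\<in>{1..int K}. 1 / (real_of_int j)^2)" by (simp add: sum_distrib_left)
   also have "... \<le> 2 * \<beta> / (1 - \<beta>^2) * 2" using sq b b2 by (intro mult_left_mono) auto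
   finally show ?thesis by simp
  qed
  from suminf_int_decode_le[OF f0[OF x] this] show ?thesis unfolding eq[OF x] eqf using x by (simp add: I1_def abs_less_iff indicator_def)
 next
  case False
  then show ?thesis by (simp add: transfer_def I1_def indicator_def) (auto simp: abs_less_iff)
 qed
qed

lemma perturbed_contraction_tendsto_0:
 fixes r c :: "nat => real"
 assumes b: "0 < \<beta>" "\<beta> < 1" and r: "\<And>n. r (Suc n) = \<beta> * r n + c n" "\<And>n. 0 \<le> r n" and c: "c \<longlonglongrightarrow> 0"
 shows "r \<longlonglongrightarrow> 0"
proof (rule LIMSEQ_I)
 fix e :: real assume e: "0 < e"
 define d where "d = e / 2 * (1 - \<beta>)"
 have d: "0 < d" using e b by (simp add: d_def)
 obtain N where N: "\<And>n. n \<ge> N ==> \<bar>c n\<bar> < d" using LIMSEQ_D[OF c d] by auto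
 have 1: "r (N + k) \<le> \<beta> ^ k * r N + e / 2" for k proof (induction k)
  case (Suc k)
  have "r (N + Suc k) = \<beta> * r (N + k) + c (N + k)" using r(1)[of "N + k"] by simp
  also have "... \<le> \<beta> * (\<beta> ^ k * r N + e / 2) + d" using Suc b N[of "N + k"] by (intro add_mono mult_left_mono) auto
  also have "... = \<beta> ^ Suc k * r N + e / 2" by (simp add: d_def field_simps)
  finally show ?case .
 qed (use e in simp)
 have "(\<lambda>k. \<beta> ^ k * r N) \<longlonglongrightarrow> 0 * r N" using b by (intro tendsto_intros LIMSEQ_power_zero) auto
 then obtain K where K: "\<And>k. k \<ge> K ==> \<bar>\<beta> ^ k * r N\<bar> < e / 2" using LIMSEQ_D[of "\<lambda>k. \<beta> ^ k * r N" 0 "e / 2"] e by auto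
 show "\<exists>no. \<forall>n\<ge>no. norm (r n - 0) < e" proof (intro exI allI impI)
  fix n assume n: "n \<ge> N + K"
  have "r n \<le> \<beta> ^ (n - N) * r N + e / 2" using 1[of "n - N"] n by simp
  moreover have "\<beta> ^ (n - N) * r N < e / 2" proof -
   have "n - N \<ge> K" using n by linarith
   from K[OF this] show ?thesis using abs_ge_self[of "\<beta> ^ (n - N) * r N"] by linarith
  qed
  ultimately show "norm (r n - 0) < e" using r(2)[of n] by simp
 qed
qed

lemma gauss_weight_ge_1: "x \<in> I1 ==> 1 \<le> gauss_weight x"
proof -
 assume "x \<in> I1"
 then have "abs x < 1" by (auto simp: I1_def)
 then have "x^2 < 1" by (simp add: abs_square_less_1)
 then show ?thesis using \<open>abs x < 1\<close> by (simp add: gauss_weight_def)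
qed

text \<open>The part of \<open>a 0\<close> above a large level has small integral, which the operator does not increase; the rest is
 dominated by a multiple of the weight, which is contracted.\<close>

theorem transfer_iteration_tendsto_0:
 fixes a :: "nat => real => ennreal" and c :: "nat => real"
 assumes b: "0 < \<beta>" "\<beta> < 1"
  and a: "\<And>n. a n \<in> Lmeasurable" "(NI x. a 0 x) < \<infinity>" "\<And>x. x \<notin> I1 ==> a 0 x = 0"
  and step: "\<And>n x. a (Suc n) x \<le> transfer \<beta> (a n) x + ennreal (c n) * indicator I1 x"
  and c: "\<And>n. 0 \<le> c n" "c \<longlonglongrightarrow> 0"
 shows "(\<lambda>n. \<integral>\<^sup>+x. a n x \<partial>lebesgue) \<longlonglongrightarrow> 0"
proof (rule order_tendstoI)
 fix e :: ennreal assume "0 < e"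
 then obtain e' where e': "0 < e'" "e' < e" using dense by blast
 then have "e' \<noteq> \<infinity>" by auto
 have "(\<lambda>L. \<integral>\<^sup>+x. (a 0 x - of_nat L) \<partial>lebesgue) \<longlonglongrightarrow> (NI (x::real). 0)" proof (rule nn_integral_dominated_convergence[where w = "a 0"])
  have "AE x in lebesgue. a 0 x \<noteq> \<infinity>" using a(1,2) by (intro nn_integral_noteq_infinite) auto
  then show "AE x in lebesgue. (\<lambda>L. a 0 x - of_nat L) \<longlonglongrightarrow> 0" proof eventually_elim
   case (elim x)
   then obtain m where m: "a 0 x \<le> of_nat m" by (metis ennreal_Ex_less_of_nat infinity_ennreal_def less_imp_le less_top)
   have "\<forall>\<^sub>F L in sequentially. a 0 x - of_nat L = 0" using eventually_ge_at_top[of m] proof eventually_elim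
    case (elim L)
    then have "(of_nat m :: ennreal) \<le> of_nat L" by simp
    with m have "a 0 x \<le> of_nat L" by (rule order_trans)
    then show ?case using \<open>a 0 x \<noteq> \<infinity>\<close> by (intro diff_eq_0_ennreal) (auto simp: less_top)
   qed
   then show ?case by (rule tendsto_eventually)
  qed
 qed (use a in \<open>auto simp: diff_le_self_ennreal\<close>)
 then have "\<forall>\<^sub>F L in sequentially. (NI x. (a 0 x - of_nat L)) < e'" using e'(1) by (intro order_tendstoD) auto
 then obtain L where L: "(NI x. (a 0 x - of_nat L)) < e'" using eventually_happens' sequentially_bot by blast
 \<comment> \<open>\<open>p n\<close> carries the excess of \<open>a 0\<close> over the level L,
   whose integral never grows; \<open>r n\<close> will be the coefficient of the weight that
   dominates everything else.\<close>
 define p where "p = rec_nat (\<lambda>x. a 0 x - of_nat L) (\<lambda>_. transfer \<beta>)"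
 have p0: "p 0 = (\<lambda>x. a 0 x - of_nat L)" and pS: "p (Suc n) = transfer \<beta> (p n)" for n by (simp_all add: p_def)
 have pm: "p n \<in> Lmeasurable" for n by (induction n) (use a(1) transfer_measurable[OF b(1)] in \<open>simp_all add: p0 pS\<close>)
 have pi: "(NI x. p n x) \<le> e'" for n proof (induction n)
  case 0 then show ?case using L by (simp add: p0)
 next
  case (Suc n) then show ?case using transfer_nn_integral[OF b(1) pm[of n]] by (simp add: pS)
 qed
 define r where "r = rec_nat (real L) (\<lambda>n r. \<beta> * r + c n)"
 have r0: "r 0 = real L" and rS: "r (Suc n) = \<beta> * r n + c n" for n by (simp_all add: r_def)
 have rnn: "0 \<le> r n" for n by (induction n) (use b c in \<open>simp_all add: r0 rS\<close>)
 have rlim: "r \<longlonglongrightarrow> 0" by (rule perturbed_contraction_tendsto_0[OF b rS rnn c(2)])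
 let ?m = "\<lambda>x. ennreal (gauss_weight x)"
 have m1: "indicator I1 x \<le> ?m x" for x using gauss_weight_ge_1[of x] by (auto simp: indicator_def)
 have m0: "0 \<le> gauss_weight x" for x by (auto simp: gauss_weight_def abs_square_le_1)
 have trans: "a (Suc n) x \<le> p (Suc n) x + ennreal (r n) * transfer \<beta> ?m x + ennreal (c n) * indicator I1 x"
  if "\<And>x. a n x \<le> p n x + ennreal (r n) * ?m x" for n x
 proof -
  have "a (Suc n) x \<le> transfer \<beta> (\<lambda>x. p n x + ennreal (r n) * ?m x) x + ennreal (c n) * indicator I1 x"
   using step[of n x] transfer_mono[of "a n" "\<lambda>x. p n x + ennreal (r n) * ?m x", OF that] by (meson add_right_mono order_trans)
  then show ?thesis by (simp only: transfer_add transfer_cmult pS)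
 qed
 have main: "a n x \<le> p n x + ennreal (r n) * ?m x" for n x proof (induction n arbitrary: x)
  case 0
  show ?case proof (cases "x \<in> I1")
   case True
   have 1: "a 0 x \<le> (a 0 x - of_nat L) + of_nat L"
    by (cases "of_nat L \<le> a 0 x") (auto simp: diff_add_cancel_ennreal not_le intro: add_increasing less_imp_le)
   have "ennreal (real L) * 1 \<le> ennreal (real L) * ?m x" using gauss_weight_ge_1[OF True] by (intro mult_left_mono) auto
   then have "of_nat L \<le> ennreal (real L) * ?m x" by (simp add: ennreal_of_nat_eq_real_of_nat)
   from order_trans[OF 1 add_left_mono[OF this]] show ?thesis by (simp add: p0 r0)
  qed (simp add: a(3))
 next
  case (Suc n)
  have "a (Suc n) x \<le> p (Suc n) x + ennreal (r n) * transfer \<beta> ?m x + ennreal (c n) * indicator I1 x" by (rule trans[OF Suc])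
  also have "... \<le> p (Suc n) x + ennreal (r n) * ennreal (\<beta> * gauss_weight x) + ennreal (c n) * ?m x"
   by (intro add_mono mult_left_mono transfer_gauss_weight(1)[OF b] m1) auto
  also have "... = p (Suc n) x + ennreal (r (Suc n)) * ?m x" proof -
   have "ennreal (r n) * ennreal (\<beta> * gauss_weight x) + ennreal (c n) * ?m x = ennreal (r (Suc n)) * ?m x" using rnn[of n] b c(1)[of n] m0[of x]
    by (simp add: rS ennreal_mult[symmetric] ennreal_plus[symmetric] del: ennreal_plus) (simp add: algebra_simps)
   then show ?thesis by (simp add: add.assoc)
  qed
  finally show ?case .
 qed
 define C where "C = 4 * \<beta> / (1 - \<beta>^2)"
 have C0: "0 \<le> C" unfolding C_def using b by (simp add: power_le_one_iff abs_square_le_1)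
 have eI: "emeasure lebesgue I1 = 2" by (simp add: I1_def)
 \<comment> \<open>The last application of the operator is not absorbed into the weight: the image
   of the weight is at most C on \<open>I1\<close>, whereas the weight itself has infinite
   integral.\<close>
 have int: "(NI x. a (Suc n) x) \<le> e' + ennreal (2 * (r n * C + c n))" for n proof -
  have "(NI x. a (Suc n) x) \<le> (NI x. p (Suc n) x + ennreal (r n * C + c n) * indicator I1 x)" proof (rule nn_integral_mono)
   fix x
   have "a (Suc n) x \<le> p (Suc n) x + ennreal (r n) * transfer \<beta> ?m x + ennreal (c n) * indicator I1 x" by (rule trans[OF main])
   also have "... \<le> p (Suc n) x + ennreal (r n) * (ennreal C * indicator I1 x) + ennreal (c n) * indicator I1 x"
    unfolding C_def by (intro add_mono mult_left_mono transfer_gauss_weight(2)[OF b]) auto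
   also have "... = p (Suc n) x + ennreal (r n * C + c n) * indicator I1 x"
    using rnn[of n] C0 c(1)[of n] by (simp add: ennreal_mult ennreal_plus distrib_right mult.assoc add.assoc)
   finally show "a (Suc n) x \<le> p (Suc n) x + ennreal (r n * C + c n) * indicator I1 x" .
  qed
  also have "... = (NI x. p (Suc n) x) + (NI x. ennreal (r n * C + c n) * indicator I1 x)" using pm[of "Suc n"] by (intro nn_integral_add) auto
  also have "(NI x. ennreal (r n * C + c n) * indicator I1 x) = ennreal (r n * C + c n) * 2" by (subst nn_integral_cmult_indicator) (auto simp: eI)
  also have "... = ennreal (2 * (r n * C + c n))" proof -
   have "ennreal z * 2 = ennreal (2 * z)" if "0 \<le> z" for z using that ennreal_mult[of z 2] by (simp add: mult.commute)
   then show ?thesis using rnn[of n] C0 c(1)[of n] by simp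
  qed
  finally show ?thesis using add_right_mono[OF pi[of "Suc n"]] by (meson order_trans)
 qed
 have "(\<lambda>n. e' + ennreal (2 * (r n * C + c n))) \<longlonglongrightarrow> e' + ennreal (2 * (0 * C + 0))"
  by (intro tendsto_add tendsto_const tendsto_ennrealI tendsto_mult rlim c(2))
 then have "\<forall>\<^sub>F n in sequentially. e' + ennreal (2 * (r n * C + c n)) < e" using e'(2) by (intro order_tendstoD) auto
 then have "\<forall>\<^sub>F n in sequentially. (NI x. a (Suc n) x) < e" by eventually_elim (use int in \<open>blast intro: le_less_trans\<close>)
 then show "\<forall>\<^sub>F n in sequentially. (NI x. a n x) < e" by (subst (asm) eventually_sequentially_Suc)
qed simp

section \<open>Boundary limits of Cauchy integrals\<close>

definition boundary_limit :: "(real => complex) => real => bool" where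
 "boundary_limit g x \<longleftrightarrow> (\<exists>l. ((\<lambda>\<tau>. cauchy_int g (Complex x \<tau>)) \<longlongrightarrow> l) (at_right 0))"

lemma boundary_limit_add:
 assumes "Lintegrable f" "Lintegrable g" "boundary_limit f x" "boundary_limit g x"
 shows "boundary_limit (\<lambda>t. f t + g t) x"
proof -
 obtain a b where ab: "((\<lambda>\<tau>. cauchy_int f (Complex x \<tau>)) \<longlongrightarrow> a) (at_right 0)" "((\<lambda>\<tau>. cauchy_int g (Complex x \<tau>)) \<longlongrightarrow> b) (at_right 0)"
  using assms(3,4) by (auto simp: boundary_limit_def)
 have "\<forall>\<^sub>F \<tau> in at_right 0. cauchy_int f (Complex x \<tau>) + cauchy_int g (Complex x \<tau>) = cauchy_int (\<lambda>t. f t + g t) (Complex x \<tau>)"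
  using eventually_at_right_less[of 0] by eventually_elim (simp add: cauchy_int_add assms)
 from Lim_transform_eventually[OF tendsto_add[OF ab] this] show ?thesis by (auto simp: boundary_limit_def)
qed

lemma boundary_limit_cmult: "boundary_limit g x ==> boundary_limit (\<lambda>t. c * g t) x"
 unfolding boundary_limit_def cauchy_int_cmult using tendsto_mult_left by blast

lemma boundary_limit_AE_cong:
 assumes "AE t in lebesgue. f t = g t" "f \<in> Lmeasurable" "g \<in> Lmeasurable" "boundary_limit f x"
 shows "boundary_limit g x"
proof -
 have "cauchy_int g (Complex x \<tau>) = cauchy_int f (Complex x \<tau>)" if "0 < \<tau>" for \<tau> unfolding cauchy_int_def proof (rule integral_cong_AE)
  have k: "(\<lambda>t. 1 / (Complex x \<tau> - of_real t)) \<in> Lmeasurable" using that by (intro cauchy_kernel_measurable) simp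
  show "(\<lambda>t. g t / (Complex x \<tau> - of_real t)) \<in> Lmeasurable"
   "(\<lambda>t. f t / (Complex x \<tau> - of_real t)) \<in> Lmeasurable" using borel_measurable_times[OF assms(2) k] borel_measurable_times[OF assms(3) k] by simp_all
  show "AE t in lebesgue. g t / (Complex x \<tau> - of_real t) = f t / (Complex x \<tau> - of_real t)" using assms(1) by eventually_elim simp
 qed
 then have "\<forall>\<^sub>F \<tau> in at_right 0. cauchy_int f (Complex x \<tau>) = cauchy_int g (Complex x \<tau>)"
  using eventually_at_right_less[of 0] by (auto elim: eventually_mono)
 moreover obtain l where "((\<lambda>\<tau>. cauchy_int f (Complex x \<tau>)) \<longlongrightarrow> l) (at_right 0)" using assms(4) by (auto simp: boundary_limit_def)
 ultimately show ?thesis unfolding boundary_limit_def by (intro exI[of _ l]) (rule Lim_transform_eventually)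
qed

text \<open>An antiderivative of the kernel in t is - log |z - t| + i arctan ((x - t) / \<tau>),
  written with real functions to avoid branches. Both parts converge as \<tau> tends to 0 unless x =
  t.\<close>

lemma boundary_limit_interval:
 assumes "x \<noteq> a" "x \<noteq> b"
 shows "boundary_limit (\<lambda>t. of_real (indicator {a..b} t)) x"
proof (cases "a \<le> b")
 case False
 then have "cauchy_int (\<lambda>t. of_real (indicator {a..b} t)) = (\<lambda>_. 0)" by (simp add: cauchy_int_def[abs_def])
 then show ?thesis unfolding boundary_limit_def by (intro exI[of _ 0]) simp
next
 case ab: True
 define \<Phi> where "\<Phi> \<tau> t = - complex_of_real (ln ((x - t)^2 + \<tau>^2) / 2) + \<i> * of_real (arctan ((x - t) / \<tau>))" for \<tau> t
 have eq: "cauchy_int (\<lambda>t. of_real (indicator {a..b} t)) (Complex x \<tau>) = \<Phi> \<tau> b - \<Phi> \<tau> a" if e: "0 < \<tau>" for \<tau> proof -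
  have der: "(\<Phi> \<tau> has_vector_derivative 1 / (Complex x \<tau> - of_real t)) (at t within {a..b})" for t proof -
   have p: "0 < (x - t)^2 + \<tau>^2" using e by (simp add: add_nonneg_pos)
   have d1: "((\<lambda>t. ln ((x - t)^2 + \<tau>^2) / 2) has_real_derivative - (x - t) / ((x - t)^2 + \<tau>^2)) (at t within {a..b})" proof -
    have "((\<lambda>t. (x - t)^2 + \<tau>^2) has_real_derivative - 2 * (x - t)) (at t within {a..b})" by (auto intro!: derivative_eq_intros)
    note d = DERIV_cdivide[OF DERIV_chain2[where f = ln and g = "\<lambda>t. (x - t)^2 + \<tau>^2" and x = t, OF DERIV_ln[OF p] this], of 2]
    have e: "inverse D * (- 2 * u) / 2 = - u / D" for D u :: real by (cases "D = 0") (simp_all add: field_simps)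
    show ?thesis by (rule DERIV_cong[OF d e])
   qed
   have d2: "((\<lambda>t. arctan ((x - t) / \<tau>)) has_real_derivative - \<tau> / ((x - t)^2 + \<tau>^2)) (at t within {a..b})"
    using e p by (auto intro!: derivative_eq_intros simp: field_simps power2_eq_square)
   have "(\<Phi> \<tau> has_vector_derivative - of_real (- (x - t) / ((x - t)^2 + \<tau>^2)) + \<i> * of_real (- \<tau> / ((x - t)^2 + \<tau>^2))) (at t within {a..b})"
    unfolding \<Phi>_def by (intro has_vector_derivative_add has_vector_derivative_minus has_vector_derivative_mult_right
      has_vector_derivative_of_real d1 d2)
   moreover have "- of_real (- (x - t) / ((x - t)^2 + \<tau>^2)) + \<i> * of_real (- \<tau> / ((x - t)^2 + \<tau>^2)) = 1 / (Complex x \<tau> - of_real t)"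
    by (simp add: complex_eq_iff Re_divide Im_divide power2_eq_square) (simp add: minus_divide_left)
   ultimately show ?thesis by simp
  qed
  have hi: "((\<lambda>t. 1 / (Complex x \<tau> - of_real t)) has_integral (\<Phi> \<tau> b - \<Phi> \<tau> a)) {a..b}" by (rule fundamental_theorem_of_calculus[OF ab der])
  have "set_integrable lebesgue {a..b} (\<lambda>t. 1 / (Complex x \<tau> - of_real t))"
   using e by (intro absolutely_integrable_continuous_real continuous_intros) (auto simp: complex_eq_iff)
  from set_lebesgue_integral_eq_integral(2)[OF this]
  have "(LINT t:{a..b}|lebesgue. 1 / (Complex x \<tau> - of_real t)) = \<Phi> \<tau> b - \<Phi> \<tau> a" using integral_unique[OF hi] by simp
  moreover have "(LINT t:{a..b}|lebesgue. 1 / (Complex x \<tau> - of_real t)) = cauchy_int (\<lambda>t. of_real (indicator {a..b} t)) (Complex x \<tau>)"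
   unfolding cauchy_int_def set_lebesgue_integral_def by (intro bochner_cong) (auto simp: indicator_def)
  ultimately show ?thesis by simp
 qed
 have lim: "\<exists>l. ((\<lambda>\<tau>. \<Phi> \<tau> t) \<longlongrightarrow> l) (at_right 0)" if xt: "x \<noteq> t" for t proof -
  have "((\<lambda>\<tau>. ln ((x - t)^2 + \<tau>^2) / 2) \<longlongrightarrow> ln ((x - t)^2 + 0^2) / 2) (at_right 0)" using xt by (intro tendsto_intros) auto
  moreover obtain m where "((\<lambda>\<tau>. arctan ((x - t) / \<tau>)) \<longlongrightarrow> m) (at_right 0)" proof (cases "x > t")
   case True
   then have "filterlim (\<lambda>\<tau>. (x - t) / \<tau>) at_top (at_right 0)"
    using filterlim_tendsto_pos_mult_at_top[OF tendsto_const _ filterlim_inverse_at_top_right, of "x - t"] by (simp add: divide_inverse)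
   then show ?thesis using that filterlim_compose[OF tendsto_arctan_at_top] by blast
  next
   case False
   then have "filterlim (\<lambda>\<tau>. (t - x) / \<tau>) at_top (at_right 0)"
    using False xt filterlim_tendsto_pos_mult_at_top[OF tendsto_const _ filterlim_inverse_at_top_right, of "t - x"] by (simp add: divide_inverse)
   then have "((\<lambda>\<tau>. - arctan ((t - x) / \<tau>)) \<longlongrightarrow> - (pi / 2)) (at_right 0)" by (intro tendsto_minus filterlim_compose[OF tendsto_arctan_at_top])
   moreover have "- arctan ((t - x) / \<tau>) = arctan ((x - t) / \<tau>)" for \<tau> by (simp add: arctan_minus[symmetric] minus_divide_left del: arctan_minus)
   ultimately show ?thesis using that by simp
  qed
  ultimately show ?thesis unfolding \<Phi>_def by (intro exI) (rule tendsto_add tendsto_minus tendsto_mult_left tendsto_of_real | assumption)+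
 qed
 obtain la lb where l: "((\<lambda>\<tau>. \<Phi> \<tau> a) \<longlongrightarrow> la) (at_right 0)" "((\<lambda>\<tau>. \<Phi> \<tau> b) \<longlongrightarrow> lb) (at_right 0)" using lim assms by meson
 have "\<forall>\<^sub>F \<tau> in at_right 0. \<Phi> \<tau> b - \<Phi> \<tau> a = cauchy_int (\<lambda>t. of_real (indicator {a..b} t)) (Complex x \<tau>)"
  using eventually_at_right_less[of 0] by eventually_elim (simp add: eq)
 from Lim_transform_eventually[OF tendsto_diff[OF l(2,1)] this] show ?thesis by (auto simp: boundary_limit_def)
qed

text \<open>The approximation is uniform in the height, so the limits of the approximants form a
  Cauchy sequence and the two limits may be interchanged.\<close>

lemma boundary_limit_from_approximation:
 assumes f: "\<And>k. \<exists>h. boundary_limit h x \<and> (\<forall>y>0. norm (cauchy_int h (Complex x y) - cauchy_int f (Complex x y)) \<le> 1 / real (Suc k))"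
 shows "boundary_limit f x"
proof -
 from f obtain h where h: "\<And>k. boundary_limit (h k) x"
  "\<And>k y. y > 0 ==> norm (cauchy_int (h k) (Complex x y) - cauchy_int f (Complex x y)) \<le> 1 / real (Suc k)" by metis
 from h(1) obtain l where l: "\<And>k. ((\<lambda>\<tau>. cauchy_int (h k) (Complex x \<tau>)) \<longlongrightarrow> l k) (at_right 0)" unfolding boundary_limit_def by metis
 have ll: "norm (l j - l k) \<le> 1 / real (Suc j) + 1 / real (Suc k)" for j k proof (rule tendsto_upperbound)
  show "((\<lambda>\<tau>. norm (cauchy_int (h j) (Complex x \<tau>) - cauchy_int (h k) (Complex x \<tau>))) \<longlongrightarrow> norm (l j - l k)) (at_right 0)"
   by (intro tendsto_norm tendsto_diff l)
  show "\<forall>\<^sub>F \<tau> in at_right 0. norm (cauchy_int (h j) (Complex x \<tau>) - cauchy_int (h k) (Complex x \<tau>)) \<le> 1 / real (Suc j) + 1 / real (Suc k)"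
   using eventually_at_right_less[of 0]
  proof eventually_elim
   case (elim \<tau>)
   show ?case using norm_triangle_le_diff[of "cauchy_int (h j) (Complex x \<tau>) - cauchy_int f (Complex x \<tau>)"
     "cauchy_int (h k) (Complex x \<tau>) - cauchy_int f (Complex x \<tau>)"] h(2)[OF elim, of j] h(2)[OF elim, of k] by simp
  qed
 qed simp
 have small: "\<exists>N. \<forall>k\<ge>N. 1 / real (Suc k) < e" if pos: "0 < e" for e :: real proof -
  obtain N where N: "1 / real (Suc N) < e" using nat_approx_posE[OF pos] by auto
  have "1 / real (Suc k) \<le> 1 / real (Suc N)" if "k \<ge> N" for k using that by (intro frac_le) auto
  with N show ?thesis by (meson le_less_trans)
 qed
 have "Cauchy l" proof (rule CauchyI)
  fix e :: real assume "0 < e"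
  then obtain N where N: "\<And>k. k \<ge> N ==> 1 / real (Suc k) < e / 2" using small[of "e / 2"] by auto
  show "\<exists>M. \<forall>m\<ge>M. \<forall>n\<ge>M. norm (l m - l n) < e" proof (intro exI allI impI)
   fix m n assume "m \<ge> N" "n \<ge> N"
   with ll[of m n] N[of m] N[of n] show "norm (l m - l n) < e" by linarith
  qed
 qed
 then obtain L where L: "l \<longlonglongrightarrow> L" using Cauchy_convergent_iff convergent_def by blast
 have "((\<lambda>\<tau>. cauchy_int f (Complex x \<tau>)) \<longlongrightarrow> L) (at_right 0)" proof (rule tendstoI)
  fix e :: real assume e: "0 < e"
  obtain N where N: "\<And>k. k \<ge> N ==> 1 / real (Suc k) < e / 3" using small[of "e / 3"] e by auto
  obtain N' where N': "\<And>k. k \<ge> N' ==> norm (l k - L) < e / 3" using LIMSEQ_D[OF L, of "e / 3"] e by auto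
  define k where "k = max N N'"
  have "\<forall>\<^sub>F \<tau> in at_right 0. dist (cauchy_int (h k) (Complex x \<tau>)) (l k) < e / 3" using l[of k] e by (intro tendstoD) auto
  then show "\<forall>\<^sub>F \<tau> in at_right 0. dist (cauchy_int f (Complex x \<tau>)) L < e" using eventually_at_right_less[of 0] proof eventually_elim
   case (elim \<tau>)
   have "norm (cauchy_int f (Complex x \<tau>) - L) \<le> norm (cauchy_int f (Complex x \<tau>) - cauchy_int (h k) (Complex x \<tau>))
     + norm (cauchy_int (h k) (Complex x \<tau>) - l k) + norm (l k - L)"
    using norm_triangle_ineq[of "cauchy_int f (Complex x \<tau>) - cauchy_int (h k) (Complex x \<tau>)" "cauchy_int (h k) (Complex x \<tau>) - l k"]
     norm_triangle_ineq[of "cauchy_int f (Complex x \<tau>) - l k" "l k - L"] by simp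
   also have "... < e / 3 + e / 3 + e / 3" using elim(1) h(2)[OF elim(2), of k] N[of k] N'[of k]
    by (intro add_strict_mono) (auto simp: k_def dist_norm norm_minus_commute)
   finally show ?case by (simp add: dist_norm)
  qed
 qed
 then show ?thesis by (auto simp: boundary_limit_def)
qed

text \<open>The maximal principle: by the weak type estimate the superlevel sets of the differences
  at a fixed level have measure tending to 0, so almost every x escapes one of them, for each of
  countably many levels.\<close>

lemma boundary_limit_L1_limit:
 assumes f: "Lintegrable f" and h: "\<And>n::nat. Lintegrable (h n)"
  and bl: "\<And>n. AE x in lebesgue. boundary_limit (h n) x"
  and lim: "(\<lambda>n. LI t. norm (h n t - f t)) \<longlonglongrightarrow> 0"
 shows "AE x in lebesgue. boundary_limit f x"
proof -
 define D where "D n t = h n t + (-1) * f t" for n t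
 have Di: "Lintegrable (D n)" for n unfolding D_def using f h by simp
 have null: "(\<Inter>n. superlevel (D n) (1 / real (Suc k))) \<in> null_sets lebesgue" for k proof -
  have "range (\<lambda>n. superlevel (D n) (1 / real (Suc k))) \<subseteq> sets lebesgue" using superlevel_sets[OF Di] by blast
  then have s: "(\<Inter>n. superlevel (D n) (1 / real (Suc k))) \<in> sets lebesgue" by (rule sets.countable_INT) simp
  have le: "emeasure lebesgue (\<Inter>n. superlevel (D n) (1 / real (Suc k))) \<le> ennreal (960 * pi * (LI t. norm (D n t)) / (1 / real (Suc k)))" for n
   by (rule order_trans[OF emeasure_mono weak_type[OF Di]]) (blast, rule superlevel_sets[OF Di], simp)
  have "(\<lambda>n. ennreal (960 * pi * (LI t. norm (D n t)) / (1 / real (Suc k)))) \<longlonglongrightarrow> ennreal (960 * pi * 0 / (1 / real (Suc k)))"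
   using lim by (intro tendsto_ennrealI tendsto_intros) (auto simp: D_def)
  then have "emeasure lebesgue (\<Inter>n. superlevel (D n) (1 / real (Suc k))) \<le> ennreal (960 * pi * 0 / (1 / real (Suc k)))"
   by (rule tendsto_lowerbound) (use le in auto)
  then show ?thesis using s by (simp add: null_setsI)
 qed
 have "AE x in lebesgue. \<forall>k. x \<notin> (\<Inter>n. superlevel (D n) (1 / real (Suc k)))" unfolding AE_all_countable using AE_not_in[OF null] by blast
 moreover have "AE x in lebesgue. \<forall>n. boundary_limit (h n) x" unfolding AE_all_countable using bl by blast
 ultimately show ?thesis proof eventually_elim
  case (elim x)
  show ?case proof (rule boundary_limit_from_approximation)
   fix k
   obtain n where n: "x \<notin> superlevel (D n) (1 / real (Suc k))" using elim(1) by blast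
   show "\<exists>h. boundary_limit h x \<and> (\<forall>y>0. norm (cauchy_int h (Complex x y) - cauchy_int f (Complex x y)) \<le> 1 / real (Suc k))"
   proof (intro exI[of _ "h n"] conjI allI impI)
    fix y :: real assume y: "0 < y"
    have "cauchy_int (D n) (Complex x y) = cauchy_int (h n) (Complex x y) - cauchy_int f (Complex x y)"
     unfolding D_def using y f h by (subst cauchy_int_add) (auto simp: cauchy_int_cmult[of "-1" f, simplified])
    moreover have "\<not> 1 / real (Suc k) < norm (cauchy_int (D n) (Complex x y))" using n y unfolding superlevel_def by blast
    ultimately show "norm (cauchy_int (h n) (Complex x y) - cauchy_int f (Complex x y)) \<le> 1 / real (Suc k)" by simp
   qed (use elim(2) in blast)
  qed
 qed
qed

lemma indicator_measurable_complex:
 "B \<in> sets lebesgue ==> (\<lambda>t. complex_of_real (indicator B t)) \<in> Lmeasurable" using borel_measurable_indicator[of B lebesgue] by measurable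

lemma L1_tendsto_dominated:
 fixes h :: "nat => real => complex"
 assumes "\<And>n. h n \<in> Lmeasurable" "f \<in> Lmeasurable" "Lintegrable w"
  "AE t in lebesgue. (\<lambda>n. h n t) \<longlonglongrightarrow> f t" "\<And>n t. norm (h n t) \<le> w t" "\<And>t. norm (f t) \<le> w t"
 shows "(\<lambda>n. LI t. norm (h n t - f t)) \<longlonglongrightarrow> 0"
proof -
 have "(\<lambda>n. LI t. norm (h n t - f t)) \<longlonglongrightarrow> (LI (t::real). (0::real))"
 proof (rule integral_dominated_convergence[where w = "\<lambda>t. 2 * w t" and M = lebesgue and f = "\<lambda>_. 0" and s = "\<lambda>n t. norm (h n t - f t)"])
  show "AE t in lebesgue. (\<lambda>n. norm (h n t - f t)) \<longlonglongrightarrow> 0" using assms(4) by eventually_elim (intro tendsto_norm_zero, simp add: LIM_zero)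
  show "AE t in lebesgue. norm (norm (h n t - f t)) \<le> 2 * w t" for n using norm_triangle_ineq4[of "h n _" "f _"] assms(5)[of n] assms(6)
   by (intro AE_I2) (smt (verit) real_norm_def norm_ge_zero)
 qed (use assms in auto)
 then show ?thesis by simp
qed

text \<open>Half-lines are a generator stable under intersection, and for them the Cauchy integral
  is explicit. Complements are differences, and disjoint unions are L1 limits of finite sums. The
  window [-N, N] keeps all indicators integrable.\<close>

lemma boundary_limit_borel:
 assumes "A \<in> sets borel"
 shows "AE x in lebesgue. boundary_limit (\<lambda>t. of_real (indicator (A \<inter> {-N..N}) t)) x"
proof -
 have ind: "Lintegrable (\<lambda>t. complex_of_real (indicator (B \<inter> {-N..N}) t))" if "B \<in> sets borel" for B
 proof (rule integrable_compact_support[where M = 1 and R = "abs N"])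
  have "B \<inter> {-N..N} \<in> sets lebesgue" using that by (auto intro: sets_completionI_sets)
  then show "(\<lambda>t. complex_of_real (indicator (B \<inter> {-N..N}) t)) \<in> Lmeasurable" by (rule indicator_measurable_complex)
 qed (auto simp: indicator_def)
 have interval: "AE x in lebesgue. boundary_limit (\<lambda>t. of_real (indicator {a..b} t)) x" for a b :: real
  using AE_lebesgue_neq[of a] AE_lebesgue_neq[of b] by eventually_elim (rule boundary_limit_interval)
 have A: "A \<in> sigma_sets UNIV (range (\<lambda>a::real. {..a}))" using assms unfolding borel_eq_atMost by (subst (asm) sets_measure_of) auto
 have "Int_stable (range (\<lambda>a::real. {..a}))" by (auto simp: Int_stable_def)
 moreover have "range (\<lambda>a::real. {..a}) \<subseteq> Pow UNIV" by simp
 moreover note A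
 ultimately show ?thesis proof (induction rule: sigma_sets_induct_disjoint)
  case (basic A)
  then obtain a where "A = {..a}" by auto
  then have "A \<inter> {-N..N} = {-N..min a N}" by auto
  then show ?case using interval by simp
 next
  case empty
  show ?case by (intro AE_I2) (auto simp: boundary_limit_def cauchy_int_def intro: exI[of _ 0])
 next
  case (compl A)
  have Ab: "A \<in> sets borel" using compl(1) unfolding borel_eq_atMost by (subst sets_measure_of) auto
  have eq: "(\<lambda>t. of_real (indicator ((UNIV - A) \<inter> {-N..N}) t)) = (\<lambda>t. of_real (indicator {-N..N} t) + (-1) * complex_of_real (indicator (A \<inter> {-N..N}) t))"
   by (auto simp: indicator_def)
  from compl(2) interval[of "-N" N] show ?case
  proof eventually_elim
   case (elim x)
   show ?case unfolding eq using ind[OF Ab] ind[of UNIV] by (intro boundary_limit_add boundary_limit_cmult elim) (auto simp: integrable_mult_right)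
  qed
 next
  case (union A)
  have Ab: "A i \<in> sets borel" for i using union(2) unfolding borel_eq_atMost by (subst sets_measure_of) auto
  define h where "h n t = (\<Sum>i<n. complex_of_real (indicator (A i \<inter> {-N..N}) t))" for n t
  have hi: "Lintegrable (h n)" for n unfolding h_def by (intro Bochner_Integration.integrable_sum ind Ab)
  have hs: "h n t = of_real (indicator ((\<Union>i<n. A i) \<inter> {-N..N}) t)" for n t proof -
   have "(\<Sum>i<n. indicator (A i \<inter> {-N..N}) t :: real) = indicator (\<Union>i<n. A i \<inter> {-N..N}) t"
    using union(1) by (intro indicator_UN_disjoint[symmetric]) (auto simp: disjoint_family_on_def)
   then show ?thesis unfolding h_def of_real_sum[symmetric] by (simp add: indicator_def)
  qed
  show ?case proof (rule boundary_limit_L1_limit[OF ind hi])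
   show "(\<Union> (range A)) \<in> sets borel" using Ab by auto
   show "AE x in lebesgue. boundary_limit (h n) x" for n proof (induction n)
    case 0
    show ?case by (intro AE_I2) (auto simp: h_def boundary_limit_def cauchy_int_def intro: exI[of _ 0])
   next
    case (Suc n)
    from Suc union(3)[of n] show ?case
    proof eventually_elim
     case (elim x)
     have "h (Suc n) = (\<lambda>t. h n t + of_real (indicator (A n \<inter> {-N..N}) t))" by (auto simp: h_def)
     then show ?case using elim by (simp add: boundary_limit_add hi ind Ab)
    qed
   qed
   show "(\<lambda>n. LI t. norm (h n t - of_real (indicator (\<Union> (range A) \<inter> {-N..N}) t))) \<longlonglongrightarrow> 0"
   proof (rule L1_tendsto_dominated[where w = "\<lambda>t. 1 * indicator {-N..N} t"])
    show "AE t in lebesgue. (\<lambda>n. h n t) \<longlonglongrightarrow> complex_of_real (indicator (\<Union> (range A) \<inter> {-N..N}) t)" proof (intro AE_I2 tendsto_eventually)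
     fix t
     show "\<forall>\<^sub>F n in sequentially. h n t = complex_of_real (indicator (\<Union> (range A) \<inter> {-N..N}) t)" proof (cases "t \<in> \<Union> (range A)")
      case True
      then obtain i where "t \<in> A i" by auto
      show ?thesis using eventually_gt_at_top[of i] by eventually_elim (use \<open>t \<in> A i\<close> in \<open>auto simp: hs indicator_def\<close>)
     next
      case False
      then show ?thesis by (auto simp: hs indicator_def)
     qed
    qed
    show "h n \<in> Lmeasurable" for n using hi by auto
    show "(\<lambda>t. complex_of_real (indicator (\<Union> (range A) \<inter> {-N..N}) t)) \<in> Lmeasurable" using ind[of "\<Union> (range A)"] Ab by auto
    show "Lintegrable (\<lambda>t. 1 * indicator {-N..N} t :: real)" by (rule integrable_indicator_interval)
   qed (auto simp: hs indicator_def)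
  qed
 qed
qed

text \<open>Passing from Borel to Lebesgue sets changes an indicator on a null set only. Unbounded
  sets of finite measure are exhausted by windows, and simple functions approximate the rest in
  L1.\<close>

theorem AE_boundary_limit:
 assumes "Lintegrable g"
 shows "AE x in lebesgue. boundary_limit g x" using assms
proof (induction rule: integrable_induct)
 case (base A c)
 have Ai: "Lintegrable (\<lambda>t. indicator A t :: real)" using base by (intro integrable_real_indicator) auto
 have fin: "A \<inter> {- real n..real n} \<in> sets lebesgue" for n using base by auto
 have AEn: "AE x in lebesgue. boundary_limit (\<lambda>t. of_real (indicator (A \<inter> {- real n..real n}) t)) x" for n proof -
  obtain B where B: "B \<in> sets borel" "AE t in lebesgue. t \<in> A \<longleftrightarrow> t \<in> B"
  proof -
   have mp: "main_part lborel A \<in> sets borel" using main_part_sets[OF base(1)] by simp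
   obtain Z where Z: "Z \<in> null_sets lborel" "null_part lborel A \<subseteq> Z" using null_part[OF base(1)] by blast
   have "AE t in lebesgue. t \<notin> Z" using Z(1) by (intro AE_not_in) (auto intro: null_sets_completionI)
   then have "AE t in lebesgue. t \<in> A \<longleftrightarrow> t \<in> main_part lborel A" proof eventually_elim
    case (elim t)
    then show ?case using Z(2) main_part_null_part_Un[OF base(1)] by blast
   qed
   with mp show ?thesis using that by blast
  qed
  from boundary_limit_borel[OF B(1), of "real n"] show ?thesis
  proof eventually_elim
   case (elim x)
   show ?case proof (rule boundary_limit_AE_cong[OF _ _ _ elim])
    show "AE t in lebesgue. complex_of_real (indicator (B \<inter> {- real n..real n}) t) = of_real (indicator (A \<inter> {- real n..real n}) t)"
     using B(2) by eventually_elim (auto simp: indicator_def)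
    have "B \<inter> {- real n..real n} \<in> sets lebesgue" using B(1) by (auto intro: sets_completionI_sets)
    then show "(\<lambda>t. complex_of_real (indicator (B \<inter> {- real n..real n}) t)) \<in> Lmeasurable" by (rule indicator_measurable_complex)
    show "(\<lambda>t. complex_of_real (indicator (A \<inter> {- real n..real n}) t)) \<in> Lmeasurable" using fin by (rule indicator_measurable_complex)
   qed
  qed
 qed
 have "AE x in lebesgue. boundary_limit (\<lambda>t. of_real (indicator A t)) x"
 proof (rule boundary_limit_L1_limit[where h = "\<lambda>n t. of_real (indicator (A \<inter> {- real n..real n}) t)"])
  show "Lintegrable (\<lambda>t. complex_of_real (indicator A t))" using Ai by simp
  show i: "Lintegrable (\<lambda>t. complex_of_real (indicator (A \<inter> {- real n..real n}) t))" for n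
   by (rule Bochner_Integration.integrable_bound[OF Ai indicator_measurable_complex[OF fin]]) (auto simp: indicator_def)
  show "(\<lambda>n. LI t. norm (of_real (indicator (A \<inter> {- real n..real n}) t) - complex_of_real (indicator A t))) \<longlonglongrightarrow> 0"
  proof (rule L1_tendsto_dominated[OF _ _ Ai])
   show "AE t in lebesgue. (\<lambda>n. complex_of_real (indicator (A \<inter> {- real n..real n}) t)) \<longlonglongrightarrow> of_real (indicator A t)"
   proof (intro AE_I2 tendsto_eventually)
    fix t
    obtain m where m: "abs t \<le> real m" using real_arch_simple by blast
    show "\<forall>\<^sub>F n in sequentially. complex_of_real (indicator (A \<inter> {- real n..real n}) t) = of_real (indicator A t)"
     using eventually_ge_at_top[of m] by eventually_elim (use m in \<open>auto simp: indicator_def\<close>)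
   qed
   show "(\<lambda>t. complex_of_real (indicator (A \<inter> {- real n..real n}) t)) \<in> Lmeasurable" for n by (rule indicator_measurable_complex[OF fin])
   show "(\<lambda>t. complex_of_real (indicator A t)) \<in> Lmeasurable" by (rule indicator_measurable_complex[OF base(1)])
  qed (auto simp: indicator_def)
 qed (rule AEn)
 then show ?case proof eventually_elim
  case (elim x)
  have "(\<lambda>t. indicator A t *\<^sub>R c) = (\<lambda>t. c * of_real (indicator A t))" by (simp add: scaleR_conv_of_real mult.commute)
  then show ?case using boundary_limit_cmult[OF elim, of c] by simp
 qed
next
 case (add f g)
 from add(3,4) show ?case by eventually_elim (rule boundary_limit_add[OF add(1,2)])
next
 case (lim f s)
 show ?case proof (rule boundary_limit_L1_limit[where h = s])
  show "(\<lambda>n. LI t. norm (s n t - f t)) \<longlonglongrightarrow> 0" proof (rule L1_tendsto_dominated[where w = "\<lambda>t. 2 * norm (f t)"])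
   show "norm (f t) \<le> 2 * norm (f t)" for t using norm_ge_zero[of "f t"] by linarith
  qed (use lim in auto)
 qed (use lim in auto)
qed

section \<open>The periodic Hilbert transform\<close>

text \<open>Differentiate the reflection formula
  \<open>Gamma x * Gamma (1 - x) * sin (pi * x) = pi\<close> and divide by the nonzero Gamma and
  sine factors.\<close>

lemma Digamma_reflection_real:
 fixes z :: real
 assumes z: "0 < z" "z < 1"
 shows "Digamma (1 - z) - Digamma z = pi * cot (pi * z)"
proof -
 have refl: "Gamma x * Gamma (1 - x) * sin (pi * x) = pi" if x: "0 < x" "x < 1" for x :: real proof -
  have s: "sin (pi * x) > 0" using x by (intro sin_gt_zero) auto
  have "complex_of_real (Gamma x * Gamma (1 - x)) = Gamma (of_real x) * Gamma (1 - of_real x)"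
   using Gamma_complex_of_real[of x] Gamma_complex_of_real[of "1 - x"] by simp
  also have "... = of_real pi / sin (of_real pi * of_real x)" by (rule Gamma_reflection_complex)
  also have "... = of_real (pi / sin (pi * x))" using sin_of_real[of "pi * x", where 'a = complex] by simp
  finally have "Gamma x * Gamma (1 - x) = pi / sin (pi * x)" by (simp only: of_real_eq_iff)
  then show ?thesis using s by simp
 qed
 have nz: "z \<notin> \<int>\<^sub>\<le>\<^sub>0" "1 - z \<notin> \<int>\<^sub>\<le>\<^sub>0" using z by (auto elim!: nonpos_Ints_cases)
 have D: "((\<lambda>x. Gamma x * Gamma (1 - x) * sin (pi * x)) has_real_derivative
   (Gamma z * Digamma z * Gamma (1 - z) + Gamma z * (Gamma (1 - z) * Digamma (1 - z) * (-1))) * sin (pi * z) +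
   Gamma z * Gamma (1 - z) * (cos (pi * z) * pi)) (at z)" using nz by (auto intro!: derivative_eq_intros)
 have "((\<lambda>x. Gamma x * Gamma (1 - x) * sin (pi * x)) has_real_derivative 0) (at z)"
  by (rule has_field_derivative_transform_within_open[of "\<lambda>_. pi" 0 z "{0<..<1}"]) (use z refl in auto)
 from DERIV_unique[OF D this]
 have "Gamma z * Gamma (1 - z) * ((Digamma z - Digamma (1 - z)) * sin (pi * z) + pi * cos (pi * z)) = 0" by (simp add: algebra_simps)
 moreover have "Gamma z * Gamma (1 - z) \<noteq> 0" using refl[OF z] by auto
 ultimately have "(Digamma z - Digamma (1 - z)) * sin (pi * z) + pi * cos (pi * z) = 0" by simp
 moreover have "sin (pi * z) \<noteq> 0" using refl[OF z] by auto
 ultimately show ?thesis by (simp add: cot_def field_simps)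
qed

text \<open>The limit formulas for \<open>Digamma z\<close> and \<open>Digamma (1 - z)\<close> give
  two sums of simple poles. Pairing the pole at j with the one at -j leaves a single unmatched term,
  which tends to 0.\<close>

lemma cot_partial_fractions:
 fixes z :: real
 assumes z: "0 < z" "z < 1"
 shows "(\<lambda>n. 1 / z + (\<Sum>j=1..n. 2 * z / (z^2 - (real j)^2))) \<longlonglongrightarrow> pi * cot (pi * z)"
proof -
 have eq: "(\<Sum>k<Suc n. inverse (z + real k)) - (\<Sum>k<Suc n. inverse (1 - z + real k)) =
  1 / z + (\<Sum>j=1..n. 2 * z / (z^2 - (real j)^2)) - inverse (1 - z + real n)" for n
 proof (induction n)
  case 0 then show ?case by (simp add: divide_inverse)
 next
  case (Suc n)
  have nz: "real (Suc n) - z \<noteq> 0" "z + real (Suc n) \<noteq> 0" using z by auto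
  have frac: "(b - a) / (- (a * b)) = inverse b - inverse a" if "a \<noteq> 0" "b \<noteq> 0" for a b :: real using that by (simp add: field_simps)
  have "z^2 - (real (Suc n))^2 = - ((real (Suc n) - z) * (z + real (Suc n)))" by (simp add: algebra_simps power2_eq_square)
  then have "2 * z / (z^2 - (real (Suc n))^2) = inverse (z + real (Suc n)) - inverse (real (Suc n) - z)" using frac[OF nz] by (simp only:) simp
  moreover have "real (Suc n) - z = 1 - z + real n" by simp
  ultimately have t: "2 * z / (z^2 - (real (Suc n))^2) = inverse (z + real (Suc n)) - inverse (1 - z + real n)" by simp
  have "(\<Sum>k<Suc (Suc n). inverse (z + real k)) - (\<Sum>k<Suc (Suc n). inverse (1 - z + real k)) =
   ((\<Sum>k<Suc n. inverse (z + real k)) - (\<Sum>k<Suc n. inverse (1 - z + real k))) + inverse (z + real (Suc n)) - inverse (1 - z + real (Suc n))" by simp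
  also have "... = 1 / z + ((\<Sum>j=1..n. 2 * z / (z^2 - (real j)^2)) + 2 * z / (z^2 - (real (Suc n))^2)) - inverse (1 - z + real (Suc n))"
   unfolding Suc t by simp
  also have "(\<Sum>j=1..n. 2 * z / (z^2 - (real j)^2)) + 2 * z / (z^2 - (real (Suc n))^2) = (\<Sum>j=1..Suc n. 2 * z / (z^2 - (real j)^2))" by simp
  finally show ?case .
 qed
 have "(\<lambda>m. (ln (real m) - (\<Sum>k<m. inverse (1 - z + real k))) - (ln (real m) - (\<Sum>k<m. inverse (z + real k)))) \<longlonglongrightarrow> Digamma (1 - z) - Digamma z"
  using Digamma_LIMSEQ[of "1 - z"] Digamma_LIMSEQ[of z] z by (intro tendsto_diff) auto
 then have "(\<lambda>m. (\<Sum>k<m. inverse (z + real k)) - (\<Sum>k<m. inverse (1 - z + real k))) \<longlonglongrightarrow> pi * cot (pi * z)"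
  unfolding Digamma_reflection_real[OF z] by (simp add: algebra_simps)
 from LIMSEQ_Suc[OF this]
 have "(\<lambda>n. 1 / z + (\<Sum>j=1..n. 2 * z / (z^2 - (real j)^2)) - inverse (1 - z + real n)) \<longlonglongrightarrow> pi * cot (pi * z)" unfolding eq .
 moreover have "(\<lambda>n. inverse (1 - z + real n)) \<longlonglongrightarrow> 0"
  by (intro tendsto_inverse_0_at_top filterlim_tendsto_add_at_top[OF tendsto_const] filterlim_real_sequentially)
 ultimately have "(\<lambda>n. 1 / z + (\<Sum>j=1..n. 2 * z / (z^2 - (real j)^2)) - inverse (1 - z + real n) + inverse (1 - z + real n)) \<longlonglongrightarrow> pi * cot (pi * z) + 0"
  by (rule tendsto_add)
 then show ?thesis by simp
qed

text \<open>Symmetric partial sums of the expansion of \<open>pi / 2 * cot (pi * v / 2)\<close>,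
  whose poles are the even integers.\<close>

definition cot_sum :: "nat => real => real" where
 "cot_sum n v = 1 / v + (\<Sum>j=1..n. 1 / (v - 2 * real j) + 1 / (v + 2 * real j))"

lemma cot_sum_tendsto:
 assumes v: "0 < v" "v < 2"
 shows "(\<lambda>n. cot_sum n v) \<longlonglongrightarrow> pi / 2 * cot (pi * v / 2)"
proof -
 have eq: "cot_sum n v = 1 / 2 * (1 / (v / 2) + (\<Sum>j=1..n. 2 * (v / 2) / ((v / 2)^2 - (real j)^2)))" for n proof -
  have "1 / (v - 2 * real j) + 1 / (v + 2 * real j) = 1 / 2 * (2 * (v / 2) / ((v / 2)^2 - (real j)^2))" if "j \<in> {1..n}" for j proof -
   have nz: "v - 2 * real j \<noteq> 0" "v + 2 * real j \<noteq> 0" using v that by auto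
   have "(v / 2)^2 - (real j)^2 = (v - 2 * real j) * (v + 2 * real j) / 4" by (simp add: algebra_simps power2_eq_square)
   then show ?thesis using nz by (simp add: field_simps)
  qed
  then have "(\<Sum>j=1..n. 1 / (v - 2 * real j) + 1 / (v + 2 * real j)) = (\<Sum>j=1..n. 1 / 2 * (2 * (v / 2) / ((v / 2)^2 - (real j)^2)))"
   by (rule sum.cong[OF refl])
  also have "... = 1 / 2 * (\<Sum>j=1..n. 2 * (v / 2) / ((v / 2)^2 - (real j)^2))" by (rule sum_distrib_left[symmetric])
  finally show ?thesis unfolding cot_sum_def by (simp only: distrib_left) simp
 qed
 have "(\<lambda>n. 1 / 2 * (1 / (v / 2) + (\<Sum>j=1..n. 2 * (v / 2) / ((v / 2)^2 - (real j)^2)))) \<longlonglongrightarrow> 1 / 2 * (pi * cot (pi * (v / 2)))"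
  using v by (intro tendsto_mult_left cot_partial_fractions) auto
 then show ?thesis unfolding eq by simp
qed

text \<open>A pair of poles contributes - 2 v / (4 j^2 - v^2), of order 1 / j^2, and v \<le> w < 2
  keeps v away from the pole at 2. A bound of the form C / v, uniform in n, is what dominated
  convergence in folded integrals needs.\<close>

lemma cot_sum_bound:
 assumes v: "0 < v" "v \<le> w" and w: "w < 2"
 shows "\<bar>cot_sum n v\<bar> \<le> (1 + 16 / (4 - w^2)) / v"
proof -
 have w2: "w^2 < 4" using power_strict_mono[of w 2 2] v w by simp
 have vw: "v^2 \<le> w^2" using v by (intro power_mono) auto
 have trm: "\<bar>1 / (v - 2 * real j) + 1 / (v + 2 * real j)\<bar> \<le> 8 / (4 - w^2) / v * (1 / (real j)^2)" if "j \<ge> 1" for j proof -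
  have j2: "1 \<le> (real j)^2" using that by simp
  have nz: "v - 2 * real j \<noteq> 0" "v + 2 * real j \<noteq> 0" using v w that by auto
  have "v^2 * 1 \<le> w^2 * (real j)^2" using vw j2 by (intro mult_mono) auto
  then have le: "(4 - w^2) * (real j)^2 \<le> 4 * (real j)^2 - v^2" by (simp add: algebra_simps)
  have pos: "0 < (4 - w^2) * (real j)^2" using w2 that by simp
  have "1 / (v - 2 * real j) + 1 / (v + 2 * real j) = - (2 * v / (4 * (real j)^2 - v^2))" proof -
   have e: "4 * (real j)^2 - v^2 = - ((v - 2 * real j) * (v + 2 * real j))" by (simp add: algebra_simps power2_eq_square)
   have frac: "1 / a + 1 / b = - ((a + b) / (- (a * b)))" if "a \<noteq> 0" "b \<noteq> 0" for a b :: real using that by (simp add: field_simps)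
   show ?thesis unfolding e frac[OF nz] by simp
  qed
  then have "\<bar>1 / (v - 2 * real j) + 1 / (v + 2 * real j)\<bar> = 2 * v / (4 * (real j)^2 - v^2)" using le pos v by (simp add: abs_of_nonneg)
  also have "... \<le> 2 * v / ((4 - w^2) * (real j)^2)" using le v w2 that less_le_trans[OF pos le] by (intro divide_left_mono mult_pos_pos) auto
  also have "... = (2 * v^2) / v / ((4 - w^2) * (real j)^2)" using v by (simp add: power2_eq_square)
  also have "... \<le> 8 / v / ((4 - w^2) * (real j)^2)" proof -
   have "2 * v^2 \<le> 8" using vw w2 by linarith
   then show ?thesis using v pos by (intro divide_right_mono) auto
  qed
  finally show ?thesis by (simp add: mult_ac)
 qed
 have sq: "(\<Sum>j=1..n. 1 / (real j)^2) \<le> 2" for n proof -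
  have "(\<Sum>j=1..n. 1 / (real j)^2) \<le> 2 - 1 / real n" proof (induction n)
   case (Suc n)
   have "1 / (real (Suc n))^2 \<le> 1 / real n - 1 / real (Suc n)" if "n \<noteq> 0" proof -
    have "1 / real n - 1 / real (Suc n) = 1 / (real n * real (Suc n))" using that by (simp add: field_simps)
    moreover have "1 / (real (Suc n))^2 \<le> 1 / (real n * real (Suc n))"
     unfolding power2_eq_square using that by (intro divide_left_mono mult_right_mono mult_pos_pos) auto
    ultimately show ?thesis by linarith
   qed
   then show ?case using Suc by (cases "n = 0") auto
  qed simp
  moreover have "0 \<le> 1 / real n" by simp
  ultimately show ?thesis by linarith
 qed
 have "\<bar>cot_sum n v\<bar> \<le> 1 / v + (\<Sum>j=1..n. \<bar>1 / (v - 2 * real j) + 1 / (v + 2 * real j)\<bar>)"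
  unfolding cot_sum_def using v by (intro order_trans[OF abs_triangle_ineq] add_mono sum_abs) auto
 also have "... \<le> 1 / v + (\<Sum>j=1..n. 8 / (4 - w^2) / v * (1 / (real j)^2))" by (intro add_left_mono sum_mono trm) auto
 also have "... = 1 / v + 8 / (4 - w^2) / v * (\<Sum>j=1..n. 1 / (real j)^2)" by (simp only: sum_distrib_left)
 also have "... \<le> 1 / v + 8 / (4 - w^2) / v * 2" using v w2 by (intro add_left_mono mult_left_mono sq) auto
 also have "... = (1 + 16 / (4 - w^2)) / v" by (simp add: add_divide_distrib)
 finally show ?thesis .
qed

lemma cot_bound:
 assumes v: "0 < v" "v \<le> w" and w: "w < 2"
 shows "\<bar>pi / 2 * cot (pi * v / 2)\<bar> \<le> (1 + 16 / (4 - w^2)) / v"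
proof (rule tendsto_upperbound)
 show "(\<lambda>n. \<bar>cot_sum n v\<bar>) \<longlonglongrightarrow> \<bar>pi / 2 * cot (pi * v / 2)\<bar>" using v w by (intro tendsto_rabs cot_sum_tendsto) auto
qed (use cot_sum_bound[OF v w] in auto)

section \<open>Folded principal values for kernels of size C / v\<close>

definition SK :: "(real => real) => real => (real => complex) => real => complex" where
 "SK \<kappa> w \<phi> y = (LINT v:{0<..w}|lebesgue. (sdiff \<phi> y v) * of_real (\<kappa> v))"

lemma SK_integrand_measurable:
 assumes \<phi>: "\<phi> \<in> test_functions E" and \<kappa>: "\<kappa> \<in> borel_measurable borel"
 shows "(\<lambda>v. indicator {0<..w} v *\<^sub>R (sdiff \<phi> y v * of_real (\<kappa> v))) \<in> Lmeasurable"
proof -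
 have c: "continuous_on UNIV \<phi>" using smooth_continuous[OF test_function_smooth[OF \<phi>]] .
 have [measurable]: "\<phi> \<in> borel_measurable borel" using c by (rule borel_measurable_continuous_onI)
 note \<kappa>[measurable]
 show ?thesis by (intro measurable_completion) measurable
qed

lemma SK_integrand_bound:
 fixes \<phi> :: "real => complex"
 assumes L: "\<And>x y. norm (\<phi> x - \<phi> y) \<le> L * \<bar>x - y\<bar>" and v: "0 < v" and k: "abs k \<le> C / v"
 shows "norm (sdiff \<phi> y v * of_real k) \<le> 2 * L * C"
proof -
 have "0 \<le> L" using order_trans[OF norm_ge_zero L[of 0 1]] by simp
 have "norm (sdiff \<phi> y v * of_real k) \<le> (L * \<bar>(y - v) - (y + v)\<bar>) * (C / v)"
  unfolding norm_mult norm_of_real using \<open>0 \<le> L\<close> by (intro mult_mono L k) auto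
 also have "... = 2 * L * C" using v by simp
 finally show ?thesis .
qed

lemma SK_integrable:
 assumes \<phi>: "\<phi> \<in> test_functions E" and \<kappa>: "\<kappa> \<in> borel_measurable borel" "\<And>v. 0 < v ==> v \<le> w ==> \<bar>\<kappa> v\<bar> \<le> C / v"
 shows "set_integrable lebesgue {0<..w} (\<lambda>v. (sdiff \<phi> y v) * of_real (\<kappa> v))"
proof -
 obtain L where L: "\<And>x y. norm (\<phi> x - \<phi> y) \<le> L * \<bar>x - y\<bar>" using test_function_lipschitz[OF \<phi>] by metis
 show ?thesis unfolding set_integrable_def
 proof (rule Bochner_Integration.integrable_bound[OF integrable_indicator_interval[of "2 * L * C" 0 w] SK_integrand_measurable[OF \<phi> \<kappa>(1)]])
  show "AE v in lebesgue. norm (indicator {0<..w} v *\<^sub>R (sdiff \<phi> y v * of_real (\<kappa> v))) \<le> norm (2 * L * C * indicator {0..w} v)" proof (intro AE_I2)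
   fix v
   show "norm (indicator {0<..w} v *\<^sub>R (sdiff \<phi> y v * of_real (\<kappa> v))) \<le> norm (2 * L * C * indicator {0..w} v)"
    using SK_integrand_bound[OF L, of v "\<kappa> v" C y] \<kappa>(2)[of v] by (cases "v \<in> {0<..w}") auto
  qed
 qed
qed

lemma SK_tendsto:
 assumes \<phi>: "\<phi> \<in> test_functions E" and \<kappa>: "\<And>n. \<kappa> n \<in> borel_measurable borel" "\<kappa>' \<in> borel_measurable borel"
  and C: "0 \<le> C" and b: "\<And>n v. 0 < v ==> v \<le> w ==> \<bar>\<kappa> n v\<bar> \<le> C / v"
  and lim: "\<And>v. 0 < v ==> v \<le> w ==> (\<lambda>n. \<kappa> n v) \<longlonglongrightarrow> \<kappa>' v"
 shows "(\<lambda>n. SK (\<kappa> n) w \<phi> y) \<longlonglongrightarrow> SK \<kappa>' w \<phi> y"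
proof -
 obtain L where L: "\<And>x y. norm (\<phi> x - \<phi> y) \<le> L * \<bar>x - y\<bar>" using test_function_lipschitz[OF \<phi>] by metis
 show ?thesis unfolding SK_def set_lebesgue_integral_def proof (rule integral_dominated_convergence[where w = "\<lambda>v. 2 * L * C * indicator {0..w} v"])
  show "AE v in lebesgue. (\<lambda>n. indicator {0<..w} v *\<^sub>R (sdiff \<phi> y v * of_real (\<kappa> n v))) \<longlonglongrightarrow> indicator {0<..w} v *\<^sub>R (sdiff \<phi> y v * of_real (\<kappa>' v))"
  proof (intro AE_I2)
   fix v
   show "(\<lambda>n. indicator {0<..w} v *\<^sub>R (sdiff \<phi> y v * of_real (\<kappa> n v))) \<longlonglongrightarrow> indicator {0<..w} v *\<^sub>R (sdiff \<phi> y v * of_real (\<kappa>' v))"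
   proof (cases "v \<in> {0<..w}")
    case True
    then show ?thesis using lim[of v] by (intro tendsto_intros) auto
   qed simp
  qed
  show "AE v in lebesgue. norm (indicator {0<..w} v *\<^sub>R (sdiff \<phi> y v * of_real (\<kappa> n v))) \<le> 2 * L * C * indicator {0..w} v" for n proof (intro AE_I2)
   fix v
   show "norm (indicator {0<..w} v *\<^sub>R (sdiff \<phi> y v * of_real (\<kappa> n v))) \<le> 2 * L * C * indicator {0..w} v" proof (cases "v \<in> {0<..w}")
    case True
    then show ?thesis using SK_integrand_bound[OF L, of v "\<kappa> n v" C y] b[of v n] by simp
   next
    case False
    have "0 \<le> L" using order_trans[OF norm_ge_zero L[of 0 1]] by simp
    with False C show ?thesis by simp
   qed
  qed
 qed (intro SK_integrand_measurable[OF \<phi>] \<kappa> integrable_indicator_interval)+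
qed

text \<open>Differentiation under the integral: \<open>vd \<phi>\<close> is itself Lipschitz, so the
  difference quotient of the folded factor is at most 2 L v and again cancels the pole.\<close>

lemma SK_has_vd:
 assumes \<phi>: "\<phi> \<in> test_functions E" and \<kappa>: "\<kappa> \<in> borel_measurable borel"
  and C: "0 \<le> C" and b: "\<And>v. 0 < v ==> v \<le> w ==> \<bar>\<kappa> v\<bar> \<le> C / v"
 shows "(SK \<kappa> w \<phi> has_vector_derivative SK \<kappa> w (vd \<phi>) y) (at y)"
proof -
 note \<phi>' = test_functions_vd[OF \<phi>]
 note dv = smooth_has_vd[OF test_function_smooth[OF \<phi>]]
 obtain L where L: "0 \<le> L" "\<And>x y. norm (vd \<phi> x - vd \<phi> y) \<le> L * \<bar>x - y\<bar>" using test_function_lipschitz[OF \<phi>'] by metis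
 have gd: "((\<lambda>y. \<phi> (y - v) - \<phi> (y + v)) has_vector_derivative (sdiff (vd \<phi>) x v)) (at x)" for v x proof -
  have "((\<lambda>y. \<phi> (y - v)) has_vector_derivative vd \<phi> (x - v)) (at x)" for v proof -
   have "((\<lambda>y. y - v) has_vector_derivative 1) (at x)" by (auto intro!: derivative_eq_intros)
   from vector_diff_chain_at[OF this dv] show ?thesis by (simp add: o_def)
  qed
  from has_vector_derivative_diff[OF this[of v] this[of "- v"]] show ?thesis by simp
 qed
 have quot: "(\<lambda>n. (1 / X n) *\<^sub>R (SK \<kappa> w \<phi> (y + X n) - SK \<kappa> w \<phi> y)) \<longlonglongrightarrow> SK \<kappa> w (vd \<phi>) y"
  if X: "\<And>n. X n \<noteq> 0" "X \<longlonglongrightarrow> 0" for X :: "nat => real"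
 proof -
  define q where "q n v = (1 / X n) *\<^sub>R ((\<phi> (y + X n - v) - \<phi> (y + X n + v)) - (sdiff \<phi> y v)) * of_real (\<kappa> v)" for n v
  have eq: "(1 / X n) *\<^sub>R (SK \<kappa> w \<phi> (y + X n) - SK \<kappa> w \<phi> y) = (LINT v:{0<..w}|lebesgue. q n v)" for n proof -
   have i: "set_integrable lebesgue {0<..w} (\<lambda>v. (\<phi> (y + X n - v) - \<phi> (y + X n + v)) * of_real (\<kappa> v))"
    "set_integrable lebesgue {0<..w} (\<lambda>v. (sdiff \<phi> y v) * of_real (\<kappa> v))" by (rule SK_integrable[OF \<phi> \<kappa> b]; simp)+
   have "SK \<kappa> w \<phi> (y + X n) - SK \<kappa> w \<phi> y = (LINT v:{0<..w}|lebesgue. (\<phi> (y + X n - v) - \<phi> (y + X n + v)) * of_real (\<kappa> v) - (sdiff \<phi> y v) * of_real (\<kappa> v))"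
    unfolding SK_def by (rule set_integral_diff(2)[symmetric, OF i])
   also have "(1 / X n) *\<^sub>R ... = (LINT v:{0<..w}|lebesgue. q n v)" unfolding set_lebesgue_integral_def integral_scaleR_right[symmetric] q_def
    by (intro bochner_cong refl) (simp add: algebra_simps scaleR_conv_of_real)
   finally show ?thesis .
  qed
  have qm: "(\<lambda>v. indicator {0<..w} v *\<^sub>R q n v) \<in> Lmeasurable" for n proof -
   have c: "continuous_on UNIV \<phi>" using smooth_continuous[OF test_function_smooth[OF \<phi>]] .
   have [measurable]: "\<phi> \<in> borel_measurable borel" using c by (rule borel_measurable_continuous_onI)
   note \<kappa>[measurable]
   show ?thesis unfolding q_def by (intro measurable_completion) measurable
  qed
  show ?thesis unfolding eq unfolding SK_def set_lebesgue_integral_def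
  proof (rule integral_dominated_convergence[where w = "\<lambda>v. 2 * L * C * indicator {0..w} v"])
   show "AE v in lebesgue. (\<lambda>n. indicator {0<..w} v *\<^sub>R q n v) \<longlonglongrightarrow> indicator {0<..w} v *\<^sub>R (sdiff (vd \<phi>) y v * of_real (\<kappa> v))"
   proof (intro AE_I2 tendsto_scaleR tendsto_const)
    fix v
    have "((\<lambda>h. ((sdiff \<phi> (y + h) v) - (sdiff \<phi> y v)) /\<^sub>R h) \<longlongrightarrow> vd \<phi> (y - v) - vd \<phi> (y + v)) (at 0)" proof -
     have "((\<lambda>h. (h - y) \<bullet> 1) \<longlongrightarrow> 0) (at y)" by (auto intro!: tendsto_eq_intros)
     from gd[of v y] have "((\<lambda>x. ((sdiff \<phi> x v) - (sdiff \<phi> y v) - (x - y) *\<^sub>R (sdiff (vd \<phi>) y v)) /\<^sub>R norm (x - y)) \<longlongrightarrow> 0) (at y)"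
      unfolding has_vector_derivative_def has_derivative_at_within by simp
     then have "((\<lambda>x. norm (((sdiff \<phi> x v) - (sdiff \<phi> y v) - (x - y) *\<^sub>R (sdiff (vd \<phi>) y v)) /\<^sub>R norm (x - y))) \<longlongrightarrow> 0) (at y)"
      by (rule tendsto_norm_zero)
     then have "((\<lambda>h. norm (((sdiff \<phi> (y + h) v) - (sdiff \<phi> y v) - h *\<^sub>R (sdiff (vd \<phi>) y v)) /\<^sub>R norm h)) \<longlongrightarrow> 0) (at 0)"
      by (subst (asm) LIM_offset_zero_iff) (simp_all add: add.commute)
     moreover have "norm (((sdiff \<phi> (y + h) v) - (sdiff \<phi> y v) - h *\<^sub>R (sdiff (vd \<phi>) y v)) /\<^sub>R norm h)
      = norm (((sdiff \<phi> (y + h) v) - (sdiff \<phi> y v)) /\<^sub>R h - (sdiff (vd \<phi>) y v))" if "h \<noteq> 0" for h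
     proof -
      have "((sdiff \<phi> (y + h) v) - (sdiff \<phi> y v)) /\<^sub>R h - (sdiff (vd \<phi>) y v) = ((sdiff \<phi> (y + h) v) - (sdiff \<phi> y v) - h *\<^sub>R (sdiff (vd \<phi>) y v)) /\<^sub>R h"
       using that by (simp add: scaleR_diff_right)
      then show ?thesis by simp
     qed
     ultimately have "((\<lambda>h. norm (((sdiff \<phi> (y + h) v) - (sdiff \<phi> y v)) /\<^sub>R h - (sdiff (vd \<phi>) y v))) \<longlongrightarrow> 0) (at 0)"
      by (elim Lim_transform_eventually) (simp add: eventually_at_filter)
     then show ?thesis using tendsto_norm_zero_iff LIM_zero_iff by blast
    qed
    then have "(\<lambda>n. ((\<phi> (y + X n - v) - \<phi> (y + X n + v)) - (sdiff \<phi> y v)) /\<^sub>R X n) \<longlonglongrightarrow> vd \<phi> (y - v) - vd \<phi> (y + v)"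
     using X unfolding tendsto_at_iff_sequentially o_def by auto
    then show "(\<lambda>n. q n v) \<longlonglongrightarrow> (sdiff (vd \<phi>) y v) * of_real (\<kappa> v)" unfolding q_def by (intro tendsto_mult tendsto_const) (simp add: divide_inverse)
   qed
   show "AE v in lebesgue. norm (indicator {0<..w} v *\<^sub>R q n v) \<le> 2 * L * C * indicator {0..w} v" for n proof (intro AE_I2)
    fix v
    show "norm (indicator {0<..w} v *\<^sub>R q n v) \<le> 2 * L * C * indicator {0..w} v" proof (cases "v \<in> {0<..w}")
     case True
     have "norm ((\<phi> (y + X n - v) - \<phi> (y + X n + v)) - (sdiff \<phi> y v)) \<le> (L * (2 * v)) * \<bar>(y + X n) - y\<bar>"
     proof (rule lipschitz_from_vd[of "\<lambda>y. \<phi> (y - v) - \<phi> (y + v)", OF gd])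
      show "norm (sdiff (vd \<phi>) x v) \<le> L * (2 * v)" for x using L(2)[of "x - v" "x + v"] True by simp
     qed
     then have "norm (q n v) \<le> (1 / \<bar>X n\<bar>) * ((L * (2 * v)) * \<bar>X n\<bar>) * (C / v)"
      unfolding q_def norm_mult norm_scaleR norm_of_real using b[of v] True L(1) by (intro mult_mono mult_left_mono) auto
     also have "... = 2 * L * C" using X(1)[of n] True by simp
     finally show ?thesis using True by simp
    next
     case False
     then show ?thesis using L(1) C by simp
    qed
   qed
  qed (intro SK_integrand_measurable[OF \<phi>'] \<kappa> integrable_indicator_interval qm)+
 qed
 have "((\<lambda>h. (1 / h) *\<^sub>R (SK \<kappa> w \<phi> (y + h) - SK \<kappa> w \<phi> y)) \<longlongrightarrow> SK \<kappa> w (vd \<phi>) y) (at 0)" unfolding tendsto_at_iff_sequentially o_def using quot by auto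
 then have "((\<lambda>h. norm ((1 / h) *\<^sub>R (SK \<kappa> w \<phi> (y + h) - SK \<kappa> w \<phi> y) - SK \<kappa> w (vd \<phi>) y)) \<longlongrightarrow> 0) (at 0)" by (intro tendsto_norm_zero) (simp add: LIM_zero)
 moreover have "norm ((1 / h) *\<^sub>R (SK \<kappa> w \<phi> (y + h) - SK \<kappa> w \<phi> y) - SK \<kappa> w (vd \<phi>) y) =
   norm (SK \<kappa> w \<phi> (y + h) - SK \<kappa> w \<phi> y - h *\<^sub>R SK \<kappa> w (vd \<phi>) y) / norm h" if "h \<noteq> 0" for h
 proof -
  have "(1 / h) *\<^sub>R (SK \<kappa> w \<phi> (y + h) - SK \<kappa> w \<phi> y) - SK \<kappa> w (vd \<phi>) y = (1 / h) *\<^sub>R (SK \<kappa> w \<phi> (y + h) - SK \<kappa> w \<phi> y - h *\<^sub>R SK \<kappa> w (vd \<phi>) y)"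
   using that by (simp add: scaleR_diff_right)
  then show ?thesis by simp
 qed
 ultimately have "((\<lambda>h. norm (SK \<kappa> w \<phi> (y + h) - SK \<kappa> w \<phi> y - h *\<^sub>R SK \<kappa> w (vd \<phi>) y) / norm h) \<longlongrightarrow> 0) (at 0)"
  by (elim Lim_transform_eventually) (simp add: eventually_at_filter)
 then show ?thesis unfolding has_vector_derivative_def has_derivative_at by (simp add: bounded_linear_scaleR_left)
qed

text \<open>By compactness the support keeps a margin 1 - r from the end points. This margin
  separates its translates by even integers and keeps the kernels below away from their next
  poles.\<close>

lemma test_I1_support:
 assumes "\<phi> \<in> test_functions I1"
 obtains r where "0 < r" "r < 1" "\<And>t. r < abs t ==> \<phi> t = 0"
proof -
 obtain K where K: "smooth \<phi>" "compact K" "K \<subseteq> I1" "\<And>t. t \<notin> K ==> \<phi> t = 0" using test_functionsE[OF assms] by blast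
 show ?thesis proof (cases "K = {}")
  case True
  then show ?thesis using that[of "1 / 2"] K(4) by simp
 next
  case False
  have "compact ((\<lambda>t. abs t) ` K)" by (intro compact_continuous_image continuous_intros K)
  then obtain s where s: "s \<in> (\<lambda>t. abs t) ` K" "\<And>t. t \<in> (\<lambda>t. abs t) ` K ==> t \<le> s" using compact_attains_sup[of "(\<lambda>t. abs t) ` K"] False by auto
  obtain k where k: "k \<in> K" "s = abs k" using s(1) by blast
  have "k \<in> {-1<..<1}" using k(1) K(3) unfolding I1_def by blast
  then have s1: "0 \<le> s" "s < 1" using k(2) by (auto simp: abs_less_iff)
  show ?thesis proof (rule that[of "(1 + s) / 2"])
   fix t assume t: "(1 + s) / 2 < abs t"
   have "t \<notin> K" proof
    assume "t \<in> K"
    then have "abs t \<le> s" using s(2) by blast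
    with t s1 show False by simp
   qed
   then show "\<phi> t = 0" by (rule K(4))
  qed (use s1 in auto)
 qed
qed

lemma hilbert_outside:
 assumes \<xi>: "\<xi> \<in> test_functions E" and d: "0 < d" "\<And>t. \<bar>z - t\<bar> < d ==> \<xi> t = 0"
 shows "hilbert \<xi> z = of_real (1 / pi) * (LI t. \<xi> t / of_real (z - t))"
  and "Lintegrable (\<lambda>t. \<xi> t / of_real (z - t))"
proof -
 define G where "G u = \<xi> (z - u) / of_real u" for u
 have c: "continuous_on UNIV \<xi>" using smooth_continuous[OF test_function_smooth[OF \<xi>]] .
 have [measurable]: "\<xi> \<in> borel_measurable borel" using c by (rule borel_measurable_continuous_onI)
 have Gi: "Lintegrable G" proof (rule Bochner_Integration.integrable_bound)
  show "Lintegrable (\<lambda>u. of_real (1 / d) * \<xi> (z - u))" using lebesgue_integrable_real_affine[OF test_function_integrable[OF \<xi>], of "-1" z] by simp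
  show "G \<in> Lmeasurable" unfolding G_def by (intro measurable_completion) measurable
  show "AE u in lebesgue. norm (G u) \<le> norm (of_real (1 / d) * \<xi> (z - u))" proof (intro AE_I2)
   fix u
   show "norm (G u) \<le> norm (of_real (1 / d) * \<xi> (z - u))" proof (cases "abs u < d")
    case True
    then have "\<xi> (z - u) = 0" by (intro d) simp
    then show ?thesis by (simp add: G_def)
   next
    case False
    then have "norm (\<xi> (z - u)) / abs u \<le> norm (\<xi> (z - u)) / d" using d(1) by (intro divide_left_mono) auto
    then show ?thesis using d(1) by (simp add: G_def norm_divide norm_mult)
   qed
  qed
 qed
 have "(LI u. G u) = Qs \<xi> z 0" unfolding fold_integral[OF Gi] Qs_def set_lebesgue_integral_def
  by (intro bochner_cong) (auto simp: G_def indicator_def power2_eq_square diff_divide_distrib)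
 moreover have "(LI t. \<xi> t / of_real (z - t)) = (LI u. G u)" by (subst lebesgue_integral_real_affine[of "-1" _ z]) (simp_all add: G_def)
 ultimately show "hilbert \<xi> z = of_real (1 / pi) * (LI t. \<xi> t / of_real (z - t))" by (simp add: hilbert_eq_Qs[OF \<xi>])
 show "Lintegrable (\<lambda>t. \<xi> t / of_real (z - t))" using lebesgue_integrable_real_affine[OF Gi, of "-1" z] by (simp add: G_def)
qed

lemma periodize_shift: "periodize \<phi> (t + 2) = periodize \<phi> t"
proof -
 have "bij_betw (\<lambda>j::int. j + 1) UNIV UNIV" by (rule bij_betwI[where g = "\<lambda>j. j - 1"]) auto
 from infsum_reindex_bij_betw[OF this, of "\<lambda>j. \<phi> (t + 2 * of_int j)"]
 show ?thesis unfolding periodize_def by (simp add: algebra_simps)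
qed

text \<open>For r < 1 the windows of half-width 2 - r around the even integers overlap, so every
  point has a neighbourhood on which \<open>periodize \<phi>\<close> is a single translate.\<close>

lemma periodize_local:
 assumes r: "\<And>t. r < abs t ==> \<phi> t = 0" and t: "\<bar>t - 2 * of_int m\<bar> < 2 - r"
 shows "periodize \<phi> t = \<phi> (t - 2 * of_int m)"
proof -
 have "infsum (\<lambda>j::int. \<phi> (t + 2 * of_int j)) UNIV = infsum (\<lambda>j. \<phi> (t + 2 * of_int j)) {- m}" proof (rule infsum_cong_neutral)
  fix j :: int assume j: "j \<in> UNIV - {- m}"
  define k where "k = j + m"
  have "k \<noteq> 0" using j by (auto simp: k_def)
  then have "1 \<le> \<bar>real_of_int k\<bar>" by linarith
  moreover have "t + 2 * of_int j = (t - 2 * of_int m) + 2 * of_int k" by (simp add: k_def algebra_simps)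
  ultimately have "r < \<bar>t + 2 * of_int j\<bar>" using t by linarith
  then show "\<phi> (t + 2 * of_int j) = 0" by (rule r)
 qed auto
 then show ?thesis by (simp add: periodize_def)
qed

lemma nearest_even: obtains m :: int where "\<bar>t - 2 * of_int m\<bar> \<le> (1::real)"
proof
 define k where "k = \<lfloor>(t + 1) / 2\<rfloor>"
 have "real_of_int k \<le> (t + 1) / 2" "(t + 1) / 2 < real_of_int k + 1" unfolding k_def by linarith+
 then have "-1 \<le> t - 2 * of_int k" "t - 2 * of_int k \<le> 1" by (simp_all add: field_simps)
 then show "\<bar>t - 2 * of_int \<lfloor>(t + 1) / 2\<rfloor>\<bar> \<le> 1" unfolding k_def[symmetric] by (simp add: abs_le_iff)
qed

lemma periodize_smooth:
 assumes "\<phi> \<in> test_functions I1"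
 shows "smooth (periodize \<phi>)"
proof (rule smooth_coinduct[where X = "{periodize \<phi> | \<phi>. \<phi> \<in> test_functions I1}"])
 fix \<psi> assume "\<psi> \<in> {periodize \<phi> | \<phi>. \<phi> \<in> test_functions I1}"
 then obtain \<phi> where \<phi>: "\<psi> = periodize \<phi>" "\<phi> \<in> test_functions I1" by blast
 obtain r where r: "0 < r" "r < 1" "\<And>t. r < abs t ==> \<phi> t = 0" using test_I1_support[OF \<phi>(2)] by blast
 have r': "vd \<phi> t = 0" if "r < abs t" for t by (rule vd_eq_0_outside[of "{-r..r}"]) (use r that in \<open>auto simp: abs_le_iff not_le\<close>)
 have "(\<psi> has_vector_derivative periodize (vd \<phi>) x) (at x)" for x proof -
  obtain m where m: "\<bar>x - 2 * of_int m\<bar> \<le> 1" by (rule nearest_even)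
  have x: "\<bar>x - 2 * of_int m\<bar> < 2 - r" using m r by linarith
  have "((\<lambda>t. t - 2 * real_of_int m) has_vector_derivative 1) (at x)" by (auto intro!: derivative_eq_intros)
  from vector_diff_chain_at[OF this smooth_has_vd[OF test_function_smooth[OF \<phi>(2)]]]
  have 1: "((\<lambda>t. \<phi> (t - 2 * of_int m)) has_vector_derivative vd \<phi> (x - 2 * of_int m)) (at x)" by (simp add: o_def)
  have "(\<psi> has_vector_derivative vd \<phi> (x - 2 * of_int m)) (at x)"
  proof (rule has_vector_derivative_transform_within_open[OF 1, where S = "{2 * of_int m - (2 - r)<..<2 * of_int m + (2 - r)}"])
   show "x \<in> {2 * of_int m - (2 - r)<..<2 * of_int m + (2 - r)}" using x by (auto simp: abs_less_iff)
   fix t assume "t \<in> {2 * of_int m - (2 - r)<..<2 * of_int m + (2 - r)}"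
   then have "\<bar>t - 2 * of_int m\<bar> < 2 - r" by (auto simp: abs_less_iff)
   then show "\<phi> (t - 2 * of_int m) = \<psi> t" unfolding \<phi>(1) using periodize_local[where t = t and m = m, OF r(3)] by simp
  qed simp
  then show ?thesis by (simp add: periodize_local[OF r' x])
 qed
 then show "\<exists>\<phi>'\<in>{periodize \<phi> | \<phi>. \<phi> \<in> test_functions I1}. \<forall>x. (\<psi> has_vector_derivative \<phi>' x) (at x)" using test_functions_vd[OF \<phi>(2)] by blast
qed (use assms in blast)

lemma periodize_test: "\<phi> \<in> test_functions I1 ==> periodize \<phi> \<in> periodic_test_functions"
 by (simp add: periodic_test_functions_def periodize_smooth periodize_shift)

lemma periodic_hilbert_shift: "periodic_hilbert \<xi> (x + 2) = periodic_hilbert \<xi> x"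
proof -
 have "range (\<lambda>j::int. x + 2 + 2 * real_of_int j) = range (\<lambda>j::int. x + 2 * real_of_int j)" proof (intro equalityI subsetI; elim rangeE)
  fix s and j :: int assume "s = x + 2 + 2 * real_of_int j"
  then have "s = x + 2 * real_of_int (j + 1)" by simp
  then show "s \<in> range (\<lambda>j::int. x + 2 * real_of_int j)" by blast
 next
  fix s and j :: int assume "s = x + 2 * real_of_int j"
  then have "s = x + 2 + 2 * real_of_int (j - 1)" by simp
  then show "s \<in> range (\<lambda>j::int. x + 2 + 2 * real_of_int j)" by blast
 qed
 moreover have "cot (pi * (x + 2 - t) / 2) = cot (pi * (x - t) / 2)" for t proof -
  have "pi * (x + 2 - t) / 2 = pi * (x - t) / 2 + pi" by (simp add: field_simps)
  then show ?thesis by (simp only: cot_def sin_add cos_add sin_pi cos_pi) simp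
 qed
 ultimately show ?thesis by (simp add: periodic_hilbert_def add.assoc)
qed

text \<open>For |t| \<le> r and |y| \<le> (3 - r) / 2 the difference y - t stays within (3 + r) / 2
  < 2, so the cotangent meets only its pole at 0. Since (3 - r) / 2 > 1, this window is longer than
  a period, which allows differentiation at its end points as well.\<close>

lemma periodic_hilbert_eq_SK:
 assumes \<phi>: "\<phi> \<in> test_functions I1" and r: "0 < r" "r < 1" "\<And>t. r < abs t ==> \<phi> t = 0"
  and y: "abs y \<le> (3 - r) / 2"
 shows "periodic_hilbert (periodize \<phi>) y = of_real (1 / 2) * SK (\<lambda>v. cot (pi * v / 2)) ((3 + r) / 2) \<phi> y"
proof -
 define w where "w = (3 + r) / 2"
 have w: "0 < w" "w < 2" "abs y \<le> w - r" using r y by (auto simp: w_def field_simps)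
 have c: "continuous_on UNIV \<phi>" using smooth_continuous[OF test_function_smooth[OF \<phi>]] .
 have [measurable]: "\<phi> \<in> borel_measurable borel" using c by (rule borel_measurable_continuous_onI)
 have cotm[measurable]: "(\<lambda>v. cot (pi * v / 2)) \<in> borel_measurable borel" unfolding cot_def by measurable
 define C where "C = (1 + 16 / (4 - w^2)) * (2 / pi)"
 have w2: "w^2 < 4" using power_strict_mono[of w 2 2] w by simp
 have C0: "0 \<le> C" using w2 by (simp add: C_def)
 have cb: "\<bar>cot (pi * v / 2)\<bar> \<le> C / v" if "0 < v" "v \<le> w" for v proof -
  have "pi / 2 * \<bar>cot (pi * v / 2)\<bar> \<le> (1 + 16 / (4 - w^2)) / v" using cot_bound[OF that w(2)] by (simp add: abs_mult)
  from mult_left_mono[OF this, of "2 / pi"] show ?thesis by (simp add: C_def mult.commute)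
 qed
 have supp: "\<phi> (y - v) = 0" "\<phi> (y + v) = 0" if "w < abs v" for v using that w(3) by (auto intro!: r(3))
 \<comment> \<open>The condition \<tau> < 2 - w ensures that the excluded intervals around the
   points y + 2j with j \<noteq> 0 miss the support.\<close>
 have eq: "(LINT t:{t \<in> {-1..1}. \<forall>s\<in>range (\<lambda>j::int. y + 2 * of_int j). \<tau> < \<bar>s - t\<bar>}|lebesgue. periodize \<phi> t * of_real (cot (pi * (y - t) / 2)))
   = SK (\<lambda>v. indicator {\<tau><..} v * cot (pi * v / 2)) w \<phi> y" if e: "0 < \<tau>" "\<tau> < 2 - w" for \<tau>
 proof -
  define G where "G u = indicator {u. \<tau> < abs u} u *\<^sub>R (\<phi> (y - u) * of_real (cot (pi * u / 2)))" for u
  have Gi: "Lintegrable G" proof (rule Bochner_Integration.integrable_bound)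
   show "Lintegrable (\<lambda>u. of_real (C / \<tau>) * \<phi> (y - u))" using lebesgue_integrable_real_affine[OF test_function_integrable[OF \<phi>], of "-1" y] by simp
   show "G \<in> Lmeasurable" unfolding G_def by (intro measurable_completion) measurable
   show "AE u in lebesgue. norm (G u) \<le> norm (of_real (C / \<tau>) * \<phi> (y - u))" proof (intro AE_I2)
    fix u
    show "norm (G u) \<le> norm (of_real (C / \<tau>) * \<phi> (y - u))" proof (cases "\<tau> < abs u \<and> \<bar>u\<bar> \<le> w")
     case True
     have "\<bar>cot (pi * u / 2)\<bar> = \<bar>cot (pi * abs u / 2)\<bar>" by (cases "u \<ge> 0") (auto simp: cot_def)
     also have "... \<le> C / abs u" using True e by (intro cb) auto
     also have "... \<le> C / \<tau>" using True e C0 by (intro divide_left_mono) auto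
     finally have "norm (\<phi> (y - u)) * \<bar>cot (pi * u / 2)\<bar> \<le> norm (\<phi> (y - u)) * (C / \<tau>)" by (intro mult_left_mono) auto
     then show ?thesis using C0 e by (auto simp: G_def norm_mult norm_divide indicator_def mult.commute)
    next
     case False
     then have "G u = 0" using supp(1)[of u] by (auto simp: G_def indicator_def)
     then show ?thesis by simp
    qed
   qed
  qed
  have "(LINT t:{t \<in> {-1..1}. \<forall>s\<in>range (\<lambda>j::int. y + 2 * of_int j). \<tau> < \<bar>s - t\<bar>}|lebesgue. periodize \<phi> t * of_real (cot (pi * (y - t) / 2)))
   = (LI t. G (y - t))" unfolding set_lebesgue_integral_def
  proof (intro bochner_cong refl)
   fix t
   show "indicator {t \<in> {-1..1}. \<forall>s\<in>range (\<lambda>j::int. y + 2 * of_int j). \<tau> < \<bar>s - t\<bar>} t *\<^sub>R (periodize \<phi> t * of_real (cot (pi * (y - t) / 2))) = G (y - t)"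
   proof (cases "abs t \<le> r")
    case True
    have p: "periodize \<phi> t = \<phi> t" using periodize_local[where t = t and m = 0, OF r(3)] True r by simp
    have "(\<forall>s\<in>range (\<lambda>j::int. y + 2 * of_int j). \<tau> < \<bar>s - t\<bar>) \<longleftrightarrow> \<tau> < \<bar>y - t\<bar>" proof
     assume a: "\<tau> < \<bar>y - t\<bar>"
     show "\<forall>s\<in>range (\<lambda>j::int. y + 2 * of_int j). \<tau> < \<bar>s - t\<bar>" proof
      fix s assume "s \<in> range (\<lambda>j::int. y + 2 * real_of_int j)"
      then obtain j :: int where s: "s = y + 2 * of_int j" by blast
      show "\<tau> < \<bar>s - t\<bar>" proof (cases "j = 0")
       case False
       then have "1 \<le> \<bar>real_of_int j\<bar>" by linarith
       then show ?thesis unfolding s using True w e by linarith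
      qed (use a s in simp)
     qed
    next
     assume "\<forall>s\<in>range (\<lambda>j::int. y + 2 * of_int j). \<tau> < \<bar>s - t\<bar>"
     from bspec[OF this, of "y + 2 * of_int 0"] show "\<tau> < \<bar>y - t\<bar>" by simp
    qed
    then show ?thesis using True r p by (auto simp: G_def indicator_def abs_le_iff)
   next
    case False
    then have z: "\<phi> t = 0" by (intro r) simp
    show ?thesis proof (cases "t \<in> {-1..1}")
     case True
     then have "periodize \<phi> t = \<phi> t" using periodize_local[where t = t and m = 0, OF r(3)] r by (simp add: abs_le_iff abs_less_iff)
     then show ?thesis using z by (simp add: G_def)
    next
     case False
     then show ?thesis by (auto simp: G_def z indicator_def)
    qed
   qed
  qed
  also have "... = (LI u. G u)" by (subst lebesgue_integral_real_affine[of "-1" _ y]) simp_all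
  also have "... = SK (\<lambda>v. indicator {\<tau><..} v * cot (pi * v / 2)) w \<phi> y" unfolding fold_integral[OF Gi] SK_def set_lebesgue_integral_def
  proof (intro bochner_cong refl)
   fix u
   show "indicator {0<..} u *\<^sub>R (G u + G (- u)) = indicator {0<..w} u *\<^sub>R (sdiff \<phi> y u * of_real (indicator {\<tau><..} u * cot (pi * u / 2)))"
   proof (cases "0 < u \<and> u \<le> w")
    case True
    then show ?thesis by (auto simp: G_def indicator_def cot_def algebra_simps diff_divide_distrib)
   next
    case False
    then show ?thesis using supp[of u] by (auto simp: G_def indicator_def)
   qed
  qed
  finally show ?thesis .
 qed
 have "((\<lambda>\<tau>. SK (\<lambda>v. indicator {\<tau><..} v * cot (pi * v / 2)) w \<phi> y) \<longlongrightarrow> SK (\<lambda>v. cot (pi * v / 2)) w \<phi> y) (at_right 0)"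
  unfolding tendsto_at_iff_sequentially o_def
 proof (intro allI impI)
  fix X :: "nat => real" assume X: "\<forall>i. X i \<in> {0<..} - {0}" "X \<longlonglongrightarrow> 0"
  show "(\<lambda>i. SK (\<lambda>v. indicator {X i<..} v * cot (pi * v / 2)) w \<phi> y) \<longlonglongrightarrow> SK (\<lambda>v. cot (pi * v / 2)) w \<phi> y" proof (rule SK_tendsto[OF \<phi> _ cotm C0])
   show "(\<lambda>v. indicator {X n<..} v * cot (pi * v / 2)) \<in> borel_measurable borel" for n by measurable
   show "\<bar>indicator {X n<..} v * cot (pi * v / 2)\<bar> \<le> C / v" if "0 < v" "v \<le> w" for n v using cb[OF that] that C0 by (auto simp: indicator_def)
   show "(\<lambda>n. indicator {X n<..} v * cot (pi * v / 2)) \<longlonglongrightarrow> cot (pi * v / 2)" if "0 < v" "v \<le> w" for v proof (rule tendsto_eventually)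
    have "\<forall>\<^sub>F n in sequentially. X n < v" using X(2) that(1) by (rule order_tendstoD)
    then show "\<forall>\<^sub>F n in sequentially. indicator {X n<..} v * cot (pi * v / 2) = cot (pi * v / 2)" by eventually_elim (simp add: indicator_def)
   qed
  qed
 qed
 moreover have "\<forall>\<^sub>F \<tau> in at_right 0. SK (\<lambda>v. indicator {\<tau><..} v * cot (pi * v / 2)) w \<phi> y =
  (LINT t:{t \<in> {-1..1}. \<forall>s\<in>range (\<lambda>j::int. y + 2 * of_int j). \<tau> < \<bar>s - t\<bar>}|lebesgue. periodize \<phi> t * of_real (cot (pi * (y - t) / 2)))"
  unfolding eventually_at_right_field using w by (intro exI[of _ "2 - w"] conjI allI impI eq[symmetric]) simp_all
 ultimately have "((\<lambda>\<tau>. LINT t:{t \<in> {-1..1}. \<forall>s\<in>range (\<lambda>j::int. y + 2 * of_int j). \<tau> < \<bar>s - t\<bar>}|lebesgue. periodize \<phi> t * of_real (cot (pi * (y - t) / 2)))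
   \<longlongrightarrow> SK (\<lambda>v. cot (pi * v / 2)) w \<phi> y) (at_right 0)" by (rule Lim_transform_eventually)
 then show ?thesis unfolding periodic_hilbert_def pv_integral_def w_def by (subst tendsto_Lim) auto
qed

lemma periodic_hilbert_shift_int: "periodic_hilbert \<xi> (x + 2 * of_int m) = periodic_hilbert \<xi> x"
proof -
 have n: "periodic_hilbert \<xi> (x + 2 * of_nat n) = periodic_hilbert \<xi> x" for n x
  by (induction n) (use periodic_hilbert_shift[of \<xi> "x + 2 * real _"] in \<open>simp_all add: algebra_simps\<close>)
 show ?thesis proof (cases "m \<ge> 0")
  case True then show ?thesis using n[of x "nat m"] by simp
 next
  case False then show ?thesis using n[of "x + 2 * of_int m" "nat (- m)"] by simp
 qed
qed

lemma cot_kernel_bound: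
 assumes r: "0 < r" "r < 1"
 obtains C where "0 \<le> C" "\<And>v. 0 < v ==> v \<le> (3 + r) / 2 ==> \<bar>cot (pi * v / 2)\<bar> \<le> C / v"
  "\<And>n v. 0 < v ==> v \<le> (3 + r) / 2 ==> \<bar>cot_sum n v\<bar> \<le> C / v"
proof -
 define w where "w = (3 + r) / 2"
 define D where "D = 1 + 16 / (4 - w^2)"
 have w: "0 < w" "w < 2" using r by (auto simp: w_def)
 have w2: "w^2 < 4" using power_strict_mono[of w 2 2] w by simp
 have D: "0 \<le> D" using w2 by (simp add: D_def)
 show ?thesis proof (rule that[OF D])
  fix v assume v: "0 < v" "v \<le> (3 + r) / 2"
  have v': "v \<le> w" using v by (simp add: w_def)
  show "\<bar>cot_sum n v\<bar> \<le> D / v" for n using cot_sum_bound[OF v(1) v' w(2)] by (simp add: D_def)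
  have "1 * \<bar>cot (pi * v / 2)\<bar> \<le> pi / 2 * \<bar>cot (pi * v / 2)\<bar>" using pi_gt3 by (intro mult_right_mono) auto
  also have "... = \<bar>pi / 2 * cot (pi * v / 2)\<bar>" by (simp add: abs_mult)
  also have "... \<le> D / v" using cot_bound[OF v(1) v' w(2)] unfolding D_def .
  finally show "\<bar>cot (pi * v / 2)\<bar> \<le> D / v" by simp
 qed
qed

text \<open>The derivative at x is taken in the window around the nearest even integer, where the
  folded formula holds, and is carried back by periodicity.\<close>

lemma periodic_hilbert_smooth:
 assumes "\<phi> \<in> test_functions I1"
 shows "smooth (periodic_hilbert (periodize \<phi>))"
proof (rule smooth_coinduct[where X = "{periodic_hilbert (periodize \<phi>) | \<phi>. \<phi> \<in> test_functions I1}"])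
 fix \<psi> assume "\<psi> \<in> {periodic_hilbert (periodize \<phi>) | \<phi>. \<phi> \<in> test_functions I1}"
 then obtain \<phi> where \<phi>: "\<psi> = periodic_hilbert (periodize \<phi>)" "\<phi> \<in> test_functions I1" by blast
 obtain r where r: "0 < r" "r < 1" "\<And>t. r < abs t ==> \<phi> t = 0" using test_I1_support[OF \<phi>(2)] by blast
 have r': "vd \<phi> t = 0" if "r < abs t" for t by (rule vd_eq_0_outside[of "{-r..r}"]) (use r that in \<open>auto simp: abs_le_iff not_le\<close>)
 obtain C where C: "0 \<le> C" "\<And>v. 0 < v ==> v \<le> (3 + r) / 2 ==> \<bar>cot (pi * v / 2)\<bar> \<le> C / v" using cot_kernel_bound[OF r(1,2)] by metis
 have cotm: "(\<lambda>v. cot (pi * v / 2)) \<in> borel_measurable borel" unfolding cot_def by measurable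
 have "(\<psi> has_vector_derivative periodic_hilbert (periodize (vd \<phi>)) x) (at x)" for x proof -
  obtain m where m: "\<bar>x - 2 * of_int m\<bar> \<le> 1" by (rule nearest_even)
  have x: "\<bar>x - 2 * of_int m\<bar> < (3 - r) / 2" using m r by (simp add: field_simps)
  have sh: "periodic_hilbert \<xi> t = periodic_hilbert \<xi> (t - 2 * of_int m)" for \<xi> t using periodic_hilbert_shift_int[of \<xi> "t - 2 * of_int m" m] by simp
  let ?S = "SK (\<lambda>v. cot (pi * v / 2)) ((3 + r) / 2)"
  have "((\<lambda>t. t - 2 * real_of_int m) has_vector_derivative 1) (at x)" by (auto intro!: derivative_eq_intros)
  from vector_diff_chain_at[OF this SK_has_vd[where w = "(3 + r) / 2", OF \<phi>(2) cotm C]]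
  have "((\<lambda>t. ?S \<phi> (t - 2 * of_int m)) has_vector_derivative ?S (vd \<phi>) (x - 2 * of_int m)) (at x)" by (simp add: o_def)
  from has_vector_derivative_mult_right[OF this, of "of_real (1 / 2)"]
  have 1: "((\<lambda>t. of_real (1 / 2) * ?S \<phi> (t - 2 * of_int m)) has_vector_derivative of_real (1 / 2) * ?S (vd \<phi>) (x - 2 * of_int m)) (at x)" .
  have "(\<psi> has_vector_derivative of_real (1 / 2) * ?S (vd \<phi>) (x - 2 * of_int m)) (at x)"
  proof (rule has_vector_derivative_transform_within_open[OF 1, where S = "{2 * of_int m - (3 - r) / 2<..<2 * of_int m + (3 - r) / 2}"])
   show "x \<in> {2 * of_int m - (3 - r) / 2<..<2 * of_int m + (3 - r) / 2}"
    by (rule greaterThanLessThan_iff[THEN iffD2], rule conjI) (use x in linarith)+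
   fix t assume "t \<in> {2 * of_int m - (3 - r) / 2<..<2 * of_int m + (3 - r) / 2}"
   then have "2 * of_int m - (3 - r) / 2 < t" "t < 2 * of_int m + (3 - r) / 2" by (simp_all only: greaterThanLessThan_iff)
   then have "\<bar>t - 2 * of_int m\<bar> \<le> (3 - r) / 2" by linarith
   from periodic_hilbert_eq_SK[OF \<phi>(2) r this]
   show "of_real (1 / 2) * ?S \<phi> (t - 2 * of_int m) = \<psi> t" unfolding \<phi>(1) sh[of _ t] by simp
  qed simp
  moreover have "periodic_hilbert (periodize (vd \<phi>)) x = of_real (1 / 2) * ?S (vd \<phi>) (x - 2 * of_int m)"
   unfolding sh[of _ x] using x by (intro periodic_hilbert_eq_SK[OF test_functions_vd[OF \<phi>(2)] r(1,2) r']) auto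
  ultimately show ?thesis by (simp only:)
 qed
 then show "\<exists>\<phi>'\<in>{periodic_hilbert (periodize \<phi>) | \<phi>. \<phi> \<in> test_functions I1}. \<forall>x. (\<psi> has_vector_derivative \<phi>' x) (at x)"
  using test_functions_vd[OF \<phi>(2)] by blast
qed (use assms in blast)

text \<open>\<open>periodic_distr_of\<close> is \<open>undefined\<close> off
  \<open>periodic_test_functions\<close>, so the transposed definition in
  \<open>periodic_hilbert_distr\<close> can be evaluated only after this.\<close>

lemma periodic_hilbert_test:
 "\<phi> \<in> test_functions I1 ==> periodic_hilbert (periodize \<phi>) \<in> periodic_test_functions"
 by (simp add: periodic_test_functions_def periodic_hilbert_smooth periodic_hilbert_shift)

section \<open>Fejer means of translates\<close>

lemma SK_diff:
 assumes \<phi>: "\<phi> \<in> test_functions E" and m: "\<kappa> \<in> borel_measurable borel" "\<kappa>' \<in> borel_measurable borel"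
  and b: "\<And>v. 0 < v ==> v \<le> w ==> \<bar>\<kappa> v\<bar> \<le> C / v" "\<And>v. 0 < v ==> v \<le> w ==> \<bar>\<kappa>' v\<bar> \<le> C / v"
 shows "SK (\<lambda>v. \<kappa> v - \<kappa>' v) w \<phi> y = SK \<kappa> w \<phi> y - SK \<kappa>' w \<phi> y"
proof -
 have "SK \<kappa> w \<phi> y - SK \<kappa>' w \<phi> y = (LINT v:{0<..w}|lebesgue. (sdiff \<phi> y v) * of_real (\<kappa> v) - (sdiff \<phi> y v) * of_real (\<kappa>' v))"
  unfolding SK_def by (rule set_integral_diff(2)[symmetric]) (rule SK_integrable[OF \<phi>]; use m b in blast)+
 then show ?thesis by (simp add: SK_def right_diff_distrib)
qed

lemma SK_cmult: "SK (\<lambda>v. c * \<kappa> v) w \<phi> y = of_real c * SK \<kappa> w \<phi> y"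
proof -
 have "SK (\<lambda>v. c * \<kappa> v) w \<phi> y = (LI v. of_real c * (indicator {0<..w} v *\<^sub>R (sdiff \<phi> y v * of_real (\<kappa> v))))"
  unfolding SK_def set_lebesgue_integral_def by (intro bochner_cong) (simp_all add: mult_ac)
 then show ?thesis by (simp only: integral_mult_right_zero SK_def set_lebesgue_integral_def)
qed

lemma cot_sum_measurable: "cot_sum n \<in> borel_measurable borel" unfolding cot_sum_def[abs_def] by measurable

lemma symmetric_interval_Suc: "{- int (Suc n)..int (Suc n)} = insert (int (Suc n)) (insert (- int (Suc n)) {- int n..int n})" by auto

lemma sum_symmetric_Suc:
 fixes c :: "int => 'a::comm_monoid_add"
 shows "(\<Sum>j\<in>{- int (Suc n)..int (Suc n)}. c j) = c (int (Suc n)) + (c (- int (Suc n)) + (\<Sum>j\<in>{- int n..int n}. c j))"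
 unfolding symmetric_interval_Suc by (subst sum.insert, simp, simp, subst sum.insert, simp_all)

text \<open>The points y - 2j and y + 2j lie off the support, so both transforms are ordinary
  integrals. Their sum has the odd kernel \<kappa> and can be folded at y.\<close>

lemma hilbert_pair_eq_SK:
 assumes \<phi>: "\<phi> \<in> test_functions I1" and r: "0 < r" "r < 1" "\<And>t. r < abs t ==> \<phi> t = 0"
  and y: "abs y \<le> 1" and j: "1 \<le> j"
 shows "hilbert \<phi> (y - 2 * real j) + hilbert \<phi> (y + 2 * real j) =
  of_real (1 / pi) * SK (\<lambda>v. 1 / (v - 2 * real j) + 1 / (v + 2 * real j)) ((3 + r) / 2) \<phi> y"
proof -
 let ?w = "(3 + r) / 2"
 have j1: "1 \<le> real j" using j by simp
 have d: "\<phi> t = 0" if "\<bar>y - 2 * real j - t\<bar> < 1 - r \<or> \<bar>y + 2 * real j - t\<bar> < 1 - r" for t by (rule r(3)) (use that y j1 r in linarith)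
 have d1: "0 < 1 - r" using r by simp
 note H1 = hilbert_outside[OF \<phi> d1, of "y - 2 * real j", OF d, OF disjI1]
 note H2 = hilbert_outside[OF \<phi> d1, of "y + 2 * real j", OF d, OF disjI2]
 have i1: "Lintegrable (\<lambda>t. \<phi> t / of_real (y - 2 * real j - t))" by (rule H1)
 have i2: "Lintegrable (\<lambda>t. \<phi> t / of_real (y + 2 * real j - t))" by (rule H2)
 define \<kappa> where "\<kappa> v = 1 / (v - 2 * real j) + 1 / (v + 2 * real j)" for v
 define G where "G u = \<phi> (y - u) * of_real (\<kappa> u)" for u
 have eqG: "\<phi> t / of_real (y - 2 * real j - t) + \<phi> t / of_real (y + 2 * real j - t) = G (y - t)" for t
  by (simp add: G_def \<kappa>_def distrib_left divide_inverse algebra_simps)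
 have GI: "Lintegrable (\<lambda>t. G (y - t))" unfolding eqG[symmetric] using i1 i2 by (rule bochner_integrable_add)
 have Gi: "Lintegrable G" using lebesgue_integrable_real_affine[OF GI, of "-1" y] by simp
 have "hilbert \<phi> (y - 2 * real j) + hilbert \<phi> (y + 2 * real j) = of_real (1 / pi) * (LI t. G (y - t))"
  unfolding eqG[symmetric] using H1(1) H2(1) i1 i2 by (simp add: distrib_left)
 also have "(LI t. G (y - t)) = (LI u. G u)" by (subst lebesgue_integral_real_affine[of "-1" _ y]) simp_all
 also have "... = SK \<kappa> ?w \<phi> y" unfolding fold_integral[OF Gi] SK_def set_lebesgue_integral_def proof (intro bochner_cong refl)
  fix u :: real
  have odd: "\<kappa> (- u) = - \<kappa> u" proof -
   have e: "- u - 2 * real j = - (u + 2 * real j)" "- u + 2 * real j = - (u - 2 * real j)" by simp_all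
   show ?thesis unfolding \<kappa>_def e divide_minus_right by simp
  qed
  show "indicator {0<..} u *\<^sub>R (G u + G (- u)) = indicator {0<..?w} u *\<^sub>R (sdiff \<phi> y u * of_real (\<kappa> u))" proof (cases "u \<le> ?w")
   case True
   then show ?thesis by (auto simp: G_def odd indicator_def algebra_simps)
  next
   case False
   then have "r < \<bar>y - u\<bar>" "r < \<bar>y + u\<bar>" using y r by (auto simp: field_simps)
   then show ?thesis using False by (simp add: G_def r(3))
  qed
 qed
 finally show ?thesis unfolding \<kappa>_def[abs_def] .
qed

text \<open>Each pair of translates adds one pair of poles to the kernel, so n pairs build up
  \<open>cot_sum n\<close>.\<close>

lemma hilbert_sum_eq_SK:
 assumes \<phi>: "\<phi> \<in> test_functions I1" and r: "0 < r" "r < 1" "\<And>t. r < abs t ==> \<phi> t = 0"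
  and y: "abs y \<le> 1"
 shows "(sym_sum (hilbert \<phi>) n y) = of_real (1 / pi) * SK (cot_sum n) ((3 + r) / 2) \<phi> y"
proof (induction n)
 case 0
 let ?w = "(3 + r) / 2"
 have "Qs \<phi> y 0 = SK (cot_sum 0) ?w \<phi> y" unfolding Qs_def SK_def set_lebesgue_integral_def proof (intro bochner_cong refl)
  fix u :: real
  show "indicator {0<..} u *\<^sub>R (sdiff \<phi> y u * of_real (Qk u 0)) = indicator {0<..?w} u *\<^sub>R (sdiff \<phi> y u * of_real (cot_sum 0 u))"
  proof (cases "u \<le> ?w")
   case True
   then show ?thesis by (auto simp: cot_sum_def indicator_def power2_eq_square)
  next
   case False
   then have "r < \<bar>y - u\<bar>" "r < \<bar>y + u\<bar>" using y r by (auto simp: field_simps)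
   then show ?thesis using False by (simp add: r(3))
  qed
 qed
 then show ?case by (simp add: hilbert_eq_Qs[OF \<phi>])
next
 case (Suc n)
 let ?w = "(3 + r) / 2"
 obtain C where C: "\<And>n v. 0 < v ==> v \<le> ?w ==> \<bar>cot_sum n v\<bar> \<le> C / v" using cot_kernel_bound[OF r(1,2)] by metis
 have "(\<lambda>v. cot_sum (Suc n) v - cot_sum n v) = (\<lambda>v. 1 / (v - 2 * real (Suc n)) + 1 / (v + 2 * real (Suc n)))" by (simp add: cot_sum_def fun_eq_iff)
 with hilbert_pair_eq_SK[OF \<phi> r y, of "Suc n"]
 have "hilbert \<phi> (y - 2 * real (Suc n)) + hilbert \<phi> (y + 2 * real (Suc n)) = of_real (1 / pi) * SK (\<lambda>v. cot_sum (Suc n) v - cot_sum n v) ?w \<phi> y"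
  by (simp only:)
 also have "... = of_real (1 / pi) * (SK (cot_sum (Suc n)) ?w \<phi> y - SK (cot_sum n) ?w \<phi> y)"
  using C by (subst SK_diff[OF \<phi> cot_sum_measurable cot_sum_measurable]) auto
 finally have "hilbert \<phi> (y - 2 * real (Suc n)) + hilbert \<phi> (y + 2 * real (Suc n)) =
   of_real (1 / pi) * SK (cot_sum (Suc n)) ?w \<phi> y - of_real (1 / pi) * SK (cot_sum n) ?w \<phi> y" by (simp add: right_diff_distrib)
 then show ?case unfolding sum_symmetric_Suc Suc.IH by (simp add: algebra_simps)
qed

lemma hilbert_sum_tendsto_unit:
 assumes \<phi>: "\<phi> \<in> test_functions I1" and y: "abs y \<le> 1"
 shows "(\<lambda>n. sym_sum (hilbert \<phi>) n y) \<longlonglongrightarrow> periodic_hilbert (periodize \<phi>) y"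
proof -
 obtain r where r: "0 < r" "r < 1" "\<And>t. r < abs t ==> \<phi> t = 0" using test_I1_support[OF \<phi>] by blast
 let ?w = "(3 + r) / 2"
 obtain C where C: "0 \<le> C" "\<And>n v. 0 < v ==> v \<le> ?w ==> \<bar>cot_sum n v\<bar> \<le> C / v" using cot_kernel_bound[OF r(1,2)] by metis
 have "(\<lambda>v. pi / 2 * cot (pi * v / 2)) \<in> borel_measurable borel" unfolding cot_def by measurable
 then have "(\<lambda>n. SK (cot_sum n) ?w \<phi> y) \<longlonglongrightarrow> SK (\<lambda>v. pi / 2 * cot (pi * v / 2)) ?w \<phi> y" proof (rule SK_tendsto[OF \<phi> cot_sum_measurable _ C])
  fix v assume "0 < v" "v \<le> ?w"
  then show "(\<lambda>n. cot_sum n v) \<longlonglongrightarrow> pi / 2 * cot (pi * v / 2)" using r(2) by (intro cot_sum_tendsto) simp_all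
 qed
 then have "(\<lambda>n. of_real (1 / pi) * SK (cot_sum n) ?w \<phi> y) \<longlonglongrightarrow> of_real (1 / pi) * SK (\<lambda>v. pi / 2 * cot (pi * v / 2)) ?w \<phi> y" by (rule tendsto_mult_left)
 moreover have "of_real (1 / pi) * SK (\<lambda>v. pi / 2 * cot (pi * v / 2)) ?w \<phi> y = periodic_hilbert (periodize \<phi>) y" proof -
  have e: "SK (\<lambda>v. pi / 2 * cot (pi * v / 2)) ?w \<phi> y = of_real (pi / 2) * SK (\<lambda>v. cot (pi * v / 2)) ?w \<phi> y" by (rule SK_cmult)
  show ?thesis unfolding e using y r(2) by (subst periodic_hilbert_eq_SK[OF \<phi> r]) simp_all
 qed
 moreover have "(sym_sum (hilbert \<phi>) n y) = of_real (1 / pi) * SK (cot_sum n) ?w \<phi> y" for n by (rule hilbert_sum_eq_SK[OF \<phi> r y])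
 ultimately show ?thesis by (simp only:)
qed

lemma hilbert_far:
 assumes \<phi>: "\<phi> \<in> test_functions I1" and z: "1 < abs z"
 shows "norm (hilbert \<phi> z) \<le> (LI t. norm (\<phi> t)) / (abs z - 1)"
proof -
 obtain r where r: "0 < r" "r < 1" "\<And>t. r < abs t ==> \<phi> t = 0" using test_I1_support[OF \<phi>] by blast
 have d: "\<phi> t = 0" if "\<bar>z - t\<bar> < abs z - 1" for t by (rule r(3)) (use that r in linarith)
 have z1: "0 < abs z - 1" using z by simp
 note H = hilbert_outside[OF \<phi> z1 d]
 have "norm (LI t. \<phi> t / of_real (z - t)) \<le> (LI t. norm (\<phi> t / of_real (z - t)))" by (rule integral_norm_bound)
 also have "... \<le> (LI t. norm (\<phi> t) * (1 / (abs z - 1)))" proof (rule integral_mono)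
  fix t
  show "norm (\<phi> t / of_real (z - t)) \<le> norm (\<phi> t) * (1 / (abs z - 1))" proof (cases "\<bar>z - t\<bar> < abs z - 1")
   case False
   then have "norm (\<phi> t) / \<bar>z - t\<bar> \<le> norm (\<phi> t) / (abs z - 1)" using z by (intro divide_left_mono) auto
   then show ?thesis by (simp add: norm_divide flip: of_real_diff)
  qed (use d[of t] in simp)
 qed (use H(2) test_function_integrable[OF \<phi>] in auto)
 also have "... = (LI t. norm (\<phi> t)) / (abs z - 1)" by simp
 finally have 1: "norm (LI t. \<phi> t / of_real (z - t)) \<le> (LI t. norm (\<phi> t)) / (abs z - 1)" .
 have "norm (hilbert \<phi> z) = (1 / pi) * norm (LI t. \<phi> t / of_real (z - t))"
  by (subst H(1)) (simp_all only: norm_mult norm_of_real abs_divide abs_one abs_of_pos pi_gt_zero)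
 also have "... \<le> 1 * norm (LI t. \<phi> t / of_real (z - t))" using pi_gt3 by (intro mult_right_mono) auto
 finally show ?thesis using 1 by simp
qed

lemma hilbert_far_tendsto:
 assumes \<phi>: "\<phi> \<in> test_functions I1"
 shows "(\<lambda>n. hilbert \<phi> (x + 2 * real n)) \<longlonglongrightarrow> 0" "(\<lambda>n. hilbert \<phi> (x - 2 * real n)) \<longlonglongrightarrow> 0"
proof -
 have *: "(\<lambda>n. hilbert \<phi> (z n)) \<longlonglongrightarrow> 0" if z: "filterlim (\<lambda>n. \<bar>z n\<bar>) at_top sequentially" for z :: "nat => real" proof (rule Lim_null_comparison)
  show "\<forall>\<^sub>F n in sequentially. norm (hilbert \<phi> (z n)) \<le> (LI t. norm (\<phi> t)) / (\<bar>z n\<bar> - 1)"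
   using z[unfolded filterlim_at_top_dense, rule_format, of 1] by eventually_elim (rule hilbert_far[OF \<phi>])
  have "filterlim (\<lambda>n. -1 + \<bar>z n\<bar>) at_top sequentially" by (rule filterlim_tendsto_add_at_top[OF tendsto_const z])
  then have "filterlim (\<lambda>n. \<bar>z n\<bar> - 1) at_top sequentially" by simp
  then show "(\<lambda>n. (LI t. norm (\<phi> t)) / (\<bar>z n\<bar> - 1)) \<longlonglongrightarrow> 0" by (intro tendsto_divide_0[OF tendsto_const] filterlim_at_top_imp_at_infinity)
 qed
 have "filterlim (\<lambda>n. - abs x + real n) at_top sequentially" by (rule filterlim_tendsto_add_at_top[OF tendsto_const filterlim_real_sequentially])
 then have f: "filterlim (\<lambda>n. \<bar>z n\<bar>) at_top sequentially" if "\<And>n. real n - abs x \<le> \<bar>z n\<bar>" for z :: "nat => real"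
  by (rule filterlim_at_top_mono) (use that in \<open>auto intro!: always_eventually simp: algebra_simps\<close>)
 show "(\<lambda>n. hilbert \<phi> (x + 2 * real n)) \<longlonglongrightarrow> 0" by (rule *[OF f]) linarith
 show "(\<lambda>n. hilbert \<phi> (x - 2 * real n)) \<longlonglongrightarrow> 0" by (rule *[OF f]) linarith
qed

text \<open>A move of y by one period exchanges one end term of the symmetric sum for another. End
  terms vanish in the limit, which extends convergence from [-1, 1] to all y.\<close>

lemma hilbert_sum_shift:
 "(\<Sum>j\<in>{- int n..int n}. hilbert \<phi> (y + 2 - 2 * of_int j)) = (sym_sum (hilbert \<phi>) n y) + hilbert \<phi> (y + 2 + 2 * real n) - hilbert \<phi> (y - 2 * real n)"
proof (induction n)
 case (Suc n)
 show ?case unfolding sum_symmetric_Suc Suc by (simp add: algebra_simps)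
qed simp

lemma hilbert_sum_tendsto:
 assumes \<phi>: "\<phi> \<in> test_functions I1"
 shows "(\<lambda>n. sym_sum (hilbert \<phi>) n y) \<longlonglongrightarrow> periodic_hilbert (periodize \<phi>) y"
proof -
 let ?S = "\<lambda>n y. \<Sum>j\<in>{- int n..int n}. hilbert \<phi> (y - 2 * of_int j)"
 let ?H = "periodic_hilbert (periodize \<phi>)"
 have up: "(\<lambda>n. ?S n (y + 2)) \<longlonglongrightarrow> ?H (y + 2)" if "(\<lambda>n. ?S n y) \<longlonglongrightarrow> ?H y" for y
  using tendsto_diff[OF tendsto_add[OF that hilbert_far_tendsto(1)[OF \<phi>, of "y + 2"]] hilbert_far_tendsto(2)[OF \<phi>, of y]]
  unfolding hilbert_sum_shift periodic_hilbert_shift by simp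
 have down: "(\<lambda>n. ?S n y) \<longlonglongrightarrow> ?H y" if "(\<lambda>n. ?S n (y + 2)) \<longlonglongrightarrow> ?H (y + 2)" for y
  using tendsto_add[OF tendsto_diff[OF that hilbert_far_tendsto(1)[OF \<phi>, of "y + 2"]] hilbert_far_tendsto(2)[OF \<phi>, of y]]
  unfolding hilbert_sum_shift periodic_hilbert_shift by simp
 obtain m where m: "\<bar>y - 2 * of_int m\<bar> \<le> 1" by (rule nearest_even)
 have "(\<lambda>n. ?S n ((y - 2 * of_int m) + 2 * of_int k)) \<longlonglongrightarrow> ?H ((y - 2 * of_int m) + 2 * of_int k)" for k
 proof (induction k rule: int_induct[where k = 0])
  case base
  show ?case using hilbert_sum_tendsto_unit[OF \<phi> m] by simp
 next
  case (step1 i)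
  from up[OF step1(2)] show ?case by (simp add: algebra_simps)
 next
  case (step2 i)
  show ?case by (rule down) (use step2(2) in \<open>simp add: algebra_simps\<close>)
 qed
 from this[of m] show ?thesis by simp
qed

text \<open>The symmetric partial sums of the translates converge, but not boundedly in \<open>y\<close>. Their Cesaro means are
 bounded, as dominated convergence requires.\<close>

lemma Cesaro_tendsto:
 fixes S :: "nat => complex"
 assumes "S \<longlonglongrightarrow> l"
 shows "(\<lambda>n. (\<Sum>m\<le>n. S m) / of_nat (Suc n)) \<longlonglongrightarrow> l"
proof (rule LIMSEQ_I)
 fix e :: real assume e: "0 < e"
 obtain N where N: "\<And>n. n \<ge> N ==> norm (S n - l) < e / 2" using LIMSEQ_D[OF assms, of "e / 2"] e by auto
 define K where "K = (\<Sum>m<N. norm (S m - l))"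
 have K0: "0 \<le> K" by (simp add: K_def sum_nonneg)
 obtain N' where N': "2 * K / e < real N'" using reals_Archimedean2 by blast
 show "\<exists>no. \<forall>n\<ge>no. norm ((\<Sum>m\<le>n. S m) / of_nat (Suc n) - l) < e" proof (intro exI allI impI)
  fix n assume n: "n \<ge> max N N'"
  have split: "{..n} = {..<N} \<union> {N..n}" using n by auto
  have "(\<Sum>m\<le>n. S m) / of_nat (Suc n) - l = (\<Sum>m\<le>n. S m - l) / of_nat (Suc n)" by (simp add: sum_subtractf field_simps del: of_nat_Suc)
  then have "norm ((\<Sum>m\<le>n. S m) / of_nat (Suc n) - l) = norm (\<Sum>m\<le>n. S m - l) / real (Suc n)" by (simp add: norm_divide del: of_nat_Suc)
  also have "... \<le> (\<Sum>m\<le>n. norm (S m - l)) / real (Suc n)" by (intro divide_right_mono norm_sum) auto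
  also have "(\<Sum>m\<le>n. norm (S m - l)) = K + (\<Sum>m\<in>{N..n}. norm (S m - l))" unfolding split K_def by (rule sum.union_disjoint) auto
  also have "(K + (\<Sum>m\<in>{N..n}. norm (S m - l))) / real (Suc n) \<le> (K + real (Suc n) * (e / 2)) / real (Suc n)"
  proof (intro divide_right_mono add_left_mono)
   have "(\<Sum>m\<in>{N..n}. norm (S m - l)) \<le> (\<Sum>m\<in>{N..n}. e / 2)" using N by (intro sum_mono less_imp_le) auto
   also have "... \<le> real (Suc n) * (e / 2)" using e by (simp add: mult_right_mono)
   finally show "(\<Sum>m\<in>{N..n}. norm (S m - l)) \<le> real (Suc n) * (e / 2)" .
  qed auto
  also have "... = K / real (Suc n) + e / 2" by (simp add: add_divide_distrib del: of_nat_Suc)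
  also have "K / real (Suc n) < e / 2" proof -
   have "real N' < real (Suc n)" using n by simp
   then have "2 * K / e < real (Suc n)" using N' by linarith
   then have "2 * K < real (Suc n) * e" using e by (simp add: pos_divide_less_eq)
   then show ?thesis by (simp add: pos_divide_less_eq del: of_nat_Suc) (simp add: mult.commute)
  qed
  finally show "norm ((\<Sum>m\<le>n. S m) / of_nat (Suc n) - l) < e" by simp
 qed
qed

section \<open>Fejer weights and a uniform bound for the means\<close>

definition fejer :: "nat => int => real" where
 "fejer n j = max 0 (1 - \<bar>of_int j\<bar> / (real n + 1))"

abbreviation fejer_mean :: "(real => complex) => nat => real => complex"
 where "fejer_mean f n y \<equiv> \<Sum>j\<in>{- int n..int n}. of_real (fejer n j) * f (y - 2 * of_int j)"

lemma fejer_bounds: "0 \<le> fejer n j" "fejer n j \<le> 1" by (auto simp: fejer_def)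

text \<open>The term \<open>c j\<close> occurs in the partial sums with m \<ge> |j|, which are n + 1
  - |j| out of n + 1.\<close>

lemma fejer_sum:
 fixes c :: "int => complex"
 shows "(\<Sum>m\<le>n. \<Sum>j\<in>{- int m..int m}. c j) / of_nat (Suc n) = (\<Sum>j\<in>{- int n..int n}. of_real (fejer n j) * c j)"
proof -
 have "(\<Sum>m\<le>n. \<Sum>j\<in>{- int m..int m}. c j) = (\<Sum>j\<in>{- int n..int n}. of_real (real n + 1 - \<bar>of_int j\<bar>) * c j)" proof (induction n)
  case (Suc n)
  have "(\<Sum>m\<le>Suc n. \<Sum>j\<in>{- int m..int m}. c j) = (\<Sum>j\<in>{- int n..int n}. of_real (real n + 1 - \<bar>of_int j\<bar>) * c j) + (\<Sum>j\<in>{- int (Suc n)..int (Suc n)}. c j)"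
   by (simp only: sum.atMost_Suc Suc)
  also have "... = (\<Sum>j\<in>{- int n..int n}. of_real (real n + 1 - \<bar>of_int j\<bar>) * c j + c j) + (c (int (Suc n)) + c (- int (Suc n)))"
   unfolding sum_symmetric_Suc sum.distrib by (simp only: ac_simps)
  also have "(\<Sum>j\<in>{- int n..int n}. of_real (real n + 1 - \<bar>of_int j\<bar>) * c j + c j) = (\<Sum>j\<in>{- int n..int n}. of_real (real (Suc n) + 1 - \<bar>of_int j\<bar>) * c j)"
   by (intro sum.cong refl) (simp add: algebra_simps)
  also have "... + (c (int (Suc n)) + c (- int (Suc n))) = (\<Sum>j\<in>{- int (Suc n)..int (Suc n)}. of_real (real (Suc n) + 1 - \<bar>of_int j\<bar>) * c j)" proof -
   have "real (Suc n) + 1 - \<bar>real_of_int (int (Suc n))\<bar> = 1" "real (Suc n) + 1 - \<bar>real_of_int (- int (Suc n))\<bar> = 1" by simp_all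
   then show ?thesis unfolding sum_symmetric_Suc by (simp only: of_real_1 mult_1 ac_simps)
  qed
  finally show ?case .
 qed simp
 moreover have "of_real (fejer n j) * c j = of_real (real n + 1 - \<bar>of_int j\<bar>) * c j / of_nat (Suc n)" if "j \<in> {- int n..int n}" for j proof -
  have "\<bar>real_of_int j\<bar> \<le> real n + 1" using that by auto
  then have "fejer n j = (real n + 1 - \<bar>of_int j\<bar>) / real (Suc n)" by (simp add: fejer_def max_def field_simps)
  then show ?thesis by simp
 qed
 ultimately show ?thesis by (simp add: sum_divide_distrib)
qed

lemma fejer_hilbert_tendsto:
 assumes "\<phi> \<in> test_functions I1"
 shows "(\<lambda>n. fejer_mean (hilbert \<phi>) n y) \<longlonglongrightarrow> periodic_hilbert (periodize \<phi>) y"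
 using Cesaro_tendsto[OF hilbert_sum_tendsto[OF assms, of y]] unfolding fejer_sum .

text \<open>Reflection at m makes 1 / (j - m) odd, so only differences of weights at reflected
  points count. They are at most 2 |j - m| / (n + 1), each term is then at most 2 / (n + 1), and
  there are at most 2 (2 n + 1) terms. With weights cut off sharply the sum would be of logarithmic
  size.\<close>

lemma fejer_reciprocal_bound: "\<bar>\<Sum>j\<in>{- int n..int n}. fejer n j * (1 / of_int (j - m))\<bar> \<le> 4"
proof -
 \<comment> \<open>A is invariant under j -> 2m - j, and the weights vanish on the added
   part.\<close>
 define A where "A = {- int n..int n} \<union> {2 * m - int n..2 * m + int n}"
 let ?S = "\<Sum>j\<in>A. fejer n j * (1 / of_int (j - m))"
 have out: "fejer n j = 0" if "j \<notin> {- int n..int n}" for j proof -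
  have "int n + 1 \<le> \<bar>j\<bar>" using that by auto
  then have "real n + 1 \<le> \<bar>real_of_int j\<bar>" by linarith
  then show ?thesis by (simp add: fejer_def divide_simps max_def)
 qed
 have S: "(\<Sum>j\<in>{- int n..int n}. fejer n j * (1 / of_int (j - m))) = ?S" by (rule sum.mono_neutral_left) (auto simp: A_def out)
 have reflect: "?S = (\<Sum>j\<in>A. - (fejer n (2 * m - j) * (1 / of_int (j - m))))"
 proof (rule sum.reindex_bij_witness[of _ "\<lambda>j. 2 * m - j" "\<lambda>j. 2 * m - j"])
  fix j assume "j \<in> A"
  show "- (fejer n (2 * m - (2 * m - j)) * (1 / of_int (2 * m - j - m))) = fejer n j * (1 / of_int (j - m))"
   by simp (metis minus_diff_eq minus_divide_right)
 qed (auto simp: A_def)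
 have "2 * ?S = (\<Sum>j\<in>A. (fejer n j - fejer n (2 * m - j)) * (1 / of_int (j - m)))" proof -
  have "2 * ?S = ?S + (\<Sum>j\<in>A. - (fejer n (2 * m - j) * (1 / of_int (j - m))))" using reflect by linarith
  also have "... = (\<Sum>j\<in>A. (fejer n j - fejer n (2 * m - j)) * (1 / of_int (j - m)))" unfolding sum.distrib[symmetric] proof (rule sum.cong[OF refl])
   fix j
   show "fejer n j * (1 / of_int (j - m)) + - (fejer n (2 * m - j) * (1 / of_int (j - m))) = (fejer n j - fejer n (2 * m - j)) * (1 / of_int (j - m))"
    using left_diff_distrib[of "fejer n j" "fejer n (2 * m - j)" "1 / of_int (j - m)"] by linarith
  qed
  finally show ?thesis .
 qed
 then have "\<bar>2 * ?S\<bar> \<le> (\<Sum>j\<in>A. \<bar>(fejer n j - fejer n (2 * m - j)) * (1 / of_int (j - m))\<bar>)" by (simp only: sum_abs)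
 then have "2 * \<bar>?S\<bar> \<le> (\<Sum>j\<in>A. \<bar>(fejer n j - fejer n (2 * m - j)) * (1 / of_int (j - m))\<bar>)" by (simp only: abs_mult abs_numeral)
 also have "... \<le> (\<Sum>j\<in>A. 2 / (real n + 1))" proof (rule sum_mono)
  fix j
  have "\<bar>fejer n j - fejer n (2 * m - j)\<bar> \<le> \<bar>\<bar>real_of_int (2 * m - j)\<bar> / (real n + 1) - \<bar>of_int j\<bar> / (real n + 1)\<bar>" unfolding fejer_def by linarith
  also have "... = \<bar>\<bar>real_of_int (2 * m - j)\<bar> - \<bar>of_int j\<bar>\<bar> / (real n + 1)" by (simp add: diff_divide_distrib[symmetric])
  also have "... \<le> (2 * \<bar>of_int (j - m)\<bar>) / (real n + 1)" proof (rule divide_right_mono)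
   show "\<bar>\<bar>real_of_int (2 * m - j)\<bar> - \<bar>of_int j\<bar>\<bar> \<le> 2 * \<bar>real_of_int (j - m)\<bar>"
    using abs_triangle_ineq3[of "real_of_int (2 * m - j)" "of_int j"] abs_mult[of 2 "real_of_int (m - j)"]
    by (simp add: algebra_simps abs_minus_commute)
  qed simp
  finally have le: "\<bar>fejer n j - fejer n (2 * m - j)\<bar> \<le> (2 * \<bar>of_int (j - m)\<bar>) / (real n + 1)" .
  show "\<bar>(fejer n j - fejer n (2 * m - j)) * (1 / of_int (j - m))\<bar> \<le> 2 / (real n + 1)" proof (cases "j = m")
   case False
   then have p: "0 < \<bar>real_of_int (j - m)\<bar>" by simp
   have "\<bar>(fejer n j - fejer n (2 * m - j)) * (1 / of_int (j - m))\<bar> = \<bar>fejer n j - fejer n (2 * m - j)\<bar> / \<bar>of_int (j - m)\<bar>" by (simp add: abs_mult)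
   also have "... \<le> ((2 * \<bar>of_int (j - m)\<bar>) / (real n + 1)) / \<bar>of_int (j - m)\<bar>" using le p by (intro divide_right_mono) auto
   also have "... = 2 / (real n + 1)" using p by simp
   finally show ?thesis .
  qed simp
 qed
 also have "... = real (card A) * (2 / (real n + 1))" by simp
 also have "... \<le> (2 * (2 * real n + 1)) * (2 / (real n + 1))" proof (rule mult_right_mono)
  have "card A \<le> card {- int n..int n} + card {2 * m - int n..2 * m + int n}" unfolding A_def by (rule card_Un_le)
  also have "... = 2 * (2 * n + 1)" by simp
  finally have "real (card A) \<le> real (2 * (2 * n + 1))" by (rule of_nat_mono)
  then show "real (card A) \<le> 2 * (2 * real n + 1)" by simp
 qed simp
 also have "... \<le> 8" by (simp add: field_simps)
 finally show ?thesis unfolding S by simp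
qed

lemma hilbert_bounded:
 assumes \<phi>: "\<phi> \<in> test_functions E"
 obtains B where "B \<ge> 0" "\<And>x. norm (hilbert \<phi> x) \<le> B"
proof -
 obtain B where B: "B \<ge> 0" "\<And>x \<delta>. norm (Qs \<phi> x \<delta>) \<le> B" using Qs_bound[OF \<phi>] by blast
 have "norm (hilbert \<phi> y) \<le> B" for y proof -
  have "norm (hilbert \<phi> y) = 1 / pi * norm (Qs \<phi> y 0)" by (simp add: hilbert_eq_Qs[OF \<phi>] norm_mult norm_divide)
  also have "... \<le> 1 * norm (Qs \<phi> y 0)" using pi_gt3 by (intro mult_right_mono) auto
  finally show ?thesis using B(2)[of y 0] by simp
 qed
 with B(1) show ?thesis by (rule that)
qed

text \<open>For |x| \<le> 1 and k \<noteq> 0, \<open>hilbert \<phi> (x - 2 * of_int k)\<close> is -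
  M / (2 pi k) + O(1 / k^2), with M the integral of \<phi>. The error sums absolutely; the leading
  terms are handled by \<open>fejer_reciprocal_bound\<close>.\<close>

lemma fejer_hilbert_bound:
 assumes \<phi>: "\<phi> \<in> test_functions I1"
 obtains B where "\<And>n y. norm (fejer_mean (hilbert \<phi>) n y) \<le> B"
proof -
 obtain r where r: "0 < r" "r < 1" "\<And>t. r < abs t ==> \<phi> t = 0" using test_I1_support[OF \<phi>] by blast
 obtain B0 where B0: "B0 \<ge> 0" and pB: "\<And>y. norm (hilbert \<phi> y) \<le> B0" using hilbert_bounded[OF \<phi>] by blast
 define M where "M = (LI t. \<phi> t)"
 define N where "N = (LI t. norm (\<phi> t))"
 have N0: "0 \<le> N" by (simp add: N_def)
 note \<phi>i = test_function_integrable[OF \<phi>]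
 define E where "E = N / (1 - r)"
 have E0: "0 \<le> E" using N0 r by (simp add: E_def)
 have e: "norm (hilbert \<phi> (x - 2 * of_int k) + of_real (1 / (2 * pi)) * M * of_real (1 / of_int k)) \<le> E * (1 / (of_int k)^2)"
  if x: "abs x \<le> 1" and k: "k \<noteq> 0" for x and k :: int
 proof -
  have k1: "1 \<le> \<bar>real_of_int k\<bar>" using k by linarith
  have d: "\<phi> t = 0" if "\<bar>x - 2 * of_int k - t\<bar> < 1 - r" for t by (rule r(3)) (use that x k1 r in linarith)
  have r0: "0 < 1 - r" using r(2) by simp
  have H1: "hilbert \<phi> (x - 2 * of_int k) = of_real (1 / pi) * (LI t. \<phi> t / of_real (x - 2 * of_int k - t))" by (rule hilbert_outside(1)[OF \<phi> r0 d])
  have i: "Lintegrable (\<lambda>t. \<phi> t / of_real (x - 2 * of_int k - t))" by (rule hilbert_outside(2)[OF \<phi> r0 d])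
  have "hilbert \<phi> (x - 2 * of_int k) + of_real (1 / (2 * pi)) * M * of_real (1 / of_int k)
   = of_real (1 / pi) * ((LI t. \<phi> t / of_real (x - 2 * of_int k - t)) + (LI t. of_real (1 / (2 * of_int k)) * \<phi> t))"
   unfolding H1 by (simp only: M_def distrib_left integral_mult_right_zero) simp
  also have "(LI t. \<phi> t / of_real (x - 2 * of_int k - t)) + (LI t. of_real (1 / (2 * of_int k)) * \<phi> t)
   = (LI t. \<phi> t / of_real (x - 2 * of_int k - t) + of_real (1 / (2 * of_int k)) * \<phi> t)" using i \<phi>i by (intro bochner_add[symmetric]) auto
  finally have eq: "hilbert \<phi> (x - 2 * of_int k) + of_real (1 / (2 * pi)) * M * of_real (1 / of_int k) =
   of_real (1 / pi) * (LI t. \<phi> t / of_real (x - 2 * of_int k - t) + of_real (1 / (2 * of_int k)) * \<phi> t)" .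
  have "norm (LI t. \<phi> t / of_real (x - 2 * of_int k - t) + of_real (1 / (2 * of_int k)) * \<phi> t) \<le>
   (LI t. norm (\<phi> t / of_real (x - 2 * of_int k - t) + of_real (1 / (2 * of_int k)) * \<phi> t))" by (rule integral_norm_bound)
  also have "... \<le> (LI t. (1 / (1 - r) * (1 / (of_int k)^2)) * norm (\<phi> t))" proof (rule integral_mono)
   fix t
   show "norm (\<phi> t / of_real (x - 2 * of_int k - t) + of_real (1 / (2 * of_int k)) * \<phi> t) \<le> (1 / (1 - r) * (1 / (of_int k)^2)) * norm (\<phi> t)"
   proof (cases "abs t \<le> r")
    case True
    define D where "D = x - 2 * of_int k - t"
    \<comment> \<open>The distance |x - 2k - t| is at least 2 |k| - 1 - r, and this is at least (1 -
      r) |k| because |k| \<ge> 1.\<close>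
    have "(1 - r) * (\<bar>of_int k\<bar> - 1) \<le> 2 * (\<bar>of_int k\<bar> - 1)" using k1 r by (intro mult_right_mono) auto
    then have "(1 - r) * \<bar>of_int k\<bar> \<le> 2 * \<bar>of_int k\<bar> - 2 + (1 - r)" by (simp add: algebra_simps)
    then have Dk: "(1 - r) * \<bar>of_int k\<bar> \<le> \<bar>D\<bar>" unfolding D_def using x True r by linarith
    have kp: "0 < (1 - r) * \<bar>real_of_int k\<bar>" using k1 r by simp
    then have D0: "D \<noteq> 0" using Dk by auto
    have "1 / D + 1 / (2 * of_int k) = (x - t) / (D * (2 * of_int k))" using D0 k by (simp add: field_simps D_def)
    then have "\<bar>1 / D + 1 / (2 * of_int k)\<bar> = \<bar>x - t\<bar> / (abs D * (2 * \<bar>of_int k\<bar>))" by (simp add: abs_mult)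
    also have "... \<le> 2 / (((1 - r) * \<bar>of_int k\<bar>) * (2 * \<bar>of_int k\<bar>))" using x True r Dk kp k1 by (intro frac_le mult_right_mono mult_pos_pos) auto
    also have "... = 1 / (1 - r) * (1 / (of_int k)^2)" by (simp add: power2_eq_square)
    finally have le: "\<bar>1 / D + 1 / (2 * of_int k)\<bar> \<le> 1 / (1 - r) * (1 / (of_int k)^2)" .
    have "\<phi> t / of_real D + of_real (1 / (2 * of_int k)) * \<phi> t = of_real (1 / D + 1 / (2 * of_int k)) * \<phi> t" by (simp add: distrib_right)
    then have "norm (\<phi> t / of_real D + of_real (1 / (2 * of_int k)) * \<phi> t) = \<bar>1 / D + 1 / (2 * of_int k)\<bar> * norm (\<phi> t)"
     by (simp only: norm_mult norm_of_real)
    then show ?thesis using mult_right_mono[OF le norm_ge_zero[of "\<phi> t"]] unfolding D_def by simp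
   next
    case False
    then have "\<phi> t = 0" by (intro r) simp
    then show ?thesis by simp
   qed
  qed (use i \<phi>i in auto)
  also have "... = E * (1 / (of_int k)^2)" by (simp add: E_def N_def)
  finally have 1: "norm (LI t. \<phi> t / of_real (x - 2 * of_int k - t) + of_real (1 / (2 * of_int k)) * \<phi> t) \<le> E * (1 / (of_int k)^2)" .
  have "norm (of_real (1 / pi) * z) \<le> norm z" for z :: complex proof -
   have "1 / pi * norm z \<le> 1 * norm z" using pi_gt3 by (intro mult_right_mono) auto
   then show ?thesis by (simp add: norm_mult norm_divide)
  qed
  with 1 show ?thesis unfolding eq by (meson order_trans)
 qed
 have sq: "(\<Sum>k\<in>{- int K..int K}. 1 / (real_of_int k)^2) \<le> 4" for K proof -
  have "(\<Sum>k\<in>{- int K..int K}. 1 / (real_of_int k)^2) \<le> 4 - 2 / real K" proof (induction K)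
   case (Suc K)
   have "1 / (real (Suc K))^2 \<le> 1 / real K - 1 / real (Suc K)" if "K \<noteq> 0" proof -
    have "1 / real K - 1 / real (Suc K) = 1 / (real K * real (Suc K))" using that by (simp add: field_simps)
    moreover have "1 / (real (Suc K))^2 \<le> 1 / (real K * real (Suc K))"
     unfolding power2_eq_square using that by (intro divide_left_mono mult_right_mono mult_pos_pos) auto
    ultimately show ?thesis by linarith
   qed
   moreover have "(\<Sum>k\<in>{- int (Suc K)..int (Suc K)}. 1 / (real_of_int k)^2) = 2 * (1 / (real (Suc K))^2) + (\<Sum>k\<in>{- int K..int K}. 1 / (real_of_int k)^2)"
    unfolding sum_symmetric_Suc by (simp del: of_nat_Suc)
   ultimately show ?case using Suc by (cases "K = 0") (simp_all add: add_increasing2 del: of_nat_Suc, simp)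
  qed simp
  moreover have "0 \<le> 2 / real K" by simp
  ultimately show ?thesis by linarith
 qed
 show ?thesis proof (rule that)
  fix n :: nat and y :: real
  obtain m where m: "\<bar>y - 2 * of_int m\<bar> \<le> 1" by (rule nearest_even)
  define x where "x = y - 2 * of_int m"
  define c where "c = complex_of_real (1 / (2 * pi)) * M"
  \<comment> \<open>Adding the leading term leaves a summable remainder. For j = m the convention 1
    / 0 = 0 leaves \<open>hilbert \<phi> x\<close> itself, which B0 bounds.\<close>
  define \<tau> where "\<tau> j = hilbert \<phi> (y - 2 * of_int j) + c * of_real (1 / of_int (j - m))" for j :: int
  have yx: "y - 2 * of_int j = x - 2 * of_int (j - m)" for j :: int by (simp add: x_def algebra_simps)
  have \<tau>b: "norm (\<tau> j) \<le> (if j = m then B0 else 0) + E * (1 / (of_int (j - m))^2)" for j proof (cases "j = m")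
   case True then show ?thesis using pB by (simp add: \<tau>_def)
  next
   case False
   then show ?thesis using e[of x "j - m"] m unfolding \<tau>_def yx c_def by (simp add: x_def)
  qed
  have "(fejer_mean (hilbert \<phi>) n y) =
   (\<Sum>j\<in>{- int n..int n}. of_real (fejer n j) * \<tau> j) - c * of_real (\<Sum>j\<in>{- int n..int n}. fejer n j * (1 / of_int (j - m)))"
   unfolding \<tau>_def by (simp add: sum_distrib_left sum_subtractf[symmetric] algebra_simps)
  then have "norm (fejer_mean (hilbert \<phi>) n y) \<le>
   norm (\<Sum>j\<in>{- int n..int n}. of_real (fejer n j) * \<tau> j) + norm c * \<bar>\<Sum>j\<in>{- int n..int n}. fejer n j * (1 / of_int (j - m))\<bar>"
   by (simp only: norm_mult[symmetric] norm_of_real[symmetric, where 'a=complex]) (rule norm_triangle_ineq4)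
  also have "... \<le> (B0 + E * 4) + norm c * 4" proof (intro add_mono mult_left_mono fejer_reciprocal_bound)
   have "norm (\<Sum>j\<in>{- int n..int n}. of_real (fejer n j) * \<tau> j) \<le> (\<Sum>j\<in>{- int n..int n}. norm (of_real (fejer n j) * \<tau> j))" by (rule norm_sum)
   also have "... \<le> (\<Sum>j\<in>{- int n..int n}. (if j = m then B0 else 0) + E * (1 / (of_int (j - m))^2))" proof (rule sum_mono)
    fix j
    have "norm (of_real (fejer n j) * \<tau> j) \<le> 1 * norm (\<tau> j)" unfolding norm_mult using fejer_bounds[of n j] by (intro mult_right_mono) auto
    then show "norm (of_real (fejer n j) * \<tau> j) \<le> (if j = m then B0 else 0) + E * (1 / (of_int (j - m))^2)" using \<tau>b[of j] by simp
   qed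
   also have "... = (\<Sum>j\<in>{- int n..int n}. (if j = m then B0 else 0)) + E * (\<Sum>j\<in>{- int n..int n}. 1 / (real_of_int (j - m))^2)"
    by (simp only: sum.distrib sum_distrib_left)
   also have "... \<le> B0 + E * 4" proof (intro add_mono mult_left_mono E0)
    show "(\<Sum>j\<in>{- int n..int n}. (if j = m then B0 else 0)) \<le> B0" using B0 by (subst sum.delta) auto
    define K where "K = n + nat \<bar>m\<bar>"
    have "(\<Sum>j\<in>{- int n..int n}. 1 / (real_of_int (j - m))^2) = (\<Sum>k\<in>(\<lambda>j. j - m) ` {- int n..int n}. 1 / (real_of_int k)^2)"
     by (subst sum.reindex) (auto simp: inj_on_def)
    also have "... \<le> (\<Sum>k\<in>{- int K..int K}. 1 / (real_of_int k)^2)" by (rule sum_mono2) (auto simp: K_def)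
    also have "... \<le> 4" by (rule sq)
    finally show "(\<Sum>j\<in>{- int n..int n}. 1 / (real_of_int (j - m))^2) \<le> 4" .
   qed
   finally show "norm (\<Sum>j\<in>{- int n..int n}. of_real (fejer n j) * \<tau> j) \<le> B0 + E * 4" .
  qed simp
  finally show "norm (fejer_mean (hilbert \<phi>) n y) \<le> (B0 + E * 4) + norm c * 4" unfolding c_def .
 qed
qed

section \<open>The subtransfer operator by transposition\<close>

lemma hilbert_isCont:
 assumes \<phi>: "\<phi> \<in> test_functions E" shows "isCont (hilbert \<phi>) x" unfolding continuous_at_sequentially o_def hilbert_eq_Qs[OF \<phi>]
 by (intro allI impI tendsto_mult_left Qs_tendsto[OF \<phi>] tendsto_const)

lemma hilbert_borel: "\<phi> \<in> test_functions E ==> hilbert \<phi> \<in> borel_measurable borel"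
 by (intro borel_measurable_continuous_onI continuous_at_imp_continuous_on ballI hilbert_isCont)

lemma hilbert_lebesgue: "\<phi> \<in> test_functions E ==> hilbert \<phi> \<in> Lmeasurable"
 by (intro continuous_measurable_lebesgue continuous_at_imp_continuous_on ballI hilbert_isCont)

lemma test_function_continuous: "\<phi> \<in> test_functions E ==> continuous_on S \<phi>" by (rule smooth_continuous[OF test_function_smooth])

lemma test_function_lebesgue: "\<phi> \<in> test_functions E ==> \<phi> \<in> Lmeasurable" by (rule continuous_measurable_lebesgue[OF test_function_continuous])

lemma integrable_test_mult:
 assumes \<phi>: "\<phi> \<in> test_functions E" and f: "Lintegrable f"
 shows "Lintegrable (\<lambda>t. \<phi> t * f t)"
proof -
 obtain M where M: "\<And>x. norm (\<phi> x) \<le> M" using test_function_bounded[OF \<phi>] by blast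
 show ?thesis by (rule integrable_mult_bounded[OF f test_function_lebesgue[OF \<phi>] M])
qed

lemma integrable_hilbert_mult:
 assumes \<phi>: "\<phi> \<in> test_functions E" and f: "Lintegrable f"
 shows "Lintegrable (\<lambda>t. hilbert \<phi> t * f t)"
proof -
 obtain M where M: "\<And>x. norm (hilbert \<phi> x) \<le> M" using hilbert_bounded[OF \<phi>] by blast
 show ?thesis by (rule integrable_mult_bounded[OF f hilbert_lebesgue[OF \<phi>] M])
qed

lemma test_functions_UNIV: "\<phi> \<in> test_functions E ==> \<phi> \<in> test_functions UNIV" using test_functions_mono[of E UNIV] by auto

lemma test_translate:
 assumes \<phi>: "\<phi> \<in> test_functions E" shows "(\<lambda>t. \<phi> (t - a)) \<in> test_functions UNIV"
proof -
 obtain R where R: "R > 0" "\<And>t. abs t > R ==> \<phi> t = 0" using test_function_support[OF \<phi>] by blast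
 show ?thesis proof (rule test_functionsI[of _ "{- (R + abs a)..R + abs a}"])
  show "smooth (\<lambda>t. \<phi> (t - a))" using smooth_affine[OF test_function_smooth[OF \<phi>], of "- a" 1] by simp
  show "\<phi> (t - a) = 0" if "t \<notin> {- (R + abs a)..R + abs a}" for t by (rule R(2)) (use that in auto)
 qed auto
qed

lemma hilbert_translate:
 assumes \<phi>: "\<phi> \<in> test_functions E" shows "hilbert (\<lambda>t. \<phi> (t - a)) y = hilbert \<phi> (y - a)"
proof -
 have e: "y - t - a = y - a - t" "y + t - a = y - a + t" for t by simp_all
 show ?thesis unfolding hilbert_eq_Qs[OF test_translate[OF \<phi>]] hilbert_eq_Qs[OF \<phi>] Qs_def e ..
qed

lemma test_lincomb:
 assumes \<phi>: "\<phi> \<in> test_functions UNIV" and \<psi>: "\<psi> \<in> test_functions UNIV"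
 shows "(\<lambda>t. c * \<phi> t + \<psi> t) \<in> test_functions UNIV"
  and "hilbert (\<lambda>t. c * \<phi> t + \<psi> t) y = c * hilbert \<phi> y + hilbert \<psi> y"
proof -
 obtain R where R: "R > 0" "\<And>t. abs t > R ==> \<phi> t = 0" using test_function_support[OF \<phi>] by blast
 obtain R' where R': "R' > 0" "\<And>t. abs t > R' ==> \<psi> t = 0" using test_function_support[OF \<psi>] by blast
 show t: "(\<lambda>t. c * \<phi> t + \<psi> t) \<in> test_functions UNIV" proof (rule test_functionsI[of _ "{- (R + R')..R + R'}"])
  show "smooth (\<lambda>t. c * \<phi> t + \<psi> t)" by (intro smooth_add smooth_cmult test_function_smooth[OF \<phi>] test_function_smooth[OF \<psi>])
  show "c * \<phi> t + \<psi> t = 0" if "t \<notin> {- (R + R')..R + R'}" for t proof -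
   have "\<phi> t = 0" by (rule R(2)) (use that R R' in auto)
   moreover have "\<psi> t = 0" by (rule R'(2)) (use that R R' in auto)
   ultimately show ?thesis by simp
  qed
 qed auto
 have i: "Lintegrable (\<lambda>t. c * (indicator {0<..} t *\<^sub>R (sdiff \<phi> y t * of_real (Qk t 0))))"
  "Lintegrable (\<lambda>t. indicator {0<..} t *\<^sub>R (sdiff \<psi> y t * of_real (Qk t 0)))"
  by (rule integrable_mult_right Qs_integrable[OF \<phi>, of y 0, unfolded set_integrable_def] Qs_integrable[OF \<psi>, of y 0, unfolded set_integrable_def])+
 have "Qs (\<lambda>t. c * \<phi> t + \<psi> t) y 0 = (LI t. c * (indicator {0<..} t *\<^sub>R (sdiff \<phi> y t * of_real (Qk t 0))) + indicator {0<..} t *\<^sub>R (sdiff \<psi> y t * of_real (Qk t 0)))"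
  unfolding Qs_def set_lebesgue_integral_def by (intro bochner_cong refl) (simp only: scaleR_conv_of_real algebra_simps)
 also have "... = c * Qs \<phi> y 0 + Qs \<psi> y 0" unfolding bochner_add[OF i] integral_mult_right_zero Qs_def set_lebesgue_integral_def ..
 finally show "hilbert (\<lambda>t. c * \<phi> t + \<psi> t) y = c * hilbert \<phi> y + hilbert \<psi> y"
  unfolding hilbert_eq_Qs[OF t] hilbert_eq_Qs[OF \<phi>] hilbert_eq_Qs[OF \<psi>] by (simp only: distrib_left mult.left_commute)
qed

lemma test_zero: "(\<lambda>_. 0) \<in> test_functions E" by (rule test_functionsI[of _ "{}"]) auto

lemma test_sum:
 assumes "finite A" "\<And>i. i \<in> A ==> \<phi> i \<in> test_functions UNIV"
 shows "(\<lambda>t. \<Sum>i\<in>A. c i * \<phi> i t) \<in> test_functions UNIV \<and> (\<forall>y. hilbert (\<lambda>t. \<Sum>i\<in>A. c i * \<phi> i t) y = (\<Sum>i\<in>A. c i * hilbert (\<phi> i) y))" using assms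
proof (induction A rule: finite_induct)
 case empty
 have "hilbert (\<lambda>t. 0) y = 0" for y unfolding hilbert_eq_Qs[OF test_zero[of UNIV]] by (simp add: Qs_def)
 then show ?case by (simp add: test_zero)
next
 case (insert i A)
 then have IH: "(\<lambda>t. \<Sum>i\<in>A. c i * \<phi> i t) \<in> test_functions UNIV"
  "\<And>y. hilbert (\<lambda>t. \<Sum>i\<in>A. c i * \<phi> i t) y = (\<Sum>i\<in>A. c i * hilbert (\<phi> i) y)" by auto
 have \<phi>: "\<phi> i \<in> test_functions UNIV" using insert by simp
 show ?case using test_lincomb[OF \<phi> IH(1), of "c i"] insert(1,2) by (simp add: IH(2))
qed

text \<open>A finite substitute for \<open>periodize q - q\<close>, the transpose of
  \<open>Sigma2\<close>: the Fejer mean without its central term. A finite combination of translates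
  of a test function is again a test function, so every distribution can be evaluated at it.\<close>

definition fejer_shift :: "(real => complex) => nat => real => complex" where
 "fejer_shift q n y = (\<Sum>j\<in>{- int n..int n}. (if j = 0 then 0 else of_real (fejer n j)) * q (y - 2 * of_int j))"

lemma fejer_shift_eq: "fejer_shift q n y = (fejer_mean q n y) - q y"
proof -
 have 0: "(0::int) \<in> {- int n..int n}" by simp
 have f0: "fejer n 0 = 1" by (simp add: fejer_def)
 have "(fejer_mean q n y) = q y + (\<Sum>j\<in>{- int n..int n} - {0}. of_real (fejer n j) * q (y - 2 * of_int j))"
  by (subst sum.remove[OF _ 0]) (simp_all add: f0)
 moreover have "fejer_shift q n y = (\<Sum>j\<in>{- int n..int n} - {0}. of_real (fejer n j) * q (y - 2 * of_int j))"
  unfolding fejer_shift_def by (subst sum.remove[OF _ 0]) (auto intro!: sum.cong)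
 ultimately show ?thesis by simp
qed

lemma fejer_shift_test:
 assumes \<phi>: "\<phi> \<in> test_functions E"
 shows "fejer_shift \<phi> n \<in> test_functions UNIV" and "hilbert (fejer_shift \<phi> n) y = fejer_shift (hilbert \<phi>) n y"
 using test_sum[of "{- int n..int n}" "\<lambda>j t. \<phi> (t - 2 * of_int j)" "\<lambda>j. if j = 0 then 0 else of_real (fejer n j)"] test_translate[OF \<phi>]
 unfolding fejer_shift_def[abs_def] hilbert_translate[OF \<phi>] by blast+

text \<open>The remaining translates are supported at distance at least 2 - r > 1 from 0, so the
  inversion carries them into a compact part of \<open>]-\<beta>, \<beta>[\<close>.\<close>

lemma fejer_shift_eq_0:
 assumes r: "r < 1" "\<And>t. r < abs t ==> \<phi> t = 0" and y: "abs y < 2 - r"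
 shows "fejer_shift \<phi> n y = 0" unfolding fejer_shift_def
proof (rule sum.neutral, intro ballI)
 fix j :: int
 show "(if j = 0 then 0 else complex_of_real (fejer n j)) * \<phi> (y - 2 * real_of_int j) = 0" proof (cases "j = 0")
  case False
  then have "1 \<le> \<bar>real_of_int j\<bar>" by linarith
  then have "r < \<bar>y - 2 * real_of_int j\<bar>" using y by linarith
  then show ?thesis by (simp add: r(2))
 qed simp
qed

text \<open>At each y at most one translate is alive, so the mean is one weight times one value, and
  that weight tends to 1.\<close>

lemma fejer_translates:
 assumes \<phi>: "\<phi> \<in> test_functions I1"
 shows "(\<lambda>n. fejer_mean \<phi> n y) \<longlonglongrightarrow> periodize \<phi> y"
  and "(\<And>x. norm (\<phi> x) \<le> M) ==> norm (fejer_mean \<phi> n y) \<le> M"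
proof -
 obtain r where r: "0 < r" "r < 1" "\<And>t. r < abs t ==> \<phi> t = 0" using test_I1_support[OF \<phi>] by blast
 obtain m where m: "\<bar>y - 2 * of_int m\<bar> \<le> 1" by (rule nearest_even)
 have other: "\<phi> (y - 2 * of_int j) = 0" if "j \<noteq> m" for j proof (rule r(3))
  have "1 \<le> \<bar>real_of_int (j - m)\<bar>" using that by linarith
  then show "r < \<bar>y - 2 * of_int j\<bar>" using m r(2) unfolding of_int_diff by linarith
 qed
 have p: "periodize \<phi> y = \<phi> (y - 2 * of_int m)" by (rule periodize_local[of r]) (use r m in auto)
 have S: "(fejer_mean \<phi> n y) = (if \<bar>m\<bar> \<le> int n then of_real (fejer n m) * \<phi> (y - 2 * of_int m) else 0)" for n proof -
  have "(fejer_mean \<phi> n y) = (\<Sum>j\<in>{- int n..int n}. if j = m then of_real (fejer n m) * \<phi> (y - 2 * of_int m) else 0)"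
   by (intro sum.cong refl) (simp add: other)
  also have "... = (if m \<in> {- int n..int n} then of_real (fejer n m) * \<phi> (y - 2 * of_int m) else 0)" by (rule sum.delta) simp
  also have "m \<in> {- int n..int n} \<longleftrightarrow> \<bar>m\<bar> \<le> int n" by auto
  finally show ?thesis .
 qed
 show "(\<lambda>n. fejer_mean \<phi> n y) \<longlonglongrightarrow> periodize \<phi> y" proof (rule Lim_transform_eventually)
  have "(\<lambda>n. \<bar>of_int m\<bar> / (real n + 1)) \<longlonglongrightarrow> 0"
   by (intro tendsto_divide_0[OF tendsto_const] filterlim_at_top_imp_at_infinity filterlim_tendsto_add_at_top[OF tendsto_const filterlim_real_sequentially, of 1, simplified add.commute[of 1]])
  then have "(\<lambda>n. fejer n m) \<longlonglongrightarrow> max 0 (1 - 0)" unfolding fejer_def by (intro tendsto_intros)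
  then have "(\<lambda>n. of_real (fejer n m) * \<phi> (y - 2 * of_int m)) \<longlonglongrightarrow> of_real (max 0 (1 - 0)) * \<phi> (y - 2 * of_int m)" by (intro tendsto_intros)
  then show "(\<lambda>n. of_real (fejer n m) * \<phi> (y - 2 * of_int m)) \<longlonglongrightarrow> periodize \<phi> y" by (simp add: p)
  show "\<forall>\<^sub>F n in sequentially. of_real (fejer n m) * \<phi> (y - 2 * of_int m) = (fejer_mean \<phi> n y)"
   using eventually_ge_at_top[of "nat \<bar>m\<bar>"] by eventually_elim (simp add: S)
 qed
 assume M: "\<And>x. norm (\<phi> x) \<le> M"
 have "norm (of_real (fejer n m) * \<phi> (y - 2 * of_int m)) \<le> 1 * norm (\<phi> (y - 2 * of_int m))"
  unfolding norm_mult using fejer_bounds[of n m] by (intro mult_right_mono) auto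
 then show "norm (fejer_mean \<phi> n y) \<le> M" unfolding S using M[of "y - 2 * of_int m"] order_trans[OF norm_ge_zero M] by auto
qed

lemma tendsto_integral_mult:
 fixes q :: "nat => real => complex"
 assumes q: "\<And>n. q n \<in> Lmeasurable" "\<And>x. (\<lambda>n. q n x) \<longlonglongrightarrow> q' x" "\<And>n x. norm (q n x) \<le> B"
  and f: "Lintegrable f"
 shows "(\<lambda>n. LI x. q n x * f x) \<longlonglongrightarrow> (LI x. q' x * f x)"
proof (rule integral_dominated_convergence[where w = "\<lambda>x. B * norm (f x)"])
 have m: "f \<in> Lmeasurable" using f by (rule borel_measurable_integrable)
 have q': "q' \<in> Lmeasurable" by (rule borel_measurable_LIMSEQ_metric[OF q(1)]) (use q(2) in auto)
 show "(\<lambda>x. q' x * f x) \<in> Lmeasurable" "\<And>n. (\<lambda>x. q n x * f x) \<in> Lmeasurable" using m q' q(1) by (auto intro!: borel_measurable_times)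
 show "Lintegrable (\<lambda>x. B * norm (f x))" using f by auto
 show "AE x in lebesgue. (\<lambda>n. q n x * f x) \<longlonglongrightarrow> q' x * f x" using q(2) by (auto intro!: tendsto_mult_right)
 show "\<And>n. AE x in lebesgue. norm (q n x * f x) \<le> B * norm (f x)" using q(3) by (auto simp: norm_mult intro!: mult_right_mono)
qed

text \<open>Dominated convergence against L1 densities needs bounds uniform in n; for the Hilbert
  factor this is what the Fejer weights provide.\<close>

lemma fejer_pairing_tendsto:
 assumes \<phi>: "\<phi> \<in> test_functions I1" and a: "Lintegrable a" and b: "Lintegrable b"
 shows "(\<lambda>n. (LI x. fejer_shift \<phi> n x * a x) - (LI x. hilbert (fejer_shift \<phi> n) x * b x)) \<longlonglongrightarrow>
  (LI x. (periodize \<phi> x - \<phi> x) * a x) - (LI x. (periodic_hilbert (periodize \<phi>) x - hilbert \<phi> x) * b x)"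
proof (intro tendsto_diff)
 obtain M where M: "\<And>x. norm (\<phi> x) \<le> M" using test_function_bounded[OF \<phi>] by blast
 show "(\<lambda>n. LI x. fejer_shift \<phi> n x * a x) \<longlonglongrightarrow> (LI x. (periodize \<phi> x - \<phi> x) * a x)" proof (rule tendsto_integral_mult[OF _ _ _ a])
  show "fejer_shift \<phi> n \<in> Lmeasurable" for n by (rule test_function_lebesgue[OF fejer_shift_test(1)[OF \<phi>]])
  show "(\<lambda>n. fejer_shift \<phi> n x) \<longlonglongrightarrow> periodize \<phi> x - \<phi> x" for x unfolding fejer_shift_eq by (intro tendsto_diff fejer_translates(1)[OF \<phi>] tendsto_const)
  show "norm (fejer_shift \<phi> n x) \<le> M + M" for n x
   unfolding fejer_shift_eq by (rule order_trans[OF norm_triangle_ineq4 add_mono[OF fejer_translates(2)[OF \<phi> M] M]])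
 qed
 obtain B where B: "\<And>n y. norm (fejer_mean (hilbert \<phi>) n y) \<le> B" using fejer_hilbert_bound[OF \<phi>] by blast
 obtain B0 where B0: "\<And>x. norm (hilbert \<phi> x) \<le> B0" using hilbert_bounded[OF \<phi>] by blast
 show "(\<lambda>n. LI x. hilbert (fejer_shift \<phi> n) x * b x) \<longlonglongrightarrow> (LI x. (periodic_hilbert (periodize \<phi>) x - hilbert \<phi> x) * b x)"
 proof (rule tendsto_integral_mult[OF _ _ _ b])
  show "hilbert (fejer_shift \<phi> n) \<in> Lmeasurable" for n by (rule hilbert_lebesgue[OF fejer_shift_test(1)[OF \<phi>]])
  show "(\<lambda>n. hilbert (fejer_shift \<phi> n) x) \<longlonglongrightarrow> periodic_hilbert (periodize \<phi>) x - hilbert \<phi> x" for x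
   unfolding fejer_shift_test(2)[OF \<phi>] fejer_shift_eq by (intro tendsto_diff fejer_hilbert_tendsto[OF \<phi>] tendsto_const)
  show "norm (hilbert (fejer_shift \<phi> n) x) \<le> B + B0" for n x
   unfolding fejer_shift_test(2)[OF \<phi>] fejer_shift_eq by (rule order_trans[OF norm_triangle_ineq4 add_mono[OF B B0]])
 qed
qed

lemma Q_kernel_bound: "\<bar>u / (u^2 + \<delta>^2)\<bar> \<le> 1 / abs \<delta>" if "\<delta> \<noteq> 0" for u \<delta> :: real
proof -
 have "0 \<le> (abs u - abs \<delta>)^2" by simp
 then have "2 * (abs u * abs \<delta>) \<le> u^2 + \<delta>^2" by (simp add: power2_diff)
 moreover have "0 \<le> \<bar>u\<bar> * abs \<delta>" by simp
 ultimately have "abs u * abs \<delta> \<le> u^2 + \<delta>^2" by linarith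
 moreover have "0 < u^2 + \<delta>^2" using that by (simp add: add_nonneg_pos)
 ultimately show ?thesis using that by (simp add: abs_divide divide_simps)
qed

lemma Q_kernel_integrable:
 fixes f :: "real => complex"
 assumes "\<delta> \<noteq> 0" "Lintegrable f"
 shows "Lintegrable (\<lambda>t. f t * of_real (Qk (x - t) \<delta>))"
proof -
 have "(\<lambda>t. complex_of_real (Qk (x - t) \<delta>)) \<in> Lmeasurable"
  using assms(1) by (intro continuous_measurable_lebesgue continuous_intros) (simp add: sum_power2_eq_zero_iff)
 from integrable_mult_bounded[OF assms(2) this, of "1 / abs \<delta>"] Q_kernel_bound[OF assms(1)] show ?thesis by (simp only: norm_of_real mult.commute)
qed

text \<open>With z = s + i \<delta> the point a + i b is - \<beta> / z, and the identity is the real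
  part of \<open>\<beta> / x^2 * (1 / (z + \<beta> / x)) = 1 / (- \<beta> / z - x) + 1 /
  x\<close>.\<close>

lemma inversion_kernel:
 fixes \<beta> s \<delta> x :: real
 assumes "0 < \<delta>" "x \<noteq> 0"
 defines "a \<equiv> - \<beta> * s / (s^2 + \<delta>^2)" and "b \<equiv> \<beta> * \<delta> / (s^2 + \<delta>^2)"
 assumes b: "0 < \<beta>"
 shows "\<beta> / x^2 * ((s - - \<beta> / x) / ((s - - \<beta> / x)^2 + \<delta>^2)) = (a - x) / ((a - x)^2 + b^2) + 1 / x"
proof -
 define N where "N = s^2 + \<delta>^2"
 define D where "D = (s * x + \<beta>)^2 + (\<delta> * x)^2"
 have N: "0 < N" unfolding N_def using assms(1) by (simp add: add_nonneg_pos)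
 have D: "0 < D" unfolding D_def using assms(1,2) by (intro add_nonneg_pos) auto
 have D2: "D = N * x^2 + 2 * s * \<beta> * x + \<beta>^2" by (simp add: D_def N_def power2_eq_square algebra_simps)
 have ax: "a - x = - (\<beta> * s + N * x) / N" unfolding a_def N_def[symmetric] using N by (simp add: field_simps)
 have "((a - x)^2 + b^2) * N^2 = (\<beta> * s + N * x)^2 + (\<beta> * \<delta>)^2" proof -
  have "(- (\<beta> * s + N * x) / N)^2 * N^2 = (\<beta> * s + N * x)^2" "(\<beta> * \<delta> / N)^2 * N^2 = (\<beta> * \<delta>)^2"
   using N unfolding power_mult_distrib[symmetric] by (simp_all del: minus_add_distrib)
  then show ?thesis unfolding ax b_def N_def[symmetric] distrib_right by simp
 qed
 also have "... = N * D" unfolding D2 by (simp add: N_def power2_eq_square algebra_simps)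
 finally have "((a - x)^2 + b^2) * N * N = D * N" by (simp only: power2_eq_square[of N] mult_ac)
 then have "((a - x)^2 + b^2) * N = D" using N by simp
 then have "(a - x)^2 + b^2 = D / N" using N by (simp add: eq_divide_eq)
 then have R: "(a - x) / ((a - x)^2 + b^2) = - (\<beta> * s + N * x) / D" unfolding ax using N D by simp
 have sx: "s - - \<beta> / x = (s * x + \<beta>) / x" using assms(2) by (simp add: field_simps)
 have "(s - - \<beta> / x)^2 + \<delta>^2 = D / x^2" unfolding sx D_def using assms(2) by (simp add: field_simps power2_eq_square)
 then have L: "\<beta> / x^2 * ((s - - \<beta> / x) / ((s - - \<beta> / x)^2 + \<delta>^2)) = \<beta> * (s * x + \<beta>) / (x * D)"
  unfolding sx using assms(2) D by (simp add: field_simps power2_eq_square)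
 have "- (\<beta> * s + N * x) / D + 1 / x = (- (\<beta> * s + N * x) * x + D) / (x * D)" using D assms(2) by (simp add: field_simps)
 also have "- (\<beta> * s + N * x) * x + D = \<beta> * (s * x + \<beta>)" unfolding D2 by (simp add: power2_eq_square algebra_simps)
 finally show ?thesis unfolding L R ..
qed

text \<open>The kernel of the inverted function is the old kernel plus \<open>1 / x\<close>, whence the constant \<open>c\<close>; densities of mean
 zero do not see it.\<close>

lemma hilbert_inversion:
 assumes \<psi>: "\<psi> \<in> test_functions UNIV" and r: "0 < r" "\<And>t. abs t < r ==> \<psi> t = 0" and \<beta>: "0 < \<beta>"
 obtains c where "(\<lambda>s. \<psi> (- \<beta> / s)) \<in> test_functions {- (\<beta> / r)..\<beta> / r}"
  "\<And>s. s \<noteq> 0 ==> hilbert (\<lambda>s. \<psi> (- \<beta> / s)) s = hilbert \<psi> (- \<beta> / s) + c"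
proof -
 let ?\<psi> = "\<lambda>s. \<psi> (- \<beta> / s)"
 obtain R where R: "R > 0" "\<And>t. abs t > R ==> \<psi> t = 0" using test_function_support[OF \<psi>] by blast
 have test: "?\<psi> \<in> test_functions {- (\<beta> / r)..\<beta> / r}" proof (rule test_functionsI[of _ "{- (\<beta> / r)..\<beta> / r}"])
  show "smooth ?\<psi>" proof (rule smooth_inversion[OF test_function_smooth[OF \<psi>] _ r(1) \<beta>, of R])
   fix t assume "t \<notin> {r..R} \<union> {- R..- r}"
   then have "abs t < r \<or> R < abs t" by auto
   then show "\<psi> t = 0" using r(2) R(2) by blast
  qed
  fix s assume s: "s \<notin> {- (\<beta> / r)..\<beta> / r}"
  then have "\<beta> / r < abs s" by auto
  moreover have "0 < \<beta> / r" using r \<beta> by simp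
  ultimately have "0 < abs s" "\<beta> < r * abs s" using r(1) by (linarith, simp add: pos_divide_less_eq mult.commute)
  then have "\<bar>- \<beta> / s\<bar> < r" using \<beta> by (simp add: abs_divide pos_divide_less_eq)
  then show "?\<psi> s = 0" by (rule r(2))
 qed auto
 define c where "c = (LI x. \<psi> x * of_real (1 / x))"
 have \<psi>i: "Lintegrable \<psi>" "Lintegrable ?\<psi>" using test_function_integrable[OF \<psi>] test_function_integrable[OF test] by auto
 \<comment> \<open>For \<delta> > 0 the integrals converge absolutely and the change of variables
   applies; the principal value is reached afterwards through \<open>Qs_tendsto\<close>.\<close>
 have Q: "Qs ?\<psi> s \<delta> = Qs \<psi> (- \<beta> * s / (s^2 + \<delta>^2)) (\<beta> * \<delta> / (s^2 + \<delta>^2)) + c" if \<delta>: "0 < \<delta>" for s \<delta> proof -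
  define a b where "a = - \<beta> * s / (s^2 + \<delta>^2)" and "b = \<beta> * \<delta> / (s^2 + \<delta>^2)"
  have "0 < s^2 + \<delta>^2" using \<delta> by (simp add: add_nonneg_pos)
  then have b0: "b \<noteq> 0" unfolding b_def using \<delta> \<beta> by auto
  define F where "F t = ?\<psi> t * of_real ((s - t) / ((s - t)^2 + \<delta>^2))" for t
  have Fi: "Lintegrable F" unfolding F_def using \<psi>i(2) \<delta> by (intro Q_kernel_integrable) auto
  have JF: "J_fun \<beta> F x = \<psi> x * of_real ((a - x) / ((a - x)^2 + b^2)) + \<psi> x * of_real (1 / x)" for x proof (cases "x = 0")
   case True
   have "\<psi> 0 = 0" by (rule r(2)) (use r in simp)
   then show ?thesis using True by (simp add: J_fun_def)
  next
   case False
   have e: "- \<beta> / (- \<beta> / x) = x" using \<beta> by simp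
   have "J_fun \<beta> F x = \<psi> x * of_real (\<beta> / x^2 * ((s - - \<beta> / x) / ((s - - \<beta> / x)^2 + \<delta>^2)))"
    unfolding J_fun_def F_def e of_real_mult by (simp only: mult_ac)
   also have "... = \<psi> x * of_real ((a - x) / ((a - x)^2 + b^2) + 1 / x)" unfolding inversion_kernel[OF \<delta> False \<beta>] a_def b_def ..
   finally show ?thesis by (simp only: of_real_add distrib_left)
  qed
  have i2: "Lintegrable (\<lambda>x. \<psi> x * of_real ((a - x) / ((a - x)^2 + b^2)))" by (rule Q_kernel_integrable[OF b0 \<psi>i(1)])
  have "Qs ?\<psi> s \<delta> = (LI x. F x)" unfolding F_def using \<delta> by (intro Qs_eq_integral[OF test]) simp
  also have "... = (LI x. J_fun \<beta> F x)" by (rule inversion_integral(2)[OF \<beta> Fi, symmetric])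
  finally have 1: "Qs ?\<psi> s \<delta> = (LI x. J_fun \<beta> F x)" .
  have "c = (LI x. J_fun \<beta> F x - \<psi> x * of_real ((a - x) / ((a - x)^2 + b^2)))" unfolding JF c_def by simp
  also have "... = (LI x. J_fun \<beta> F x) - (LI x. \<psi> x * of_real ((a - x) / ((a - x)^2 + b^2)))"
   by (rule bochner_diff[OF inversion_integral(1)[OF \<beta> Fi] i2])
  also have "(LI x. \<psi> x * of_real ((a - x) / ((a - x)^2 + b^2))) = Qs \<psi> a b" by (rule Qs_eq_integral[OF \<psi> b0, symmetric])
  finally show ?thesis using 1 unfolding a_def b_def by simp
 qed
 have "hilbert ?\<psi> s = hilbert \<psi> (- \<beta> / s) + of_real (1 / pi) * c" if s: "s \<noteq> 0" for s proof -
  let ?d = "\<lambda>n. 1 / real (Suc n)"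
  have d0: "?d \<longlonglongrightarrow> 0" using LIMSEQ_inverse_real_of_nat by (simp only: inverse_eq_divide)
  have s2: "s^2 + 0^2 \<noteq> 0" using s by simp
  have "(\<lambda>n. Qs \<psi> (- \<beta> * s / (s^2 + (?d n)^2)) (\<beta> * ?d n / (s^2 + (?d n)^2)) + c) \<longlonglongrightarrow> Qs \<psi> (- \<beta> * s / (s^2 + 0^2)) (\<beta> * 0 / (s^2 + 0^2)) + c"
   by (intro tendsto_add Qs_tendsto[OF \<psi>] tendsto_divide tendsto_mult tendsto_power tendsto_const d0 s2)
  then have "(\<lambda>n. Qs ?\<psi> s (?d n)) \<longlonglongrightarrow> Qs \<psi> (- \<beta> * s / (s^2 + 0^2)) (\<beta> * 0 / (s^2 + 0^2)) + c" by (subst Q) auto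
  moreover have "(\<lambda>n. Qs ?\<psi> s (?d n)) \<longlonglongrightarrow> Qs ?\<psi> s 0" by (rule Qs_tendsto[OF test tendsto_const d0])
  ultimately have "Qs ?\<psi> s 0 = Qs \<psi> (- \<beta> * s / (s^2 + 0^2)) (\<beta> * 0 / (s^2 + 0^2)) + c" by (rule LIMSEQ_unique[rotated])
  moreover have "- \<beta> * s / (s^2 + 0^2) = - \<beta> / s" using s by (simp add: power2_eq_square)
  ultimately show ?thesis unfolding hilbert_eq_Qs[OF test] hilbert_eq_Qs[OF \<psi>] by (simp add: distrib_left)
 qed
 with test show ?thesis by (rule that)
qed

lemma integral_J_mult:
 assumes \<beta>: "0 < \<beta>" and q: "q \<in> borel_measurable borel" "\<And>x. norm (q x) \<le> B" and f: "Lintegrable f"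
 shows "(LI x. q x * J_fun \<beta> f x) = (LI s. q (- \<beta> / s) * f s)"
  and "Lintegrable (\<lambda>s. q (- \<beta> / s) * f s)"
proof -
 have "(\<lambda>s::real. - \<beta> / s) \<in> borel_measurable borel" by measurable
 then have "(\<lambda>s. q (- \<beta> / s)) \<in> borel_measurable borel" using q(1) by (rule measurable_compose)
 then have "(\<lambda>s. q (- \<beta> / s)) \<in> Lmeasurable" by (intro measurable_completion) simp
 then show i: "Lintegrable (\<lambda>s. q (- \<beta> / s) * f s)" by (rule integrable_mult_bounded[OF f]) (rule q(2))
 have "q x * J_fun \<beta> f x = J_fun \<beta> (\<lambda>s. q (- \<beta> / s) * f s) x" for x using \<beta> by (cases "x = 0") (simp_all add: J_fun_def)
 then show "(LI x. q x * J_fun \<beta> f x) = (LI s. q (- \<beta> / s) * f s)" using inversion_integral(2)[OF \<beta> i] by simp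
qed

text \<open>The transform of the inverted test function and the inverted transform differ by a
  constant, which a density g of mean zero annihilates. Thus \<open>J\<close> is transposed to plain
  composition with the inversion.\<close>

lemma J_pairing:
 assumes \<psi>: "\<psi> \<in> test_functions UNIV" and r: "0 < r" "\<And>t. abs t < r ==> \<psi> t = 0" and \<beta>: "0 < \<beta>"
  and f: "f \<in> L1" and g: "g \<in> L1_0"
 shows "(LI x. \<psi> x * J_fun \<beta> f x) - (LI x. hilbert \<psi> x * J_fun \<beta> g x) = (LI s. \<psi> (- \<beta> / s) * f s) - (LI s. hilbert (\<lambda>s. \<psi> (- \<beta> / s)) s * g s)"
proof -
 have fi: "Lintegrable f" and gi: "Lintegrable g" and g0: "(LI t. g t) = 0" using f g by (auto simp: L1_def L1_0_def)
 obtain c where test: "(\<lambda>s. \<psi> (- \<beta> / s)) \<in> test_functions {- (\<beta> / r)..\<beta> / r}"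
  and c: "\<And>s. s \<noteq> 0 ==> hilbert (\<lambda>s. \<psi> (- \<beta> / s)) s = hilbert \<psi> (- \<beta> / s) + c" using hilbert_inversion[OF \<psi> r \<beta>] by blast
 obtain M where M: "\<And>x. norm (\<psi> x) \<le> M" using test_function_bounded[OF \<psi>] by blast
 obtain B where B: "\<And>x. norm (hilbert \<psi> x) \<le> B" using hilbert_bounded[OF \<psi>] by blast
 have b: "\<psi> \<in> borel_measurable borel" by (rule borel_measurable_continuous_onI[OF test_function_continuous[OF \<psi>]])
 note J = integral_J_mult[OF \<beta> hilbert_borel[OF \<psi>] B gi]
 have "(LI s. hilbert (\<lambda>s. \<psi> (- \<beta> / s)) s * g s) = (LI s. hilbert \<psi> (- \<beta> / s) * g s + c * g s)" proof (rule integral_cong_AE)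
  show "AE s in lebesgue. hilbert (\<lambda>s. \<psi> (- \<beta> / s)) s * g s = hilbert \<psi> (- \<beta> / s) * g s + c * g s"
   using AE_lebesgue_neq[of 0] by eventually_elim (subst c, assumption, rule distrib_right)
 qed (use integrable_hilbert_mult[OF test gi] J(2) gi in \<open>auto intro!: borel_measurable_integrable bochner_integrable_add\<close>)
 also have "... = (LI s. hilbert \<psi> (- \<beta> / s) * g s) + c * (LI s. g s)" using J(2) gi by simp
 finally show ?thesis using integral_J_mult(1)[OF \<beta> b M fi] J(1) g0 by simp
qed

lemma periodic_hilbert_integrable:
 assumes \<phi>: "\<phi> \<in> test_functions I1" and b: "Lintegrable b"
 shows "Lintegrable (\<lambda>x. periodic_hilbert (periodize \<phi>) x * b x)"
proof -
 obtain B where B: "\<And>n y. norm (fejer_mean (hilbert \<phi>) n y) \<le> B" using fejer_hilbert_bound[OF \<phi>] by blast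
 have HB: "norm (periodic_hilbert (periodize \<phi>) x) \<le> B" for x
  by (rule Lim_bounded[OF tendsto_norm[OF fejer_hilbert_tendsto[OF \<phi>]], of 0]) (use B in blast)
 show ?thesis by (intro integrable_mult_bounded[OF b _ HB] continuous_measurable_lebesgue smooth_continuous periodic_hilbert_smooth[OF \<phi>])
qed

lemma periodize_integrable_mult:
 assumes \<phi>: "\<phi> \<in> test_functions I1" and b: "Lintegrable b"
 shows "Lintegrable (\<lambda>x. periodize \<phi> x * b x)"
proof -
 obtain M where M: "\<And>x. norm (\<phi> x) \<le> M" using test_function_bounded[OF \<phi>] by blast
 have HB: "norm (periodize \<phi> x) \<le> M" for x
  by (rule Lim_bounded[OF tendsto_norm[OF fejer_translates(1)[OF \<phi>]], of 0]) (use fejer_translates(2)[OF \<phi> M] in blast)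
 show ?thesis by (intro integrable_mult_bounded[OF b _ HB] continuous_measurable_lebesgue smooth_continuous periodize_smooth[OF \<phi>])
qed

lemma test_interval_subset: "d < b ==> \<phi> \<in> test_functions {- d..d} ==> \<phi> \<in> test_functions {- b<..<b}" for b d :: real
 by (rule subsetD[OF test_functions_mono]) auto

text \<open>A relation in place of the chosen \<open>rep\<close>: any pair may be used, and E may be
  smaller than the domain of u. The minus sign is that of the transposed Hilbert transform.\<close>

definition represents :: "real set => distr => (real => complex) => (real => complex) => bool" where
 "represents E u f g \<longleftrightarrow> f \<in> L1 \<and> g \<in> L1_0 \<and> (\<forall>\<phi>\<in>test_functions E. u \<phi> = (LI t. \<phi> t * f t) - (LI t. hilbert \<phi> t * g t))"

lemma is_rep_represents: "is_rep U (f, g) ==> represents UNIV U f g" by (auto simp: is_rep_def represents_def distr_of_def hilbert_distr_def)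

lemma represents_subset: "represents F u f g ==> E \<subseteq> F ==> represents E u f g" using test_functions_mono[of E F] by (auto simp: represents_def)

lemma represents_restrict: "represents E (restrict u (test_functions E)) f g \<longleftrightarrow> represents E u f g" by (auto simp: represents_def)

lemma LR_on_represents:
 assumes "u \<in> LR_on E" obtains f g where "represents E u f g"
proof -
 from assms obtain U f g where "u = restrict U (test_functions E)" "is_rep U (f, g)" by (auto simp: LR_on_def LR_def)
 then have "represents E u f g" by (simp add: represents_restrict represents_subset[OF is_rep_represents])
 then show ?thesis by (rule that)
qed

lemma represents_LR_on:
 assumes "represents E (restrict u (test_functions E)) f g"
 shows "restrict u (test_functions E) \<in> LR_on E"
proof -
 define U where "U = (\<lambda>\<phi>\<in>test_functions UNIV. distr_of f \<phi> + hilbert_distr g \<phi>)"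
 have "U \<in> LR" using assms unfolding LR_def U_def is_rep_def represents_def by auto
 moreover have "restrict u (test_functions E) = restrict U (test_functions E)" proof (rule restrict_ext)
  fix \<phi> assume \<phi>: "\<phi> \<in> test_functions E"
  then show "u \<phi> = U \<phi>" using assms test_functions_UNIV[OF \<phi>] by (simp add: represents_def U_def distr_of_def hilbert_distr_def)
 qed
 ultimately show ?thesis by (auto simp: LR_on_def)
qed

lemma J_fun_L1:
 assumes "0 < \<beta>" shows "f \<in> L1 ==> J_fun \<beta> f \<in> L1" "g \<in> L1_0 ==> J_fun \<beta> g \<in> L1_0" using inversion_integral[OF assms] by (auto simp: L1_def L1_0_def)

text \<open>The extension and the representations chosen in the definition of \<open>T\<close> drop out: the value is a limit of values of
 \<open>u\<close> at test functions supported in \<open>]-\<beta>, \<beta>[\<close>.\<close>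

lemma T_tendsto:
 assumes \<beta>: "0 < \<beta>" "\<beta> < 1" and u: "u \<in> LR_on I1" and \<phi>: "\<phi> \<in> test_functions I1"
 shows "(\<lambda>n. u (\<lambda>s. fejer_shift \<phi> n (- \<beta> / s))) \<longlonglongrightarrow> T \<beta> u \<phi>"
proof -
 obtain r where r: "0 < r" "r < 1" "\<And>t. r < abs t ==> \<phi> t = 0" using test_I1_support[OF \<phi>] by blast
 define \<psi> where "\<psi> = fejer_shift \<phi>"
 note \<psi> = fejer_shift_test(1)[OF \<phi>, folded \<psi>_def]
 have r1: "0 < 2 - r" using r by simp
 have \<psi>0: "\<psi> n t = 0" if "abs t < 2 - r" for n t unfolding \<psi>_def by (rule fejer_shift_eq_0[OF r(2,3) that])
 have U: "extension u \<in> LR \<and> restrict (extension u) (test_functions I1) = u" proof -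
  have "\<exists>U. U \<in> LR \<and> restrict U (test_functions I1) = u" using u unfolding LR_on_def by blast
  from someI_ex[OF this] show ?thesis by (simp only: extension_def)
 qed
 obtain f1 g1 where rep1: "rep (extension u) = (f1, g1)" by (cases "rep (extension u)")
 have "is_rep (extension u) (rep (extension u))" unfolding rep_def by (rule someI_ex) (use U in \<open>auto simp: LR_def\<close>)
 then have is1: "is_rep (extension u) (f1, g1)" by (simp add: rep1)
 define V where "V = J \<beta> (extension u)"
 have f1: "f1 \<in> L1" "g1 \<in> L1_0" using is1 by (auto simp: is_rep_def)
 have isV: "is_rep V (J_fun \<beta> f1, J_fun \<beta> g1)" unfolding V_def J_def rep1 using J_fun_L1[OF \<beta>(1)] f1 by (simp add: is_rep_def)
 \<comment> \<open>\<open>Pi2\<close> chooses its own pair for V, which may differ from the inverted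
   pair of \<open>extension u\<close>. The two are compared only through the values of V at test
   functions.\<close>
 obtain f2 g2 where rep2: "rep V = (f2, g2)" by (cases "rep V")
 have "is_rep V (rep V)" unfolding rep_def by (rule someI[of "is_rep V", OF isV])
 then have is2: "represents UNIV V f2 g2" by (intro is_rep_represents) (simp add: rep2)
 have L: "Lintegrable f2" "Lintegrable g2" using is2 by (auto simp: represents_def L1_def L1_0_def)
 let ?P = "periodize \<phi>" and ?H = "periodic_hilbert (periodize \<phi>)"
 note Pi = periodize_integrable_mult[OF \<phi> L(1)] periodic_hilbert_integrable[OF \<phi> L(2)]
 have fold: "(LINT x:{-1..1}|lebesgue. q x * periodize h x) = (LI x. q x * h x)"
  if "\<And>x. q (x + 2) = q x" "Lintegrable (\<lambda>x. q x * h x)" for q h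
  using periodize_integral(2)[OF that(2)] unfolding periodize_mult_periodic[where q = q and f = h, OF that(1)] .
 have "T \<beta> u \<phi> = unroll (Pi2 V) \<phi> - V \<phi>" using \<phi> test_functions_UNIV[OF \<phi>] by (simp add: T_def Sigma2_def V_def)
 also have "unroll (Pi2 V) \<phi> = (LINT x:{-1..1}|lebesgue. ?P x * periodize f2 x) - (LINT x:{-1..1}|lebesgue. ?H x * periodize g2 x)"
  using test_functions_UNIV[OF \<phi>] periodize_test[OF \<phi>] periodic_hilbert_test[OF \<phi>]
  by (simp add: unroll_def Pi2_def rep2 periodic_distr_of_def periodic_hilbert_distr_def)
 also have "... = (LI x. ?P x * f2 x) - (LI x. ?H x * g2 x)" by (simp only: fold[OF periodize_shift Pi(1)] fold[OF periodic_hilbert_shift Pi(2)])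
 also have "V \<phi> = (LI x. \<phi> x * f2 x) - (LI x. hilbert \<phi> x * g2 x)" using is2 test_functions_UNIV[OF \<phi>] by (simp add: represents_def)
 also have "(LI x. ?P x * f2 x) - (LI x. ?H x * g2 x) - ... = (LI x. (?P x - \<phi> x) * f2 x) - (LI x. (?H x - hilbert \<phi> x) * g2 x)"
  using Pi integrable_test_mult[OF \<phi> L(1)] integrable_hilbert_mult[OF \<phi> L(2)] by (simp add: left_diff_distrib)
 finally have "(\<lambda>n. (LI x. \<psi> n x * f2 x) - (LI x. hilbert (\<psi> n) x * g2 x)) \<longlonglongrightarrow> T \<beta> u \<phi>" using fejer_pairing_tendsto[OF \<phi> L] by (simp add: \<psi>_def)
 \<comment> \<open>\<open>\<psi> n\<close> vanishes near 0, so \<open>J_pairing\<close> moves the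
   pairing from V back to u, independently of all choices.\<close>
 moreover have "(LI x. \<psi> n x * f2 x) - (LI x. hilbert (\<psi> n) x * g2 x) = u (\<lambda>s. \<psi> n (- \<beta> / s))" for n proof -
  obtain c where test: "(\<lambda>s. \<psi> n (- \<beta> / s)) \<in> test_functions {- (\<beta> / (2 - r))..\<beta> / (2 - r)}" using hilbert_inversion[OF \<psi> r1 \<psi>0 \<beta>(1)] by blast
  have "\<beta> / (2 - r) < 1" using \<beta> r by (simp add: divide_less_eq)
  then have test1: "(\<lambda>s. \<psi> n (- \<beta> / s)) \<in> test_functions I1" unfolding I1_def by (rule test_interval_subset[OF _ test])
  have "(LI x. \<psi> n x * f2 x) - (LI x. hilbert (\<psi> n) x * g2 x) = V (\<psi> n)" using is2 \<psi> by (simp add: represents_def)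
  also have "... = (LI x. \<psi> n x * J_fun \<beta> f1 x) - (LI x. hilbert (\<psi> n) x * J_fun \<beta> g1 x)"
   using is_rep_represents[OF isV] \<psi> by (simp add: represents_def)
  also have "... = (LI s. \<psi> n (- \<beta> / s) * f1 s) - (LI s. hilbert (\<lambda>s. \<psi> n (- \<beta> / s)) s * g1 s)" by (rule J_pairing[OF \<psi> r1 \<psi>0 \<beta>(1) f1])
  also have "... = extension u (\<lambda>s. \<psi> n (- \<beta> / s))" using is_rep_represents[OF is1] test_functions_UNIV[OF test] by (simp add: represents_def)
  also have "... = u (\<lambda>s. \<psi> n (- \<beta> / s))" using U test1 by (metis restrict_apply')
  finally show ?thesis .
 qed
 ultimately show ?thesis by (simp add: \<psi>_def)
qed

text \<open>The limit in \<open>T_tendsto\<close> evaluates u only at functions supported in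
  \<open>]-\<beta>, \<beta>[\<close>. Computing it with an arbitrary pair valid there gives the
  formula by uniqueness of limits.\<close>

lemma T_formula:
 assumes \<beta>: "0 < \<beta>" "\<beta> < 1" and u: "u \<in> LR_on I1" and uf: "represents {-\<beta><..<\<beta>} u f g" and \<phi>: "\<phi> \<in> test_functions I1"
 shows "T \<beta> u \<phi> = (LI x. (periodize \<phi> x - \<phi> x) * J_fun \<beta> f x) - (LI x. (periodic_hilbert (periodize \<phi>) x - hilbert \<phi> x) * J_fun \<beta> g x)"
proof -
 obtain r where r: "0 < r" "r < 1" "\<And>t. r < abs t ==> \<phi> t = 0" using test_I1_support[OF \<phi>] by blast
 define \<psi> where "\<psi> = fejer_shift \<phi>"
 note \<psi> = fejer_shift_test(1)[OF \<phi>, folded \<psi>_def]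
 have r1: "0 < 2 - r" using r by simp
 have \<psi>0: "\<psi> n t = 0" if "abs t < 2 - r" for n t unfolding \<psi>_def by (rule fejer_shift_eq_0[OF r(2,3) that])
 have fg: "f \<in> L1" "g \<in> L1_0" using uf by (auto simp: represents_def)
 then have L: "Lintegrable (J_fun \<beta> f)" "Lintegrable (J_fun \<beta> g)" using J_fun_L1[OF \<beta>(1)] by (auto simp: L1_def L1_0_def)
 have "(LI x. \<psi> n x * J_fun \<beta> f x) - (LI x. hilbert (\<psi> n) x * J_fun \<beta> g x) = u (\<lambda>s. \<psi> n (- \<beta> / s))" for n proof -
  obtain c where test: "(\<lambda>s. \<psi> n (- \<beta> / s)) \<in> test_functions {- (\<beta> / (2 - r))..\<beta> / (2 - r)}" using hilbert_inversion[OF \<psi> r1 \<psi>0 \<beta>(1)] by blast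
  have "\<beta> / (2 - r) < \<beta>" using \<beta> r by (simp add: divide_less_eq)
  then have "(\<lambda>s. \<psi> n (- \<beta> / s)) \<in> test_functions {-\<beta><..<\<beta>}" by (rule test_interval_subset[OF _ test])
  then show ?thesis using uf J_pairing[OF \<psi> r1 \<psi>0 \<beta>(1) fg] by (simp add: represents_def)
 qed
 then have "(\<lambda>n. u (\<lambda>s. \<psi> n (- \<beta> / s))) \<longlonglongrightarrow> (LI x. (periodize \<phi> x - \<phi> x) * J_fun \<beta> f x)
  - (LI x. (periodic_hilbert (periodize \<phi>) x - hilbert \<phi> x) * J_fun \<beta> g x)" using fejer_pairing_tendsto[OF \<phi> L] by (simp add: \<psi>_def)
 then show ?thesis using LIMSEQ_unique T_tendsto[OF \<beta> u \<phi>, folded \<psi>_def] by blast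
qed

section \<open>Densities of the image\<close>

lemma sigma_finite_lebesgue: "sigma_finite_measure (lebesgue :: real measure)"
proof
 let ?A = "range (\<lambda>n::nat. {- real n..real n})"
 have "\<Union> ?A = UNIV" proof (rule UNIV_eq_I[symmetric])
  fix x :: real
  obtain n where "abs x < real n" using reals_Archimedean2 by blast
  then show "x \<in> \<Union> ?A" by (auto intro!: exI[of _ n])
 qed
 moreover have "countable ?A" "?A \<subseteq> sets lebesgue" by auto
 moreover have "\<forall>a\<in>?A. emeasure lebesgue a \<noteq> \<infinity>" by auto
 ultimately show "\<exists>A. countable A \<and> A \<subseteq> sets (lebesgue :: real measure) \<and> \<Union> A = space lebesgue \<and> (\<forall>a\<in>A. emeasure lebesgue a \<noteq> \<infinity>)"
  by (intro exI[of _ ?A]) simp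
qed

interpretation lebesgue: sigma_finite_measure "lebesgue :: real measure" by (rule sigma_finite_lebesgue)

interpretation lebesgue_pair: pair_sigma_finite "lebesgue :: real measure" "lebesgue :: real measure" ..

text \<open>The kernel is evaluated at y - t, not at t - y: this is the transpose of the integral
  over t that occurs in \<open>hilbert \<phi> y\<close>, so Fubini moves the operator from \<phi> to
  the density.\<close>

definition conv :: "(real => real) => (real => complex) => real => complex" where
 "conv \<kappa> q t = (LI y. of_real (\<kappa> (y - t)) * q y)"

context
 fixes \<kappa> :: "real => real" and C :: real and q :: "real => complex"
 assumes \<kappa>: "\<kappa> \<in> borel_measurable borel" and C: "\<And>v. \<bar>\<kappa> v\<bar> \<le> C" and q: "Lintegrable q"
begin

lemma kernel_lebesgue: "(\<lambda>y. complex_of_real (\<kappa> (y - t))) \<in> Lmeasurable"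
proof -
 have "(\<lambda>y. complex_of_real (\<kappa> (y - t))) \<in> borel_measurable borel" using \<kappa> by measurable
 then show ?thesis by (intro measurable_completion) simp
qed

lemma conv_integrable: "Lintegrable (\<lambda>y. of_real (\<kappa> (y - t)) * q y)" by (rule integrable_mult_bounded[OF q kernel_lebesgue, of _ C]) (simp add: C)

lemma norm_kernel_integral: "(LI y. norm (of_real (\<kappa> (y - t)) * q y)) \<le> (LI y. C * norm (q y))"
proof (rule integral_mono)
 show "Lintegrable (\<lambda>y. norm (of_real (\<kappa> (y - t)) * q y))" using conv_integrable by (rule integrable_norm)
 show "Lintegrable (\<lambda>y. C * norm (q y))" using q by auto
 show "norm (of_real (\<kappa> (y - t)) * q y) \<le> C * norm (q y)" for y unfolding norm_mult norm_of_real by (intro mult_right_mono C) simp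
qed

lemma conv_bound: "norm (conv \<kappa> q t) \<le> C * (LI y. norm (q y))"
proof -
 have "norm (conv \<kappa> q t) \<le> (LI y. norm (of_real (\<kappa> (y - t)) * q y))" unfolding conv_def by (rule integral_norm_bound)
 also have "... \<le> (LI y. C * norm (q y))" by (rule norm_kernel_integral)
 finally show ?thesis by simp
qed

lemma kernel_pair_measurable: "(\<lambda>p. complex_of_real (\<kappa> (snd p - fst p)) * q (snd p)) \<in> borel_measurable (lebesgue \<Otimes>\<^sub>M lebesgue)"
proof -
 have id: "(\<lambda>x::real. x) \<in> Lmeasurable" by (intro measurable_completion) simp
 have [measurable]: "(\<lambda>p. snd p) \<in> borel_measurable (lebesgue \<Otimes>\<^sub>M (lebesgue :: real measure))"
  "(\<lambda>p. fst p) \<in> borel_measurable ((lebesgue :: real measure) \<Otimes>\<^sub>M lebesgue)"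
  using measurable_compose[OF measurable_snd id] measurable_compose[OF measurable_fst id] by auto
 have [measurable]: "(\<lambda>p. q (snd p)) \<in> borel_measurable (lebesgue \<Otimes>\<^sub>M lebesgue)"
  by (rule measurable_compose[OF measurable_snd borel_measurable_integrable[OF q]])
 have [measurable]: "\<kappa> \<in> borel_measurable borel" by (rule \<kappa>)
 show ?thesis by measurable
qed

lemma conv_measurable: "conv \<kappa> q \<in> Lmeasurable" unfolding conv_def[abs_def]
 by (rule lebesgue.borel_measurable_lebesgue_integral) (use kernel_pair_measurable in \<open>simp add: case_prod_beta'\<close>)

lemma conv_pairing:
 assumes \<phi>: "Lintegrable \<phi>"
 shows "(LI y. (LI t. \<phi> t * of_real (\<kappa> (y - t))) * q y) = (LI t. \<phi> t * conv \<kappa> q t)"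
proof -
 let ?F = "\<lambda>p. \<phi> (fst p) * (complex_of_real (\<kappa> (snd p - fst p)) * q (snd p))"
 have m: "?F \<in> borel_measurable (lebesgue \<Otimes>\<^sub>M lebesgue)"
  by (rule borel_measurable_times[OF measurable_compose[OF measurable_fst borel_measurable_integrable[OF \<phi>]] kernel_pair_measurable])
 have C0: "0 \<le> C" using C[of 0] by linarith
 have F: "integrable (lebesgue \<Otimes>\<^sub>M lebesgue) ?F" proof (rule lebesgue_pair.Fubini_integrable[OF m])
  show "AE x in lebesgue. Lintegrable (\<lambda>y. ?F (x, y))" using conv_integrable by (intro AE_I2) auto
  show "Lintegrable (\<lambda>x. LI y. norm (?F (x, y)))"
  proof (rule Bochner_Integration.integrable_bound[of lebesgue "\<lambda>x. (C * (LI y. norm (q y))) * norm (\<phi> x)"])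
   show "Lintegrable (\<lambda>x. C * (LI y. norm (q y)) * norm (\<phi> x))" using \<phi> by auto
   show "(\<lambda>x. LI y. norm (?F (x, y))) \<in> Lmeasurable" by (rule lebesgue.borel_measurable_lebesgue_integral) (use m in \<open>simp add: case_prod_beta'\<close>)
   show "AE x in lebesgue. norm (LI y. norm (?F (x, y))) \<le> norm (C * (LI y. norm (q y)) * norm (\<phi> x))" proof (rule AE_I2)
    fix x
    have "(LI y. norm (?F (x, y))) = norm (\<phi> x) * (LI y. norm (of_real (\<kappa> (y - x)) * q y))" by (simp add: norm_mult)
    also have "... \<le> norm (\<phi> x) * (LI y. C * norm (q y))" by (intro mult_left_mono norm_kernel_integral) simp
    finally have "(LI y. norm (?F (x, y))) \<le> C * (LI y. norm (q y)) * norm (\<phi> x)" by (simp add: mult_ac)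
    moreover have "0 \<le> (LI y. norm (?F (x, y)))" by (rule bochner_nonneg) simp
    ultimately show "norm (LI y. norm (?F (x, y))) \<le> norm (C * (LI y. norm (q y)) * norm (\<phi> x))" unfolding real_norm_def by linarith
   qed
  qed
 qed
 have "(LI y. (LI t. \<phi> t * of_real (\<kappa> (y - t))) * q y) = (LI y. LI t. \<phi> t * (of_real (\<kappa> (y - t)) * q y))"
  by (simp only: integral_mult_left_zero[symmetric] mult.assoc)
 also have "... = (LI t. LI y. \<phi> t * (of_real (\<kappa> (y - t)) * q y))" by (rule lebesgue_pair.Fubini_integral) (use F in \<open>simp add: case_prod_beta'\<close>)
 finally show ?thesis by (simp add: conv_def)
qed

end

text \<open>For |v| < 2 the poles at 2j with |j| \<ge> 2 stay out of reach, so these partial sums of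
  the cotangent expansion remain bounded.\<close>

definition far_sum :: "nat => real => real" where
 "far_sum n v = (if \<bar>v\<bar> < 2 then 1 / pi * (\<Sum>j\<in>{2..n}. 1 / (v - 2 * real j) + 1 / (v + 2 * real j)) else 0)"

text \<open>The cotangent kernel without its three poles in \<open>[-2, 2]\<close>.\<close>

definition far_kernel :: "real => real" where
 "far_kernel v = (if \<bar>v\<bar> < 2 then 1 / pi * (pi / 2 * cot (pi * v / 2) - 1 / v - (1 / (v - 2) + 1 / (v + 2))) else 0)"

lemma far_sum_borel [measurable]: "far_sum n \<in> borel_measurable borel" unfolding far_sum_def[abs_def] by measurable

lemma far_kernel_borel: "far_kernel \<in> borel_measurable borel" unfolding far_kernel_def[abs_def] cot_def by measurable

text \<open>A paired term is at most 1 / (j (j - 1)) in absolute value, and these telescope to at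
  most 1.\<close>

lemma far_sum_bound: "\<bar>far_sum n v\<bar> \<le> 1"
proof (cases "abs v < 2")
 case True
 have "(\<Sum>j\<in>{2..n}. \<bar>1 / (v - 2 * real j) + 1 / (v + 2 * real j)\<bar>) \<le> 1 - 1 / real n \<or> n = 0" proof (induction n)
  case (Suc n)
  show ?case proof (cases "n = 0")
   case False
   define j where "j = real (Suc n)"
   have j: "2 \<le> j" using False by (simp add: j_def)
   have v2: "v^2 < 4" using True abs_square_less_1[of "v / 2"] by (simp add: power_divide)
   have D: "4 * j^2 - v^2 > 4 * (j * (j - 1))" using v2 j by (simp add: power2_eq_square algebra_simps)
   have jp: "0 < j * (j - 1)" using j by simp
   have "1 / (v - 2 * j) + 1 / (v + 2 * j) = - (2 * v) / (4 * j^2 - v^2)" proof -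
    have n: "v - 2 * j \<noteq> 0" "v + 2 * j \<noteq> 0" using True j by auto
    have "1 / (v - 2 * j) + 1 / (v + 2 * j) = 2 * v / ((v - 2 * j) * (v + 2 * j))" using n by (simp add: field_simps)
    also have "(v - 2 * j) * (v + 2 * j) = - (4 * j^2 - v^2)" by (simp add: power2_eq_square algebra_simps)
    finally show ?thesis by (simp only: divide_minus_right minus_divide_left)
   qed
   then have "\<bar>1 / (v - 2 * j) + 1 / (v + 2 * j)\<bar> = 2 * abs v / (4 * j^2 - v^2)" using D jp by (simp add: abs_mult)
   also have "... \<le> 4 / (4 * (j * (j - 1)))" using True D jp by (intro frac_le) auto
   also have "... = 1 / (j - 1) - 1 / j" using j by (simp add: field_simps)
   finally have "\<bar>1 / (v - 2 * j) + 1 / (v + 2 * j)\<bar> \<le> 1 / (j - 1) - 1 / j" .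
   then have 1: "\<bar>1 / (v - 2 * real (Suc n)) + 1 / (v + 2 * real (Suc n))\<bar> \<le> 1 / real n - 1 / real (Suc n)" unfolding j_def by simp
   have "{2..Suc n} = insert (Suc n) {2..n}" using False by auto
   then have "(\<Sum>j\<in>{2..Suc n}. \<bar>1 / (v - 2 * real j) + 1 / (v + 2 * real j)\<bar>) =
    \<bar>1 / (v - 2 * real (Suc n)) + 1 / (v + 2 * real (Suc n))\<bar> + (\<Sum>j\<in>{2..n}. \<bar>1 / (v - 2 * real j) + 1 / (v + 2 * real j)\<bar>)"
    by (simp only:) (rule sum.insert; simp)
   then show ?thesis using 1 Suc False by linarith
  qed simp
 qed simp
 then have "(\<Sum>j\<in>{2..n}. \<bar>1 / (v - 2 * real j) + 1 / (v + 2 * real j)\<bar>) \<le> 1" by (elim disjE) (auto intro: order_trans)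
 then have "\<bar>\<Sum>j\<in>{2..n}. 1 / (v - 2 * real j) + 1 / (v + 2 * real j)\<bar> \<le> 1" by (rule order_trans[OF sum_abs])
 then have "1 / pi * \<bar>\<Sum>j\<in>{2..n}. 1 / (v - 2 * real j) + 1 / (v + 2 * real j)\<bar> \<le> 1 * 1" using pi_gt3 by (intro mult_mono) auto
 then show ?thesis using True by (simp add: far_sum_def abs_mult)
qed (simp add: far_sum_def)

lemma far_sum_tendsto: "(\<lambda>n. far_sum n v) \<longlonglongrightarrow> far_kernel v"
proof -
 have pos: "(\<lambda>n. far_sum n v) \<longlonglongrightarrow> far_kernel v" if v: "0 < v" "v < 2" for v proof (rule Lim_transform_eventually)
  show "(\<lambda>n. 1 / pi * (cot_sum n v - 1 / v - (1 / (v - 2) + 1 / (v + 2)))) \<longlonglongrightarrow> far_kernel v"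
   using v unfolding far_kernel_def by (simp only: abs_of_pos if_True) (intro tendsto_intros cot_sum_tendsto)
  show "\<forall>\<^sub>F n in sequentially. 1 / pi * (cot_sum n v - 1 / v - (1 / (v - 2) + 1 / (v + 2))) = far_sum n v" using eventually_ge_at_top[of 1]
  proof eventually_elim
   fix n :: nat assume "1 \<le> n"
   then have "{1..n} = insert 1 {2..n}" by auto
   then have "(\<Sum>j\<in>{1..n}. 1 / (v - 2 * real j) + 1 / (v + 2 * real j)) = (1 / (v - 2) + 1 / (v + 2)) + (\<Sum>j\<in>{2..n}. 1 / (v - 2 * real j) + 1 / (v + 2 * real j))"
    by simp
   then show "1 / pi * (cot_sum n v - 1 / v - (1 / (v - 2) + 1 / (v + 2))) = far_sum n v" using v unfolding far_sum_def cot_sum_def by simp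
  qed
 qed
 consider "0 < v" "v < 2" | "v = 0" | "v < 0" "- 2 < v" | "2 \<le> \<bar>v\<bar>" by linarith
 then show ?thesis proof cases
  case 2
  \<comment> \<open>At 0 the limit is 0 too: the poles at 2 and -2 cancel, and 1 / 0 = 0 as well as
    cot 0 = 0 by convention.\<close>
  have "far_sum n 0 = 0" for n by (simp add: far_sum_def)
  then show ?thesis using 2 by (simp add: far_kernel_def)
 next
  case 3
  have e: "1 / (v - c) = - (1 / (- v + c))" "1 / (v + c) = - (1 / (- v - c))" for c unfolding divide_minus_right[symmetric] by simp_all
  have "far_sum n v = - far_sum n (- v)" for n
   unfolding far_sum_def e minus_add_distrib[symmetric] sum_negf by (simp only: abs_minus_cancel mult_minus_right add.commute minus_zero split: if_split) simp
  moreover have "far_kernel v = - far_kernel (- v)" unfolding far_kernel_def e using 3 by (simp add: algebra_simps)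
  ultimately show ?thesis using pos[of "- v"] 3 by (simp add: tendsto_minus)
 qed (use pos in \<open>auto simp: far_sum_def far_kernel_def\<close>)
qed

lemma far_kernel_bound: "\<bar>far_kernel v\<bar> \<le> 1" by (rule Lim_bounded[OF tendsto_rabs[OF far_sum_tendsto], of 0]) (use far_sum_bound in blast)

lemma far_sum_integrable:
 assumes \<phi>: "\<phi> \<in> test_functions E" shows "Lintegrable (\<lambda>t. of_real (far_sum n (y - t)) * \<phi> t)"
proof (rule integrable_mult_bounded[OF test_function_integrable[OF \<phi>]])
 have "(\<lambda>t. complex_of_real (far_sum n (y - t))) \<in> borel_measurable borel" by measurable
 then show "(\<lambda>t. complex_of_real (far_sum n (y - t))) \<in> Lmeasurable" by (intro measurable_completion) simp
 show "norm (complex_of_real (far_sum n (y - t))) \<le> 1" for t using far_sum_bound by simp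
qed

lemma hilbert_sum_split:
 assumes \<phi>: "\<phi> \<in> test_functions I1" and y: "abs y \<le> 1"
 shows "(\<Sum>j\<in>{- int (Suc n)..int (Suc n)}. hilbert \<phi> (y - 2 * of_int j)) =
  hilbert \<phi> y + hilbert \<phi> (y - 2) + hilbert \<phi> (y + 2) + (LI t. of_real (far_sum (Suc n) (y - t)) * \<phi> t)"
proof (induction n)
 case 0
 have "far_sum (Suc 0) v = 0" for v by (simp add: far_sum_def)
 then show ?case by (simp add: sum_symmetric_Suc del: of_nat_Suc) simp
next
 case (Suc n)
 obtain r where r: "0 < r" "r < 1" "\<And>t. r < abs t ==> \<phi> t = 0" using test_I1_support[OF \<phi>] by blast
 define j where "j = real (Suc (Suc n))"
 have j1: "2 \<le> j" by (simp add: j_def)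
 have r0: "0 < 1 - r" using r by simp
 have d1: "\<phi> t = 0" if "\<bar>y - 2 * j - t\<bar> < 1 - r" for t by (rule r(3)) (use that y j1 r in linarith)
 have d2: "\<phi> t = 0" if "\<bar>y + 2 * j - t\<bar> < 1 - r" for t by (rule r(3)) (use that y j1 r in linarith)
 have H1: "hilbert \<phi> (y - 2 * j) = of_real (1 / pi) * (LI t. \<phi> t / of_real (y - 2 * j - t))"
  "Lintegrable (\<lambda>t. \<phi> t / of_real (y - 2 * j - t))" by (rule hilbert_outside[OF \<phi> r0 d1], assumption)+
 have H2: "hilbert \<phi> (y + 2 * j) = of_real (1 / pi) * (LI t. \<phi> t / of_real (y + 2 * j - t))"
  "Lintegrable (\<lambda>t. \<phi> t / of_real (y + 2 * j - t))" by (rule hilbert_outside[OF \<phi> r0 d2], assumption)+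
 have i: "Lintegrable (\<lambda>t. of_real (far_sum (Suc n) (y - t)) * \<phi> t)" by (rule far_sum_integrable[OF \<phi>])
 have f: "of_real (far_sum (Suc (Suc n)) (y - t)) * \<phi> t = of_real (far_sum (Suc n) (y - t)) * \<phi> t +
   of_real (1 / pi) * (\<phi> t / of_real (y - 2 * j - t) + \<phi> t / of_real (y + 2 * j - t))" for t
 proof (cases "r < abs t")
  case False
  then have v: "\<bar>y - t\<bar> < 2" using y r(2) by linarith
  have "{2..Suc (Suc n)} = insert (Suc (Suc n)) {2..Suc n}" by auto
  then have "far_sum (Suc (Suc n)) (y - t) = far_sum (Suc n) (y - t) + 1 / pi * (1 / ((y - t) - 2 * j) + 1 / ((y - t) + 2 * j))"
   unfolding far_sum_def j_def using v by (simp add: distrib_left del: of_nat_Suc)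
  then show ?thesis by (simp add: distrib_right distrib_left algebra_simps divide_inverse)
 qed (simp add: r(3))
 have "(LI t. of_real (far_sum (Suc (Suc n)) (y - t)) * \<phi> t) = (LI t. of_real (far_sum (Suc n) (y - t)) * \<phi> t) +
  of_real (1 / pi) * ((LI t. \<phi> t / of_real (y - 2 * j - t)) + (LI t. \<phi> t / of_real (y + 2 * j - t)))"
  unfolding f bochner_add[OF i integrable_mult_right[OF bochner_integrable_add[OF H1(2) H2(2)]]]
   integral_mult_right_zero bochner_add[OF H1(2) H2(2)] ..
 then have s: "(LI t. of_real (far_sum (Suc (Suc n)) (y - t)) * \<phi> t) = (LI t. of_real (far_sum (Suc n) (y - t)) * \<phi> t) + (hilbert \<phi> (y - 2 * j) + hilbert \<phi> (y + 2 * j))"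
  unfolding H1(1) H2(1) by (simp only: distrib_left)
 show ?case unfolding sum_symmetric_Suc[of _ "Suc n"] Suc.IH s unfolding j_def by (simp add: algebra_simps)
qed

text \<open>The three nearest poles give the transform at y, y - 2 and y + 2; all others are
  absorbed in a bounded kernel. These three terms become the three copies in
  \<open>T_hilbert_part\<close>.\<close>

lemma periodic_hilbert_split:
 assumes \<phi>: "\<phi> \<in> test_functions I1" and y: "abs y \<le> 1"
 shows "periodic_hilbert (periodize \<phi>) y = hilbert \<phi> y + hilbert \<phi> (y - 2) + hilbert \<phi> (y + 2) + (LI t. \<phi> t * of_real (far_kernel (y - t)))"
proof -
 have "(\<lambda>n. LI t. of_real (far_sum (Suc n) (y - t)) * \<phi> t) \<longlonglongrightarrow> (LI t. of_real (far_kernel (y - t)) * \<phi> t)"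
 proof (rule tendsto_integral_mult[OF _ _ _ test_function_integrable[OF \<phi>]])
  show "(\<lambda>t. complex_of_real (far_sum (Suc n) (y - t))) \<in> Lmeasurable" for n proof -
   have "(\<lambda>t. complex_of_real (far_sum (Suc n) (y - t))) \<in> borel_measurable borel" by measurable
   then show ?thesis by (intro measurable_completion) simp
  qed
  show "(\<lambda>n. complex_of_real (far_sum (Suc n) (y - t))) \<longlonglongrightarrow> of_real (far_kernel (y - t))" for t by (intro tendsto_of_real LIMSEQ_Suc far_sum_tendsto)
  show "norm (complex_of_real (far_sum (Suc n) (y - t))) \<le> 1" for n t using far_sum_bound by simp
 qed
 from tendsto_add[OF tendsto_const this, of "hilbert \<phi> y + hilbert \<phi> (y - 2) + hilbert \<phi> (y + 2)"]
 have "(\<lambda>n. \<Sum>j\<in>{- int (Suc n)..int (Suc n)}. hilbert \<phi> (y - 2 * of_int j)) \<longlonglongrightarrow>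
  hilbert \<phi> y + hilbert \<phi> (y - 2) + hilbert \<phi> (y + 2) + (LI t. of_real (far_kernel (y - t)) * \<phi> t)" unfolding hilbert_sum_split[OF \<phi> y] .
 moreover have "(\<lambda>n. \<Sum>j\<in>{- int (Suc n)..int (Suc n)}. hilbert \<phi> (y - 2 * of_int j)) \<longlonglongrightarrow> periodic_hilbert (periodize \<phi>) y"
  by (rule LIMSEQ_Suc[OF hilbert_sum_tendsto[OF \<phi>]])
 ultimately show ?thesis using LIMSEQ_unique by (simp add: mult.commute)
qed

abbreviation L1_norm :: "(real => complex) => real" where
 "L1_norm f \<equiv> LI t. norm (f t)"

lemma nn_integral_norm: "Lintegrable f ==> (NI x. ennreal (norm (f x))) = ennreal (L1_norm f)" for f :: "real => complex"
 by (rule nn_integral_eq_integral) auto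

lemma L1_norm_nonneg: "0 \<le> L1_norm f" by (rule bochner_nonneg) simp

lemma L1_norm_shift:
 assumes f: "Lintegrable f" shows "L1_norm (\<lambda>x. f (x + c)) = L1_norm f"
proof -
 have "ennreal (L1_norm (\<lambda>x. f (x + c))) = (NI x. ennreal (norm (f (x + c))))" by (rule nn_integral_norm[OF integrable_shift[OF f], symmetric])
 also have "... = (NI x. ennreal (norm (f x)))"
  by (rule nn_integral_shift[where f = "\<lambda>x. ennreal (norm (f x))"]) (use borel_measurable_integrable[OF f] in measurable)
 also have "... = ennreal (L1_norm f)" by (rule nn_integral_norm[OF f])
 finally show ?thesis using L1_norm_nonneg by simp
qed

lemma norm_J_fun: "0 < \<beta> ==> norm (J_fun \<beta> f x) = \<beta> / x^2 * norm (f (- \<beta> / x))" by (simp add: J_fun_def norm_mult norm_divide norm_power)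

lemma L1_norm_J:
 assumes "0 < \<beta>" "Lintegrable f" shows "L1_norm (J_fun \<beta> f) = L1_norm f"
 unfolding norm_J_fun[OF assms(1)] by (rule inversion_integral_real(2)[OF assms(1) integrable_norm[OF assms(2)]])

text \<open>The operator evaluates its argument only at points - \<beta> / (x + 2j) with j \<noteq>
  0, and these lie in \<open>I1\<close>.\<close>

lemma transfer_local:
 assumes b: "0 < \<beta>" "\<beta> < 1"
 shows "transfer \<beta> (\<lambda>x. a x * indicator I1 x) x = transfer \<beta> a x"
proof (cases "x \<in> I1")
 case True
 have "- \<beta> / (x + shift n) \<in> I1" if "n \<noteq> 0" for n proof -
  have "1 < \<bar>x + shift n\<bar>" using shifted_ge_1[of x "int_decode n"] shift_nonzero[OF that] True by (auto simp: I1_def abs_less_iff)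
  then have "\<beta> / \<bar>x + shift n\<bar> < 1" using b by (simp add: divide_less_eq)
  then have "\<bar>- \<beta> / (x + shift n)\<bar> < 1" using b by (simp add: abs_divide)
  moreover have "z \<in> I1" if "abs z < 1" for z using that by (auto simp: I1_def)
  ultimately show ?thesis by blast
 qed
 then show ?thesis unfolding transfer_def by (intro arg_cong2[where f = times] refl suminf_cong) auto
qed (simp add: transfer_def)

lemma transfer_norm_J:
 assumes \<beta>: "0 < \<beta>" and x: "x \<in> I1"
 shows "(\<Sum>n. if n = 0 then 0 else ennreal (norm (J_fun \<beta> f (x + shift n)))) = transfer \<beta> (\<lambda>x. ennreal (norm (f x))) x"
proof -
 have "ennreal (norm (J_fun \<beta> f y)) = ennreal (\<beta> / y^2) * ennreal (norm (f (- \<beta> / y)))" for y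
  unfolding norm_J_fun[OF \<beta>] using \<beta> by (intro ennreal_mult) auto
 then show ?thesis unfolding transfer_def using x by (simp only: indicator_simps mult_1)
qed

text \<open>One period of the periodization, cut out of the line so that it can serve as an
  integrable density.\<close>

definition central :: "(real => complex) => real => complex" where
 "central b y = indicator {-1..1} y *\<^sub>R periodize b y"

lemma central_integrable: "Lintegrable b ==> Lintegrable (central b)"
 using periodize_integral(1) unfolding set_integrable_def central_def[abs_def] by blast

lemma integral_central: "Lintegrable b ==> (LI x. central b x) = (LI x. b x)"
 using periodize_integral(2) unfolding set_lebesgue_integral_def central_def[abs_def] by blast

lemma L1_norm_central:
 assumes b: "Lintegrable b" shows "L1_norm (central b) \<le> L1_norm b"
proof -
 have bm: "(\<lambda>x. ennreal (norm (b x))) \<in> Lmeasurable" using borel_measurable_integrable[OF b] by measurable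
 have "ennreal (L1_norm (central b)) = (NI x. ennreal (norm (central b x)))" by (rule nn_integral_norm[OF central_integrable[OF b], symmetric])
 also have "... \<le> (\<integral>\<^sup>+x\<in>{-1..<1}. (\<Sum>n. ennreal (norm (b (x + shift n)))) \<partial>lebesgue)" proof (rule nn_integral_mono_AE)
  show "AE x in lebesgue. ennreal (norm (central b x)) \<le> (\<Sum>n. ennreal (norm (b (x + shift n)))) * indicator {-1..<1} x"
   using AE_lebesgue_neq[of 1] by eventually_elim (auto simp: central_def indicator_def norm_periodize_le)
 qed
 also have "... = ennreal (L1_norm b)" unfolding nn_integral_periodize[OF bm] nn_integral_norm[OF b] ..
 finally show ?thesis using L1_norm_nonneg by (simp add: ennreal_le_iff)
qed

lemma integral_periodic_fold:
 assumes "\<And>x. q (x + 2) = q x" "Lintegrable (\<lambda>x. q x * h x)"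
 shows "(LI x. q x * central h x) = (LI x. q x * h x)"
 using integral_central[OF assms(2)] unfolding central_def periodize_mult_periodic[where q = q and f = h, OF assms(1)]
 by (simp only: mult_scaleR_right)

text \<open>Translations move the two shifted transforms onto the density, and Fubini does the same
  for the bounded kernel. All pairings left are with \<phi> or with
  \<open>hilbert \<phi>\<close>.\<close>

lemma periodic_hilbert_pairing:
 assumes \<phi>: "\<phi> \<in> test_functions I1" and b: "Lintegrable b"
 shows "(LI x. periodic_hilbert (periodize \<phi>) x * b x) = (LI x. hilbert \<phi> x * (central b x + central b (x - 2) + central b (x + 2)))
  + (LI t. \<phi> t * conv far_kernel (central b) t)"
proof -
 let ?c = "central b" and ?k = "\<lambda>y. LI t. \<phi> t * of_real (far_kernel (y - t))"
 have c: "Lintegrable ?c" by (rule central_integrable[OF b])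
 have cs: "Lintegrable (\<lambda>x. ?c (x - 2))" "Lintegrable (\<lambda>x. ?c (x + 2))"
  using integrable_shift[OF c, of "- 2"] integrable_shift[OF c, of 2] by simp_all
 have i0: "Lintegrable (\<lambda>x. hilbert \<phi> x * ?c x)" by (rule integrable_hilbert_mult[OF \<phi> c])
 have j1: "Lintegrable (\<lambda>x. hilbert \<phi> x * ?c (x + 2))" by (rule integrable_hilbert_mult[OF \<phi> cs(2)])
 have j2: "Lintegrable (\<lambda>x. hilbert \<phi> x * ?c (x - 2))" by (rule integrable_hilbert_mult[OF \<phi> cs(1)])
 have i1: "Lintegrable (\<lambda>x. hilbert \<phi> (x - 2) * ?c x)" using integrable_shift[OF j1, of "- 2"] by simp
 have i2: "Lintegrable (\<lambda>x. hilbert \<phi> (x + 2) * ?c x)" using integrable_shift[OF j2, of 2] by simp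
 have s1: "(LI x. hilbert \<phi> (x - 2) * ?c x) = (LI x. hilbert \<phi> x * ?c (x + 2))" using integral_shift[of "\<lambda>x. hilbert \<phi> x * ?c (x + 2)" "- 2"] by simp
 have s2: "(LI x. hilbert \<phi> (x + 2) * ?c x) = (LI x. hilbert \<phi> x * ?c (x - 2))" using integral_shift[of "\<lambda>x. hilbert \<phi> x * ?c (x - 2)" 2] by simp
 have eq: "periodic_hilbert (periodize \<phi>) x * ?c x = hilbert \<phi> x * ?c x + hilbert \<phi> (x - 2) * ?c x + hilbert \<phi> (x + 2) * ?c x + ?k x * ?c x" for x
 proof (cases "abs x \<le> 1")
  case True
  then show ?thesis unfolding periodic_hilbert_split[OF \<phi> True] by (simp only: distrib_right)
 next
  case False
  then have "?c x = 0" by (auto simp: central_def indicator_def)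
  then show ?thesis by simp
 qed
 have P: "Lintegrable (\<lambda>x. periodic_hilbert (periodize \<phi>) x * ?c x)" by (rule periodic_hilbert_integrable[OF \<phi> c])
 have "Lintegrable (\<lambda>x. periodic_hilbert (periodize \<phi>) x * ?c x - (hilbert \<phi> x * ?c x + hilbert \<phi> (x - 2) * ?c x + hilbert \<phi> (x + 2) * ?c x))"
  using P i0 i1 i2 by (intro bochner_integrable_diff bochner_integrable_add)
 then have ik: "Lintegrable (\<lambda>x. ?k x * ?c x)" unfolding eq by simp
 have "(LI x. periodic_hilbert (periodize \<phi>) x * b x) = (LI x. periodic_hilbert (periodize \<phi>) x * ?c x)"
  by (rule integral_periodic_fold[OF periodic_hilbert_shift periodic_hilbert_integrable[OF \<phi> b], symmetric])
 also have "... = (LI x. hilbert \<phi> x * ?c x) + (LI x. hilbert \<phi> x * ?c (x + 2)) + (LI x. hilbert \<phi> x * ?c (x - 2)) + (LI x. ?k x * ?c x)"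
  unfolding eq s1[symmetric] s2[symmetric] using i0 i1 i2 ik by simp
 also have "(LI x. ?k x * ?c x) = (LI t. \<phi> t * conv far_kernel ?c t)"
  by (rule conv_pairing[OF far_kernel_borel far_kernel_bound c test_function_integrable[OF \<phi>]])
 finally show ?thesis using i0 j1 j2 by (simp add: distrib_left)
qed

text \<open>The convolution comes from the periodic Hilbert transform of the inverted g. Its sign is
  negative because functionals pair g with minus the transform of \<phi>.\<close>

definition T_smooth_part :: "real => (real => complex) => (real => complex) => real => complex" where
 "T_smooth_part \<beta> f g x = indicator I1 x *\<^sub>R (periodize (J_fun \<beta> f) x - J_fun \<beta> f x - conv far_kernel (central (J_fun \<beta> g)) x)"

text \<open>The copies of the period at 2 and -2 vanish on \<open>I1\<close> but cannot be dropped: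
  their Hilbert transforms reach into it and are singular at its end points.\<close>

definition T_hilbert_part :: "real => (real => complex) => real => complex" where
 "T_hilbert_part \<beta> g x = central (J_fun \<beta> g) x + central (J_fun \<beta> g) (x - 2) + central (J_fun \<beta> g) (x + 2) - J_fun \<beta> g x"

text \<open>The fourfold norm bound alone would not survive iteration. Inside \<open>I1\<close> the
  outer copies vanish and only the terms j \<noteq> 0 of the periodization remain, which the
  transfer operator dominates.\<close>

lemma T_hilbert_part:
 assumes \<beta>: "0 < \<beta>" and g: "g \<in> L1_0"
 shows "T_hilbert_part \<beta> g \<in> L1_0" "L1_norm (T_hilbert_part \<beta> g) \<le> 4 * L1_norm g"
  "ennreal (norm (T_hilbert_part \<beta> g x)) * indicator I1 x \<le> transfer \<beta> (\<lambda>x. ennreal (norm (g x))) x"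
proof -
 let ?b = "J_fun \<beta> g" let ?c = "central ?b"
 have b: "Lintegrable ?b" "(LI x. ?b x) = 0" using J_fun_L1(2)[OF \<beta> g] by (auto simp: L1_0_def L1_def)
 have gi: "Lintegrable g" using g by (auto simp: L1_0_def L1_def)
 note c = central_integrable[OF b(1)]
 have cs: "Lintegrable (\<lambda>x. ?c (x - 2))" "Lintegrable (\<lambda>x. ?c (x + 2))"
  using integrable_shift[OF c, of "- 2"] integrable_shift[OF c, of 2] by simp_all
 have cI: "(LI x. ?c (x - 2)) = 0" "(LI x. ?c (x + 2)) = 0" "(LI x. ?c x) = 0"
  using integral_shift[of ?c "- 2"] integral_shift[of ?c 2] integral_central[OF b(1)] b(2) by simp_all
 have cN: "L1_norm (\<lambda>x. ?c (x - 2)) \<le> L1_norm g" "L1_norm (\<lambda>x. ?c (x + 2)) \<le> L1_norm g" "L1_norm ?c \<le> L1_norm g"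
  using L1_norm_shift[OF c, of "- 2"] L1_norm_shift[OF c, of 2] L1_norm_central[OF b(1)] L1_norm_J[OF \<beta> gi] by simp_all
 have int: "Lintegrable (T_hilbert_part \<beta> g)"
  unfolding T_hilbert_part_def[abs_def] using b(1) c cs by (intro bochner_integrable_diff bochner_integrable_add)
 moreover have "(LI x. T_hilbert_part \<beta> g x) = 0" unfolding T_hilbert_part_def using b c cs cI by simp
 ultimately show "T_hilbert_part \<beta> g \<in> L1_0" by (simp add: L1_0_def L1_def)
 have "L1_norm (T_hilbert_part \<beta> g) \<le> (LI x. norm (?c x) + norm (?c (x - 2)) + norm (?c (x + 2)) + norm (?b x))" proof (rule integral_mono)
  show "norm (T_hilbert_part \<beta> g x) \<le> norm (?c x) + norm (?c (x - 2)) + norm (?c (x + 2)) + norm (?b x)" for x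
   unfolding T_hilbert_part_def by (intro order_trans[OF norm_triangle_ineq4] add_right_mono order_trans[OF norm_triangle_ineq] norm_triangle_ineq order_refl)
 qed (use int b(1) c cs in auto)
 also have "... = L1_norm ?c + L1_norm (\<lambda>x. ?c (x - 2)) + L1_norm (\<lambda>x. ?c (x + 2)) + L1_norm ?b" using b(1) c cs by simp
 also have "... \<le> 4 * L1_norm g" using cN L1_norm_J[OF \<beta> gi] by simp
 finally show "L1_norm (T_hilbert_part \<beta> g) \<le> 4 * L1_norm g" .
 show "ennreal (norm (T_hilbert_part \<beta> g x)) * indicator I1 x \<le> transfer \<beta> (\<lambda>x. ennreal (norm (g x))) x" proof (cases "x \<in> I1")
  case True
  then have "T_hilbert_part \<beta> g x = periodize ?b x - ?b x" by (auto simp: T_hilbert_part_def central_def indicator_def I1_def)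
  then have "ennreal (norm (T_hilbert_part \<beta> g x)) \<le> (\<Sum>n. if n = 0 then 0 else ennreal (norm (?b (x + shift n))))"
   using norm_periodize_minus_le by simp
  also have "... = transfer \<beta> (\<lambda>x. ennreal (norm (g x))) x" by (rule transfer_norm_J[OF \<beta> True])
  finally show ?thesis using True by simp
 qed simp
qed

lemma indicator_I1_integrable: "Lintegrable f ==> Lintegrable (\<lambda>x. indicator I1 x *\<^sub>R f x)" for f :: "real => complex"
 by (rule integrable_mult_indicator) (simp add: I1_def)

lemma conv_I1_integrable:
 assumes "\<kappa> \<in> borel_measurable borel" "\<And>v. \<bar>\<kappa> v\<bar> \<le> C" "Lintegrable q"
 shows "Lintegrable (\<lambda>x. indicator I1 x *\<^sub>R conv \<kappa> q x)"
proof (rule integrable_compact_support[of _ "C * L1_norm q" 1])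
 show "(\<lambda>x. indicator I1 x *\<^sub>R conv \<kappa> q x) \<in> Lmeasurable"
  using conv_measurable[OF assms] by (intro borel_measurable_scaleR borel_measurable_indicator) auto
 have "0 \<le> C * L1_norm q" by (rule order_trans[OF norm_ge_zero conv_bound[OF assms, of 0]])
 then show "norm (indicator I1 x *\<^sub>R conv \<kappa> q x) \<le> C * L1_norm q" for x using conv_bound[OF assms, of x] by (simp add: indicator_def)
 show "1 < abs t ==> indicator I1 t *\<^sub>R conv \<kappa> q t = 0" for t by (auto simp: indicator_def I1_def)
qed

text \<open>The error term is the convolution: \<open>far_kernel\<close> is at most 1, and neither
  \<open>J_fun\<close> nor \<open>central\<close> increases the L1 norm.\<close>

lemma T_smooth_part:
 assumes \<beta>: "0 < \<beta>" and f: "f \<in> L1" and g: "g \<in> L1_0"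
 shows "T_smooth_part \<beta> f g \<in> L1"
  "ennreal (norm (T_smooth_part \<beta> f g x)) \<le> transfer \<beta> (\<lambda>x. ennreal (norm (f x))) x + ennreal (L1_norm g) * indicator I1 x"
proof -
 let ?a = "J_fun \<beta> f" and ?c = "central (J_fun \<beta> g)"
 have gi: "Lintegrable g" using g by (auto simp: L1_0_def L1_def)
 have a: "Lintegrable ?a" using J_fun_L1(1)[OF \<beta> f] by (simp add: L1_def)
 have b: "Lintegrable (J_fun \<beta> g)" using J_fun_L1(2)[OF \<beta> g] by (simp add: L1_0_def L1_def)
 note c = central_integrable[OF b]
 note k = far_kernel_borel far_kernel_bound c
 have e: "T_smooth_part \<beta> f g x = indicator I1 x *\<^sub>R central ?a x - indicator I1 x *\<^sub>R ?a x - indicator I1 x *\<^sub>R conv far_kernel ?c x" for x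
  by (auto simp: T_smooth_part_def central_def indicator_def I1_def)
 show "T_smooth_part \<beta> f g \<in> L1" unfolding L1_def mem_Collect_eq e[abs_def]
  by (intro bochner_integrable_diff indicator_I1_integrable conv_I1_integrable[OF k] central_integrable a)
 show "ennreal (norm (T_smooth_part \<beta> f g x)) \<le> transfer \<beta> (\<lambda>x. ennreal (norm (f x))) x + ennreal (L1_norm g) * indicator I1 x" proof (cases "x \<in> I1")
  case True
  have "norm (conv far_kernel ?c x) \<le> 1 * L1_norm ?c" by (rule conv_bound[OF k])
  also have "... \<le> L1_norm g" using L1_norm_central[OF b] L1_norm_J[OF \<beta> gi] by simp
  finally have "norm (T_smooth_part \<beta> f g x) \<le> norm (periodize ?a x - ?a x) + L1_norm g"
   using True norm_triangle_ineq4[of "periodize ?a x - ?a x" "conv far_kernel ?c x"] by (simp add: T_smooth_part_def)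
  then have "ennreal (norm (T_smooth_part \<beta> f g x)) \<le> ennreal (norm (periodize ?a x - ?a x)) + ennreal (L1_norm g)"
   using L1_norm_nonneg[of g] by (simp add: ennreal_plus[symmetric] del: ennreal_plus)
  also have "ennreal (norm (periodize ?a x - ?a x)) \<le> (\<Sum>n. if n = 0 then 0 else ennreal (norm (?a (x + shift n))))" by (rule norm_periodize_minus_le)
  also have "... = transfer \<beta> (\<lambda>x. ennreal (norm (f x))) x" by (rule transfer_norm_J[OF \<beta> True])
  finally show ?thesis using True by (simp add: add_right_mono)
 qed (simp add: T_smooth_part_def)
qed

lemma test_I1_outside: "\<phi> \<in> test_functions I1 ==> x \<notin> I1 ==> \<phi> x = 0" by (metis test_functionsE subsetD)

text \<open>Rewrites \<open>T_formula\<close>, whose pairings involve periodic functions, as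
  pairings of \<phi> and \<open>hilbert \<phi>\<close> with densities on the line.\<close>

lemma T_represents:
 assumes \<beta>: "0 < \<beta>" "\<beta> < 1" and u: "u \<in> LR_on I1" and uf: "represents {-\<beta><..<\<beta>} u f g"
 shows "represents I1 (T \<beta> u) (T_smooth_part \<beta> f g) (T_hilbert_part \<beta> g)" unfolding represents_def
proof (intro conjI ballI)
 have f: "f \<in> L1" and g: "g \<in> L1_0" using uf by (auto simp: represents_def)
 show F: "T_smooth_part \<beta> f g \<in> L1" by (rule T_smooth_part(1)[OF \<beta>(1) f g])
 show G: "T_hilbert_part \<beta> g \<in> L1_0" by (rule T_hilbert_part(1)[OF \<beta>(1) g])
 let ?a = "J_fun \<beta> f" and ?b = "J_fun \<beta> g" let ?c = "central ?b"
 have a: "Lintegrable ?a" using J_fun_L1(1)[OF \<beta>(1) f] by (simp add: L1_def)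
 have b: "Lintegrable ?b" using J_fun_L1(2)[OF \<beta>(1) g] by (simp add: L1_0_def L1_def)
 note c = central_integrable[OF b]
 note k = far_kernel_borel far_kernel_bound c
 fix \<phi> assume \<phi>: "\<phi> \<in> test_functions I1"
 obtain r where r: "0 < r" "r < 1" "\<And>t. r < abs t ==> \<phi> t = 0" using test_I1_support[OF \<phi>] by blast
 have "(LI x. periodize \<phi> x * ?a x) = (LI x. periodize \<phi> x * central ?a x)"
  by (rule integral_periodic_fold[OF periodize_shift periodize_integrable_mult[OF \<phi> a], symmetric])
 also have "... = (LI x. \<phi> x * central ?a x)" proof (intro bochner_cong refl)
  fix x
  show "periodize \<phi> x * central ?a x = \<phi> x * central ?a x" proof (cases "abs x \<le> 1")
   case True
   have "periodize \<phi> x = \<phi> (x - 2 * of_int 0)" by (rule periodize_local[of r]) (use r True in auto)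
   then show ?thesis by simp
  qed (auto simp: central_def indicator_def)
 qed
 finally have P: "(LI x. periodize \<phi> x * ?a x) = (LI x. \<phi> x * central ?a x)" .
 have i3: "Lintegrable (\<lambda>x. \<phi> x * conv far_kernel ?c x)"
  using integrable_mult_bounded[OF test_function_integrable[OF \<phi>] conv_measurable[OF k] conv_bound[OF k]] by (simp add: mult.commute)
 note i1 = integrable_test_mult[OF \<phi> central_integrable[OF a]] and i2 = integrable_test_mult[OF \<phi> a]
 have "(LI x. \<phi> x * T_smooth_part \<beta> f g x) = (LI x. \<phi> x * central ?a x - \<phi> x * ?a x - \<phi> x * conv far_kernel ?c x)" proof (intro bochner_cong refl)
  fix x
  show "\<phi> x * T_smooth_part \<beta> f g x = \<phi> x * central ?a x - \<phi> x * ?a x - \<phi> x * conv far_kernel ?c x" proof (cases "x \<in> I1")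
   case True
   then have "T_smooth_part \<beta> f g x = central ?a x - ?a x - conv far_kernel ?c x" by (simp add: T_smooth_part_def central_def I1_def)
   then show ?thesis by (simp only: right_diff_distrib)
  qed (simp add: test_I1_outside[OF \<phi>])
 qed
 also have "... = (LI x. periodize \<phi> x * ?a x) - (LI x. \<phi> x * ?a x) - (LI x. \<phi> x * conv far_kernel ?c x)" unfolding P using i1 i2 i3 by simp
 finally have FF: "(LI x. \<phi> x * T_smooth_part \<beta> f g x) = (LI x. periodize \<phi> x * ?a x) - (LI x. \<phi> x * ?a x) - (LI x. \<phi> x * conv far_kernel ?c x)" .
 have cs: "Lintegrable (\<lambda>x. ?c (x - 2))" "Lintegrable (\<lambda>x. ?c (x + 2))"
  using integrable_shift[OF c, of "- 2"] integrable_shift[OF c, of 2] by simp_all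
 have "Lintegrable (\<lambda>x. ?c x + ?c (x - 2) + ?c (x + 2))" using c cs by auto
 then have "(LI x. hilbert \<phi> x * T_hilbert_part \<beta> g x) = (LI x. hilbert \<phi> x * (?c x + ?c (x - 2) + ?c (x + 2))) - (LI x. hilbert \<phi> x * ?b x)"
  unfolding T_hilbert_part_def right_diff_distrib by (intro bochner_diff integrable_hilbert_mult[OF \<phi>] b)
 then have GG: "(LI x. hilbert \<phi> x * T_hilbert_part \<beta> g x) =
  (LI x. periodic_hilbert (periodize \<phi>) x * ?b x) - (LI t. \<phi> t * conv far_kernel ?c t) - (LI x. hilbert \<phi> x * ?b x)"
  unfolding periodic_hilbert_pairing[OF \<phi> b] by simp
 have "T \<beta> u \<phi> = ((LI x. periodize \<phi> x * ?a x) - (LI x. \<phi> x * ?a x)) - ((LI x. periodic_hilbert (periodize \<phi>) x * ?b x) - (LI x. hilbert \<phi> x * ?b x))"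
  unfolding T_formula[OF \<beta> u uf \<phi>] left_diff_distrib
  using periodize_integrable_mult[OF \<phi> a] i2 periodic_hilbert_integrable[OF \<phi> b] integrable_hilbert_mult[OF \<phi> b] by simp
 then show "T \<beta> u \<phi> = (LI t. \<phi> t * T_smooth_part \<beta> f g t) - (LI t. hilbert \<phi> t * T_hilbert_part \<beta> g t)" unfolding FF GG by simp
qed

lemma T_LR_on:
 assumes \<beta>: "0 < \<beta>" "\<beta> < 1" and u: "u \<in> LR_on I1"
 shows "T \<beta> u \<in> LR_on I1"
proof -
 obtain f g where "represents I1 u f g" by (rule LR_on_represents[OF u])
 then have "represents {-\<beta><..<\<beta>} u f g" by (rule represents_subset) (use \<beta> in \<open>auto simp: I1_def\<close>)
 from T_represents[OF \<beta> u this] show ?thesis unfolding T_def by (rule represents_LR_on)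
qed

text \<open>On \<open>]-\<beta>, \<beta>[\<close> the density \<open>G\<close> may be changed outside \<open>I1\<close> at the price of a bounded function. The constant on
 \<open>[1, 2]\<close>, invisible to the transfer operator, restores mean zero.\<close>

definition reduce_hilbert :: "(real => complex) => real => complex" where
 "reduce_hilbert G x = indicator I1 x *\<^sub>R G x - indicator {1..2} x *\<^sub>R (LI y. indicator I1 y *\<^sub>R G y)"

text \<open>The Hilbert kernel as felt between a point of \<open>]-\<beta>, \<beta>[\<close> and a
  point outside \<open>I1\<close>, which are at least 1 - \<beta> apart.\<close>

definition away_kernel :: "real => real => real" where
 "away_kernel \<beta> v = (if 1 - \<beta> \<le> \<bar>v\<bar> then 1 / (pi * v) else 0)"

definition reduce_smooth :: "real => (real => complex) => (real => complex) => real => complex" where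
 "reduce_smooth \<beta> F G x = F x - indicator I1 x *\<^sub>R conv (away_kernel \<beta>) (\<lambda>y. G y - reduce_hilbert G y) x"

text \<open>The integral over \<open>I1\<close> is at most the norm there, and [1, 2] has length 1;
  hence the factor 2, and 3 after adding G. The factor 2 bounds the full norm by the part inside
  \<open>I1\<close>, the only part that the recursion controls.\<close>

lemma reduce_hilbert:
 assumes G: "Lintegrable G"
 shows "reduce_hilbert G \<in> L1_0"
  "ennreal (L1_norm (reduce_hilbert G)) \<le> 2 * (NI x. ennreal (norm (reduce_hilbert G x)) * indicator I1 x)"
  "x \<in> I1 ==> reduce_hilbert G x = G x"
  "L1_norm (\<lambda>y. G y - reduce_hilbert G y) \<le> 3 * L1_norm G"
proof -
 let ?w = "\<lambda>x. indicator I1 x *\<^sub>R G x" define m where "m = (LI y. ?w y)"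
 have e: "reduce_hilbert G x = ?w x - indicator {1..2} x *\<^sub>R m" for x by (simp add: reduce_hilbert_def m_def)
 have w: "Lintegrable ?w" by (rule indicator_I1_integrable[OF G])
 have i: "Lintegrable (\<lambda>x. indicator {1..2::real} x *\<^sub>R m)" proof (rule integrable_compact_support[of _ "norm m" 2])
  show "(\<lambda>x. indicator {1..2::real} x *\<^sub>R m) \<in> Lmeasurable" by (intro borel_measurable_scaleR borel_measurable_indicator) auto
 qed (auto simp: indicator_def)
 have im: "(LI x. indicator {1..2::real} x *\<^sub>R m) = m" using set_integral_const[of "{1..2::real}" lebesgue m] by (simp add: set_lebesgue_integral_def)
 have ri: "Lintegrable (reduce_hilbert G)" unfolding e[abs_def] using w i by (rule bochner_integrable_diff)
 then show "reduce_hilbert G \<in> L1_0" using w i im by (simp add: L1_0_def L1_def e[abs_def] m_def)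
 show I: "x \<in> I1 ==> reduce_hilbert G x = G x" for x by (simp add: e I1_def)
 have in1: "(LI x. norm (indicator {1..2::real} x *\<^sub>R m)) = norm m" proof -
  have "(LI x. norm (indicator {1..2::real} x *\<^sub>R m)) = (LI x. indicator {1..2::real} x *\<^sub>R norm m)"
   by (intro bochner_cong) (auto simp: indicator_def)
  then show ?thesis using set_integral_const[of "{1..2::real}" lebesgue "norm m"] by (simp add: set_lebesgue_integral_def)
 qed
 have mw: "norm m \<le> L1_norm ?w" unfolding m_def by (rule integral_norm_bound)
 have N: "L1_norm (reduce_hilbert G) \<le> L1_norm ?w + norm m" proof -
  have "L1_norm (reduce_hilbert G) \<le> (LI x. norm (?w x) + norm (indicator {1..2} x *\<^sub>R m))"
   unfolding e by (intro integral_mono norm_triangle_ineq4 integrable_norm bochner_integrable_add bochner_integrable_diff w i)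
  also have "... = L1_norm ?w + norm m" unfolding in1[symmetric] by (intro bochner_add integrable_norm w i)
  finally show ?thesis .
 qed
 have "(NI x. ennreal (norm (reduce_hilbert G x)) * indicator I1 x) = (NI x. ennreal (norm (?w x)))"
  by (intro nn_integral_cong) (auto simp: I indicator_def)
 also have "... = ennreal (L1_norm ?w)" by (rule nn_integral_norm[OF w])
 finally have W: "(NI x. ennreal (norm (reduce_hilbert G x)) * indicator I1 x) = ennreal (L1_norm ?w)" .
 have "L1_norm (reduce_hilbert G) \<le> 2 * L1_norm ?w" using N mw by simp
 then have "ennreal (L1_norm (reduce_hilbert G)) \<le> ennreal (2 * L1_norm ?w)" by (rule ennreal_leI)
 also have "... = 2 * ennreal (L1_norm ?w)" using L1_norm_nonneg[of ?w] by (simp add: ennreal_mult)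
 finally show "ennreal (L1_norm (reduce_hilbert G)) \<le> 2 * (NI x. ennreal (norm (reduce_hilbert G x)) * indicator I1 x)" unfolding W .
 have wG: "L1_norm ?w \<le> L1_norm G" by (intro integral_mono integrable_norm w G) (auto simp: indicator_def)
 have "L1_norm (\<lambda>y. G y - reduce_hilbert G y) \<le> (LI y. norm (G y) + norm (reduce_hilbert G y))"
  using ri G by (intro integral_mono norm_triangle_ineq4) auto
 also have "... = L1_norm G + L1_norm (reduce_hilbert G)" using ri G by (intro bochner_add) auto
 finally show "L1_norm (\<lambda>y. G y - reduce_hilbert G y) \<le> 3 * L1_norm G" using N mw wG by linarith
qed

lemma away_kernel:
 assumes "\<beta> < 1" shows "away_kernel \<beta> \<in> borel_measurable borel" "\<bar>away_kernel \<beta> v\<bar> \<le> 1 / (1 - \<beta>)"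
proof -
 show "away_kernel \<beta> \<in> borel_measurable borel" unfolding away_kernel_def[abs_def] by measurable
 show "\<bar>away_kernel \<beta> v\<bar> \<le> 1 / (1 - \<beta>)" proof (cases "1 - \<beta> \<le> \<bar>v\<bar>")
  case True
  have "1 * (1 - \<beta>) \<le> pi * abs v" using True pi_gt3 assms by (intro mult_mono) auto
  then have "1 / (pi * abs v) \<le> 1 / (1 - \<beta>)" using assms by (intro divide_left_mono) auto
  then show ?thesis using True by (simp add: away_kernel_def abs_mult)
 qed (use assms in \<open>simp add: away_kernel_def\<close>)
qed

text \<open>For \<phi> supported in \<open>]-\<beta>, \<beta>[\<close> the transform outside
  \<open>I1\<close> is an ordinary integral with the bounded \<open>away_kernel\<close>. Fubini
  turns its pairing with the discarded density into a pairing of \<phi> with a bounded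
  function.\<close>

lemma reduce_represents:
 assumes \<beta>: "0 < \<beta>" "\<beta> < 1" and v: "represents I1 v F G"
 shows "represents {-\<beta><..<\<beta>} v (reduce_smooth \<beta> F G) (reduce_hilbert G)"
  and "norm (reduce_smooth \<beta> F G x) \<le> norm (F x) + 3 / (1 - \<beta>) * L1_norm G * indicator I1 x"
proof -
 have F: "Lintegrable F" and G: "Lintegrable G" using v by (auto simp: represents_def L1_def L1_0_def)
 let ?q = "\<lambda>y. G y - reduce_hilbert G y"
 have g1: "Lintegrable (reduce_hilbert G)" using reduce_hilbert(1)[OF G] by (simp add: L1_0_def L1_def)
 have q: "Lintegrable ?q" using G g1 by (rule bochner_integrable_diff)
 note k = away_kernel[OF \<beta>(2)] q
 have "reduce_smooth \<beta> F G \<in> L1"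
  unfolding L1_def mem_Collect_eq reduce_smooth_def[abs_def] by (intro bochner_integrable_diff F conv_I1_integrable[OF k])
 moreover have "v \<phi> = (LI t. \<phi> t * reduce_smooth \<beta> F G t) - (LI t. hilbert \<phi> t * reduce_hilbert G t)"
  if \<phi>: "\<phi> \<in> test_functions {-\<beta><..<\<beta>}" for \<phi>
 proof -
  have \<phi>1: "\<phi> \<in> test_functions I1" by (rule subsetD[OF test_functions_mono \<phi>]) (use \<beta> in \<open>auto simp: I1_def\<close>)
  have out: "\<phi> t = 0" if "\<beta> \<le> \<bar>t\<bar>" for t proof -
   have "t \<notin> {-\<beta><..<\<beta>}" using that by auto
   then show ?thesis using \<phi> by (metis test_functionsE subsetD)
  qed
  have d: "0 < 1 - \<beta>" using \<beta> by simp
  have "(LI y. hilbert \<phi> y * ?q y) = (LI y. (LI t. \<phi> t * of_real (away_kernel \<beta> (y - t))) * ?q y)" proof (intro bochner_cong refl)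
   fix y
   show "hilbert \<phi> y * ?q y = (LI t. \<phi> t * of_real (away_kernel \<beta> (y - t))) * ?q y" proof (cases "y \<in> I1")
    case False
    then have y: "1 \<le> \<bar>y\<bar>" by (auto simp: I1_def)
    have z: "\<phi> t = 0" if "\<bar>y - t\<bar> < 1 - \<beta>" for t by (rule out) (use that y in linarith)
    have "hilbert \<phi> y = of_real (1 / pi) * (LI t. \<phi> t / of_real (y - t))" by (rule hilbert_outside(1)[OF \<phi> d z])
    also have "... = (LI t. of_real (1 / pi) * (\<phi> t / of_real (y - t)))" by (rule integral_mult_right_zero[symmetric])
    also have "... = (LI t. \<phi> t * of_real (away_kernel \<beta> (y - t)))" proof (intro bochner_cong refl)
     fix t
     show "of_real (1 / pi) * (\<phi> t / of_real (y - t)) = \<phi> t * of_real (away_kernel \<beta> (y - t))"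
      using z[of t] by (cases "\<bar>y - t\<bar> < 1 - \<beta>") (simp_all add: away_kernel_def)
    qed
    finally show ?thesis by simp
   qed (simp add: reduce_hilbert(3)[OF G])
  qed
  also have "... = (LI t. \<phi> t * conv (away_kernel \<beta>) ?q t)" by (rule conv_pairing[OF k test_function_integrable[OF \<phi>]])
  also have "... = (LI t. \<phi> t * (indicator I1 t *\<^sub>R conv (away_kernel \<beta>) ?q t))"
   by (intro bochner_cong refl) (auto simp: indicator_def test_I1_outside[OF \<phi>1])
  finally have 1: "(LI y. hilbert \<phi> y * ?q y) = (LI t. \<phi> t * (indicator I1 t *\<^sub>R conv (away_kernel \<beta>) ?q t))" .
  have 2: "(LI y. hilbert \<phi> y * ?q y) = (LI y. hilbert \<phi> y * G y) - (LI y. hilbert \<phi> y * reduce_hilbert G y)"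
   unfolding right_diff_distrib by (intro bochner_diff integrable_hilbert_mult[OF \<phi>] G g1)
  have 3: "(LI t. \<phi> t * reduce_smooth \<beta> F G t) = (LI t. \<phi> t * F t) - (LI t. \<phi> t * (indicator I1 t *\<^sub>R conv (away_kernel \<beta>) ?q t))"
   unfolding reduce_smooth_def right_diff_distrib by (intro bochner_diff integrable_test_mult[OF \<phi>] F conv_I1_integrable[OF k])
  have "v \<phi> = (LI t. \<phi> t * F t) - (LI t. hilbert \<phi> t * G t)" using v \<phi>1 by (simp add: represents_def)
  then show ?thesis unfolding 3 1[symmetric] 2 by simp
 qed
 ultimately show "represents {-\<beta><..<\<beta>} v (reduce_smooth \<beta> F G) (reduce_hilbert G)" using reduce_hilbert(1)[OF G] by (auto simp: represents_def)
 show "norm (reduce_smooth \<beta> F G x) \<le> norm (F x) + 3 / (1 - \<beta>) * L1_norm G * indicator I1 x" proof (cases "x \<in> I1")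
  case True
  have "norm (conv (away_kernel \<beta>) ?q x) \<le> 1 / (1 - \<beta>) * L1_norm ?q" by (rule conv_bound[OF k])
  also have "... \<le> 1 / (1 - \<beta>) * (3 * L1_norm G)" using \<beta> by (intro mult_left_mono reduce_hilbert(4)[OF G]) auto
  finally show ?thesis using True norm_triangle_ineq4[of "F x" "conv (away_kernel \<beta>) ?q x"] by (simp add: reduce_smooth_def)
 qed (simp add: reduce_smooth_def)
qed

section \<open>Valeur au point\<close>

text \<open>The total mass is read off from \<open>poisson_representation\<close> with G = 1;
  monotone convergence turns the limit over symmetric intervals into integrability.\<close>

lemma poisson_has_integral_1:
 assumes y: "0 < y"
 shows "Lintegrable (poisson x y)" "(LI t. poisson x y t) = 1"
proof -
 let ?f = "\<lambda>n::nat. \<lambda>t. indicator {- real n..real n} t *\<^sub>R poisson x y t"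
 have cont: "continuous_on S (poisson x y)" for S unfolding poisson_def[abs_def] using y by (intro continuous_intros) (auto simp: add_nonneg_eq_0_iff)
 have i: "Lintegrable (?f n)" for n using absolutely_integrable_continuous_real[OF cont, of "- real n" "real n"] by (simp add: set_integrable_def)
 have I: "(LI t. ?f n t) = integral {- real n..real n} (poisson x y)" for n
  using set_lebesgue_integral_eq_integral(2)[of "{- real n..real n}" "poisson x y"] i[of n]
  by (simp add: set_lebesgue_integral_def set_integrable_def)
 have integral_poisson_of_real: "integral {-R..R} (\<lambda>t. complex_of_real (poisson x y t)) = of_real (integral {-R..R} (poisson x y))" for R
  by (rule integral_unique, rule has_integral_of_real, rule integrable_integral, rule integrable_continuous_real[OF cont])
 have "((\<lambda>R. integral {-R..R} (\<lambda>t. of_real (poisson x y t) * (1::complex))) \<longlongrightarrow> 1) at_top"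
  by (rule poisson_representation[where G = "\<lambda>_. 1" and \<delta> = 1]) (use y in auto)
 then have "((\<lambda>R. complex_of_real (integral {-R..R} (poisson x y))) \<longlongrightarrow> 1) at_top" proof (rule Lim_transform_eventually)
  show "\<forall>\<^sub>F R in at_top. integral {-R..R} (\<lambda>t. of_real (poisson x y t) * (1::complex)) = of_real (integral {-R..R} (poisson x y))"
   by (intro always_eventually allI) (simp only: mult_1_right integral_poisson_of_real)
 qed
 then have "((\<lambda>R. complex_of_real (integral {-R..R} (poisson x y))) \<longlongrightarrow> of_real 1) at_top" by (simp only: of_real_1)
 then have "((\<lambda>R. integral {-R..R} (poisson x y)) \<longlongrightarrow> 1) at_top" by (simp only: tendsto_of_real_iff)
 then have lim: "(\<lambda>n. LI t. ?f n t) \<longlonglongrightarrow> 1" unfolding I by (rule filterlim_compose) (rule filterlim_real_sequentially)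
 have mono: "AE t in lebesgue. mono (\<lambda>n. ?f n t)" using poisson_nonneg[of y x] y by (intro AE_I2 monoI) (auto simp: indicator_def)
 have pos: "AE t in lebesgue. 0 \<le> ?f n t" for n using poisson_nonneg[of y x] y by (intro AE_I2) auto
 have l: "AE t in lebesgue. (\<lambda>n. ?f n t) \<longlonglongrightarrow> poisson x y t" proof (rule AE_I2, rule tendsto_eventually)
  fix t
  show "\<forall>\<^sub>F n in sequentially. ?f n t = poisson x y t" using eventually_ge_at_top[of "nat \<lceil>abs t\<rceil>"] proof eventually_elim
   fix n assume "nat \<lceil>abs t\<rceil> \<le> n"
   then have "abs t \<le> real n" by linarith
   then show "?f n t = poisson x y t" by (simp add: indicator_def abs_le_iff)
  qed
 qed
 have m: "poisson x y \<in> Lmeasurable" by (rule continuous_measurable_lebesgue[OF cont])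
 show "Lintegrable (poisson x y)" "(LI t. poisson x y t) = 1" using integral_monotone_convergence_nonneg[OF i mono pos l lim m] by auto
qed

text \<open>Near y the half-line may be cut at w because the support is compact, which reduces the
  claim to the folded kernel 1 / v.\<close>

lemma Qs_has_vd:
 assumes \<xi>: "\<xi> \<in> test_functions E"
 shows "((\<lambda>y. Qs \<xi> y 0) has_vector_derivative Qs (vd \<xi>) y 0) (at y)"
proof -
 obtain R1 where R1: "R1 > 0" "\<And>t. abs t > R1 ==> \<xi> t = 0" using test_function_support[OF \<xi>] by blast
 obtain R2 where R2: "R2 > 0" "\<And>t. abs t > R2 ==> vd \<xi> t = 0" using test_function_support[OF test_functions_vd[OF \<xi>]] by blast
 define R where "R = max R1 R2"
 define w where "w = abs y + 1 + R"
 have eq: "Qs \<psi> z 0 = SK (\<lambda>v. 1 / v) w \<psi> z" if \<psi>: "\<And>t. R < abs t ==> \<psi> t = 0" and z: "abs z < abs y + 1" for \<psi> z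
  unfolding Qs_def SK_def set_lebesgue_integral_def
 proof (intro bochner_cong refl)
  fix u :: real
  show "indicator {0<..} u *\<^sub>R (sdiff \<psi> z u * of_real (Qk u 0)) = indicator {0<..w} u *\<^sub>R (sdiff \<psi> z u * of_real (1 / u))" proof (cases "u \<le> w")
   case True
   then show ?thesis by (auto simp: indicator_def power2_eq_square)
  next
   case False
   then have "R < \<bar>z - u\<bar>" "R < \<bar>z + u\<bar>" using z unfolding w_def by linarith+
   then show ?thesis using False by (simp add: \<psi>)
  qed
 qed
 have "(SK (\<lambda>v. 1 / v) w \<xi> has_vector_derivative SK (\<lambda>v. 1 / v) w (vd \<xi>) y) (at y)" by (rule SK_has_vd[OF \<xi>, of _ 1]) auto
 then have "((\<lambda>y. Qs \<xi> y 0) has_vector_derivative SK (\<lambda>v. 1 / v) w (vd \<xi>) y) (at y)"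
 proof (rule has_vector_derivative_transform_within_open[of _ _ _ "{- (abs y + 1)<..<abs y + 1}"])
  show "SK (\<lambda>v. 1 / v) w \<xi> z = Qs \<xi> z 0" if "z \<in> {- (abs y + 1)<..<abs y + 1}" for z by (rule eq[symmetric]) (use that R1(2) in \<open>auto simp: R_def\<close>)
 qed auto
 also have "SK (\<lambda>v. 1 / v) w (vd \<xi>) y = Qs (vd \<xi>) y 0" by (rule eq[symmetric]) (use R2(2) in \<open>auto simp: R_def\<close>)
 finally show ?thesis .
qed

text \<open>In s the transform has a bounded derivative. In \<tau> the kernels differ by \<tau>^2 /
  (u (u^2 + \<tau>^2)); against a difference of size 2 M u this is 2 pi M \<tau> times the Poisson
  kernel, whose mass is 1.\<close>

lemma Qs_lipschitz:
 assumes \<xi>: "\<xi> \<in> test_functions E"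
 obtains L where "0 \<le> L" "\<And>s x \<tau>. 0 < \<tau> ==> norm (Qs \<xi> s 0 - Qs \<xi> x \<tau>) \<le> L * (\<bar>s - x\<bar> + \<tau>)"
proof -
 obtain B where B: "B \<ge> 0" "\<And>x \<delta>. norm (Qs (vd \<xi>) x \<delta>) \<le> B" using Qs_bound[OF test_functions_vd[OF \<xi>]] by blast
 obtain M where M: "M \<ge> 0" "\<And>x y. norm (\<xi> x - \<xi> y) \<le> M * \<bar>x - y\<bar>" using test_function_lipschitz[OF \<xi>] by blast
 have 1: "norm (Qs \<xi> s 0 - Qs \<xi> x 0) \<le> B * \<bar>s - x\<bar>" for s x by (rule lipschitz_from_vd[OF Qs_has_vd[OF \<xi>] B(2)])
 have 2: "norm (Qs \<xi> x 0 - Qs \<xi> x \<tau>) \<le> 2 * pi * M * \<tau>" if \<tau>: "0 < \<tau>" for x \<tau> proof -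
  let ?h = "\<lambda>\<delta> u. indicator {0<..} u *\<^sub>R (sdiff \<xi> x u * of_real (Qk u \<delta>))"
  have i: "Lintegrable (?h \<delta>)" for \<delta> using Qs_integrable[OF \<xi>, of x \<delta>] by (simp add: set_integrable_def)
  have "Qs \<xi> x 0 - Qs \<xi> x \<tau> = (LI u. ?h 0 u - ?h \<tau> u)" unfolding Qs_def set_lebesgue_integral_def by (rule bochner_diff[symmetric]) (rule i)+
  then have "norm (Qs \<xi> x 0 - Qs \<xi> x \<tau>) \<le> (LI u. norm (?h 0 u - ?h \<tau> u))" by (simp only:) (rule integral_norm_bound)
  also have "... \<le> (LI u. 2 * pi * M * \<tau> * poisson 0 \<tau> u)" proof (rule integral_mono)
   show "Lintegrable (\<lambda>u. norm (?h 0 u - ?h \<tau> u))" by (intro integrable_norm bochner_integrable_diff i)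
   show "Lintegrable (\<lambda>u. 2 * pi * M * \<tau> * poisson 0 \<tau> u)" using poisson_has_integral_1(1)[OF \<tau>] by auto
   fix u :: real
   show "norm (?h 0 u - ?h \<tau> u) \<le> 2 * pi * M * \<tau> * poisson 0 \<tau> u" proof (cases "0 < u")
    case True
    have D: "0 < u^2 + \<tau>^2" using True by (simp add: add_pos_nonneg)
    have k: "u / (u^2 + 0^2) - u / (u^2 + \<tau>^2) = \<tau>^2 / (u * (u^2 + \<tau>^2))" proof -
     have "u / (u^2 + 0^2) = 1 / u" using True by (simp add: power2_eq_square)
     moreover have "1 / u - u / (u^2 + \<tau>^2) = \<tau>^2 / (u * (u^2 + \<tau>^2))"
      using True D by (simp add: diff_divide_eq_iff divide_diff_eq_iff) (simp add: power2_eq_square)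
     ultimately show ?thesis by simp
    qed
    have "?h 0 u - ?h \<tau> u = (sdiff \<xi> x u) * of_real (\<tau>^2 / (u * (u^2 + \<tau>^2)))" unfolding k[symmetric] using True by (simp add: right_diff_distrib)
    then have "norm (?h 0 u - ?h \<tau> u) = norm (sdiff \<xi> x u) * (\<tau>^2 / (u * (u^2 + \<tau>^2)))" using True D by (simp only: norm_mult norm_of_real) simp
    also have "... \<le> (M * (2 * u)) * (\<tau>^2 / (u * (u^2 + \<tau>^2)))" using M(2)[of "x - u" "x + u"] True D by (intro mult_right_mono) auto
    also have "... = 2 * pi * M * \<tau> * poisson 0 \<tau> u" proof -
     have "(M * (2 * u)) * (\<tau>^2 / (u * D)) = 2 * pi * M * \<tau> * (1 / pi * (\<tau> / D))" for D :: real using True by (simp add: power2_eq_square)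
     then show ?thesis by (simp add: poisson_def add.commute)
    qed
    finally show ?thesis .
   qed (use \<tau> M poisson_nonneg[of \<tau> 0 u] in simp)
  qed
  also have "... = 2 * pi * M * \<tau>" using poisson_has_integral_1(2)[OF \<tau>] by simp
  finally show ?thesis .
 qed
 show ?thesis proof (rule that[of "B + 2 * pi * M"])
  show "0 \<le> B + 2 * pi * M" using B M by simp
  fix s x \<tau> :: real assume \<tau>: "0 < \<tau>"
  have "norm (Qs \<xi> s 0 - Qs \<xi> x \<tau>) \<le> norm (Qs \<xi> s 0 - Qs \<xi> x 0) + norm (Qs \<xi> x 0 - Qs \<xi> x \<tau>)"
   using norm_triangle_ineq[of "Qs \<xi> s 0 - Qs \<xi> x 0" "Qs \<xi> x 0 - Qs \<xi> x \<tau>"] by simp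
  also have "... \<le> B * \<bar>s - x\<bar> + 2 * pi * M * \<tau>" using 1[of s x] 2[OF \<tau>, of x] by (rule add_mono)
  also have "... \<le> (B + 2 * pi * M) * (\<bar>s - x\<bar> + \<tau>)" using B M \<tau> by (simp add: algebra_simps)
  finally show "norm (Qs \<xi> s 0 - Qs \<xi> x \<tau>) \<le> (B + 2 * pi * M) * (\<bar>s - x\<bar> + \<tau>)" .
 qed
qed

text \<open>Partial fractions write the Poisson kernel as a multiple of the difference of 1 / (t -
  z) at two conjugate points.\<close>

lemma poisson_test:
 assumes \<eta>: "\<eta> \<in> test_functions E" and \<tau>: "0 < \<tau>"
 shows "(\<lambda>t. \<eta> t * of_real (poisson x \<tau> t)) \<in> test_functions E"
proof -
 obtain K where K: "smooth \<eta>" "compact K" "K \<subseteq> E" "\<And>t. t \<notin> K ==> \<eta> t = 0" using test_functionsE[OF \<eta>] by blast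
 have e: "complex_of_real (poisson x \<tau> t) = 1 / (2 * pi * \<i>) * (1 / (of_real t - Complex x \<tau>) - 1 / (of_real t - Complex x (- \<tau>)))" for t proof -
  have D: "\<tau>^2 + (x - t)^2 > 0" using \<tau> by (simp add: add_pos_nonneg)
  have n: "of_real t - Complex x \<tau> \<noteq> 0" "of_real t - Complex x (- \<tau>) \<noteq> 0" using \<tau> by (auto simp: complex_eq_iff)
  have p: "(of_real t - Complex x \<tau>) * (of_real t - Complex x (- \<tau>)) = of_real (\<tau>^2 + (x - t)^2)"
   by (simp add: complex_eq_iff power2_eq_square algebra_simps)
  have d: "1 / (of_real t - Complex x \<tau>) - 1 / (of_real t - Complex x (- \<tau>)) = (2 * \<i> * of_real \<tau>) / of_real (\<tau>^2 + (x - t)^2)"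
   unfolding p[symmetric] using n by (simp add: field_simps) (simp add: complex_eq_iff)
  show ?thesis unfolding d poisson_def by simp
 qed
 have "smooth (\<lambda>t. 1 / (2 * pi * \<i>) * (1 / (of_real t - Complex x \<tau>) - 1 / (of_real t - Complex x (- \<tau>))))"
  using \<tau> by (intro smooth_cmult smooth_minus smooth_inverse_linear) auto
 then have "smooth (\<lambda>t. complex_of_real (poisson x \<tau> t))" unfolding e .
 then show ?thesis using K by (intro test_functionsI[OF _ K(2,3)] smooth_mult) auto
qed

text \<open>From \<open>\<tau> / ((t^2 + \<tau>^2) * (s - t)) = \<tau> / (s^2 + \<tau>^2) * (1 / (s - t) + (s + t) / (t^2 + \<tau>^2))\<close>, centred at \<open>x\<close>.\<close>

lemma hilbert_cutoff_poisson:
 assumes \<eta>: "\<eta> \<in> test_functions E" and \<tau>: "0 < \<tau>"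
 shows "Qs (\<lambda>t. \<eta> t * of_real (poisson x \<tau> t)) s 0 = of_real ((1 / pi) * (\<tau> / (\<tau>^2 + (s - x)^2))) * (Qs \<eta> s 0 - Qs \<eta> x \<tau>)
  + of_real ((s - x) / (\<tau>^2 + (s - x)^2)) * (LI t. \<eta> t * of_real (poisson x \<tau> t))"
proof -
 define A where "A = (1 / pi) * (\<tau> / (\<tau>^2 + (s - x)^2))"
 define \<rho> where "\<rho> t = \<eta> t * of_real ((s - x + (t - x)) / (\<tau>^2 + (x - t)^2))" for t
 let ?\<xi> = "\<lambda>t. \<eta> t * of_real (poisson x \<tau> t)"
 note \<xi> = poisson_test[OF \<eta> \<tau>, of x]
 have D: "0 < \<tau>^2 + v^2" for v :: real using \<tau> by (simp add: add_pos_nonneg)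
 have k: "poisson x \<tau> t = A * (1 + (s - t) * ((s - x + (t - x)) / (\<tau>^2 + (x - t)^2)))" for t proof -
  have "1 + (s - t) * ((s - x + (t - x)) / (\<tau>^2 + (x - t)^2)) = (\<tau>^2 + (x - t)^2 + (s - t) * (s - x + (t - x))) / (\<tau>^2 + (x - t)^2)"
   
  proof -
   have "1 + a * (b / d) = (d + a * b) / d" if "0 < d" for a b d :: real using that by (simp add: add_divide_distrib)
   then show ?thesis using D by blast
  qed
  also have "\<tau>^2 + (x - t)^2 + (s - t) * (s - x + (t - x)) = \<tau>^2 + (s - x)^2" by (simp add: power2_eq_square algebra_simps)
  finally show ?thesis unfolding poisson_def A_def using D[of "s - x"] by simp
 qed
 have \<xi>k: "?\<xi> t = of_real A * (\<eta> t + of_real (s - t) * \<rho> t)" for t unfolding k \<rho>_def by (simp add: distrib_left mult_ac del: of_real_diff)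
 have i1: "Lintegrable (\<lambda>t. of_real (pi / \<tau> * (s - x)) * ?\<xi> t)" using test_function_integrable[OF \<xi>] by simp
 have i2: "Lintegrable (\<lambda>t. \<eta> t * of_real (Qk (x - t) \<tau>))" using \<tau> by (intro Q_kernel_integrable test_function_integrable[OF \<eta>]) simp
 have \<rho>e: "\<rho> t = of_real (pi / \<tau> * (s - x)) * ?\<xi> t - \<eta> t * of_real (Qk (x - t) \<tau>)" for t proof -
  have "(s - x + (t - x)) / (\<tau>^2 + (x - t)^2) = pi / \<tau> * (s - x) * poisson x \<tau> t - (x - t) / ((x - t)^2 + \<tau>^2)"
   unfolding poisson_def add.commute[of "(x - t)^2"] using \<tau> by (simp add: diff_divide_distrib add_divide_distrib)
  then have "\<rho> t = \<eta> t * (of_real (pi / \<tau> * (s - x)) * of_real (poisson x \<tau> t) - of_real (Qk (x - t) \<tau>))"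
   unfolding \<rho>_def by (simp only: of_real_diff[of "pi / \<tau> * (s - x) * poisson x \<tau> t"] of_real_mult[of "pi / \<tau> * (s - x)"])
  then show ?thesis by (simp only: right_diff_distrib[of "\<eta> t"] mult.left_commute[of "\<eta> t"])
 qed
 have \<rho>i: "Lintegrable \<rho>" unfolding \<rho>e[abs_def] using i1 i2 by (rule bochner_integrable_diff)
 have \<rho>I: "(LI t. \<rho> t) = of_real (pi / \<tau> * (s - x)) * (LI t. ?\<xi> t) - Qs \<eta> x \<tau>" unfolding \<rho>e bochner_diff[OF i1 i2] integral_mult_right_zero
  using \<tau> by (subst Qs_eq_integral[OF \<eta>]) auto
 have Gi: "Lintegrable (\<lambda>u. \<rho> (s - u))" using lebesgue_integrable_real_affine[OF \<rho>i, of "-1" s] by simp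
 have GI: "(LI u. \<rho> (s - u)) = (LI t. \<rho> t)" by (subst (2) lebesgue_integral_real_affine[of "-1" _ s]) simp_all
 let ?h = "\<lambda>u. indicator {0<..} u *\<^sub>R (sdiff \<eta> s u * of_real (Qk u 0))"
 let ?r = "\<lambda>u. indicator {0<..} u *\<^sub>R (\<rho> (s - u) + \<rho> (s - - u))"
 have h: "Lintegrable ?h" using Qs_integrable[OF \<eta>, of s 0] by (simp add: set_integrable_def)
 have r: "Lintegrable ?r" proof (rule integrable_mult_indicator)
  show "Lintegrable (\<lambda>u. \<rho> (s - u) + \<rho> (s - - u))" using Gi lebesgue_integrable_real_affine[OF \<rho>i, of 1 s] by simp
 qed simp
 have "Qs ?\<xi> s 0 = (LI u. of_real A * (?h u + ?r u))" unfolding Qs_def set_lebesgue_integral_def proof (intro bochner_cong refl)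
  fix u :: real
  show "indicator {0<..} u *\<^sub>R ((?\<xi> (s - u) - ?\<xi> (s + u)) * of_real (Qk u 0)) = of_real A * (?h u + ?r u)" proof (cases "0 < u")
   case True
   have uu: "complex_of_real u * of_real (Qk u 0) = 1" using True unfolding of_real_mult[symmetric] by (simp add: power2_eq_square)
   have "?\<xi> (s - u) - ?\<xi> (s + u) = of_real A * ((sdiff \<eta> s u) + of_real u * (\<rho> (s - u) + \<rho> (s - - u)))" unfolding \<xi>k by (simp add: algebra_simps)
   then have "(?\<xi> (s - u) - ?\<xi> (s + u)) * of_real (Qk u 0) =
    of_real A * (sdiff \<eta> s u * of_real (Qk u 0) + (of_real u * of_real (Qk u 0)) * (\<rho> (s - u) + \<rho> (s - - u)))"
    by (simp only: distrib_right distrib_left mult_ac)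
   then show ?thesis unfolding uu using True by simp
  qed simp
 qed
 also have "... = of_real A * ((LI u. ?h u) + (LI u. ?r u))" unfolding integral_mult_right_zero bochner_add[OF h r] ..
 also have "(LI u. ?r u) = (LI u. \<rho> (s - u))" using fold_integral[OF Gi] by (simp add: set_lebesgue_integral_def)
 also have "(LI u. ?h u) = Qs \<eta> s 0" by (simp add: Qs_def set_lebesgue_integral_def)
 finally have "Qs ?\<xi> s 0 = of_real A * (Qs \<eta> s 0 - Qs \<eta> x \<tau>) + of_real A * of_real (pi / \<tau> * (s - x)) * (LI t. ?\<xi> t)"
  unfolding GI \<rho>I by (simp add: algebra_simps)
 also have "complex_of_real A * of_real (pi / \<tau> * (s - x)) = of_real ((s - x) / (\<tau>^2 + (s - x)^2))"
  unfolding of_real_mult[symmetric] A_def using \<tau> by simp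
 finally show ?thesis unfolding A_def .
qed

text \<open>At distance at least d from x the kernel at height \<tau> is O(\<tau>) times the kernel
  at height 1, a majorant that is both integrable and bounded.\<close>

lemma poisson_cutoff_bound:
 assumes d: "0 < d" "\<And>t. \<bar>t - x\<bar> < d ==> \<eta> t = 1" and M: "0 \<le> M" "\<And>t. norm (\<eta> t) \<le> M" and \<tau>: "0 < \<tau>"
 shows "norm ((\<eta> t - 1) * complex_of_real (poisson x \<tau> t)) \<le> \<tau> * ((1 + M) * (1 + 1 / d^2)) * poisson x 1 t"
proof (cases "\<bar>t - x\<bar> < d")
 case True
 then show ?thesis using d M \<tau> poisson_nonneg[of 1 x t] by simp
next
 case False
 define v where "v = (x - t)^2"
 have v: "d^2 \<le> v" unfolding v_def using False d(1) by (metis abs_le_square_iff abs_minus_commute abs_of_pos not_less)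
 have d2: "0 < d^2" using d by simp
 have v0: "0 < v" using v d2 by linarith
 have "d^2 * (1 + v) \<le> (d^2 + 1) * v" using v by (simp add: algebra_simps)
 then have "1 + v \<le> (1 + 1 / d^2) * v" using d2 by (simp add: field_simps)
 then have "1 / v \<le> (1 + 1 / d^2) / (1 + v)" using v0 by (simp add: field_simps)
 moreover have "1 / (\<tau>^2 + v) \<le> 1 / v" using v0 \<tau> by (intro divide_left_mono) (auto intro!: mult_pos_pos add_pos_pos)
 ultimately have "1 / (\<tau>^2 + v) \<le> (1 + 1 / d^2) / (1 + v)" by linarith
 then have "(\<tau> / pi) * (1 / (\<tau>^2 + v)) \<le> (\<tau> / pi) * ((1 + 1 / d^2) / (1 + v))" using \<tau> by (intro mult_left_mono) auto
 then have p: "poisson x \<tau> t \<le> \<tau> * (1 + 1 / d^2) * poisson x 1 t" by (simp add: poisson_def v_def mult_ac)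
 have "norm ((\<eta> t - 1) * complex_of_real (poisson x \<tau> t)) = norm (\<eta> t - 1) * poisson x \<tau> t" using poisson_nonneg[of \<tau> x t] \<tau> by (simp add: norm_mult)
 also have "... \<le> (1 + M) * (\<tau> * (1 + 1 / d^2) * poisson x 1 t)"
  using norm_triangle_ineq4[of "\<eta> t" 1] M(2)[of t] M(1) p poisson_nonneg[of \<tau> x t] \<tau> by (intro mult_mono) auto
 finally show ?thesis by (simp add: mult_ac)
qed

lemma cutoff_I1:
 assumes "x \<in> I1"
 shows "cutoff I1 x \<in> test_functions I1" "\<exists>d>0. \<forall>t. \<bar>t - x\<bar> < d \<longrightarrow> cutoff I1 x t = 1"
proof -
 have x: "-1 < x" "x < 1" using assms by (auto simp: I1_def)
 obtain h where "h \<in> test_functions {-1<..<1}" "\<forall>\<^sub>F t in nhds x. h t = 1" by (rule cutoff_exists[OF x])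
 then have "\<exists>h. h \<in> test_functions I1 \<and> (\<forall>\<^sub>F t in nhds x. h t = 1)" unfolding I1_def by blast
 from someI_ex[OF this] have c: "cutoff I1 x \<in> test_functions I1" "\<forall>\<^sub>F t in nhds x. cutoff I1 x t = 1" unfolding cutoff_def by auto
 show "cutoff I1 x \<in> test_functions I1" by (rule c)
 show "\<exists>d>0. \<forall>t. \<bar>t - x\<bar> < d \<longrightarrow> cutoff I1 x t = 1" using c(2) unfolding eventually_nhds_metric dist_real_def .
qed

lemma tendsto_integral_mult_0:
 fixes q :: "nat => real => complex"
 assumes q: "\<And>n. q n \<in> Lmeasurable" "AE x in lebesgue. (\<lambda>n. q n x) \<longlonglongrightarrow> 0" "\<And>n x. norm (q n x) \<le> B"
  and f: "Lintegrable f"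
 shows "(\<lambda>n. LI x. q n x * f x) \<longlonglongrightarrow> 0"
proof -
 have m: "f \<in> Lmeasurable" using f by (rule borel_measurable_integrable)
 have "(\<lambda>n. LI x. q n x * f x) \<longlonglongrightarrow> (LI (x::real). 0)" proof (rule integral_dominated_convergence[where w = "\<lambda>x. B * norm (f x)"])
  show "\<And>n. (\<lambda>x. q n x * f x) \<in> Lmeasurable" using m q(1) by (intro borel_measurable_times)
  show "Lintegrable (\<lambda>x. B * norm (f x))" using f by auto
  show "AE x in lebesgue. (\<lambda>n. q n x * f x) \<longlonglongrightarrow> 0" using q(2) by eventually_elim (rule tendsto_mult_left_zero)
  show "\<And>n. AE x in lebesgue. norm (q n x * f x) \<le> B * norm (f x)" using q(3) by (auto simp: norm_mult intro!: mult_right_mono)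
 qed simp
 then show ?thesis by simp
qed

text \<open>Poisson integral of \<open>f\<close> plus conjugate Poisson integral of \<open>g\<close>, split into boundary values of a Cauchy integral
 from above and, by conjugation, from below.\<close>

definition upper_density :: "(real => complex) => (real => complex) => real => complex" where
 "upper_density f g t = of_real (1 / (2 * pi)) * (g t + \<i> * f t)"

definition lower_density :: "(real => complex) => (real => complex) => real => complex" where
 "lower_density f g t = of_real (1 / (2 * pi)) * cnj (g t - \<i> * f t)"

lemma density_integrable:
 assumes f: "Lintegrable f" and g: "Lintegrable g"
 shows "Lintegrable (upper_density f g)" "Lintegrable (lower_density f g)"
  "L1_norm (upper_density f g) \<le> L1_norm f + L1_norm g" "L1_norm (lower_density f g) \<le> L1_norm f + L1_norm g"
proof -
 show u: "Lintegrable (upper_density f g)" unfolding upper_density_def[abs_def] using f g by auto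
 have "Lintegrable (\<lambda>t. cnj (g t - \<i> * f t))" using f g by (subst integrable_cnj) auto
 then show l: "Lintegrable (lower_density f g)" unfolding lower_density_def[abs_def] by auto
 have s: "1 / (2 * pi) * z \<le> z" if "0 \<le> z" for z :: real proof -
  have "1 / (2 * pi) * z \<le> 1 * z" using that pi_gt3 by (intro mult_right_mono) auto
  then show ?thesis by simp
 qed
 have b: "norm (upper_density f g t) \<le> norm (f t) + norm (g t)" "norm (lower_density f g t) \<le> norm (f t) + norm (g t)" for t proof -
  have "norm (upper_density f g t) \<le> norm (g t + \<i> * f t)" "norm (lower_density f g t) \<le> norm (g t - \<i> * f t)"
   using s[of "norm (g t + \<i> * f t)"] s[of "norm (g t - \<i> * f t)"]
   by (simp_all only: upper_density_def lower_density_def norm_mult norm_of_real complex_mod_cnj) auto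
  then show "norm (upper_density f g t) \<le> norm (f t) + norm (g t)" "norm (lower_density f g t) \<le> norm (f t) + norm (g t)"
   using norm_triangle_ineq[of "g t" "\<i> * f t"] norm_triangle_ineq4[of "g t" "\<i> * f t"] by (simp_all add: norm_mult)
 qed
 have sum: "(LI t. norm (f t) + norm (g t)) = L1_norm f + L1_norm g" using f g by (intro bochner_add) auto
 show "L1_norm (upper_density f g) \<le> L1_norm f + L1_norm g" "L1_norm (lower_density f g) \<le> L1_norm f + L1_norm g"
  unfolding sum[symmetric] by (intro integral_mono b integrable_norm u l bochner_integrable_add f g)+
qed

definition boundary_value :: "(real => complex) => (real => complex) => real => real => complex" where
 "boundary_value f g x \<tau> = cauchy_int (upper_density f g) (Complex x \<tau>) + cnj (cauchy_int (lower_density f g) (Complex x \<tau>))"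

lemma boundary_value_eq:
 assumes f: "Lintegrable f" and g: "Lintegrable g" and \<tau>: "0 < \<tau>"
 shows "boundary_value f g x \<tau> = (LI t. of_real (poisson x \<tau> t) * f t) + (LI t. of_real (1 / pi * Qk (x - t) \<tau>) * g t)"
  and "Lintegrable (\<lambda>t. of_real (poisson x \<tau> t) * f t)"
  and "Lintegrable (\<lambda>t. of_real (1 / pi * Qk (x - t) \<tau>) * g t)"
proof -
 let ?z = "Complex x \<tau>"
 have D: "0 < (x - t)^2 + \<tau>^2" for t using \<tau> by (simp add: add_nonneg_pos)
 have c: "(\<lambda>t. complex_of_real (poisson x \<tau> t)) \<in> Lmeasurable" using borel_measurable_integrable[OF poisson_has_integral_1(1)[OF \<tau>]] by measurable
 have "poisson x \<tau> t \<le> 1 / pi * (1 / \<tau>)" for t proof -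
  have "\<tau> / (\<tau>^2 + (x - t)^2) \<le> \<tau> / \<tau>^2" using \<tau> by (intro divide_left_mono) (auto intro!: mult_pos_pos add_pos_nonneg)
  also have "... = 1 / \<tau>" using \<tau> by (simp add: power2_eq_square)
  finally show ?thesis unfolding poisson_def by (intro mult_left_mono) auto
 qed
 then have Pb: "norm (complex_of_real (poisson x \<tau> t)) \<le> 1 / pi * (1 / \<tau>)" for t using poisson_nonneg[of \<tau> x t] \<tau> by simp
 show i1: "Lintegrable (\<lambda>t. of_real (poisson x \<tau> t) * f t)" by (rule integrable_mult_bounded[OF f c Pb])
 have "Lintegrable (\<lambda>t. of_real (1 / pi) * (g t * of_real (Qk (x - t) \<tau>)))" using \<tau> by (intro integrable_mult_right Q_kernel_integrable g) simp
 then show i2: "Lintegrable (\<lambda>t. of_real (1 / pi * Qk (x - t) \<tau>) * g t)" by (simp only: of_real_mult mult_ac)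
 have Im: "Im ?z \<noteq> 0" using \<tau> by simp
 note d = density_integrable(1,2)[OF f g]
 have j1: "Lintegrable (\<lambda>t. upper_density f g t / (?z - of_real t))" by (rule cauchy_integrable[OF d(1) Im])
 have j2: "Lintegrable (\<lambda>t. cnj (lower_density f g t / (?z - of_real t)))" using cauchy_integrable[OF d(2) Im] by (simp only: integrable_cnj)
 have pt: "upper_density f g t / (?z - of_real t) + cnj (lower_density f g t / (?z - of_real t)) =
  of_real (poisson x \<tau> t) * f t + of_real (1 / pi * Qk (x - t) \<tau>) * g t" for t
 proof -
  define w where "w = ?z - of_real t"
  define E where "E = complex_of_real ((x - t)^2 + \<tau>^2)"
  have E0: "E \<noteq> 0" using D[of t] unfolding E_def of_real_eq_0_iff by linarith
  have wE: "w * cnj w = E" by (simp add: w_def E_def complex_eq_iff power2_eq_square algebra_simps)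
  have w0: "w \<noteq> 0" "cnj w \<noteq> 0" using wE E0 by auto
  have w: "w = of_real (x - t) + \<i> * of_real \<tau>" "cnj w = of_real (x - t) - \<i> * of_real \<tau>" by (simp_all add: w_def complex_eq_iff)
  have u: "upper_density f g t / w = upper_density f g t * cnj w / E" unfolding wE[symmetric] using w0 by simp
  have l: "cnj (lower_density f g t / w) = of_real (1 / (2 * pi)) * (g t - \<i> * f t) * w / E"
   unfolding wE[symmetric] lower_density_def using w0 by simp
  have "upper_density f g t / w + cnj (lower_density f g t / w) = of_real (1 / (2 * pi)) * ((g t + \<i> * f t) * cnj w + (g t - \<i> * f t) * w) / E"
   unfolding u l by (simp only: upper_density_def add_divide_distrib[symmetric] distrib_left[of "complex_of_real (1 / (2 * pi))" "(g t + \<i> * f t) * cnj w"] mult.assoc)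
  also have "(g t + \<i> * f t) * cnj w + (g t - \<i> * f t) * w = 2 * (of_real \<tau> * f t + of_real (x - t) * g t)" unfolding w by (simp add: algebra_simps)
  also have "of_real (1 / (2 * pi)) * (2 * (of_real \<tau> * f t + of_real (x - t) * g t)) / E =
   of_real (1 / pi) * of_real \<tau> / E * f t + of_real (1 / pi) * of_real (x - t) / E * g t" by (simp add: add_divide_distrib distrib_left)
  also have "... = of_real (poisson x \<tau> t) * f t + of_real (1 / pi * Qk (x - t) \<tau>) * g t"
   unfolding E_def poisson_def add.commute[of "\<tau>^2"] by (simp only: of_real_mult of_real_divide times_divide_eq_right)
  finally show ?thesis unfolding w_def .
 qed
 have "boundary_value f g x \<tau> = (LI t. upper_density f g t / (?z - of_real t)) + (LI t. cnj (lower_density f g t / (?z - of_real t)))"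
  unfolding boundary_value_def cauchy_int_def Bochner_Integration.integral_cnj ..
 also have "... = (LI t. of_real (poisson x \<tau> t) * f t + of_real (1 / pi * Qk (x - t) \<tau>) * g t)" unfolding bochner_add[OF j1 j2, symmetric] pt ..
 finally show "boundary_value f g x \<tau> = (LI t. of_real (poisson x \<tau> t) * f t) + (LI t. of_real (1 / pi * Qk (x - t) \<tau>) * g t)"
  unfolding bochner_add[OF i1 i2] .
qed

lemma poisson_1_le_1: "poisson x 1 t \<le> 1"
proof -
 have "1 / pi * (1 / (1^2 + (x - t)^2)) \<le> 1 * 1" using pi_gt3 by (intro mult_mono) (auto simp: divide_le_eq add_pos_nonneg)
 then show ?thesis by (simp add: poisson_def)
qed

text \<open>The transform of the cut-off Poisson kernel is compared with the conjugate Poisson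
  kernel. The error is at most 2 (L + C) everywhere and tends to 0 with \<tau> for s \<noteq> x. It
  is not uniformly small near x, but this suffices for dominated convergence against an L1
  density.\<close>

lemma hilbert_error_bound:
 assumes \<eta>: "\<eta> \<in> test_functions E" and L: "0 \<le> L" "\<And>s x \<tau>. 0 < \<tau> ==> norm (Qs \<eta> s 0 - Qs \<eta> x \<tau>) \<le> L * (\<bar>s - x\<bar> + \<tau>)"
  and C: "0 \<le> C" "norm ((LI t. \<eta> t * of_real (poisson x \<tau> t)) - 1) \<le> C * \<tau>" and \<tau>: "0 < \<tau>"
 shows "norm (hilbert (\<lambda>t. \<eta> t * of_real (poisson x \<tau> t)) s + of_real (1 / pi * ((x - s) / ((x - s)^2 + \<tau>^2))))
  \<le> (L + C) * (\<tau> * (\<bar>s - x\<bar> + \<tau>) / (\<tau>^2 + (s - x)^2))"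
proof -
 define D where "D = \<tau>^2 + (s - x)^2"
 define I where "I = (LI t. \<eta> t * of_real (poisson x \<tau> t))"
 define v where "v = \<bar>s - x\<bar>"
 define W where "W = Qs \<eta> s 0 - Qs \<eta> x \<tau>"
 have D: "0 < D" using \<tau> by (simp add: D_def add_pos_nonneg)
 have D': "(x - s)^2 + \<tau>^2 = D" by (simp add: D_def power2_commute add.commute)
 have "hilbert (\<lambda>t. \<eta> t * of_real (poisson x \<tau> t)) s + of_real (1 / pi * ((x - s) / ((x - s)^2 + \<tau>^2)))
  = of_real (1 / pi) * (of_real (1 / pi * (\<tau> / D)) * W + of_real ((s - x) / D) * (I - 1))"
 proof -
  have "complex_of_real (1 / pi * ((x - s) / D)) = - (of_real (1 / pi) * of_real ((s - x) / D))"
   unfolding of_real_mult[symmetric] of_real_minus[symmetric] by (simp add: minus_divide_left)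
  then show ?thesis
   unfolding hilbert_eq_Qs[OF poisson_test[OF \<eta> \<tau>]] hilbert_cutoff_poisson[OF \<eta> \<tau>] D' D_def[symmetric] I_def[symmetric] W_def[symmetric]
   by (simp only: distrib_left right_diff_distrib mult_1_right) simp
 qed
 then have "norm (hilbert (\<lambda>t. \<eta> t * of_real (poisson x \<tau> t)) s + of_real (1 / pi * ((x - s) / ((x - s)^2 + \<tau>^2))))
  = \<bar>1 / pi\<bar> * norm (of_real (1 / pi * (\<tau> / D)) * W + of_real ((s - x) / D) * (I - 1))" by (simp only: norm_mult norm_of_real)
 also have "... \<le> 1 * norm (of_real (1 / pi * (\<tau> / D)) * W + of_real ((s - x) / D) * (I - 1))" using pi_gt3 by (intro mult_right_mono) auto
 also have "... \<le> norm (of_real (1 / pi * (\<tau> / D)) * W) + norm (of_real ((s - x) / D) * (I - 1))" unfolding mult_1 by (rule norm_triangle_ineq)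
 also have "... \<le> (\<tau> / D) * (L * (v + \<tau>)) + v / D * (C * \<tau>)" proof (rule add_mono)
  have "1 / pi * (\<tau> / D) \<le> 1 * (\<tau> / D)" using pi_gt3 \<tau> D by (intro mult_right_mono) auto
  then have "\<bar>1 / pi * (\<tau> / D)\<bar> \<le> \<tau> / D" using \<tau> D by simp
  then show "norm (of_real (1 / pi * (\<tau> / D)) * W) \<le> (\<tau> / D) * (L * (v + \<tau>))"
   unfolding norm_mult norm_of_real using L(2)[OF \<tau>, of s x] \<tau> D by (intro mult_mono) (auto simp: W_def v_def)
  show "norm (of_real ((s - x) / D) * (I - 1)) \<le> v / D * (C * \<tau>)"
   unfolding norm_mult norm_of_real abs_divide using C(2) D by (intro mult_mono) (auto simp: I_def v_def)
 qed
 also have "... = (L * (\<tau> * (v + \<tau>)) + C * (\<tau> * v)) / D" by (simp add: add_divide_distrib mult_ac)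
 also have "... \<le> (L * (\<tau> * (v + \<tau>)) + C * (\<tau> * (v + \<tau>))) / D" using D C(1) \<tau> by (intro divide_right_mono add_left_mono mult_left_mono) auto
 also have "... = (L + C) * (\<tau> * (v + \<tau>) / D)" by (simp add: distrib_right add_divide_distrib)
 finally show ?thesis unfolding v_def D_def .
qed

lemma product_ratio_le_2:
 fixes v y :: real
 assumes "0 < y" shows "y * (v + y) / (y^2 + v^2) \<le> 2"
proof -
 have D: "0 < y^2 + v^2" using assms by (simp add: add_pos_nonneg)
 have "0 \<le> (y - v)^2 + y^2 + 3 * v^2" by simp
 also have "... = 2 * (2 * (y^2 + v^2) - y * (v + y))" by (simp add: power2_eq_square algebra_simps)
 finally have "y * (v + y) \<le> 2 * (y^2 + v^2)" by simp
 then show ?thesis using D by (simp add: pos_divide_le_eq)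
qed

text \<open>The densities live on the whole line while the cut-off is supported in
  \<open>I1\<close>. What the cut-off changes disappears in the limit, separately against f and
  against g, at every x of \<open>I1\<close>.\<close>

lemma vp_pairing_sequence:
 assumes u: "represents I1 u f g" and x: "x \<in> I1" and X: "X \<longlonglongrightarrow> 0" "\<And>n. 0 < X n"
 shows "(\<lambda>n. u (\<lambda>t. cutoff I1 x t * of_real (poisson x (X n) t)) - boundary_value f g x (X n)) \<longlonglongrightarrow> 0"
proof -
 have f: "Lintegrable f" and g: "Lintegrable g" using u by (auto simp: represents_def L1_def L1_0_def)
 define \<eta> where "\<eta> = cutoff I1 x"
 have \<eta>: "\<eta> \<in> test_functions I1" unfolding \<eta>_def by (rule cutoff_I1(1)[OF x])
 obtain d where d: "0 < d" "\<And>t. \<bar>t - x\<bar> < d ==> \<eta> t = 1" using cutoff_I1(2)[OF x] unfolding \<eta>_def by blast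
 obtain M where M: "0 \<le> M" "\<And>t. norm (\<eta> t) \<le> M" using test_function_bounded[OF \<eta>] by blast
 obtain L where L: "0 \<le> L" "\<And>s x \<tau>. 0 < \<tau> ==> norm (Qs \<eta> s 0 - Qs \<eta> x \<tau>) \<le> L * (\<bar>s - x\<bar> + \<tau>)" using Qs_lipschitz[OF \<eta>] by blast
 define C where "C = (1 + M) * (1 + 1 / d^2)"
 have C0: "0 \<le> C" using M by (simp add: C_def)
 define P where "P n t = complex_of_real (poisson x (X n) t)" for n t
 define Q where "Q n t = complex_of_real (1 / pi * ((x - t) / ((x - t)^2 + (X n)^2)))" for n t
 define \<xi> where "\<xi> n t = \<eta> t * P n t" for n t
 have \<xi>: "\<xi> n \<in> test_functions I1" for n unfolding \<xi>_def[abs_def] P_def by (rule poisson_test[OF \<eta> X(2)])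
 have Pb: "norm ((\<eta> t - 1) * P n t) \<le> X n * C * poisson x 1 t" for n t unfolding P_def C_def by (rule poisson_cutoff_bound[OF d M X(2)])
 have Pi: "Lintegrable (P n)" "(LI t. P n t) = 1" for n unfolding P_def[abs_def] using poisson_has_integral_1[OF X(2)[of n], of x] by simp_all
 have I: "norm ((LI t. \<eta> t * of_real (poisson x (X n) t)) - 1) \<le> C * X n" for n proof -
  have "(LI t. \<eta> t * of_real (poisson x (X n) t)) - 1 = (LI t. \<xi> n t) - (LI t. P n t)" unfolding Pi(2) by (simp only: \<xi>_def P_def)
  also have "... = (LI t. \<xi> n t - P n t)" by (rule bochner_diff[symmetric, OF test_function_integrable[OF \<xi>] Pi(1)])
  finally have "norm ((LI t. \<eta> t * of_real (poisson x (X n) t)) - 1) \<le> (LI t. norm (\<xi> n t - P n t))" by (simp only:) (rule integral_norm_bound)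
  also have "... \<le> (LI t. X n * C * poisson x 1 t)" proof (rule integral_mono)
   show "Lintegrable (\<lambda>t. norm (\<xi> n t - P n t))" by (intro integrable_norm bochner_integrable_diff test_function_integrable[OF \<xi>] Pi(1))
   show "Lintegrable (\<lambda>t. X n * C * poisson x 1 t)" using poisson_has_integral_1(1)[of 1 x] by auto
   show "norm (\<xi> n t - P n t) \<le> X n * C * poisson x 1 t" for t using Pb[of t n] by (simp add: \<xi>_def left_diff_distrib)
  qed
  also have "... = C * X n" using poisson_has_integral_1(2)[of 1 x] by simp
  finally show ?thesis .
 qed
 have Hb: "norm (hilbert (\<xi> n) s + Q n s) \<le> (L + C) * (X n * (\<bar>s - x\<bar> + X n) / ((X n)^2 + (s - x)^2))" for n s
  unfolding \<xi>_def[abs_def] P_def Q_def by (rule hilbert_error_bound[OF \<eta> L C0 I X(2)])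
 obtain K where K: "\<And>n. \<bar>X n\<bar> \<le> K" using Bseq_eq_bounded convergent_imp_Bseq[OF convergentI[OF X(1)]] unfolding Bseq_def by auto
 have m: "P n \<in> Lmeasurable" "Q n \<in> Lmeasurable" for n proof -
  show "P n \<in> Lmeasurable" by (rule borel_measurable_integrable[OF Pi(1)])
  have "(x - t)^2 + (X n)^2 \<noteq> 0" for t using X(2)[of n] by (simp add: sum_power2_eq_zero_iff)
  then show "Q n \<in> Lmeasurable" unfolding Q_def[abs_def] by (intro continuous_measurable_lebesgue continuous_intros ballI) simp_all
 qed
 have lim1: "(\<lambda>n. LI t. (\<xi> n t - P n t) * f t) \<longlonglongrightarrow> 0" proof (rule tendsto_integral_mult_0[OF _ _ _ f])
  have b: "norm (\<xi> n t - P n t) \<le> X n * C" for n t proof -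
   have "norm (\<xi> n t - P n t) \<le> X n * C * poisson x 1 t" using Pb[of t n] by (simp add: \<xi>_def left_diff_distrib)
   also have "... \<le> X n * C * 1" using poisson_1_le_1 X(2)[of n] C0 by (intro mult_left_mono) auto
   finally show ?thesis by simp
  qed
  show "(\<lambda>t. \<xi> n t - P n t) \<in> Lmeasurable" for n by (intro borel_measurable_diff test_function_lebesgue[OF \<xi>] m)
  show "AE t in lebesgue. (\<lambda>n. \<xi> n t - P n t) \<longlonglongrightarrow> 0" proof (rule AE_I2)
   fix t
   show "(\<lambda>n. \<xi> n t - P n t) \<longlonglongrightarrow> 0" by (rule Lim_null_comparison[OF always_eventually[rule_format, OF b] tendsto_mult_left_zero[OF X(1)]])
  qed
  show "norm (\<xi> n t - P n t) \<le> K * C" for n t using b[of n t] mult_right_mono[OF K[of n] C0] X(2)[of n] by simp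
 qed
 have lim2: "(\<lambda>n. LI t. (hilbert (\<xi> n) t + Q n t) * g t) \<longlonglongrightarrow> 0" proof (rule tendsto_integral_mult_0[OF _ _ _ g])
  show "(\<lambda>t. hilbert (\<xi> n) t + Q n t) \<in> Lmeasurable" for n by (intro borel_measurable_add hilbert_lebesgue[OF \<xi>] m)
  show "AE t in lebesgue. (\<lambda>n. hilbert (\<xi> n) t + Q n t) \<longlonglongrightarrow> 0" using AE_lebesgue_neq[of x] proof eventually_elim
   fix s :: real assume s: "s \<noteq> x"
   have "(\<lambda>n. (L + C) * (X n * (\<bar>s - x\<bar> + X n) / ((X n)^2 + (s - x)^2))) \<longlonglongrightarrow> (L + C) * (0 * (\<bar>s - x\<bar> + 0) / (0^2 + (s - x)^2))"
    using s by (intro tendsto_intros X(1)) auto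
   then have "(\<lambda>n. (L + C) * (X n * (\<bar>s - x\<bar> + X n) / ((X n)^2 + (s - x)^2))) \<longlonglongrightarrow> 0" by simp
   then show "(\<lambda>n. hilbert (\<xi> n) s + Q n s) \<longlonglongrightarrow> 0" by (rule Lim_null_comparison[OF always_eventually[rule_format, OF Hb]])
  qed
  show "norm (hilbert (\<xi> n) s + Q n s) \<le> (L + C) * 2" for n s proof (rule order_trans[OF Hb mult_left_mono])
   show "X n * (\<bar>s - x\<bar> + X n) / ((X n)^2 + (s - x)^2) \<le> 2" using product_ratio_le_2[of "X n" "\<bar>s - x\<bar>"] X(2)[of n] by simp
  qed (use L C0 in simp)
 qed
 have "u (\<xi> n) - boundary_value f g x (X n) = (LI t. (\<xi> n t - P n t) * f t) - (LI t. (hilbert (\<xi> n) t + Q n t) * g t)" for n proof -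
  note B = boundary_value_eq[OF f g X(2)[of n], where x = x, folded P_def Q_def]
  have "u (\<xi> n) = (LI t. \<xi> n t * f t) - (LI t. hilbert (\<xi> n) t * g t)" using u \<xi> by (simp add: represents_def)
  then show ?thesis unfolding B(1) left_diff_distrib distrib_right
    bochner_diff[OF integrable_test_mult[OF \<xi> f] B(2)]
    bochner_add[OF integrable_hilbert_mult[OF \<xi> g] B(3)] by simp
 qed
 then have "(\<lambda>n. u (\<xi> n) - boundary_value f g x (X n)) \<longlonglongrightarrow> 0 - 0" using tendsto_diff[OF lim1 lim2] by simp
 then show ?thesis unfolding \<xi>_def[abs_def] P_def \<eta>_def by simp
qed

lemma vp_eq:
 assumes u: "represents I1 u f g" and x: "x \<in> I1"
  and l1: "((\<lambda>\<tau>. cauchy_int (upper_density f g) (Complex x \<tau>)) \<longlongrightarrow> l1) (at_right 0)"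
  and l2: "((\<lambda>\<tau>. cauchy_int (lower_density f g) (Complex x \<tau>)) \<longlongrightarrow> l2) (at_right 0)"
 shows "vp I1 u x = l1 + cnj l2"
proof -
 have "((\<lambda>\<tau>. u (\<lambda>t. cutoff I1 x t * of_real (poisson x \<tau> t)) - boundary_value f g x \<tau>) \<longlongrightarrow> 0) (at_right 0)" unfolding tendsto_at_iff_sequentially o_def
  by (intro allI impI vp_pairing_sequence[OF u x]) auto
 moreover have "(boundary_value f g x \<longlongrightarrow> l1 + cnj l2) (at_right 0)" unfolding boundary_value_def[abs_def] by (intro tendsto_add l1 tendsto_cnj l2)
 ultimately have "((\<lambda>\<tau>. u (\<lambda>t. cutoff I1 x t * of_real (poisson x \<tau> t)) - boundary_value f g x \<tau> + boundary_value f g x \<tau>) \<longlongrightarrow> 0 + (l1 + cnj l2)) (at_right 0)"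
  by (rule tendsto_add)
 then show ?thesis unfolding vp_def by (intro tendsto_Lim) simp_all
qed

lemma superlevel_of_limit:
 assumes "((\<lambda>\<tau>. cauchy_int h (Complex x \<tau>)) \<longlongrightarrow> l) (at_right 0)" "\<mu> < norm l"
 shows "x \<in> superlevel h \<mu>"
proof -
 have "\<forall>\<^sub>F \<tau> in at_right 0. \<mu> < norm (cauchy_int h (Complex x \<tau>))" using order_tendstoD(1)[OF tendsto_norm[OF assms(1)] assms(2)] .
 moreover have "\<forall>\<^sub>F \<tau> in at_right (0::real). 0 < \<tau>" by (simp add: eventually_at_filter)
 ultimately have "\<forall>\<^sub>F \<tau> in at_right (0::real). 0 < \<tau> \<and> \<mu> < norm (cauchy_int h (Complex x \<tau>))" by eventually_elim simp
 then have "\<exists>\<tau>. 0 < \<tau> \<and> \<mu> < norm (cauchy_int h (Complex x \<tau>))" using eventually_happens'[of "at_right (0::real)"] by simp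
 then show ?thesis unfolding superlevel_def by blast
qed

text \<open>Where both boundary limits exist, a value of \<open>vp\<close> beyond c forces one of
  them beyond c / 2, and then some height puts x into a superlevel set. The constant is 2 * 2 * 960:
  two densities, each at level c / 2.\<close>

lemma vp_weak_L1_norm:
 assumes u: "represents I1 u f g"
 shows "weak_L1_norm I1 (vp I1 u) \<le> ennreal (3840 * pi * (L1_norm f + L1_norm g))"
proof -
 have f: "Lintegrable f" and g: "Lintegrable g" using u by (auto simp: represents_def L1_def L1_0_def)
 note d = density_integrable[OF f g]
 let ?a = "upper_density f g" and ?b = "lower_density f g"
 define S where "S = L1_norm f + L1_norm g"
 have S0: "0 \<le> S" using L1_norm_nonneg by (simp add: S_def)
 show ?thesis unfolding weak_L1_norm_def S_def[symmetric] proof (rule SUP_least)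
  fix c :: real assume "c \<in> {0<..}"
  then have c: "0 < c" by simp
  have "emeasure lebesgue {t \<in> I1. c < norm (vp I1 u t)} \<le> emeasure lebesgue (superlevel ?a (c / 2) \<union> superlevel ?b (c / 2))"
  proof (rule emeasure_mono_AE)
   show "AE x in lebesgue. x \<in> {t \<in> I1. c < norm (vp I1 u t)} \<longrightarrow> x \<in> superlevel ?a (c / 2) \<union> superlevel ?b (c / 2)"
    using AE_boundary_limit[OF d(1)] AE_boundary_limit[OF d(2)]
   proof eventually_elim
    fix x assume bl: "boundary_limit ?a x" "boundary_limit ?b x"
    then obtain l1 l2 where l: "((\<lambda>\<tau>. cauchy_int ?a (Complex x \<tau>)) \<longlongrightarrow> l1) (at_right 0)" "((\<lambda>\<tau>. cauchy_int ?b (Complex x \<tau>)) \<longlongrightarrow> l2) (at_right 0)"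
     unfolding boundary_limit_def by blast
    show "x \<in> {t \<in> I1. c < norm (vp I1 u t)} \<longrightarrow> x \<in> superlevel ?a (c / 2) \<union> superlevel ?b (c / 2)" proof
     assume x: "x \<in> {t \<in> I1. c < norm (vp I1 u t)}"
     then have "c < norm (l1 + cnj l2)" using vp_eq[OF u _ l] by auto
     then have "c / 2 < norm l1 \<or> c / 2 < norm l2" using norm_triangle_ineq[of l1 "cnj l2"] by auto
     then show "x \<in> superlevel ?a (c / 2) \<union> superlevel ?b (c / 2)" using superlevel_of_limit[OF l(1)] superlevel_of_limit[OF l(2)] by blast
    qed
   qed
   show "superlevel ?a (c / 2) \<union> superlevel ?b (c / 2) \<in> sets lebesgue" by (intro sets.Un superlevel_sets d)
  qed
  also have "... \<le> emeasure lebesgue (superlevel ?a (c / 2)) + emeasure lebesgue (superlevel ?b (c / 2))"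
   by (intro emeasure_subadditive superlevel_sets d)
  also have "... \<le> ennreal (960 * pi * S / (c / 2)) + ennreal (960 * pi * S / (c / 2))" proof (rule add_mono)
   have m: "ennreal (960 * pi * z / (c / 2)) \<le> ennreal (960 * pi * S / (c / 2))" if "z \<le> S" for z
    using that c by (intro ennreal_leI divide_right_mono mult_left_mono) auto
   show "emeasure lebesgue (superlevel ?a (c / 2)) \<le> ennreal (960 * pi * S / (c / 2))"
    using weak_type[OF d(1), of "c / 2"] m[OF d(3)[folded S_def]] c by (meson half_gt_zero order_trans)
   show "emeasure lebesgue (superlevel ?b (c / 2)) \<le> ennreal (960 * pi * S / (c / 2))"
    using weak_type[OF d(2), of "c / 2"] m[OF d(4)[folded S_def]] c by (meson half_gt_zero order_trans)
  qed
  also have "... = ennreal (3840 * pi * S / c)" using S0 c by (simp add: ennreal_plus[symmetric] del: ennreal_plus)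
  finally have "ennreal c * emeasure lebesgue {t \<in> I1. c < norm (vp I1 u t)} \<le> ennreal c * ennreal (3840 * pi * S / c)" by (rule mult_left_mono) simp
  also have "... = ennreal (3840 * pi * S)" using c S0 by (simp add: ennreal_mult[symmetric])
  finally show "ennreal c * emeasure lebesgue {t \<in> I1. c < norm (vp I1 u t)} \<le> ennreal (3840 * pi * S)" .
 qed
qed

text \<open>Almost everywhere on \<open>I1\<close>, \<open>vp\<close> is a limit of continuous
  functions along the heights 1 / (n + 1). Lebesgue measure is complete, so the unspecified values
  on the remaining null set do no harm.\<close>

lemma vp_measurable:
 assumes u: "represents I1 u f g"
 shows "vp I1 u \<in> borel_measurable (lebesgue_on I1)"
proof -
 have f: "Lintegrable f" and g: "Lintegrable g" using u by (auto simp: represents_def L1_def L1_0_def)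
 note d = density_integrable[OF f g]
 let ?a = "upper_density f g" and ?b = "lower_density f g"
 let ?e = "\<lambda>n. 1 / real (Suc n)"
 have cm: "(\<lambda>x. cauchy_int h (Complex x (?e n))) \<in> Lmeasurable" if "Lintegrable h" for h n proof (rule continuous_measurable_lebesgue)
  have "continuous_on {z. 0 < Im z} (cauchy_int h)" by (rule holomorphic_on_imp_continuous_on[OF cauchy_int_holomorphic[OF that]])
  moreover have "continuous_on UNIV (\<lambda>x. Complex x (?e n))" unfolding Complex_eq by (intro continuous_intros)
  ultimately show "continuous_on UNIV (\<lambda>x. cauchy_int h (Complex x (?e n)))" by (rule continuous_on_compose2) auto
 qed
 define B where "B n x = boundary_value f g x (?e n)" for n x
 have Bm: "B n \<in> Lmeasurable" for n proof -
  have "(\<lambda>x. cnj (cauchy_int ?b (Complex x (?e n)))) \<in> Lmeasurable"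
   using measurable_compose[OF cm[OF d(2)] borel_measurable_continuous_onI[OF continuous_on_cnj[OF continuous_on_id]]] .
  then show ?thesis unfolding B_def[abs_def] boundary_value_def by (intro borel_measurable_add cm[OF d(1)])
 qed
 define L where "L x = lim (\<lambda>n. B n x)" for x
 have Lm: "L \<in> Lmeasurable" unfolding L_def[abs_def] by (rule borel_measurable_lim_metric[OF Bm])
 have "AE x in lebesgue. L x = (if x \<in> I1 then vp I1 u x else L x)" using AE_boundary_limit[OF d(1)] AE_boundary_limit[OF d(2)] proof eventually_elim
  fix x assume bl: "boundary_limit ?a x" "boundary_limit ?b x"
  then obtain l1 l2 where l: "((\<lambda>\<tau>. cauchy_int ?a (Complex x \<tau>)) \<longlongrightarrow> l1) (at_right 0)" "((\<lambda>\<tau>. cauchy_int ?b (Complex x \<tau>)) \<longlongrightarrow> l2) (at_right 0)"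
   unfolding boundary_limit_def by blast
  have "?e \<longlonglongrightarrow> 0" using LIMSEQ_inverse_real_of_nat by (simp only: inverse_eq_divide)
  then have e: "filterlim ?e (at_right 0) sequentially" by (simp add: filterlim_at del: of_nat_Suc)
  have "(\<lambda>n. B n x) \<longlonglongrightarrow> l1 + cnj l2" unfolding B_def boundary_value_def
   by (intro tendsto_add tendsto_cnj filterlim_compose[OF l(1) e] filterlim_compose[OF l(2) e])
  then have "L x = l1 + cnj l2" unfolding L_def by (rule limI)
  then show "L x = (if x \<in> I1 then vp I1 u x else L x)" using vp_eq[OF u _ l] by simp
 qed
 from borel_measurable_AE[OF Lm this] have "(\<lambda>x. if x \<in> I1 then vp I1 u x else L x) \<in> borel_measurable (lebesgue_on I1)"
  by (rule measurable_restrict_space1)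
 then show ?thesis by (rule measurable_cong[THEN iffD1, rotated]) simp
qed

section \<open>Convergence of the iterates\<close>

text \<open>F and G describe \<open>T \<beta> u\<close> on all of \<open>I1\<close> and enter the
  weak estimate; f' and g' describe it only on \<open>]-\<beta>, \<beta>[\<close> and feed the next
  step. The 6 is 2 + 4: the length of \<open>I1\<close> times the bounded error, and the four terms
  of G. The 12 is 3 * 4, from the reduction applied to G.\<close>

lemma T_step:
 assumes \<beta>: "0 < \<beta>" "\<beta> < 1" and u: "u \<in> LR_on I1" and uf: "represents {-\<beta><..<\<beta>} u f g"
 defines "F \<equiv> T_smooth_part \<beta> f g" and "G \<equiv> T_hilbert_part \<beta> g"
 defines "f' \<equiv> reduce_smooth \<beta> F G" and "g' \<equiv> reduce_hilbert G"
 shows "represents {-\<beta><..<\<beta>} (T \<beta> u) f' g'" "represents I1 (T \<beta> u) F G"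
  "L1_norm F + L1_norm G \<le> L1_norm f + 6 * L1_norm g"
  "ennreal (norm (g' x)) * indicator I1 x \<le> transfer \<beta> (\<lambda>x. ennreal (norm (g x)) * indicator I1 x) x"
  "ennreal (norm (f' x)) \<le> transfer \<beta> (\<lambda>x. ennreal (norm (f x)) * indicator I1 x) x + ennreal ((1 + 12 / (1 - \<beta>)) * L1_norm g) * indicator I1 x"
  "ennreal (L1_norm g') \<le> 2 * (NI x. ennreal (norm (g' x)) * indicator I1 x)"
proof -
 have f: "f \<in> L1" and g: "g \<in> L1_0" using uf by (auto simp: represents_def)
 then have fi: "Lintegrable f" by (simp add: L1_def)
 have fm: "(\<lambda>x. ennreal (norm (f x))) \<in> Lmeasurable" using borel_measurable_integrable[OF fi] by measurable
 show FG: "represents I1 (T \<beta> u) F G" unfolding F_def G_def by (rule T_represents[OF \<beta> u uf])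
 then have Fi: "Lintegrable F" and Gi: "Lintegrable G" by (auto simp: represents_def L1_def L1_0_def)
 note Gp = T_hilbert_part[OF \<beta>(1) g, folded G_def]
 note Fp = T_smooth_part(2)[OF \<beta>(1) f g, folded F_def]
 show "represents {-\<beta><..<\<beta>} (T \<beta> u) f' g'" unfolding f'_def g'_def by (rule reduce_represents(1)[OF \<beta> FG])
 have g0: "0 \<le> L1_norm g" by (rule L1_norm_nonneg)
 have "ennreal (L1_norm F) = (NI x. ennreal (norm (F x)))" by (rule nn_integral_norm[OF Fi, symmetric])
 also have "... \<le> (NI x. transfer \<beta> (\<lambda>x. ennreal (norm (f x))) x + ennreal (L1_norm g) * indicator I1 x)" by (intro nn_integral_mono Fp)
 also have "... = (NI x. transfer \<beta> (\<lambda>x. ennreal (norm (f x))) x) + (NI x. ennreal (L1_norm g) * indicator I1 x)"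
  by (intro nn_integral_add transfer_measurable[OF \<beta>(1) fm]) simp
 also have "... \<le> ennreal (L1_norm f) + ennreal (2 * L1_norm g)" proof (rule add_mono)
  show "(NI x. transfer \<beta> (\<lambda>x. ennreal (norm (f x))) x) \<le> ennreal (L1_norm f)"
   using transfer_nn_integral[OF \<beta>(1) fm] unfolding nn_integral_norm[OF fi] .
  have "(NI x. ennreal (L1_norm g) * indicator I1 x) = ennreal (L1_norm g) * emeasure lebesgue I1" by (rule nn_integral_cmult_indicator) simp
  also have "emeasure lebesgue I1 = 2" by (simp add: I1_def)
  also have "ennreal (L1_norm g) * 2 = ennreal (2 * L1_norm g)" using g0 by (simp add: ennreal_mult mult.commute)
  finally show "(NI x. ennreal (L1_norm g) * indicator I1 x) \<le> ennreal (2 * L1_norm g)" by simp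
 qed
 also have "... = ennreal (L1_norm f + 2 * L1_norm g)" using g0 L1_norm_nonneg[of f] by (intro ennreal_plus[symmetric]) auto
 finally have "ennreal (L1_norm F) \<le> ennreal (L1_norm f + 2 * L1_norm g)" .
 moreover have "0 \<le> L1_norm f + 2 * L1_norm g" using g0 L1_norm_nonneg[of f] by simp
 ultimately have "L1_norm F \<le> L1_norm f + 2 * L1_norm g" by (simp only: ennreal_le_iff)
 then show "L1_norm F + L1_norm G \<le> L1_norm f + 6 * L1_norm g" using Gp(2) by simp
 show "ennreal (L1_norm g') \<le> 2 * (NI x. ennreal (norm (g' x)) * indicator I1 x)" unfolding g'_def by (rule reduce_hilbert(2)[OF Gi])
 show "ennreal (norm (g' x)) * indicator I1 x \<le> transfer \<beta> (\<lambda>x. ennreal (norm (g x)) * indicator I1 x) x"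
  unfolding transfer_local[OF \<beta>] using Gp(3)[of x] reduce_hilbert(3)[OF Gi, of x] by (cases "x \<in> I1") (simp_all add: g'_def)
 have "norm (f' x) \<le> norm (F x) + 3 / (1 - \<beta>) * L1_norm G * indicator I1 x" unfolding f'_def by (rule reduce_represents(2)[OF \<beta> FG])
 also have "... \<le> norm (F x) + 12 / (1 - \<beta>) * L1_norm g * indicator I1 x" proof -
  have "3 / (1 - \<beta>) * L1_norm G \<le> 3 / (1 - \<beta>) * (4 * L1_norm g)" using Gp(2) \<beta> by (intro mult_left_mono) auto
  then show ?thesis by (auto simp: indicator_def)
 qed
 finally have "ennreal (norm (f' x)) \<le> ennreal (norm (F x) + 12 / (1 - \<beta>) * L1_norm g * indicator I1 x)" by (rule ennreal_leI)
 also have "... = ennreal (norm (F x)) + ennreal (12 / (1 - \<beta>) * L1_norm g) * indicator I1 x"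
  using \<beta> g0 by (subst ennreal_plus) (auto simp: indicator_def)
 also have "... \<le> (transfer \<beta> (\<lambda>x. ennreal (norm (f x))) x + ennreal (L1_norm g) * indicator I1 x) + ennreal (12 / (1 - \<beta>) * L1_norm g) * indicator I1 x"
  by (intro add_right_mono Fp)
 also have "... = transfer \<beta> (\<lambda>x. ennreal (norm (f x))) x + ennreal ((1 + 12 / (1 - \<beta>)) * L1_norm g) * indicator I1 x" proof -
  have "ennreal ((1 + 12 / (1 - \<beta>)) * L1_norm g) = ennreal (L1_norm g) + ennreal (12 / (1 - \<beta>) * L1_norm g)"
   using \<beta> g0 by (subst ennreal_plus[symmetric]) (auto simp: distrib_right)
  then show ?thesis by (simp only: distrib_right add.assoc)
 qed
 finally show "ennreal (norm (f' x)) \<le> transfer \<beta> (\<lambda>x. ennreal (norm (f x)) * indicator I1 x) x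
    + ennreal ((1 + 12 / (1 - \<beta>)) * L1_norm g) * indicator I1 x" unfolding transfer_local[OF \<beta>] .
qed

lemma T_iterates_LR_on:
 "0 < \<beta> ==> \<beta> < 1 ==> u \<in> LR_on I1 ==> (T \<beta> ^^ N) u \<in> LR_on I1" by (induction N) (simp_all add: T_LR_on)

primrec state :: "real => (real => complex) => (real => complex) => nat => (real => complex) \<times> (real => complex)" where
 "state \<beta> f g 0 = (f, g)"
| "state \<beta> f g (Suc N) = (case state \<beta> f g N of (f, g) =>
   (reduce_smooth \<beta> (T_smooth_part \<beta> f g) (T_hilbert_part \<beta> g), reduce_hilbert (T_hilbert_part \<beta> g)))"

theorem theorem1p2p2:
 fixes \<beta> :: real and u0 :: distr
 assumes "0 < \<beta>" and "\<beta> < 1"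
  and "u0 \<in> LR_on I1"
 shows "(\<forall>N. vp I1 ((T \<beta> ^^ N) u0) \<in> weak_L1 I1) \<and> (\<lambda>N. weak_L1_norm I1 (vp I1 ((T \<beta> ^^ N) u0))) \<longlonglongrightarrow> 0"
proof
 note \<beta> = assms(1,2)
 define v where "v N = (T \<beta> ^^ N) u0" for N
 have vLR: "v N \<in> LR_on I1" for N unfolding v_def by (rule T_iterates_LR_on[OF assms])
 have vSuc: "v (Suc N) = T \<beta> (v N)" for N by (simp add: v_def)
 have "vp I1 (v N) \<in> weak_L1 I1" for N proof -
  obtain f g where r: "represents I1 (v N) f g" by (rule LR_on_represents[OF vLR])
  have "weak_L1_norm I1 (vp I1 (v N)) < \<infinity>" by (rule le_less_trans[OF vp_weak_L1_norm[OF r]]) simp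
  with vp_measurable[OF r] show ?thesis by (simp add: weak_L1_def)
 qed
 then show "\<forall>N. vp I1 ((T \<beta> ^^ N) u0) \<in> weak_L1 I1" by (simp add: v_def)
 obtain f0 g0 where "represents I1 u0 f0 g0" by (rule LR_on_represents[OF assms(3)])
 then have r0: "represents {-\<beta><..<\<beta>} u0 f0 g0" by (rule represents_subset) (use \<beta> in \<open>auto simp: I1_def\<close>)
 define f where "f N = fst (state \<beta> f0 g0 N)" for N
 define g where "g N = snd (state \<beta> f0 g0 N)" for N
 define F where "F N = T_smooth_part \<beta> (f N) (g N)" for N
 define G where "G N = T_hilbert_part \<beta> (g N)" for N
 have fS: "f (Suc N) = reduce_smooth \<beta> (F N) (G N)" "g (Suc N) = reduce_hilbert (G N)" for N by (simp_all add: f_def g_def F_def G_def case_prod_beta)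
 have r: "represents {-\<beta><..<\<beta>} (v N) (f N) (g N)" for N proof (induction N)
  case 0
  then show ?case using r0 by (simp add: v_def f_def g_def)
 next
  case (Suc N)
  show ?case using T_step(1)[OF \<beta> vLR Suc] unfolding vSuc fS F_def G_def .
 qed
 note step = T_step[OF \<beta> vLR r, folded F_def G_def, folded fS vSuc]
 have fi: "Lintegrable (f N)" and gi: "Lintegrable (g N)" for N using r[of N] by (auto simp: represents_def L1_def L1_0_def)
 define a where "a N x = ennreal (norm (f N x)) * indicator I1 x" for N x
 define b where "b N x = ennreal (norm (g N x)) * indicator I1 x" for N x
 have meas: "(\<lambda>x. ennreal (norm (h x)) * indicator I1 x) \<in> Lmeasurable"
  and fin: "(NI x. ennreal (norm (h x)) * indicator I1 x) < \<infinity>" if h: "Lintegrable h" for h :: "real => complex"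
 proof -
  have [measurable]: "h \<in> Lmeasurable" by (rule borel_measurable_integrable[OF h])
  show "(\<lambda>x. ennreal (norm (h x)) * indicator I1 x) \<in> Lmeasurable" by measurable
  have "(NI x. ennreal (norm (h x)) * indicator I1 x) \<le> (NI x. ennreal (norm (h x)))" by (intro nn_integral_mono) (auto simp: indicator_def)
  also have "... < \<infinity>" unfolding nn_integral_norm[OF h] by simp
  finally show "(NI x. ennreal (norm (h x)) * indicator I1 x) < \<infinity>" .
 qed
 \<comment> \<open>No error term occurs here: on \<open>I1\<close> the modulus of g is dominated by
   the transfer operator alone.\<close>
 have b0: "(\<lambda>N. \<integral>\<^sup>+x. b N x \<partial>lebesgue) \<longlonglongrightarrow> 0" proof (rule transfer_iteration_tendsto_0[OF \<beta>, where c = "\<lambda>_. 0"])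
  show "b (Suc N) x \<le> transfer \<beta> (b N) x + ennreal 0 * indicator I1 x" for N x using step(4)[of N x] by (simp add: b_def[abs_def])
 qed (use meas[OF gi] fin[OF gi] in \<open>auto simp: b_def[abs_def]\<close>)
 \<comment> \<open>The recursion controls g only on \<open>I1\<close>; from index 1 on, its full
   norm, including the constant on [1, 2], is at most twice that integral.\<close>
 have gN: "(\<lambda>N. L1_norm (g N)) \<longlonglongrightarrow> 0" proof -
  have "(\<lambda>N. 2 * (NI x. b (Suc N) x)) \<longlonglongrightarrow> 2 * 0" by (intro ennreal_tendsto_cmult LIMSEQ_Suc[OF b0]) simp
  then have lim: "(\<lambda>N. 2 * (NI x. b (Suc N) x)) \<longlonglongrightarrow> 0" by simp
  have up: "ennreal (L1_norm (g (Suc N))) \<le> 2 * (NI x. b (Suc N) x)" for N using step(6)[of N] unfolding b_def .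
  have "(\<lambda>N. ennreal (L1_norm (g (Suc N)))) \<longlonglongrightarrow> 0"
   by (rule tendsto_sandwich[OF always_eventually always_eventually tendsto_const lim]) (rule allI, rule zero_le, rule allI, rule up)
  then have "(\<lambda>N. ennreal (L1_norm (g (Suc N)))) \<longlonglongrightarrow> ennreal 0" by simp
  then have "(\<lambda>N. L1_norm (g (Suc N))) \<longlonglongrightarrow> 0" by (rule tendsto_ennrealD) (auto simp: L1_norm_nonneg)
  then show ?thesis by (rule LIMSEQ_imp_Suc)
 qed
 define C where "C = 1 + 12 / (1 - \<beta>)"
 have C: "0 \<le> C" using \<beta> by (simp add: C_def)
 \<comment> \<open>The bound in \<open>T_step\<close> is 0 off \<open>I1\<close>, so every f after
   the initial one vanishes there.\<close>
 have fout: "ennreal (norm (f (Suc N) x)) = a (Suc N) x" for N x using step(5)[of N x] by (cases "x \<in> I1") (simp_all add: a_def transfer_def)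
 \<comment> \<open>The error term is C times the norm of \<open>g N\<close>; that it tends to 0 is
   the hypothesis of the iteration theorem on c, so g had to be treated first.\<close>
 have a0: "(\<lambda>N. \<integral>\<^sup>+x. a N x \<partial>lebesgue) \<longlonglongrightarrow> 0" proof (rule transfer_iteration_tendsto_0[OF \<beta>, where c = "\<lambda>N. C * L1_norm (g N)"])
  show "a (Suc N) x \<le> transfer \<beta> (a N) x + ennreal (C * L1_norm (g N)) * indicator I1 x" for N x
   using step(5)[of N x] unfolding fout C_def by (simp add: a_def[abs_def])
  show "(\<lambda>N. C * L1_norm (g N)) \<longlonglongrightarrow> 0" using tendsto_mult_left[OF gN, of C] by simp
  show "0 \<le> C * L1_norm (g N)" for N using C L1_norm_nonneg by simp
 qed (use meas[OF fi] fin[OF fi] in \<open>auto simp: a_def[abs_def]\<close>)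
 have fN: "(\<lambda>N. L1_norm (f N)) \<longlonglongrightarrow> 0" proof -
  have "ennreal (L1_norm (f (Suc N))) = (NI x. a (Suc N) x)" for N unfolding nn_integral_norm[OF fi, symmetric] fout ..
  then have "(\<lambda>N. ennreal (L1_norm (f (Suc N)))) \<longlonglongrightarrow> ennreal 0" using LIMSEQ_Suc[OF a0] by simp
  then have "(\<lambda>N. L1_norm (f (Suc N))) \<longlonglongrightarrow> 0" by (rule tendsto_ennrealD) (auto simp: L1_norm_nonneg)
  then show ?thesis by (rule LIMSEQ_imp_Suc)
 qed
 \<comment> \<open>\<open>vp\<close> needs a pair valid on all of \<open>I1\<close>.
   \<open>F N\<close> and \<open>G N\<close> are such a pair for \<open>v (Suc N)\<close>, so the
   estimate at N + 1 uses the norms at N.\<close>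
 have bound: "weak_L1_norm I1 (vp I1 (v (Suc N))) \<le> ennreal (3840 * pi * (L1_norm (f N) + 6 * L1_norm (g N)))" for N
  by (rule order_trans[OF vp_weak_L1_norm[OF step(2)] ennreal_leI]) (intro mult_left_mono step(3); simp)
 have "(\<lambda>N. 3840 * pi * (L1_norm (f N) + 6 * L1_norm (g N))) \<longlonglongrightarrow> 3840 * pi * (0 + 6 * 0)" by (intro tendsto_intros fN gN)
 then have "(\<lambda>N. ennreal (3840 * pi * (L1_norm (f N) + 6 * L1_norm (g N)))) \<longlonglongrightarrow> ennreal 0" by (intro tendsto_ennrealI) simp
 then have lim: "(\<lambda>N. ennreal (3840 * pi * (L1_norm (f N) + 6 * L1_norm (g N)))) \<longlonglongrightarrow> 0" by simp
 have "(\<lambda>N. weak_L1_norm I1 (vp I1 (v (Suc N)))) \<longlonglongrightarrow> 0"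
  by (rule tendsto_sandwich[OF always_eventually always_eventually tendsto_const lim]) (rule allI, rule zero_le, rule allI, rule bound)
 then show "(\<lambda>N. weak_L1_norm I1 (vp I1 ((T \<beta> ^^ N) u0))) \<longlonglongrightarrow> 0" unfolding v_def by (rule LIMSEQ_imp_Suc)
qed

end
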